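(* Let $m,n\ge 1$ and let $\lambda$ be a partition with at most $mn$ rows such that at least one of the following holds: (i) $\lambda$ has at most two columns; (ii) $\lambda=(k)$ for some $k\ge 0$; (iii) $m=n=2$. Then there exists a finite-dimensional $U_q(gl_m)\otimes U_q(gl_n)$-module $W_\lambda$ over $\mathbb{C}(q)$ such that: 1. $W_\lambda$ has a basis of weight vectors and there is a weight-preserving bijection between this basis and the set of semi-standard tableaux of shape $\lambda$ with entries in $\{1,\dots,mn\}$ (which indexes a weight basis of the Weyl module $V_\lambda(\mathbb{C}^{mn})$); 2. the action of $U_q(gl_m)\otimes U_q(gl_n)$ on $W_\lambda$ at $q=1$ matches the restriction of the $gl_{mn}(\mathbb{C})$-module $V_\lambda(\mathbb{C}^{mn})$ to $gl_m(\mathbb{C})\times gl_n(\mathbb{C})$ along the map induced by $\phi:GL_m(\mathbb{C})\times GL_n(\mathbb{C})\to GL_{mn}(\mathbb{C})$.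
   Context: For $N\ge 1$, $U_q(gl_N)$ is the associative $\mathbb{C}(q)$-algebra generated by $e_i,f_i$ ($1\le i\le N-1$) and $q^{\epsilon_i},q^{-\epsilon_i}$ ($1\le i\le N$) with relations: $q^{\epsilon_i}q^{-\epsilon_i}=q^{-\epsilon_i}q^{\epsilon_i}=1$; $[q^{\epsilon_i},q^{\epsilon_j}]=0$; $q^{\epsilon_i}e_jq^{-\epsilon_i}=q^{\delta_{i,j}-\delta_{i,j+1}}e_j$; $q^{\epsilon_i}f_jq^{-\epsilon_i}=q^{-\delta_{i,j}+\delta_{i,j+1}}f_j$; $[e_i,f_j]=\delta_{ij}\frac{q^{h_i}-q^{-h_i}}{q-q^{-1}}$ with $q^{h_i}=q^{\epsilon_i}q^{-\epsilon_{i+1}}$; $[e_i,e_j]=[f_i,f_j]=0$ for $|i-j|>1$; $e_je_i^2-(q+q^{-1})e_ie_je_i+e_i^2e_j=0=f_jf_i^2-(q+q^{-1})f_if_jf_i+f_i^2f_j$ for $|i-j|=1$. $V_\lambda(\mathbb{C}^{N})$ is the irreducible (Weyl) module of $GL_N$ of highest weight $\lambda$. The group homomorphism $\phi$ is given by the action $(a,b)\cdot x=a\,x\,b^{T}$ of $GL_m(\mathbb{C})\times GL_n(\mathbb{C})$ on the space of complex $m\times n$ matrices, identified with $\mathbb{C}^{mn}=\mathbb{C}^m\otimes\mathbb{C}^n$ by letting the index $(j-1)m+i\in\{1,\dots,mn\}$ correspond to position $(i,j)$ (row $i$, column $j$). A weight vector of a $U_q(gl_m)\otimes U_q(gl_n)$-module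 is a simultaneous eigenvector of the $q^{\epsilon_i}$ of $U_q(gl_m)$ and the $q^{\epsilon_j}$ of $U_q(gl_n)$ with eigenvalues $q^{\mu_i}$, $q^{\nu_j}$, $\mu_i,\nu_j\in\mathbb{Z}$; its weight is $(\mu,\nu)$. The weight of a tableau with entries in $\{1,\dots,mn\}$ is $(\mu,\nu)$, where $\mu_i$ (resp. $\nu_j$) is the number of entries whose corresponding position lies in row $i$ (resp. column $j$). "Matches at $q=1$" means: in a suitable basis of weight vectors, the matrices of all $e_i,f_i$ of $U_q(gl_m)$ and $U_q(gl_n)$ have entries regular at $q=1$, and evaluating them at $q=1$ (with the diagonal generators acting by the weights $\mu_i,\nu_j$) gives a representation of $gl_m(\mathbb{C})\times gl_n(\mathbb{C})$ isomorphic to the indicated restriction. *)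

theory Defs
  imports
    "HOL-Analysis.Derivative"
    "HOL-Library.FuncSet"
    "HOL-Computational_Algebra.Fraction_Field"
    "Jordan_Normal_Form.VS_Connect"
begin

(* All indices are 0-based: rows 0..m-1, columns 0..n-1, generators e_i, f_i with i + 1 < N.
   Position (i, j) of an m x n matrix corresponds to the index j * m + i, so the index x
   lies in row x mod m and column x div m. *)

section \<open>The field of rational functions in q and evaluation at q = 1\<close>

type_synonym ratfun = "complex poly fract"

definition qq :: ratfun where
  "qq = Fract [:0, 1:] 1"

definition regular_at_one :: "ratfun \<Rightarrow> bool" where
  "regular_at_one x \<longleftrightarrow> (\<exists>a b. poly b 1 \<noteq> 0 \<and> x = Fract a b)"

definition at_one :: "ratfun \<Rightarrow> complex" where
  "at_one x = (THE c. \<exists>a b. poly b 1 \<noteq> 0 \<and> x = Fract a b \<and> c = poly a 1 / poly b 1)"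

lemma at_one_Fract:
  assumes "poly b 1 \<noteq> 0"
  shows "at_one (Fract a b) = poly a 1 / poly b 1"
  unfolding at_one_def
proof (rule the_equality)
  show "\<exists>a' b'. poly b' 1 \<noteq> 0 \<and> Fract a b = Fract a' b' \<and> poly a 1 / poly b 1 = poly a' 1 / poly b' 1"
    using assms by blast
next
  fix c assume "\<exists>a' b'. poly b' 1 \<noteq> 0 \<and> Fract a b = Fract a' b' \<and> c = poly a' 1 / poly b' 1"
  then obtain a' b' where *: "poly b' 1 \<noteq> 0" "Fract a b = Fract a' b'" "c = poly a' 1 / poly b' 1"
    by blast
  have "b \<noteq> 0" "b' \<noteq> 0" using assms * by auto
  then have "a * b' = a' * b" using *(2) by (simp add: eq_fract)
  then have "poly a 1 * poly b' 1 = poly a' 1 * poly b 1"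
    by (metis poly_mult)
  then have "poly a' 1 * poly b 1 = poly a 1 * poly b' 1" by simp
  then show "c = poly a 1 / poly b 1"
    using assms *(1) unfolding *(3) by (metis frac_eq_eq)
qed


section \<open>Modules over the quantum group and over the tensor product\<close>

(* A module over the algebra presented by e_i, f_i, q^(eps_i), q^(-eps_i) on the d-dimensional
   coordinate space is a choice of operators for the generators that satisfy the relations. *)

record uq_ops =
  opE :: "nat \<Rightarrow> ratfun mat"
  opF :: "nat \<Rightarrow> ratfun mat"
  opK :: "nat \<Rightarrow> ratfun mat"   \<comment> \<open>the action of \<open>q\<close> to the power \<open>\<epsilon>\<^sub>i\<close>\<close>
  opL :: "nat \<Rightarrow> ratfun mat"   \<comment> \<open>the action of \<open>q\<close> to the power \<open>- \<epsilon>\<^sub>i\<close>\<close>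

definition gens :: "nat \<Rightarrow> uq_ops \<Rightarrow> ratfun mat set" where
  "gens N A = {opE A i | i. i + 1 < N} \<union> {opF A i | i. i + 1 < N}
            \<union> {opK A i | i. i < N} \<union> {opL A i | i. i < N}"

definition kdelta :: "nat \<Rightarrow> nat \<Rightarrow> int" where
  "kdelta i j = (if i = j then 1 else 0)"

definition serre :: "nat \<Rightarrow> ratfun mat \<Rightarrow> ratfun mat \<Rightarrow> bool" where
  "serre d X Y \<longleftrightarrow> Y * X * X - (qq + inverse qq) \<cdot>\<^sub>m (X * Y * X) + X * X * Y = 0\<^sub>m d d"

definition uq_module :: "nat \<Rightarrow> nat \<Rightarrow> uq_ops \<Rightarrow> bool" where
  "uq_module N d A \<longleftrightarrow>
     gens N A \<subseteq> carrier_mat d d \<and>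
     (\<forall>i<N. opK A i * opL A i = 1\<^sub>m d \<and> opL A i * opK A i = 1\<^sub>m d) \<and>
     (\<forall>i<N. \<forall>j<N. opK A i * opK A j = opK A j * opK A i) \<and>
     (\<forall>i<N. \<forall>j. j + 1 < N \<longrightarrow>
        opK A i * opE A j * opL A i = (qq powi (kdelta i j - kdelta i (j + 1))) \<cdot>\<^sub>m opE A j \<and>
        opK A i * opF A j * opL A i = (qq powi (- kdelta i j + kdelta i (j + 1))) \<cdot>\<^sub>m opF A j) \<and>
     (\<forall>i j. i + 1 < N \<and> j + 1 < N \<longrightarrow>
        opE A i * opF A j - opF A j * opE A i =
          (if i = j
           then (1 / (qq - inverse qq)) \<cdot>\<^sub>m (opK A i * opL A (i + 1) - opL A i * opK A (i + 1))
           else 0\<^sub>m d d)) \<and>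
     (\<forall>i j. i + 1 < N \<and> j + 1 < N \<and> (i + 1 < j \<or> j + 1 < i) \<longrightarrow>
        opE A i * opE A j = opE A j * opE A i \<and> opF A i * opF A j = opF A j * opF A i) \<and>
     (\<forall>i j. i + 1 < N \<and> j + 1 < N \<and> (j = i + 1 \<or> i = j + 1) \<longrightarrow>
        serre d (opE A i) (opE A j) \<and> serre d (opF A i) (opF A j))"

(* A module over a tensor product of two algebras is a vector space with two commuting actions. *)
definition uq_tensor_module :: "nat \<Rightarrow> nat \<Rightarrow> nat \<Rightarrow> uq_ops \<Rightarrow> uq_ops \<Rightarrow> bool" where
  "uq_tensor_module m n d A B \<longleftrightarrow>
     uq_module m d A \<and> uq_module n d B \<and>
     (\<forall>X\<in>gens m A. \<forall>Y\<in>gens n B. X * Y = Y * X)"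

definition weight_vector ::
  "nat \<Rightarrow> nat \<Rightarrow> nat \<Rightarrow> uq_ops \<Rightarrow> uq_ops \<Rightarrow> (nat \<Rightarrow> int) \<Rightarrow> (nat \<Rightarrow> int) \<Rightarrow> ratfun vec \<Rightarrow> bool" where
  "weight_vector m n d A B \<mu> \<nu> v \<longleftrightarrow>
     v \<in> carrier_vec d \<and> v \<noteq> 0\<^sub>v d \<and>
     (\<forall>i<m. opK A i *\<^sub>v v = (qq powi \<mu> i) \<cdot>\<^sub>v v) \<and>
     (\<forall>j<n. opK B j *\<^sub>v v = (qq powi \<nu> j) \<cdot>\<^sub>v v)"

definition ordered_basis :: "nat \<Rightarrow> ratfun vec list \<Rightarrow> bool" where
  "ordered_basis d bs \<longleftrightarrow> distinct bs \<and> vectorspace.basis class_ring (module_vec TYPE(ratfun) d) (set bs)"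

(* The k-th basis vector has weight (\<mu> k, \<nu> k). *)
definition weight_basis ::
  "nat \<Rightarrow> nat \<Rightarrow> nat \<Rightarrow> uq_ops \<Rightarrow> uq_ops \<Rightarrow> ratfun vec list
     \<Rightarrow> (nat \<Rightarrow> nat \<Rightarrow> int) \<Rightarrow> (nat \<Rightarrow> nat \<Rightarrow> int) \<Rightarrow> bool" where
  "weight_basis m n d A B bs \<mu> \<nu> \<longleftrightarrow>
     ordered_basis d bs \<and> (\<forall>k<length bs. weight_vector m n d A B (\<mu> k) (\<nu> k) (bs ! k))"

definition matrix_in_basis :: "nat \<Rightarrow> ratfun vec list \<Rightarrow> ratfun mat \<Rightarrow> ratfun mat" where
  "matrix_in_basis d bs X =
     (THE M. M \<in> carrier_mat d d \<and> X * mat_of_cols d bs = mat_of_cols d bs * M)"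


section \<open>Partitions and semistandard tableaux\<close>

definition is_partition :: "(nat \<Rightarrow> nat) \<Rightarrow> bool" where
  "is_partition lam \<longleftrightarrow> antimono lam \<and> finite {i. lam i \<noteq> 0}"

definition cells :: "(nat \<Rightarrow> nat) \<Rightarrow> (nat \<times> nat) set" where
  "cells lam = {(r, c). c < lam r}"

definition ssyt :: "(nat \<Rightarrow> nat) \<Rightarrow> nat \<Rightarrow> (nat \<times> nat \<Rightarrow> nat) set" where
  "ssyt lam N = {T \<in> cells lam \<rightarrow>\<^sub>E {..<N}.
     (\<forall>r c c'. c < c' \<and> (r, c') \<in> cells lam \<longrightarrow> T (r, c) \<le> T (r, c')) \<and>
     (\<forall>r r' c. r < r' \<and> (r', c) \<in> cells lam \<longrightarrow> T (r, c) < T (r', c))}"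

definition row_weight :: "nat \<Rightarrow> (nat \<Rightarrow> nat) \<Rightarrow> (nat \<times> nat \<Rightarrow> nat) \<Rightarrow> nat \<Rightarrow> nat" where
  "row_weight m lam T i = card {x \<in> cells lam. T x mod m = i}"

definition col_weight :: "nat \<Rightarrow> (nat \<Rightarrow> nat) \<Rightarrow> (nat \<times> nat \<Rightarrow> nat) \<Rightarrow> nat \<Rightarrow> nat" where
  "col_weight m lam T j = card {x \<in> cells lam. T x div m = j}"


section \<open>The irreducible (Weyl) module of the general linear group\<close>

definition GL :: "nat \<Rightarrow> complex mat set" where
  "GL N = {g \<in> carrier_mat N N. invertible_mat g}"

(* The coordinate ring of GL N, generated by the matrix entries and the inverse determinant. *)
inductive_set regular_functions :: "nat \<Rightarrow> (complex mat \<Rightarrow> complex) set" for N :: nat where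
  const: "(\<lambda>g. c) \<in> regular_functions N"
| coord: "i < N \<Longrightarrow> j < N \<Longrightarrow> (\<lambda>g. g $$ (i, j)) \<in> regular_functions N"
| inverse_det: "(\<lambda>g. inverse (det g)) \<in> regular_functions N"
| add: "f \<in> regular_functions N \<Longrightarrow> f' \<in> regular_functions N
         \<Longrightarrow> (\<lambda>g. f g + f' g) \<in> regular_functions N"
| mult: "f \<in> regular_functions N \<Longrightarrow> f' \<in> regular_functions N
         \<Longrightarrow> (\<lambda>g. f g * f' g) \<in> regular_functions N"

definition GL_rep :: "nat \<Rightarrow> nat \<Rightarrow> (complex mat \<Rightarrow> complex mat) \<Rightarrow> bool" where
  "GL_rep N d \<rho> \<longleftrightarrow>
     (\<forall>g\<in>GL N. \<rho> g \<in> carrier_mat d d) \<and>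
     \<rho> (1\<^sub>m N) = 1\<^sub>m d \<and>
     (\<forall>g\<in>GL N. \<forall>h\<in>GL N. \<rho> (g * h) = \<rho> g * \<rho> h) \<and>
     (\<forall>i<d. \<forall>j<d. \<exists>f\<in>regular_functions N. \<forall>g\<in>GL N. \<rho> g $$ (i, j) = f g)"

definition GL_irreducible :: "nat \<Rightarrow> nat \<Rightarrow> (complex mat \<Rightarrow> complex mat) \<Rightarrow> bool" where
  "GL_irreducible N d \<rho> \<longleftrightarrow>
     d > 0 \<and>
     (\<forall>U. subspace class_ring U (module_vec TYPE(complex) d) \<and>
          (\<forall>g\<in>GL N. \<forall>u\<in>U. \<rho> g *\<^sub>v u \<in> U)
        \<longrightarrow> U = {0\<^sub>v d} \<or> U = carrier_vec d)"

definition highest_weight :: "nat \<Rightarrow> nat \<Rightarrow> (complex mat \<Rightarrow> complex mat) \<Rightarrow> (nat \<Rightarrow> nat) \<Rightarrow> bool" where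
  "highest_weight N d \<rho> lam \<longleftrightarrow>
     (\<exists>v\<in>carrier_vec d. v \<noteq> 0\<^sub>v d \<and>
        (\<forall>t. (\<forall>i<N. t i \<noteq> 0) \<longrightarrow> \<rho> (mat_diag N t) *\<^sub>v v = (\<Prod>i<N. t i ^ lam i) \<cdot>\<^sub>v v) \<and>
        (\<forall>u\<in>carrier_mat N N. upper_triangular u \<and> (\<forall>i<N. u $$ (i, i) = 1) \<longrightarrow> \<rho> u *\<^sub>v v = v))"

(* These conditions determine \<rho> up to isomorphism. *)
definition weyl_module :: "nat \<Rightarrow> (nat \<Rightarrow> nat) \<Rightarrow> nat \<Rightarrow> (complex mat \<Rightarrow> complex mat) \<Rightarrow> bool" where
  "weyl_module N lam d \<rho> \<longleftrightarrow>
     GL_rep N d \<rho> \<and> GL_irreducible N d \<rho> \<and> highest_weight N d \<rho> lam"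

(* The Lie algebra representation of all N x N matrices attached to \<rho>:
   the differential of \<rho> at the identity, entry by entry. *)
definition gl_differential :: "nat \<Rightarrow> nat \<Rightarrow> (complex mat \<Rightarrow> complex mat) \<Rightarrow> complex mat \<Rightarrow> complex mat" where
  "gl_differential N d \<rho> X =
     mat d d (\<lambda>(i, j). deriv (\<lambda>z. \<rho> (1\<^sub>m N + z \<cdot>\<^sub>m X) $$ (i, j)) 0)"


section \<open>Restriction along the action on m x n matrices\<close>

definition munit :: "nat \<Rightarrow> nat \<Rightarrow> nat \<Rightarrow> nat \<Rightarrow> complex mat" where
  "munit m n i j = mat m n (\<lambda>(r, c). if r = i \<and> c = j then 1 else 0)"

(* The matrix of x \<mapsto> a x b^T on m x n matrices in the basis of matrix units. *)
definition phi :: "nat \<Rightarrow> nat \<Rightarrow> complex mat \<Rightarrow> complex mat \<Rightarrow> complex mat" where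
  "phi m n a b =
     mat (m * n) (m * n) (\<lambda>(k, l).
       (a * munit m n (l mod m) (l div m) * transpose_mat b) $$ (k mod m, k div m))"

definition dphi :: "nat \<Rightarrow> nat \<Rightarrow> complex mat \<Rightarrow> complex mat \<Rightarrow> complex mat" where
  "dphi m n X Y =
     mat (m * n) (m * n) (\<lambda>(k, l).
       deriv (\<lambda>z. phi m n (1\<^sub>m m + z \<cdot>\<^sub>m X) (1\<^sub>m n + z \<cdot>\<^sub>m Y) $$ (k, l)) 0)"

definition restricted_rep ::
  "nat \<Rightarrow> nat \<Rightarrow> nat \<Rightarrow> (complex mat \<Rightarrow> complex mat) \<Rightarrow> complex mat \<Rightarrow> complex mat \<Rightarrow> complex mat" where
  "restricted_rep m n d \<rho> X Y = gl_differential (m * n) d \<rho> (dphi m n X Y)"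


section \<open>Matching at q = 1\<close>

definition commutator :: "complex mat \<Rightarrow> complex mat \<Rightarrow> complex mat" where
  "commutator X Y = X * Y - Y * X"

definition gl_gl_rep :: "nat \<Rightarrow> nat \<Rightarrow> nat \<Rightarrow> (complex mat \<Rightarrow> complex mat \<Rightarrow> complex mat) \<Rightarrow> bool" where
  "gl_gl_rep m n d \<sigma> \<longleftrightarrow>
     (\<forall>X\<in>carrier_mat m m. \<forall>Y\<in>carrier_mat n n. \<sigma> X Y \<in> carrier_mat d d \<and>
        (\<forall>c. \<sigma> (c \<cdot>\<^sub>m X) (c \<cdot>\<^sub>m Y) = c \<cdot>\<^sub>m \<sigma> X Y) \<and>
        (\<forall>X'\<in>carrier_mat m m. \<forall>Y'\<in>carrier_mat n n.
           \<sigma> (X + X') (Y + Y') = \<sigma> X Y + \<sigma> X' Y' \<and>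
           \<sigma> (commutator X X') (commutator Y Y') = commutator (\<sigma> X Y) (\<sigma> X' Y')))"

definition gl_gl_isomorphic ::
  "nat \<Rightarrow> nat \<Rightarrow> nat \<Rightarrow> (complex mat \<Rightarrow> complex mat \<Rightarrow> complex mat)
     \<Rightarrow> nat \<Rightarrow> (complex mat \<Rightarrow> complex mat \<Rightarrow> complex mat) \<Rightarrow> bool" where
  "gl_gl_isomorphic m n d \<sigma> d' \<tau> \<longleftrightarrow>
     (\<exists>S\<in>carrier_mat d d'. invertible_mat S \<and>
        (\<forall>X\<in>carrier_mat m m. \<forall>Y\<in>carrier_mat n n. \<sigma> X Y * S = S * \<tau> X Y))"

definition regular_matrix :: "ratfun mat \<Rightarrow> bool" where
  "regular_matrix M \<longleftrightarrow> (\<forall>i<dim_row M. \<forall>j<dim_col M. regular_at_one (M $$ (i, j)))"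

(* The matrices at q = 1 of e_i, f_i and the diagonal generators are required to be the values
   of a representation \<sigma> on the elementary matrices E_(i,i+1), E_(i+1,i), E_(i,i) of the two
   factors; these generate the Lie algebra, so \<sigma> is unique. *)
definition matches_at_one ::
  "nat \<Rightarrow> nat \<Rightarrow> nat \<Rightarrow> uq_ops \<Rightarrow> uq_ops
     \<Rightarrow> nat \<Rightarrow> (complex mat \<Rightarrow> complex mat \<Rightarrow> complex mat) \<Rightarrow> bool" where
  "matches_at_one m n d A B d' \<tau> \<longleftrightarrow>
     (\<exists>bs \<mu> \<nu>. weight_basis m n d A B bs \<mu> \<nu> \<and>
        (\<forall>i. i + 1 < m \<longrightarrow> regular_matrix (matrix_in_basis d bs (opE A i)) \<and>
                            regular_matrix (matrix_in_basis d bs (opF A i))) \<and>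
        (\<forall>j. j + 1 < n \<longrightarrow> regular_matrix (matrix_in_basis d bs (opE B j)) \<and>
                            regular_matrix (matrix_in_basis d bs (opF B j))) \<and>
        (\<exists>\<sigma>. gl_gl_rep m n d \<sigma> \<and>
           (\<forall>i. i + 1 < m \<longrightarrow>
              \<sigma> (munit m m i (i + 1)) (0\<^sub>m n n) = map_mat at_one (matrix_in_basis d bs (opE A i)) \<and>
              \<sigma> (munit m m (i + 1) i) (0\<^sub>m n n) = map_mat at_one (matrix_in_basis d bs (opF A i))) \<and>
           (\<forall>j. j + 1 < n \<longrightarrow>
              \<sigma> (0\<^sub>m m m) (munit n n j (j + 1)) = map_mat at_one (matrix_in_basis d bs (opE B j)) \<and>
              \<sigma> (0\<^sub>m m m) (munit n n (j + 1) j) = map_mat at_one (matrix_in_basis d bs (opF B j))) \<and>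
           (\<forall>i<m. \<sigma> (munit m m i i) (0\<^sub>m n n) = mat_diag d (\<lambda>k. of_int (\<mu> k i))) \<and>
           (\<forall>j<n. \<sigma> (0\<^sub>m m m) (munit n n j j) = mat_diag d (\<lambda>k. of_int (\<nu> k j))) \<and>
           gl_gl_isomorphic m n d \<sigma> d' \<tau>))"

end

(* Howe duality at generic q. On the exterior algebra of C^m (x) C^r the Chevalley generators of
   U_q(gl_m) and of a (twisted) U_q(gl_r) commute, and each Young diagram gives a joint highest weight
   vector. At q = 1 an invariant positive form makes all linear relations between the words in the f_i
   applied to a highest weight vector depend on its weight alone; counting tableaux (dual Cauchy identity)
   shows that the words obtained from the Young vectors exhaust the exterior algebra. Independence survives
   from q = 1 to generic q, so a word basis of an irreducible gl_m-module carries an action of U_q(gl_m) with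
   matrix entries regular at q = 1. The Weyl module V is realised in a tensor power of C^(mn) as generated by
   an antisymmetrized tensor and decomposed under gl_m x gl_n along orthogonal joint highest weight vectors;
   W is the corresponding sum of tensor products of the quantized blocks. *)

theory Submission
  imports Defs "HOL-Combinatorics.Permutations"
begin

section \<open>Linear algebra over a field and specialization at \<open>q = 1\<close>\<close>

section \<open>Linear algebra of families of functions\<close>

text \<open>Positivity exists only at \<open>q = 1\<close>. Over C(q) a relation between words that
  holds at \<open>q = 1\<close> could therefore break, and the span of a block could grow. The
  exterior algebra supplies the missing bound: its dimension \<open>2 ^ (m * r)\<close> is known,
  and words that are independent at \<open>q = 1\<close> already reach it, so generic
  \<open>q\<close> leaves no room for more. The second action serves to cut the blocks down: within
  the block of a diagram, the vectors of highest weight for it form a single copy of the wanted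
  module. Its parameter is \<open>- inverse q\<close> because \<open>mv\<close> moves particles
  without the signs of the wedge product; along the rows these signs are carried by the diagonal
  factors. Over C(q) the blocks are separated by a bilinear form, for which nondegeneracy replaces
  positivity. Since relations between words depend on the weight alone, they can be carried from the
  exterior algebra to the tensor power; one choice of word bases serves for both, and the quantum
  matrices specialize exactly to those of the restricted Weyl module in its basis of words.\<close>

definition lin_indep :: "'a set \<Rightarrow> ('a \<Rightarrow> 'b \<Rightarrow> 'k::field) \<Rightarrow> bool" where
  "lin_indep A Y \<longleftrightarrow> (\<forall>c. (\<forall>b. (\<Sum>a\<in>A. c a * Y a b) = 0) \<longrightarrow> (\<forall>a\<in>A. c a = 0))"

definition in_span :: "'a set \<Rightarrow> ('a \<Rightarrow> 'b \<Rightarrow> 'k::field) \<Rightarrow> ('b \<Rightarrow> 'k) \<Rightarrow> bool" where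
  "in_span A Y x \<longleftrightarrow> (\<exists>c. \<forall>b. x b = (\<Sum>a\<in>A. c a * Y a b))"

lemma if_one_mult: "(if P then 1 else 0) * (y::'k::semiring_1) = (if P then y else 0)"
  by simp

lemma in_spanI: "(\<And>b. x b = (\<Sum>a\<in>A. c a * Y a b)) \<Longrightarrow> in_span A Y x"
  unfolding in_span_def by blast

lemma lin_indepI:
  "(\<And>c a. (\<And>b. (\<Sum>a\<in>A. c a * Y a b) = 0) \<Longrightarrow> a \<in> A \<Longrightarrow> c a = 0) \<Longrightarrow> lin_indep A Y"
  unfolding lin_indep_def by blast

lemma lin_indepD:
  assumes "lin_indep A Y" and "\<And>b. (\<Sum>a\<in>A. c a * Y a b) = 0" and "a \<in> A"
  shows "c a = 0"
  using assms unfolding lin_indep_def by blast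

lemma lin_indep_coeffs_eq:
  assumes "lin_indep A Y" and "\<And>b. (\<Sum>a\<in>A. c a * Y a b) = (\<Sum>a\<in>A. c' a * Y a b)" and "a \<in> A"
  shows "c a = c' a"
proof -
  have "(\<Sum>a\<in>A. (c a - c' a) * Y a b) = 0" for b
    using assms(2)[of b] by (simp add: left_diff_distrib sum_subtractf)
  from lin_indepD[OF assms(1) this assms(3)] show ?thesis by simp
qed

lemma lin_indep_mono: "lin_indep A Y \<Longrightarrow> B \<subseteq> A \<Longrightarrow> finite A \<Longrightarrow> lin_indep B Y"
  unfolding lin_indep_def
proof (intro allI impI ballI)
  fix c b assume *: "\<forall>c. (\<forall>b. (\<Sum>a\<in>A. c a * Y a b) = 0) \<longrightarrow> (\<forall>a\<in>A. c a = 0)" "B \<subseteq> A" "finite A"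
    "\<forall>b. (\<Sum>a\<in>B. c a * Y a b) = 0" "b \<in> B"
  have "(\<Sum>a\<in>A. (if a \<in> B then c a else 0) * Y a b) = (\<Sum>a\<in>B. c a * Y a b)" for b
    using * by (intro sum.mono_neutral_cong_right) auto
  then have "\<forall>b. (\<Sum>a\<in>A. (if a \<in> B then c a else 0) * Y a b) = 0" using *(4) by metis
  from spec[OF *(1), of "\<lambda>a. if a \<in> B then c a else 0"] this
  have "\<forall>a\<in>A. (if a \<in> B then c a else 0) = 0" by (rule mp)
  moreover have "b \<in> A" using * by blast
  ultimately show "c b = 0" using *(5) by metis
qed

text \<open>Gaussian elimination, by induction on the set of equations: an equation with a nonzero
  coefficient at \<open>a0\<close> is solved for that unknown and substituted into the others, which
  leaves one equation and one unknown less.\<close>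

lemma homogeneous_system_nontrivial_solution:
  fixes M :: "'b \<Rightarrow> 'a \<Rightarrow> 'k::field"
  assumes "finite B" and "finite A" and "card B < card A"
  shows "\<exists>c. (\<exists>a\<in>A. c a \<noteq> 0) \<and> (\<forall>b\<in>B. (\<Sum>a\<in>A. c a * M b a) = 0)"
  using assms
proof (induction B arbitrary: A M rule: finite_induct)
  case empty
  then obtain a where "a \<in> A" by fastforce
  then show ?case by (intro exI[of _ "\<lambda>_. 1"]) auto
next
  case (insert b B)
  show ?case
  proof (cases "\<forall>a\<in>A. M b a = 0")
    case True
    from insert have "card B < card A" by simp
    from insert.IH[OF insert.prems(1) this, of M] True show ?thesis by auto
  next
    case False
    then obtain a0 where a0: "a0 \<in> A" "M b a0 \<noteq> 0" by blast
    have "card B < card (A - {a0})" using insert a0 by simp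
    from insert.IH[OF _ this, of "\<lambda>b' a. M b' a - M b' a0 * M b a / M b a0"] insert.prems
    obtain c where c: "\<exists>a\<in>A - {a0}. c a \<noteq> 0"
      "\<forall>b'\<in>B. (\<Sum>a\<in>A - {a0}. c a * (M b' a - M b' a0 * M b a / M b a0)) = 0"
      by auto
    \<comment> \<open>\<open>- s\<close> is the value that the solved equation assigns to the
      eliminated unknown \<open>a0\<close>.\<close>
    define s where "s = (\<Sum>a\<in>A - {a0}. c a * M b a) / M b a0"
    define c' where "c' = c(a0 := - s)"
    have S: "(\<Sum>a\<in>A. c' a * M b' a) = (\<Sum>a\<in>A - {a0}. c a * M b' a) - s * M b' a0" for b'
      using insert.prems a0 unfolding c'_def by (simp add: sum.remove[of A a0])
    have "(\<Sum>a\<in>A. c' a * M b' a) = 0" if "b' \<in> B" for b'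
    proof -
      have "(\<Sum>a\<in>A - {a0}. c a * (M b' a - M b' a0 * M b a / M b a0))
          = (\<Sum>a\<in>A - {a0}. c a * M b' a) - s * M b' a0"
        unfolding s_def
        by (simp add: right_diff_distrib sum_subtractf sum_divide_distrib sum_distrib_left mult_ac)
      then show ?thesis using c(2) that S by simp
    qed
    moreover have "(\<Sum>a\<in>A. c' a * M b a) = 0" unfolding S s_def using a0 by simp
    moreover have "\<exists>a\<in>A. c' a \<noteq> 0" using c(1) unfolding c'_def by auto
    ultimately show ?thesis by blast
  qed
qed

text \<open>If \<open>A\<close> were larger than \<open>B\<close>, expanding each \<open>Y a\<close>
  in \<open>B\<close> would give a homogeneous system with more unknowns than equations.\<close>

lemma card_le_of_lin_indep_in_span:
  assumes "finite A" and "finite B" and "lin_indep A Y" and "\<And>a. a \<in> A \<Longrightarrow> in_span B Z (Y a)"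
  shows "card A \<le> card B"
proof (rule ccontr)
  assume "\<not> ?thesis"
  then have lt: "card B < card A" by simp
  from assms(4) have "\<forall>a\<in>A. \<exists>c. \<forall>x. Y a x = (\<Sum>b\<in>B. c b * Z b x)"
    unfolding in_span_def by blast
  from bchoice[OF this] obtain M where M: "\<And>a x. a \<in> A \<Longrightarrow> Y a x = (\<Sum>b\<in>B. M a b * Z b x)"
    by blast
  from homogeneous_system_nontrivial_solution[OF assms(2,1) lt, of "\<lambda>b a. M a b"]
  obtain c where c: "\<exists>a\<in>A. c a \<noteq> 0" "\<forall>b\<in>B. (\<Sum>a\<in>A. c a * M a b) = 0" by blast
  have "(\<Sum>a\<in>A. c a * Y a x) = 0" for x
  proof -
    have "(\<Sum>a\<in>A. c a * Y a x) = (\<Sum>a\<in>A. \<Sum>b\<in>B. c a * M a b * Z b x)"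
      by (intro sum.cong refl) (simp add: M sum_distrib_left mult.assoc)
    also have "\<dots> = (\<Sum>b\<in>B. (\<Sum>a\<in>A. c a * M a b) * Z b x)"
      by (subst sum.swap) (simp add: sum_distrib_right)
    finally show ?thesis using c(2) by simp
  qed
  with c(1) assms(3) show False unfolding lin_indep_def by blast
qed

lemma lin_indep_insert:
  assumes "finite A" and "lin_indep A Y" and "a \<notin> A" and "\<not> in_span A Y (Y a)"
  shows "lin_indep (insert a A) Y"
  unfolding lin_indep_def
proof (intro allI impI)
  fix c assume *: "\<forall>b. (\<Sum>a\<in>insert a A. c a * Y a b) = 0"
  then have eq: "c a * Y a b = - (\<Sum>a\<in>A. c a * Y a b)" for b
    using assms by (simp add: eq_neg_iff_add_eq_0)
  have "c a = 0"
  proof (rule ccontr)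
    assume "c a \<noteq> 0"
    then have "Y a b = (\<Sum>x\<in>A. - c x / c a * Y x b)" for b
      using eq[of b] by (simp add: sum_divide_distrib[symmetric] sum_negf field_simps)
    then have "in_span A Y (Y a)" unfolding in_span_def by (intro exI[of _ "\<lambda>x. - c x / c a"]) simp
    with assms(4) show False by blast
  qed
  moreover have "(\<Sum>x\<in>A. c x * Y x b) = 0" for b using eq[of b] calculation by simp
  ultimately show "\<forall>a\<in>insert a A. c a = 0" using assms(2) unfolding lin_indep_def by auto
qed

definition supp_in :: "'b set \<Rightarrow> ('b \<Rightarrow> 'k::zero) \<Rightarrow> bool" where
  "supp_in X x \<longleftrightarrow> (\<forall>b. b \<notin> X \<longrightarrow> x b = 0)"

definition delta :: "'b \<Rightarrow> 'b \<Rightarrow> 'k::zero_neq_one" where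
  "delta b = (\<lambda>b'. if b' = b then 1 else 0)"

lemma in_span_delta:
  fixes x :: "'b \<Rightarrow> 'k::field"
  assumes "finite X" and "supp_in X x"
  shows "in_span X delta x"
  unfolding in_span_def
  using assms by (intro exI[of _ x]) (auto simp: delta_def supp_in_def if_distrib cong: if_cong)

lemma card_le_of_lin_indep_supp:
  assumes "finite X" and "finite A" and "lin_indep A Y" and "\<And>a. a \<in> A \<Longrightarrow> supp_in X (Y a)"
  shows "card A \<le> card X"
  by (rule card_le_of_lin_indep_in_span[OF assms(2,1,3)]) (use assms in_span_delta in blast)

text \<open>\<open>J\<close> may be infinite, as it is for the set of all words. The bound
  \<open>n\<close> makes an independent subfamily of greatest cardinality exist, and every other
  member then lies in its span.\<close>

lemma finite_basis_exists:
  assumes bd: "\<And>A. A \<subseteq> J \<Longrightarrow> finite A \<Longrightarrow> lin_indep A Y \<Longrightarrow> card A \<le> n"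
  shows "\<exists>B\<subseteq>J. finite B \<and> lin_indep B Y \<and> (\<forall>a\<in>J. in_span B Y (Y a))"
proof -
  let ?P = "\<lambda>k. \<exists>A\<subseteq>J. finite A \<and> lin_indep A Y \<and> card A = k"
  have P0: "?P 0" by (intro exI[of _ "{}"]) (simp add: lin_indep_def)
  have bd': "\<And>k. ?P k \<Longrightarrow> k \<le> n" using bd by blast
  obtain k where k: "?P k" "\<And>k'. ?P k' \<Longrightarrow> k' \<le> k"
    using GreatestI_nat[of ?P, OF P0 bd'] Greatest_le_nat[of ?P, OF _ bd'] by metis
  then obtain B where B: "B \<subseteq> J" "finite B" "lin_indep B Y" "card B = k" by blast
  have "in_span B Y (Y a)" if "a \<in> J" for a
  proof (cases "a \<in> B")
    case True
    then show ?thesis unfolding in_span_def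
      using B(2) by (intro exI[of _ "\<lambda>x. if x = a then 1 else 0"]) (simp add: if_one_mult)
  next
    case False
    show ?thesis
    proof (rule ccontr)
      assume "\<not> ?thesis"
      from lin_indep_insert[OF B(2,3) False this] have "?P (Suc k)"
        using B False that by (intro exI[of _ "insert a B"]) auto
      from k(2)[OF this] show False by simp
    qed
  qed
  with B show ?thesis by blast
qed

text \<open>A vector outside the span would be one more independent vector supported in
  \<open>X\<close>. It is added under the index \<open>None\<close>, since \<open>x\<close> has no
  index in \<open>A\<close>.\<close>

lemma in_span_of_card_eq:
  assumes X: "finite X" and A: "finite A" and ind: "lin_indep A Y"
    and s: "\<And>a. a \<in> A \<Longrightarrow> supp_in X (Y a)" and c: "card X \<le> card A" and x: "supp_in X x"
  shows "in_span A Y x"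
proof (rule ccontr)
  assume n: "\<not> ?thesis"
  let ?Y = "\<lambda>a. case a of None \<Rightarrow> x | Some a \<Rightarrow> Y a"
  have "lin_indep (Some ` A) ?Y"
  proof (rule lin_indepI)
    fix c a assume z: "\<And>b. (\<Sum>a\<in>Some ` A. c a * ?Y a b) = 0" and a: "a \<in> Some ` A"
    have "(\<Sum>a\<in>A. c (Some a) * Y a b) = 0" for b using z[of b] by (simp add: sum.reindex)
    from lin_indepD[OF ind, of "\<lambda>a. c (Some a)", OF this] a show "c a = 0" by auto
  qed
  moreover have "\<not> in_span (Some ` A) ?Y (?Y None)"
  proof
    assume "in_span (Some ` A) ?Y (?Y None)"
    then obtain c where "\<And>b. x b = (\<Sum>a\<in>A. c (Some a) * Y a b)"
      unfolding in_span_def by (auto simp: sum.reindex)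
    then have "in_span A Y x" by (rule in_spanI)
    with n show False by blast
  qed
  ultimately have "lin_indep (insert None (Some ` A)) ?Y"
    using A by (intro lin_indep_insert) auto
  then have "card (insert None (Some ` A)) \<le> card X"
    using X A s x by (intro card_le_of_lin_indep_supp[where Y = ?Y]) auto
  then show False using A c by (simp add: card_image)
qed

lemma in_span_sum:
  assumes "finite I" and "\<And>i. i \<in> I \<Longrightarrow> in_span A Y (x i)"
  shows "in_span A Y (\<lambda>b. \<Sum>i\<in>I. c i * x i b)"
proof -
  from assms(2) have "\<forall>i\<in>I. \<exists>c. \<forall>b. x i b = (\<Sum>a\<in>A. c a * Y a b)"
    unfolding in_span_def by blast
  from bchoice[OF this] obtain d where d: "\<And>i b. i \<in> I \<Longrightarrow> x i b = (\<Sum>a\<in>A. d i a * Y a b)"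
    by blast
  have "(\<Sum>i\<in>I. c i * x i b) = (\<Sum>a\<in>A. (\<Sum>i\<in>I. c i * d i a) * Y a b)" for b
  proof -
    have "(\<Sum>i\<in>I. c i * x i b) = (\<Sum>i\<in>I. \<Sum>a\<in>A. c i * d i a * Y a b)"
      by (intro sum.cong refl) (simp add: d sum_distrib_left mult.assoc)
    then show ?thesis by (subst (asm) sum.swap) (simp add: sum_distrib_right)
  qed
  then show ?thesis by (rule in_spanI)
qed

lemma in_span_trans:
  assumes "finite A" and "in_span A Y x" and "\<And>a. a \<in> A \<Longrightarrow> in_span B Z (Y a)"
  shows "in_span B Z x"
proof -
  from assms(2) obtain c where "x = (\<lambda>b. \<Sum>a\<in>A. c a * Y a b)" unfolding in_span_def by blast
  with in_span_sum[of A B Z Y c, OF assms(1,3)] show ?thesis by simp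
qed

lemma in_span_base:
  assumes "finite A" and "a \<in> A"
  shows "in_span A Y (Y a)"
  unfolding in_span_def
  using assms by (intro exI[of _ "\<lambda>x. if x = a then 1 else 0"]) (simp add: if_one_mult)

text \<open>\<open>w\<close> and \<open>w'\<close> are the weights of the vectors, \<open>g\<close> gives the weights of the points of the domain.\<close>

lemma card_weight_le:
  fixes g :: "'b \<Rightarrow> 'w"
  assumes A: "finite A" and B: "finite B" and ind: "lin_indep B Z"
    and sp: "\<And>b. b \<in> B \<Longrightarrow> in_span A Y (Z b)"
    and wA: "\<And>a x. a \<in> A \<Longrightarrow> Y a x \<noteq> 0 \<Longrightarrow> g x = w a"
    and wB: "\<And>b x. b \<in> B \<Longrightarrow> Z b x \<noteq> 0 \<Longrightarrow> g x = w' b"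
  shows "card {b \<in> B. w' b = \<omega>} \<le> card {a \<in> A. w a = \<omega>}"
proof (rule card_le_of_lin_indep_in_span[where Y = Z and Z = Y])
  show "lin_indep {b \<in> B. w' b = \<omega>} Z" by (rule lin_indep_mono[OF ind]) (use B in auto)
  fix b assume b: "b \<in> {b \<in> B. w' b = \<omega>}"
  then obtain c where c: "\<And>x. Z b x = (\<Sum>a\<in>A. c a * Y a x)" using sp unfolding in_span_def by blast
  have "Z b x = (\<Sum>a\<in>{a \<in> A. w a = \<omega>}. c a * Y a x)" for x
  proof (cases "g x = \<omega>")
    case True
    then show ?thesis unfolding c using A wA by (intro sum.mono_neutral_right) force+
  next
    case False
    then have "Z b x = 0" using b wB by force
    moreover have "(\<Sum>a\<in>{a \<in> A. w a = \<omega>}. c a * Y a x) = 0"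
      using wA False by (intro sum.neutral) force
    ultimately show ?thesis by simp
  qed
  then show "in_span {a \<in> A. w a = \<omega>} Y (Z b)" unfolding in_span_def by blast
qed (use A B in auto)

text \<open>Bijections between the fibres over each weight are glued along \<open>w\<close>.\<close>

lemma bij_betw_of_card_eq:
  assumes A: "finite A" and B: "finite B"
    and eq: "\<And>\<omega>. card {a \<in> A. w a = \<omega>} = card {b \<in> B. w' b = \<omega>}"
  shows "\<exists>h. bij_betw h A B \<and> (\<forall>a\<in>A. w' (h a) = w a)"
proof -
  have "\<exists>h. bij_betw h {a \<in> A. w a = \<omega>} {b \<in> B. w' b = \<omega>}" for \<omega>
    using A B eq by (intro finite_same_card_bij) auto
  then obtain h where h: "\<And>\<omega>. bij_betw (h \<omega>) {a \<in> A. w a = \<omega>} {b \<in> B. w' b = \<omega>}" by metis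
  let ?h = "\<lambda>a. h (w a) a"
  have 1: "?h a \<in> B \<and> w' (?h a) = w a" if "a \<in> A" for a
    using h[of "w a"] that unfolding bij_betw_def by auto
  have "inj_on ?h A"
    using h unfolding bij_betw_def inj_on_def by (smt (verit) 1 mem_Collect_eq)
  moreover have "?h ` A = B"
  proof
    show "?h ` A \<subseteq> B" using 1 by auto
    show "B \<subseteq> ?h ` A"
    proof
      fix b assume "b \<in> B"
      then have "b \<in> h (w' b) ` {a \<in> A. w a = w' b}" using h[of "w' b"] unfolding bij_betw_def by auto
      then obtain a where "a \<in> A" "w a = w' b" "b = h (w' b) a" by blast
      then show "b \<in> ?h ` A" by (intro image_eqI[of _ _ a]) simp_all
    qed
  qed
  ultimately show ?thesis using 1 unfolding bij_betw_def by (intro exI[of _ ?h]) auto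
qed

section \<open>Regularity at \<open>q = 1\<close>\<close>

lemma regular_at_oneE:
  assumes "regular_at_one x"
  obtains a b where "poly b 1 \<noteq> 0" and "b \<noteq> 0" and "x = Fract a b" and "at_one x = poly a 1 / poly b 1"
  using assms at_one_Fract unfolding regular_at_one_def by (metis poly_0)

lemma regular_FractI: "poly b 1 \<noteq> 0 \<Longrightarrow> regular_at_one (Fract a b)"
  unfolding regular_at_one_def by blast

lemma regular_add [simp]: "regular_at_one x \<Longrightarrow> regular_at_one y \<Longrightarrow> regular_at_one (x + y)"
  and at_one_add [simp]: "regular_at_one x \<Longrightarrow> regular_at_one y \<Longrightarrow> at_one (x + y) = at_one x + at_one y"
proof -
  assume "regular_at_one x" "regular_at_one y"
  from this(1) obtain a b where 1: "poly b 1 \<noteq> 0" "b \<noteq> 0" "x = Fract a b" "at_one x = poly a 1 / poly b 1"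
    by (rule regular_at_oneE)
  from \<open>regular_at_one y\<close> obtain a' b' where 2: "poly b' 1 \<noteq> 0" "b' \<noteq> 0" "y = Fract a' b'"
    "at_one y = poly a' 1 / poly b' 1" by (rule regular_at_oneE)
  have "x + y = Fract (a * b' + a' * b) (b * b')" using 1 2 by simp
  then show "regular_at_one (x + y)" "at_one (x + y) = at_one x + at_one y"
    using 1 2 by (simp_all add: regular_FractI at_one_Fract add_frac_eq)
qed

lemma regular_mult [simp]: "regular_at_one x \<Longrightarrow> regular_at_one y \<Longrightarrow> regular_at_one (x * y)"
  and at_one_mult [simp]: "regular_at_one x \<Longrightarrow> regular_at_one y \<Longrightarrow> at_one (x * y) = at_one x * at_one y"
proof -
  assume "regular_at_one x" "regular_at_one y"
  from this(1) obtain a b where 1: "poly b 1 \<noteq> 0" "b \<noteq> 0" "x = Fract a b" "at_one x = poly a 1 / poly b 1"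
    by (rule regular_at_oneE)
  from \<open>regular_at_one y\<close> obtain a' b' where 2: "poly b' 1 \<noteq> 0" "b' \<noteq> 0" "y = Fract a' b'"
    "at_one y = poly a' 1 / poly b' 1" by (rule regular_at_oneE)
  have "x * y = Fract (a * a') (b * b')" using 1 2 by simp
  then show "regular_at_one (x * y)" "at_one (x * y) = at_one x * at_one y"
    using 1 2 by (simp_all add: regular_FractI at_one_Fract)
qed

lemma regular_const: "regular_at_one (Fract [:c:] 1)" "at_one (Fract [:c:] 1) = c"
  by (simp_all add: regular_FractI at_one_Fract)

lemma regular_0 [simp]: "regular_at_one 0" "at_one 0 = 0"
  using regular_const[of 0] by (simp_all add: Zero_fract_def)

lemma regular_1 [simp]: "regular_at_one 1" "at_one 1 = 1"
  using regular_const[of 1] by (simp_all add: One_fract_def one_pCons)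

lemma regular_uminus [simp]: "regular_at_one x \<Longrightarrow> regular_at_one (- x)"
  and at_one_uminus [simp]: "regular_at_one x \<Longrightarrow> at_one (- x) = - at_one x"
proof -
  assume "regular_at_one x"
  then obtain a b where 1: "poly b 1 \<noteq> 0" "b \<noteq> 0" "x = Fract a b" "at_one x = poly a 1 / poly b 1"
    by (rule regular_at_oneE)
  then have "- x = Fract (- a) b" by simp
  then show "regular_at_one (- x)" "at_one (- x) = - at_one x"
    using 1 by (simp_all add: regular_FractI at_one_Fract)
qed

lemma regular_sum: "(\<And>a. a \<in> A \<Longrightarrow> regular_at_one (f a)) \<Longrightarrow> regular_at_one (sum f A)"
  and at_one_sum: "(\<And>a. a \<in> A \<Longrightarrow> regular_at_one (f a)) \<Longrightarrow> at_one (sum f A) = (\<Sum>a\<in>A. at_one (f a))"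
proof -
  assume r: "\<And>a. a \<in> A \<Longrightarrow> regular_at_one (f a)"
  have "regular_at_one (sum f A) \<and> at_one (sum f A) = (\<Sum>a\<in>A. at_one (f a))"
    using r by (induction A rule: infinite_finite_induct) auto
  then show "regular_at_one (sum f A)" "at_one (sum f A) = (\<Sum>a\<in>A. at_one (f a))" by auto
qed

lemma regular_inverse: "regular_at_one x \<Longrightarrow> at_one x \<noteq> 0 \<Longrightarrow> regular_at_one (inverse x)"
  and at_one_inverse: "regular_at_one x \<Longrightarrow> at_one x \<noteq> 0 \<Longrightarrow> at_one (inverse x) = inverse (at_one x)"
proof -
  assume "regular_at_one x" and n: "at_one x \<noteq> 0"
  then obtain a b where 1: "poly b 1 \<noteq> 0" "b \<noteq> 0" "x = Fract a b" "at_one x = poly a 1 / poly b 1"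
    using regular_at_oneE by metis
  then have "poly a 1 \<noteq> 0" "inverse x = Fract b a" using n by auto
  then show "regular_at_one (inverse x)" "at_one (inverse x) = inverse (at_one x)"
    using 1 by (simp_all add: regular_FractI at_one_Fract)
qed

lemma regular_power: "regular_at_one x \<Longrightarrow> regular_at_one (x ^ n) \<and> at_one (x ^ n) = at_one x ^ n"
  by (induction n) auto

lemma regular_powi:
  assumes "regular_at_one x" and "at_one x \<noteq> 0"
  shows "regular_at_one (x powi k) \<and> at_one (x powi k) = at_one x powi k"
  using regular_power[OF assms(1)] regular_power[OF regular_inverse[OF assms]] at_one_inverse[OF assms]
  by (simp add: power_int_def)

lemma qq_nonzero [simp]: "qq \<noteq> 0"
  and regular_qq [simp]: "regular_at_one qq"
  and at_one_qq [simp]: "at_one qq = 1"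
  unfolding qq_def by (simp_all add: regular_FractI at_one_Fract Zero_fract_def eq_fract)

lemma qq_power: "qq ^ n = Fract (monom 1 n) 1"
  by (induction n) (simp_all add: qq_def One_fract_def one_pCons monom_0 monom_Suc)

lemma qq_power_inj: "qq ^ n = qq ^ k \<longleftrightarrow> n = k"
  by (simp add: qq_power eq_fract monom_eq_iff')

lemma qq_square_ne_1: "qq * qq \<noteq> 1"
  using qq_power_inj[of 2 0] by (simp add: power2_eq_square)

lemma common_denominator:
  fixes c :: "'a \<Rightarrow> complex poly fract"
  assumes "finite A"
  shows "\<exists>b a. b \<noteq> 0 \<and> (\<forall>i\<in>A. c i = Fract (a i) b)"
  using assms
proof (induction A rule: finite_induct)
  case empty
  then show ?case by (intro exI[of _ 1]) auto
next
  case (insert x A)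
  then obtain b a where b: "b \<noteq> 0" "\<forall>i\<in>A. c i = Fract (a i) b" by blast
  obtain p r where pr: "c x = Fract p r" "r \<noteq> 0" by (cases "c x") auto
  show ?case
  proof (intro exI conjI ballI)
    show "b * r \<noteq> 0" using b pr by simp
    fix i assume "i \<in> insert x A"
    then show "c i = Fract ((\<lambda>i. if i = x then p * b else a i * r) i) (b * r)"
      using b pr by (auto simp: eq_fract)
  qed
qed

text \<open>Multiply by the common denominator and cancel the common power of \<open>q - 1\<close>; the scaling
  factor vanishes at \<open>q = 1\<close> as soon as one coefficient has a pole there.\<close>

lemma primitive_scaling:
  fixes c :: "'a \<Rightarrow> ratfun"
  assumes A: "finite A" and nz: "\<exists>i\<in>A. c i \<noteq> 0"
  obtains s where "\<forall>i\<in>A. regular_at_one (s * c i)" and "\<exists>i\<in>A. at_one (s * c i) \<noteq> 0"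
    and "(\<forall>i\<in>A. regular_at_one (c i)) \<or> (regular_at_one s \<and> at_one s = 0)"
proof -
  obtain b a where b: "b \<noteq> 0" "\<And>i. i \<in> A \<Longrightarrow> c i = Fract (a i) b"
    using common_denominator[OF A, of c] by blast
  let ?X = "[:-1, 1:] :: complex poly"
  define J where "J = {i \<in> A. a i \<noteq> 0}"
  have J: "finite J" "J \<noteq> {}" using A nz b by (auto simp: J_def Zero_fract_def eq_fract)
  define k where "k = Min ((\<lambda>i. order 1 (a i)) ` J)"
  define l where "l = order 1 b"
  have "\<exists>a'. a i = ?X ^ k * a'" if "i \<in> A" for i
  proof (cases "i \<in> J")
    case True
    then have "k \<le> order 1 (a i)" unfolding k_def using J by simp
    then have "?X ^ k dvd a i" by (meson dvd_trans le_imp_power_dvd order_1)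
    then show ?thesis by (simp add: dvd_def)
  next
    case False
    then show ?thesis using that by (intro exI[of _ 0]) (auto simp: J_def)
  qed
  then obtain a' where a': "\<And>i. i \<in> A \<Longrightarrow> a i = ?X ^ k * a' i" by metis
  have "k \<in> (\<lambda>i. order 1 (a i)) ` J" unfolding k_def using J by (intro Min_in) auto
  then obtain j where j: "j \<in> A" "a j \<noteq> 0" "order 1 (a j) = k" unfolding J_def by blast
  have j': "poly (a' j) 1 \<noteq> 0"
  proof
    assume "poly (a' j) 1 = 0"
    then have "?X dvd a' j" by (simp add: poly_eq_0_iff_dvd)
    then have "?X ^ k * ?X dvd ?X ^ k * a' j" by (intro mult_dvd_mono) auto
    then have "?X ^ Suc k dvd a j" unfolding a'[OF j(1)] power_Suc2 .
    with order_2[OF j(2), of 1] j(3) show False by simp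
  qed
  have X0: "?X ^ k \<noteq> 0" by simp
  define s where "s = Fract b (?X ^ k)"
  have sc: "s * c i = Fract (a' i) 1" if "i \<in> A" for i
    using b a'[OF that] that X0 unfolding s_def by (simp add: eq_fract)
  have r: "\<forall>i\<in>A. regular_at_one (s * c i)" using sc by (simp add: regular_FractI)
  have e: "\<exists>i\<in>A. at_one (s * c i) \<noteq> 0" using sc j j' by (intro bexI[of _ j]) (simp_all add: at_one_Fract)
  obtain b' where b': "b = ?X ^ l * b'" using order_1[of 1 b] unfolding l_def by (auto simp: dvd_def)
  have b'1: "poly b' 1 \<noteq> 0"
  proof
    assume "poly b' 1 = 0"
    then have "?X dvd b'" by (simp add: poly_eq_0_iff_dvd)
    then have "?X ^ l * ?X dvd ?X ^ l * b'" by (intro mult_dvd_mono) auto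
    then have "?X ^ Suc l dvd b" unfolding b'[symmetric] power_Suc2 .
    with order_2[OF b(1), of 1] show False unfolding l_def by simp
  qed
  have "(\<forall>i\<in>A. regular_at_one (c i)) \<or> (regular_at_one s \<and> at_one s = 0)"
  proof (cases "l \<le> k")
    case True
    have "c i = Fract (?X ^ (k - l) * a' i) b'" if "i \<in> A" for i
    proof -
      have "?X ^ k = ?X ^ l * ?X ^ (k - l)" using True by (simp add: power_add[symmetric])
      moreover have "b' \<noteq> 0" using b'1 by auto
      ultimately show ?thesis using b(2)[OF that] b' a'[OF that] b(1) by (simp add: eq_fract)
    qed
    then show ?thesis using b'1 by (auto intro: regular_FractI)
  next
    case False
    then obtain d where "l = k + Suc d" by (metis less_imp_Suc_add not_le add_Suc_right)
    then have "?X ^ l = ?X ^ k * (?X * ?X ^ d)" by (simp only: power_add power_Suc)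
    then have "s = Fract (?X * ?X ^ d * b') 1"
      unfolding s_def b' using X0 by (simp add: eq_fract)
    then show ?thesis by (simp add: regular_FractI at_one_Fract)
  qed
  with r e that show ?thesis by blast
qed

text \<open>A nontrivial relation over C(q) can be scaled so that its coefficients are regular at
  \<open>q = 1\<close> and not all zero there; evaluation then gives a nontrivial relation at
  \<open>q = 1\<close>.\<close>

lemma lin_indep_of_at_one:
  fixes Y :: "'a \<Rightarrow> 'b \<Rightarrow> ratfun"
  assumes A: "finite A" and r: "\<And>a b. a \<in> A \<Longrightarrow> regular_at_one (Y a b)"
    and ind: "lin_indep A (\<lambda>a b. at_one (Y a b))"
  shows "lin_indep A Y"
  unfolding lin_indep_def
proof (intro allI impI, rule ccontr)
  fix c assume z: "\<forall>b. (\<Sum>a\<in>A. c a * Y a b) = 0" and n: "\<not> (\<forall>a\<in>A. c a = 0)"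
  then obtain s where s: "\<forall>i\<in>A. regular_at_one (s * c i)" "\<exists>i\<in>A. at_one (s * c i) \<noteq> 0"
    using primitive_scaling[OF A, of c] by metis
  have "(\<Sum>a\<in>A. at_one (s * c a) * at_one (Y a b)) = 0" for b
  proof -
    have "(\<Sum>a\<in>A. at_one (s * c a) * at_one (Y a b)) = at_one (\<Sum>a\<in>A. s * c a * Y a b)"
      using s r by (subst at_one_sum) (auto intro!: sum.cong)
    also have "(\<Sum>a\<in>A. s * c a * Y a b) = s * (\<Sum>a\<in>A. c a * Y a b)" by (simp add: sum_distrib_left mult.assoc)
    finally show ?thesis using z by simp
  qed
  from lin_indepD[OF ind, of "\<lambda>a. at_one (s * c a)", OF this] s(2) show False by blast
qed

text \<open>If some \<open>c a\<close> had a pole at \<open>q = 1\<close>, the primitive scaling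
  factor would vanish there, and the scaled equation would specialize to a nontrivial relation
  between the \<open>Y a\<close> at \<open>q = 1\<close>.\<close>

lemma regular_coefficients:
  fixes Y :: "'a \<Rightarrow> 'b \<Rightarrow> ratfun"
  assumes A: "finite A" and r: "\<And>a b. a \<in> A \<Longrightarrow> regular_at_one (Y a b)"
    and ind: "lin_indep A (\<lambda>a b. at_one (Y a b))"
    and x: "\<And>b. regular_at_one (x b)" and eq: "\<And>b. x b = (\<Sum>a\<in>A. c a * Y a b)"
  shows "\<forall>a\<in>A. regular_at_one (c a)"
proof (rule ccontr)
  assume n: "\<not> ?thesis"
  then have "\<exists>i\<in>A. c i \<noteq> 0" by (metis regular_0(1))
  from primitive_scaling[OF A this] n obtain s where s: "\<forall>i\<in>A. regular_at_one (s * c i)"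
    "\<exists>i\<in>A. at_one (s * c i) \<noteq> 0" "regular_at_one s" "at_one s = 0" by metis
  have "(\<Sum>a\<in>A. at_one (s * c a) * at_one (Y a b)) = 0" for b
  proof -
    have "(\<Sum>a\<in>A. at_one (s * c a) * at_one (Y a b)) = at_one (\<Sum>a\<in>A. s * c a * Y a b)"
      using s r by (subst at_one_sum) (auto intro!: sum.cong)
    also have "(\<Sum>a\<in>A. s * c a * Y a b) = s * x b" by (simp add: eq sum_distrib_left mult.assoc)
    finally show ?thesis using s x by simp
  qed
  from lin_indepD[OF ind, of "\<lambda>a. at_one (s * c a)", OF this] s(2) show False by blast
qed

section \<open>Commuting quantum actions on the exterior algebra\<close>

section \<open>Linear operators on functions\<close>

text \<open>Linear maps form a type of class \<open>ring_1\<close>, so that relations between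
  operators are calculated like identities in a noncommutative ring. Scalars enter as the central
  elements \<open>sc c\<close>.\<close>

typedef (overloaded) ('b, 'k::field) lop =
  "{f :: ('b \<Rightarrow> 'k) \<Rightarrow> ('b \<Rightarrow> 'k). (\<forall>x y. f (\<lambda>b. x b + y b) = (\<lambda>b. f x b + f y b)) \<and>
      (\<forall>c x. f (\<lambda>b. c * x b) = (\<lambda>b. c * f x b))}"
  morphisms ap Lop
  by (intro exI[of _ "\<lambda>x. x"]) simp

setup_lifting type_definition_lop

instantiation lop :: (type, field) ring_1
begin
lift_definition zero_lop :: "('a, 'b) lop" is "\<lambda>x b. 0" by simp
lift_definition one_lop :: "('a, 'b) lop" is "\<lambda>x. x" by simp
lift_definition plus_lop :: "('a, 'b) lop \<Rightarrow> ('a, 'b) lop \<Rightarrow> ('a, 'b) lop" is "\<lambda>f g x b. f x b + g x b"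
  by (simp add: algebra_simps)
lift_definition minus_lop :: "('a, 'b) lop \<Rightarrow> ('a, 'b) lop \<Rightarrow> ('a, 'b) lop" is "\<lambda>f g x b. f x b - g x b"
  by (simp add: algebra_simps)
lift_definition uminus_lop :: "('a, 'b) lop \<Rightarrow> ('a, 'b) lop" is "\<lambda>f x b. - f x b"
  by (simp add: algebra_simps)
lift_definition times_lop :: "('a, 'b) lop \<Rightarrow> ('a, 'b) lop \<Rightarrow> ('a, 'b) lop" is "\<lambda>f g x. f (g x)"
  by simp
instance
proof
  fix a b c :: "('a, 'b) lop"
  show "a * b * c = a * (b * c)" by transfer simp
  show "1 * a = a" "a * 1 = a" by (transfer, simp)+
  show "a + b + c = a + (b + c)" "a + b = b + a" "0 + a = a" "- a + a = 0" "a - b = a + - b"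
    by (transfer, simp add: algebra_simps)+
  show "(a + b) * c = a * c + b * c" by transfer simp
  show "a * (b + c) = a * b + a * c" by transfer simp
  have "\<exists>x :: 'a \<Rightarrow> 'b. (\<lambda>b. 0) \<noteq> x" by (intro exI[of _ "\<lambda>b. 1"]) (simp add: fun_eq_iff)
  then show "(0::('a, 'b) lop) \<noteq> 1" by transfer (auto simp: fun_eq_iff)
qed
end

lift_definition dg :: "('b \<Rightarrow> 'k::field) \<Rightarrow> ('b, 'k) lop" is "\<lambda>g x b. g b * x b"
  by (simp add: algebra_simps)

abbreviation sc :: "'k::field \<Rightarrow> ('b, 'k) lop" where "sc c \<equiv> dg (\<lambda>_. c)"

lemma lop_eqI: "(\<And>x b. ap A x b = ap B x b) \<Longrightarrow> A = B"
  by (metis ap_inject ext)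

lemma ap_simps [simp]:
  "ap (A * B) x = ap A (ap B x)"
  "ap (A + B) x = (\<lambda>b. ap A x b + ap B x b)"
  "ap (A - B) x = (\<lambda>b. ap A x b - ap B x b)"
  "ap (- A) x = (\<lambda>b. - ap A x b)"
  "ap 0 x = (\<lambda>b. 0)"
  "ap 1 x = x"
  "ap (dg g) x = (\<lambda>b. g b * x b)"
  by (transfer, simp)+

lemma ap_linear: "ap A (\<lambda>b. x b + c * y b) = (\<lambda>b. ap A x b + c * ap A y b)"
  by transfer simp

lemma ap_zero [simp]: "ap A (\<lambda>b. 0) = (\<lambda>b. 0)"
  using ap_linear[of A "\<lambda>b. 0" "-1" "\<lambda>b. 0"] by (simp add: fun_eq_iff)

lemma ap_scale: "ap A (\<lambda>b. c * y b) = (\<lambda>b. c * ap A y b)"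
  using ap_linear[of A "\<lambda>b. 0" c y] by simp

lemma ap_add: "ap A (\<lambda>b. x b + y b) = (\<lambda>b. ap A x b + ap A y b)"
  using ap_linear[of A x 1 y] by simp

lemma ap_diff: "ap A (\<lambda>b. x b - y b) = (\<lambda>b. ap A x b - ap A y b)"
  using ap_linear[of A x "-1" y] by simp

lemma ap_sum: "ap A (\<lambda>b. \<Sum>i\<in>I. c i * Y i b) = (\<lambda>b. \<Sum>i\<in>I. c i * ap A (Y i) b)"
proof (induction I rule: infinite_finite_induct)
  case (insert i I)
  then show ?case
    using ap_linear[of A "\<lambda>b. \<Sum>i\<in>I. c i * Y i b" "c i" "Y i"] by (simp add: add.commute)
qed auto

lemma ap_sum_op: "ap (\<Sum>i\<in>I. A i) x = (\<lambda>b. \<Sum>i\<in>I. ap (A i) x b)"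
  by (induction I rule: infinite_finite_induct) auto

lemma dg_mult: "dg g * dg h = dg (\<lambda>b. g b * h b)"
  and dg_add: "dg g + dg h = dg (\<lambda>b. g b + h b)"
  and dg_diff: "dg g - dg h = dg (\<lambda>b. g b - h b)"
  and dg_one: "dg (\<lambda>b. 1) = 1"
  and dg_zero: "dg (\<lambda>b. 0) = 0"
  by (auto intro!: lop_eqI simp: algebra_simps)

lemma dg_commute: "dg g * dg h = dg h * dg g"
  by (simp add: dg_mult mult.commute)

lemma sc_central: "A * sc c = sc c * A"
  by (rule lop_eqI) (simp add: ap_scale)

lemma sc_left: "A * (sc c * B) = sc c * (A * B)"
  by (metis mult.assoc sc_central)

lemma sc_sc: "sc c * (sc d * A) = sc (c * d) * A"
  by (simp add: mult.assoc[symmetric] dg_mult)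

section \<open>Column chains on the exterior algebra\<close>

text \<open>A state marks the occupied sites, i.e. it is a basis vector of an exterior power. All operators
  act on coefficient functions, so \<open>mv p p'\<close> moves a particle from \<open>p'\<close> to \<open>p\<close>.\<close>

lift_definition mv :: "'s \<Rightarrow> 's \<Rightarrow> ('s \<Rightarrow> bool, 'k::field) lop" is
  "\<lambda>p p' x S. if S p \<and> \<not> S p' then x (S(p := False, p' := True)) else 0"
  by (auto simp: fun_eq_iff)

lemma ap_mv: "ap (mv p p') x S = (if S p \<and> \<not> S p' then x (S(p := False, p' := True)) else 0)"
  by transfer simp

lemma mv_commute:
  assumes "{p, p'} \<inter> {r, r'} = {}"
  shows "mv p p' * mv r r' = mv r r' * mv p p'"
proof (rule lop_eqI)
  fix x :: "('a \<Rightarrow> bool) \<Rightarrow> 'b" and S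
  have "p \<noteq> r" "p \<noteq> r'" "p' \<noteq> r" "p' \<noteq> r'" using assms by auto
  note ne = this this[symmetric]
  then have *: "S(p := False, p' := True, r := False, r' := True) = S(r := False, r' := True, p := False, p' := True)"
    by (simp add: fun_eq_iff)
  show "ap (mv p p' * mv r r') x S = ap (mv r r' * mv p p') x S"
    using ne by (simp add: ap_mv *)
qed

lemma mv_dg:
  assumes "\<And>S. S p \<Longrightarrow> \<not> S p' \<Longrightarrow> g (S(p := False, p' := True)) = c * g S"
  shows "mv p p' * dg g = sc c * (dg g * mv p p')"
  by (rule lop_eqI) (simp add: ap_mv assms)

lemma mv_mv_zero [simp]: "mv p p' * mv p p' = 0"
  by (rule lop_eqI) (simp add: ap_mv)

lemma mv_braid_zero [simp]:
  "p \<noteq> p'' \<Longrightarrow> mv p p' * (mv p' p'' * mv p p') = 0"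
  "p \<noteq> p'' \<Longrightarrow> mv p' p'' * (mv p p' * mv p' p'') = 0"
  by (rule lop_eqI, simp add: ap_mv)+

definition cartan :: "nat \<Rightarrow> nat \<Rightarrow> int" where
  "cartan i j = (if i = j then 2 else if j = Suc i \<or> i = Suc j then -1 else 0)"

definition loc :: "(nat \<Rightarrow> nat \<Rightarrow> 's) \<Rightarrow> bool \<Rightarrow> nat \<Rightarrow> nat \<Rightarrow> ('s \<Rightarrow> bool, 'k::field) lop" where
  "loc s d i c = (if d then mv (s i c) (s (Suc i) c) else mv (s (Suc i) c) (s i c))"

definition hloc :: "(nat \<Rightarrow> nat \<Rightarrow> 's) \<Rightarrow> nat \<Rightarrow> nat \<Rightarrow> ('s \<Rightarrow> bool) \<Rightarrow> int" where
  "hloc s i c S = of_bool (S (s i c)) - of_bool (S (s (Suc i) c))"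

definition kloc :: "'k::field \<Rightarrow> (nat \<Rightarrow> nat \<Rightarrow> 's) \<Rightarrow> nat \<Rightarrow> nat \<Rightarrow> ('s \<Rightarrow> bool, 'k) lop" where
  "kloc p s i c = dg (\<lambda>S. p powi hloc s i c S)"

definition wts :: "(nat \<Rightarrow> nat \<Rightarrow> 's) \<Rightarrow> nat \<Rightarrow> ('s \<Rightarrow> bool) \<Rightarrow> nat \<Rightarrow> int" where
  "wts s r S i = (\<Sum>c<r. of_bool (S (s i c)))"

definition hw :: "(nat \<Rightarrow> int) \<Rightarrow> nat \<Rightarrow> int" where
  "hw kp i = kp i - kp (Suc i)"

text \<open>\<open>chn p s True r i\<close> is the iterated coproduct of \<open>e\<^sub>i\<close> on \<open>r\<close> columns;
  \<open>chn p s False r i\<close> is its transpose, which is \<open>f\<^sub>i\<close> up to a diagonal factor.\<close>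

primrec chn :: "'k::field \<Rightarrow> (nat \<Rightarrow> nat \<Rightarrow> 's) \<Rightarrow> bool \<Rightarrow> nat \<Rightarrow> nat \<Rightarrow> ('s \<Rightarrow> bool, 'k) lop" where
  "chn p s d 0 i = 0"
| "chn p s d (Suc c) i = chn p s d c i * kloc p s i c + loc s d i c"

text \<open>The quantum integer. The first case is its limit at \<open>p = 1\<close> and
  \<open>p = -1\<close>, where the quotient degenerates; both values occur, as the parameters
  \<open>q\<close> and \<open>- inverse q\<close> at \<open>q = 1\<close>.\<close>

definition qint :: "'k::field \<Rightarrow> int \<Rightarrow> 'k" where
  "qint p a = (if p * p = 1 then of_int a * p powi (a - 1) else (p powi a - p powi (- a)) / (p - inverse p))"

lemma qint_add:
  assumes "p \<noteq> 0"
  shows "qint p (a + b) = qint p a * p powi b + p powi (- a) * qint p b"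
proof (cases "p * p = 1")
  case True
  then have "inverse p = p" using assms by (simp add: field_simps)
  then have "p powi (- a) = p powi a" by (metis power_int_inverse power_int_minus)
  then show ?thesis using True assms
    by (simp add: qint_def algebra_simps power_int_add power_int_diff add_divide_distrib)
next
  case False
  have "p powi (a + b) - p powi (- (a + b))
      = (p powi a - p powi (- a)) * p powi b + p powi (- a) * (p powi b - p powi (- b))"
    using assms power_int_add[of p a b] power_int_add[of p "- a" "- b"] by (simp add: algebra_simps)
  then show ?thesis using False
    by (simp add: qint_def add_divide_distrib)
qed

lemma qint_0 [simp]: "qint p 0 = 0"
  and qint_1 [simp]: "p \<noteq> 0 \<Longrightarrow> qint p 1 = 1"
  by (auto simp: qint_def field_simps)

lemma qint_uminus:
  assumes "p \<noteq> 0"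
  shows "qint p (- a) = - qint p a"
proof -
  have "p powi (- a) * (qint p (- a) + qint p a) = 0"
    using qint_add[OF assms, of a "- a"] by (simp add: distrib_left mult.commute add.commute)
  then show ?thesis using assms by (simp add: eq_neg_iff_add_eq_0)
qed

lemma commute_mult: "a * c = c * a \<Longrightarrow> b * c = c * b \<Longrightarrow> (a * b) * c = c * (a * b :: 'a::semigroup_mult)"
  by (metis mult.assoc)

lemma commute_add: "a * c = c * a \<Longrightarrow> b * c = c * b \<Longrightarrow> (a + b) * c = c * (a + b :: 'a::ring)"
  by (simp add: distrib_left distrib_right)

text \<open>\<open>s i c\<close> is the site of level \<open>i\<close> in column \<open>c\<close>.
  With the numbering kept abstract, the rows and the columns of one rectangle are treated by the
  same lemmas, through \<open>s1\<close> and \<open>s2\<close>.\<close>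

locale sites =
  fixes s :: "nat \<Rightarrow> nat \<Rightarrow> 's"
  assumes inj: "s i c = s i' c' \<longleftrightarrow> i = i' \<and> c = c'"
begin

lemma loc_commute:
  assumes "c \<noteq> c' \<or> (i \<noteq> j \<and> i \<noteq> Suc j \<and> j \<noteq> Suc i)"
  shows "loc s d i c * loc s d' j c' = loc s d' j c' * loc s d i c"
  unfolding loc_def using assms by (auto intro!: mv_commute simp: inj)

lemma kloc_loc_other:
  assumes "c \<noteq> c'"
  shows "kloc p s i c * loc s d j c' = loc s d j c' * kloc p s i c"
proof -
  have "loc s d j c' * kloc p s i c = sc 1 * (kloc p s i c * loc s d j c')"
    unfolding loc_def kloc_def
    using assms by (auto intro!: mv_dg simp: hloc_def inj)
  then show ?thesis by (simp add: dg_one)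
qed

lemma kloc_loc:
  assumes "p \<noteq> 0"
  shows "kloc p s i c * loc s d j c
    = sc (p powi ((if d then 1 else -1) * cartan i j)) * (loc s d j c * kloc p s i c)"
proof -
  let ?a = "(if d then 1 else -1) * cartan i j"
  have "loc s d j c * kloc p s i c = sc (p powi (- ?a)) * (kloc p s i c * loc s d j c)"
  proof (cases d)
    case True
    have "hloc s i c (S(s j c := False, s (Suc j) c := True)) = - ?a + hloc s i c S"
      if "S (s j c)" "\<not> S (s (Suc j) c)" for S
      using that True by (auto simp: hloc_def cartan_def inj)
    then have "p powi hloc s i c (S(s j c := False, s (Suc j) c := True)) = p powi (- ?a) * p powi hloc s i c S"
      if "S (s j c)" "\<not> S (s (Suc j) c)" for S
      using that assms by (simp only: power_int_add simp_thms)
    from mv_dg[where g = "\<lambda>S. p powi hloc s i c S", OF this] show ?thesis using True unfolding loc_def kloc_def by simp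
  next
    case False
    have "hloc s i c (S(s (Suc j) c := False, s j c := True)) = - ?a + hloc s i c S"
      if "S (s (Suc j) c)" "\<not> S (s j c)" for S
      using that False by (auto simp: hloc_def cartan_def inj)
    then have "p powi hloc s i c (S(s (Suc j) c := False, s j c := True)) = p powi (- ?a) * p powi hloc s i c S"
      if "S (s (Suc j) c)" "\<not> S (s j c)" for S
      using that assms by (simp only: power_int_add simp_thms)
    from mv_dg[where g = "\<lambda>S. p powi hloc s i c S", OF this] show ?thesis using False unfolding loc_def kloc_def by simp
  qed
  then show ?thesis using assms by (simp add: sc_sc power_int_add[symmetric] dg_one)
qed

lemma chn_loc_commute: "r \<le> c \<Longrightarrow> chn p s d r i * loc s d' j c = loc s d' j c * chn p s d r i"
proof (induction r)
  case (Suc r)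
  then have "kloc p s i r * loc s d' j c = loc s d' j c * kloc p s i r"
    "loc s d i r * loc s d' j c = loc s d' j c * loc s d i r"
    "chn p s d r i * loc s d' j c = loc s d' j c * chn p s d r i"
    using kloc_loc_other[of r c p i d' j] loc_commute[of r c i j d d'] by auto
  then show ?case unfolding chn.simps by (intro commute_add commute_mult)
qed simp

lemma chn_kloc_commute: "r \<le> c \<Longrightarrow> chn p s d r i * kloc p' s j c = kloc p' s j c * chn p s d r i"
proof (induction r)
  case (Suc r)
  then have "kloc p s i r * kloc p' s j c = kloc p' s j c * kloc p s i r"
    "loc s d i r * kloc p' s j c = kloc p' s j c * loc s d i r"
    "chn p s d r i * kloc p' s j c = kloc p' s j c * chn p s d r i"
    using kloc_loc_other[of c r p' j d i] by (auto simp: kloc_def dg_commute)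
  then show ?case unfolding chn.simps by (intro commute_add commute_mult)
qed simp

lemma chn_commute_far:
  assumes "i \<noteq> j" "i \<noteq> Suc j" "j \<noteq> Suc i" and "p \<noteq> 0"
  shows "chn p s d r i * chn p s d r j = chn p s d r j * chn p s d r i"
proof (induction r)
  case (Suc r)
  have k: "kloc p s i r * loc s d j r = loc s d j r * kloc p s i r"
    "kloc p s j r * loc s d i r = loc s d i r * kloc p s j r"
    using assms by (simp_all add: kloc_loc cartan_def dg_one)
  have l: "loc s d i r * loc s d j r = loc s d j r * loc s d i r" using assms loc_commute by blast
  have kk: "kloc p s i r * kloc p s j r = kloc p s j r * kloc p s i r" by (simp add: kloc_def dg_commute)
  have X: "chn p s d r i * loc s d j r = loc s d j r * chn p s d r i"
    "chn p s d r j * loc s d i r = loc s d i r * chn p s d r j"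
    "chn p s d r i * kloc p s j r = kloc p s j r * chn p s d r i"
    "chn p s d r j * kloc p s i r = kloc p s i r * chn p s d r j"
    by (rule chn_loc_commute chn_kloc_commute, simp)+
  have "chn p s d r i * kloc p s i r * (chn p s d r j * kloc p s j r)
      = chn p s d r j * kloc p s j r * (chn p s d r i * kloc p s i r)"
    using X kk Suc by (intro commute_mult commute_mult[symmetric]) simp_all
  moreover have "chn p s d r i * kloc p s i r * loc s d j r = loc s d j r * (chn p s d r i * kloc p s i r)"
    "chn p s d r j * kloc p s j r * loc s d i r = loc s d i r * (chn p s d r j * kloc p s j r)"
    using X k by (auto intro: commute_mult)
  ultimately show ?case using l by (simp add: distrib_left distrib_right)
qed simp

end

text \<open>The induction step of the Serre relation along the coproduct, as an identity in a ring:
  \<open>X\<close> and \<open>Y\<close> act on the earlier columns, \<open>e\<close> and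
  \<open>e'\<close> on the new column with Cartan factors \<open>k\<close> and \<open>k'\<close>,
  and the central elements \<open>\<tau>\<close> and \<open>\<tau>'\<close> stand for the parameter
  and its inverse. A site of the new column holds at most one particle, hence
  \<open>e * e = 0\<close> and \<open>e * (e' * e) = 0\<close>.\<close>

lemma serre_step:
  fixes X Y k k' e e' \<tau> \<tau>' :: "'a::ring_1"
  assumes c: "\<And>x. x * \<tau> = \<tau> * x" "\<And>x. x * \<tau>' = \<tau>' * x" "\<tau> * \<tau>' = 1"
    and X: "k * X = X * k" "k' * X = X * k'" "X * e = e * X" "X * e' = e' * X"
    and Y: "k * Y = Y * k" "k' * Y = Y * k'" "Y * e = e * Y" "Y * e' = e' * Y"
    and k: "k' * k = k * k'" "k * e = \<tau> * (\<tau> * (e * k))" "k' * e = \<tau>' * (e * k')"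
      "k * e' = \<tau>' * (e' * k)"
    and e: "e * e = 0" "e * (e' * e) = 0"
    and S: "Y * X * X - (\<tau> + \<tau>') * (X * Y * X) + X * X * Y = 0"
  shows "(Y * k' + e') * (X * k + e) * (X * k + e) - (\<tau> + \<tau>') * ((X * k + e) * (Y * k' + e') * (X * k + e))
      + (X * k + e) * (X * k + e) * (Y * k' + e') = 0"
proof -
  have cc: "x * (\<tau> * z) = \<tau> * (x * z)" "x * (\<tau>' * z) = \<tau>' * (x * z)" for x z
    using c by (metis mult.assoc)+
  have "\<tau> * (\<tau>' * z) = z" "\<tau>' * (\<tau> * z) = z" for z
    using c by (metis mult.assoc mult_1)+
  note c' = this cc[where x = X] cc[where x = Y] cc[where x = k] cc[where x = k'] cc[where x = e] cc[where x = e']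
  have m: "k * (X * z) = X * (k * z)" "k' * (X * z) = X * (k' * z)" "X * (e * z) = e * (X * z)"
    "X * (e' * z) = e' * (X * z)" "k * (Y * z) = Y * (k * z)" "k' * (Y * z) = Y * (k' * z)"
    "Y * (e * z) = e * (Y * z)" "Y * (e' * z) = e' * (Y * z)" "k' * (k * z) = k * (k' * z)"
    "k * (e * z) = \<tau> * (\<tau> * (e * (k * z)))" "k' * (e * z) = \<tau>' * (e * (k' * z))"
    "k * (e' * z) = \<tau>' * (e' * (k * z))" "e * (e * z) = 0" "e * (e' * (e * z)) = 0" for z
    using X Y k e by (metis mult.assoc mult_zero_left)+
  \<comment> \<open>\<open>S\<close> is oriented as a rewrite rule for \<open>X * X * Y\<close>, in
    a form that also applies inside longer products.\<close>
  have S': "X * (X * (Y * z)) = \<tau> * (X * (Y * (X * z))) + \<tau>' * (X * (Y * (X * z))) - Y * (X * (X * z))" for z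
  proof -
    have "X * X * Y = (\<tau> + \<tau>') * (X * Y * X) - Y * X * X" using S by (simp add: algebra_simps)
    from arg_cong[OF this, of "\<lambda>t. t * z"] show ?thesis by (simp add: algebra_simps)
  qed
  show ?thesis
    by (simp add: distrib_left distrib_right mult.assoc m c' X Y k e S' right_diff_distrib)
qed

context sites begin

lemma chn_serre:
  fixes p :: "'k::field"
  assumes "p \<noteq> 0" and ij: "j = Suc i \<or> i = Suc j"
  shows "chn p s d r j * chn p s d r i * chn p s d r i
    - sc (p + inverse p) * (chn p s d r i * chn p s d r j * chn p s d r i)
    + chn p s d r i * chn p s d r i * chn p s d r j = 0"
proof (induction r)
  case (Suc r)
  define t where "t = (if d then p else inverse p)"
  have t: "t \<noteq> 0" "t + inverse t = p + inverse p" using assms by (auto simp: t_def)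
  have pt: "sc (p + inverse p) = sc t + (sc (inverse t) :: ('s \<Rightarrow> bool, 'k) lop)"
    unfolding t(2)[symmetric] by (simp add: dg_add)
  have kk: "kloc p s i r * loc s d i r = sc t * (sc t * (loc s d i r * kloc p s i r))"
    "kloc p s j r * loc s d i r = sc (inverse t) * (loc s d i r * kloc p s j r)"
    "kloc p s i r * loc s d j r = sc (inverse t) * (loc s d j r * kloc p s i r)"
    using ij assms(1)
    by (auto simp: kloc_loc cartan_def sc_sc t_def power_int_minus power2_eq_square)
  show ?case unfolding chn.simps pt
  proof (rule serre_step[OF _ _ _ _ _ _ _ _ _ _ _ _ kk])
    show "loc s d i r * (loc s d j r * loc s d i r) = 0" using ij unfolding loc_def by (auto simp: inj)
    show "loc s d i r * loc s d i r = 0" unfolding loc_def by auto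
    show "chn p s d r j * chn p s d r i * chn p s d r i -
      (sc t + sc (inverse t)) * (chn p s d r i * chn p s d r j * chn p s d r i) +
      chn p s d r i * chn p s d r i * chn p s d r j = 0" using Suc pt by simp
    show "kloc p s j r * kloc p s i r = kloc p s i r * kloc p s j r" by (simp add: kloc_def dg_commute)
    show "sc t * sc (inverse t) = (1 :: ('s \<Rightarrow> bool, 'k) lop)" using t by (simp add: dg_mult dg_one)
  qed (auto simp: sc_central chn_loc_commute chn_kloc_commute)
qed simp

lemma loc_loc:
  fixes p :: "'k::field"
  assumes "p \<noteq> 0"
  shows "loc s True i c * loc s False j c - sc (p powi (- cartan i j)) * (loc s False j c * loc s True i c)
    = (if i = j then dg (\<lambda>S. inverse p * qint p (hloc s i c S) * p powi (hloc s i c S)) else 0)"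
proof (cases "i = j")
  case True
  have "s i c \<noteq> s (Suc i) c" by (simp add: inj)
  moreover have "S(s i c := True) = S" if "S (s i c)" for S using that by (simp add: fun_upd_idem)
  ultimately show ?thesis
    using True assms qint_uminus[OF assms, of 1] unfolding loc_def cartan_def
    by (intro lop_eqI)
       (auto simp: ap_mv hloc_def power_int_minus power2_eq_square fun_upd_idem fun_upd_twist field_simps)
next
  case False
  then have "loc s True i c * loc s False j c = (0 :: ('s \<Rightarrow> bool, 'k) lop)
      \<and> loc s False j c * loc s True i c = (0 :: ('s \<Rightarrow> bool, 'k) lop)" if "j = Suc i \<or> i = Suc j"
    using that unfolding loc_def by (auto intro!: lop_eqI simp: ap_mv inj)
  moreover have "loc s True i c * loc s False j c = (loc s False j c * loc s True i c :: ('s \<Rightarrow> bool, 'k) lop)"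
    if "\<not> (j = Suc i \<or> i = Suc j)" using that False loc_commute by blast
  ultimately show ?thesis using False unfolding cartan_def
    by (cases "j = Suc i \<or> i = Suc j") (auto simp: dg_one)
qed

lemma hw_wts_Suc: "hw (wts s (Suc r) S) i = hw (wts s r S) i + hloc s i r S"
  by (simp add: hw_def wts_def hloc_def)

text \<open>The commutator is twisted by \<open>p powi (- cartan i j)\<close> because
  \<open>chn p s False\<close> is the transpose of the raising operator and so carries the same
  Cartan factors. In the induction step the mixed terms of old and new columns cancel, and
  \<open>qint_add\<close> joins the two diagonal contributions.\<close>

lemma chn_chn:
  fixes p :: "'k::field"
  assumes "p \<noteq> 0"
  shows "chn p s True r i * chn p s False r j - sc (p powi (- cartan i j)) * (chn p s False r j * chn p s True r i)
    = (if i = j then dg (\<lambda>S. inverse p * qint p (hw (wts s r S) i) * p powi hw (wts s r S) i) else 0)"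
proof (induction r)
  case 0
  then show ?case by (simp add: hw_def wts_def dg_zero)
next
  case (Suc r)
  let ?X = "chn p s True r i" and ?Y = "chn p s False r j" and ?k = "kloc p s i r" and ?k' = "kloc p s j r"
    and ?e = "loc s True i r :: ('s \<Rightarrow> bool, 'k) lop" and ?f = "loc s False j r :: ('s \<Rightarrow> bool, 'k) lop"
    and ?t = "sc (p powi (- cartan i j)) :: ('s \<Rightarrow> bool, 'k) lop" and ?t' = "sc (p powi (cartan i j)) :: ('s \<Rightarrow> bool, 'k) lop"
  have c: "cartan j i = cartan i j" unfolding cartan_def by auto
  have k: "?k * ?f = ?t * (?f * ?k)" "?k' * ?e = ?t' * (?e * ?k')"
    using assms by (simp_all add: kloc_loc c)
  have tt: "?t * (?t' * z) = z" for z using assms by (simp add: sc_sc power_int_add[symmetric] dg_one)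
  have X: "?X * ?f = ?f * ?X" "?Y * ?e = ?e * ?Y" "?X * ?k' = ?k' * ?X" "?Y * ?k = ?k * ?Y"
    by (rule chn_loc_commute chn_kloc_commute, simp)+
  have kk: "?k * ?k' = ?k' * ?k" by (simp add: kloc_def dg_commute)
  have a: "?k * (?Y * z) = ?Y * (?k * z)" "?k' * (?X * z) = ?X * (?k' * z)" "?X * (?f * z) = ?f * (?X * z)"
    "?Y * (?e * z) = ?e * (?Y * z)" for z
    using X by (simp_all add: mult.assoc[symmetric])
  have 1: "(?X * ?k) * (?Y * ?k') = ?X * ?Y * (?k * ?k')" "(?Y * ?k') * (?X * ?k) = ?Y * ?X * (?k * ?k')"
    by (simp_all only: mult.assoc a kk)
  have 2: "?X * ?k * ?f = ?t * (?f * (?X * ?k))" by (simp only: mult.assoc k sc_left[where A = ?X] a)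
  have 3: "?t * (?Y * ?k' * ?e) = ?e * (?Y * ?k')" by (simp only: mult.assoc k sc_left[where A = ?Y] a tt)
  have "chn p s True (Suc r) i * chn p s False (Suc r) j - ?t * (chn p s False (Suc r) j * chn p s True (Suc r) i)
    = (?X * ?Y - ?t * (?Y * ?X)) * (?k * ?k') + (?e * ?f - ?t * (?f * ?e))"
  proof -
    have "chn p s True (Suc r) i * chn p s False (Suc r) j
        = ?X * ?Y * (?k * ?k') + ?t * (?f * (?X * ?k)) + ?e * (?Y * ?k') + ?e * ?f"
      by (simp add: distrib_left distrib_right 1[symmetric] 2[symmetric])
    moreover have "?t * (chn p s False (Suc r) j * chn p s True (Suc r) i)
        = ?t * (?Y * ?X) * (?k * ?k') + ?e * (?Y * ?k') + ?t * (?f * (?X * ?k)) + ?t * (?f * ?e)"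
      unfolding 3[symmetric] by (simp only: chn.simps distrib_left distrib_right mult.assoc a kk add.assoc add.left_commute)
    ultimately show ?thesis by (simp add: left_diff_distrib)
  qed
  also have "\<dots> = (if i = j then dg (\<lambda>S. inverse p * qint p (hw (wts s (Suc r) S) i) * p powi hw (wts s (Suc r) S) i) else 0)"
  proof (cases "i = j")
    case True
    have "inverse p * qint p (H + h) * p powi (H + h)
        = inverse p * qint p H * p powi H * (p powi h * p powi h) + inverse p * qint p h * p powi h" for H h
    proof -
      have "qint p (H + h) * p powi (H + h) = qint p H * p powi H * (p powi h * p powi h) + qint p h * p powi h"
        unfolding qint_add[OF assms, of H h] using assms
        by (simp add: power_int_add power_int_minus distrib_right distrib_left)
      then show ?thesis by (simp add: distrib_left mult.assoc)
    qed
    with True show ?thesis unfolding Suc loc_loc[OF assms] hw_wts_Suc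
      by (simp add: kloc_def dg_mult dg_add)
  next
    case False
    then show ?thesis unfolding Suc loc_loc[OF assms] by simp
  qed
  finally show ?case .
qed

end

lemma mv_dg_shift:
  assumes "\<And>S. S p \<Longrightarrow> \<not> S p' \<Longrightarrow> g (S(p := False, p' := True)) = g' S"
  shows "mv p p' * dg g = dg g' * mv p p'"
  by (rule lop_eqI) (simp add: ap_mv assms)

definition alpha :: "nat \<Rightarrow> nat \<Rightarrow> int" where
  "alpha i k = (if k = i then 1 else if k = Suc i then -1 else 0)"

context sites begin

text \<open>Stated for an arbitrary function \<open>h\<close> of the weight, since it is needed for
  powers of the parameter, for signs and for indicator functions.\<close>

lemma loc_wts:
  assumes "c < r"
  shows "loc s d i c * dg (\<lambda>S. h (wts s r S))
    = dg (\<lambda>S. h (\<lambda>k. wts s r S k - (if d then 1 else -1) * alpha i k)) * loc s d i c"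
proof -
  have R: "wts s r S k = of_bool (S (s k c)) + (\<Sum>c'\<in>{..<r} - {c}. of_bool (S (s k c')))" for S k
    using assms unfolding wts_def by (subst sum.remove[of "{..<r}" c]) auto
  have rest: "(\<Sum>c'\<in>{..<r} - {c}. of_bool ((S(s a c := x, s b c := y)) (s k c')) :: int)
      = (\<Sum>c'\<in>{..<r} - {c}. of_bool (S (s k c')))" for S k a b x y
    by (rule sum.cong) (auto simp: inj)
  have 1: "wts s r (S(s i c := False, s (Suc i) c := True)) = (\<lambda>k. wts s r S k - alpha i k)"
    if "S (s i c)" "\<not> S (s (Suc i) c)" for S
    unfolding R rest using that by (auto simp: alpha_def inj fun_eq_iff)
  have 2: "wts s r (S(s (Suc i) c := False, s i c := True)) = (\<lambda>k. wts s r S k + alpha i k)"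
    if "S (s (Suc i) c)" "\<not> S (s i c)" for S
    unfolding R rest using that by (auto simp: alpha_def inj fun_eq_iff)
  show ?thesis unfolding loc_def by (auto intro!: mv_dg_shift simp: 1 2)
qed

lemma chn_wts_le:
  "r \<le> R \<Longrightarrow> chn p s d r i * dg (\<lambda>S. h (wts s R S))
    = dg (\<lambda>S. h (\<lambda>k. wts s R S k - (if d then 1 else -1) * alpha i k)) * chn p s d r i"
proof (induction r)
  case (Suc r)
  let ?D = "dg (\<lambda>S. h (wts s R S))" and ?D' = "dg (\<lambda>S. h (\<lambda>k. wts s R S k - (if d then 1 else -1) * alpha i k))"
  have 1: "chn p s d r i * ?D = ?D' * chn p s d r i" using Suc by simp
  have 2: "loc s d i r * ?D = ?D' * loc s d i r" by (rule loc_wts) (use Suc in simp)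
  have 3: "kloc p s i r * ?D = ?D * kloc p s i r" by (simp add: kloc_def dg_commute)
  have "chn p s d r i * kloc p s i r * ?D = ?D' * (chn p s d r i * kloc p s i r)"
    by (simp only: mult.assoc 3) (simp only: mult.assoc[symmetric] 1)
  with 2 show ?case by (simp add: distrib_left distrib_right)
qed simp

lemmas chn_wts = chn_wts_le[OF order.refl]

lemma chn_commuteI:
  assumes "\<And>c. c < r \<Longrightarrow> loc s d i c * X = X * loc s d i c"
    and "\<And>c. c < r \<Longrightarrow> kloc p s i c * X = X * kloc p s i c"
  shows "chn p s d r i * X = X * chn p s d r i"
  using assms by (induction r) (auto intro!: commute_add commute_mult)

end

text \<open>The diagonal factor cancels the one in \<open>chn_chn\<close> and turns the twisted
  commutator there into an ordinary one, which leaves the quantum integer of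
  \<open>hw\<close>.\<close>

definition fop :: "'k::field \<Rightarrow> (nat \<Rightarrow> nat \<Rightarrow> 's) \<Rightarrow> nat \<Rightarrow> nat \<Rightarrow> ('s \<Rightarrow> bool, 'k) lop" where
  "fop p s r i = chn p s False r i * dg (\<lambda>S. p * p powi (- hw (wts s r S) i))"

lemma hw_minus_alpha: "hw (\<lambda>k. kp k - c * alpha j k) i = hw kp i - c * cartan i j"
  by (auto simp: hw_def alpha_def cartan_def algebra_simps)

context sites begin

lemma chn_fop:
  fixes p :: "'k::field"
  assumes "p \<noteq> 0"
  shows "chn p s True r i * fop p s r j - fop p s r j * chn p s True r i
    = (if i = j then dg (\<lambda>S. qint p (hw (wts s r S) i)) else 0)"
proof -
  let ?E = "chn p s True r i" and ?F = "chn p s False r j" and ?D = "dg (\<lambda>S. p * p powi (- hw (wts s r S) j))"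
  have c: "cartan i j = cartan j i" unfolding cartan_def by auto
  have "?E * ?D = dg (\<lambda>S. p * p powi (- (hw (wts s r S) j - cartan j i))) * ?E"
    using chn_wts[of p True r i "\<lambda>kp. p * p powi (- hw kp j)"] by (simp only: if_True hw_minus_alpha) simp
  also have "dg (\<lambda>S. p * p powi (- (hw (wts s r S) j - cartan j i))) = sc (p powi cartan i j) * ?D"
    using assms by (simp add: dg_mult power_int_diff power_int_minus c divide_inverse mult_ac)
  finally have "sc (p powi (- cartan i j)) * (?E * ?D) = ?D * ?E"
    using assms by (simp add: mult.assoc sc_sc power_int_add[symmetric] dg_one)
  then have "?F * (?D * ?E) = sc (p powi (- cartan i j)) * (?F * (?E * ?D))" by (metis sc_left)
  then have "chn p s True r i * fop p s r j - fop p s r j * chn p s True r i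
    = (?E * ?F - sc (p powi (- cartan i j)) * (?F * ?E)) * ?D"
    by (simp add: fop_def mult.assoc left_diff_distrib)
  also have "\<dots> = (if i = j then dg (\<lambda>S. qint p (hw (wts s r S) i)) else 0)"
    unfolding chn_chn[OF assms] using assms by (auto simp: dg_mult power_int_minus field_simps)
  finally show ?thesis .
qed

lemma fop_wts:
  "fop p s r i * dg (\<lambda>S. h (wts s r S)) = dg (\<lambda>S. h (\<lambda>k. wts s r S k + alpha i k)) * fop p s r i"
proof -
  have "fop p s r i * dg (\<lambda>S. h (wts s r S))
    = chn p s False r i * dg (\<lambda>S. h (wts s r S)) * dg (\<lambda>S. p * p powi (- hw (wts s r S) i))"
    unfolding fop_def by (simp only: mult.assoc dg_commute)
  also have "\<dots> = dg (\<lambda>S. h (\<lambda>k. wts s r S k + alpha i k)) * fop p s r i"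
    unfolding chn_wts fop_def by (simp add: mult.assoc)
  finally show ?thesis .
qed

lemma fop_commute_far:
  assumes "i \<noteq> j" "i \<noteq> Suc j" "j \<noteq> Suc i" and "p \<noteq> 0"
  shows "fop p s r i * fop p s r j = fop p s r j * fop p s r i"
proof -
  have 1: "dg (\<lambda>S. p * p powi (- hw (wts s r S) i)) * chn p s False r j
      = chn p s False r j * dg (\<lambda>S. p * p powi (- hw (wts s r S) i))"
    if "i \<noteq> j" "i \<noteq> Suc j" "j \<noteq> Suc i" for i j
    using chn_wts[of p False r j "\<lambda>kp. p * p powi (- hw kp i)"] that
    by (simp only: if_False hw_minus_alpha) (simp add: cartan_def)
  have 2: "fop p s r i * fop p s r j = chn p s False r i * chn p s False r j *
      (dg (\<lambda>S. p * p powi (- hw (wts s r S) i)) * dg (\<lambda>S. p * p powi (- hw (wts s r S) j)))"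
    if "i \<noteq> j" "i \<noteq> Suc j" "j \<noteq> Suc i" for i j
    unfolding fop_def by (simp only: mult.assoc) (simp only: mult.assoc[symmetric] 1[OF that])
  show ?thesis using assms by (simp add: 2 chn_commute_far[OF assms] dg_commute)
qed

text \<open>Moving the three diagonal factors to the right costs the same scalar \<open>c\<close> in
  each of the three monomials, so the relation reduces to \<open>chn_serre\<close>.\<close>

lemma fop_serre:
  fixes p :: "'k::field"
  assumes p: "p \<noteq> 0" and ij: "j = Suc i \<or> i = Suc j"
  shows "fop p s r j * fop p s r i * fop p s r i
    - sc (p + inverse p) * (fop p s r i * fop p s r j * fop p s r i)
    + fop p s r i * fop p s r i * fop p s r j = 0"
proof -
  let ?C = "chn p s False r" and ?D = "\<lambda>i. dg (\<lambda>S. p * p powi (- hw (wts s r S) i))"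
  have D: "?D a * (?C b * z) = sc (p powi cartan a b) * (?C b * (?D a * z))" for a b z
  proof -
    have "?C b * ?D a = dg (\<lambda>S. p * p powi (- (hw (wts s r S) a + cartan a b))) * ?C b"
      using chn_wts[of p False r b "\<lambda>kp. p * p powi (- hw kp a)"] by (simp only: if_False hw_minus_alpha) simp
    also have "dg (\<lambda>S. p * p powi (- (hw (wts s r S) a + cartan a b))) = sc (p powi (- cartan a b)) * ?D a"
      using p by (simp add: dg_mult power_int_add power_int_diff power_int_minus divide_inverse mult_ac)
    finally have "sc (p powi cartan a b) * (?C b * ?D a) = ?D a * ?C b"
      using p by (simp add: mult.assoc sc_sc power_int_add[symmetric] dg_one)
    then show ?thesis by (simp only: mult.assoc[symmetric])
  qed
  define c where "c = p powi cartan i j * p powi cartan i j * p powi cartan i i"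
  have cc: "cartan j i = cartan i j" unfolding cartan_def by auto
  have DD: "?D a * (?D b * z) = ?D b * (?D a * z)" for a b z
    by (simp only: mult.assoc[symmetric] dg_commute)
  have sl: "?C a * (sc x * z) = sc x * (?C a * z)" "?D a * (sc x * z) = sc x * (?D a * z)" for a x z
    by (rule sc_left)+
  have "fop p s r j * fop p s r i * fop p s r i = sc c * (?C j * (?C i * (?C i * (?D i * (?D i * ?D j)))))"
    "fop p s r i * fop p s r j * fop p s r i = sc c * (?C i * (?C j * (?C i * (?D i * (?D i * ?D j)))))"
    "fop p s r i * fop p s r i * fop p s r j = sc c * (?C i * (?C i * (?C j * (?D i * (?D i * ?D j)))))"
    unfolding fop_def c_def by (simp_all only: mult.assoc D sl sc_sc cc DD dg_commute mult.commute mult.left_commute)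
  then have "fop p s r j * fop p s r i * fop p s r i
    - sc (p + inverse p) * (fop p s r i * fop p s r j * fop p s r i)
    + fop p s r i * fop p s r i * fop p s r j
    = sc c * ((?C j * ?C i * ?C i - sc (p + inverse p) * (?C i * ?C j * ?C i) + ?C i * ?C i * ?C j) * (?D i * (?D i * ?D j)))"
    by (simp add: distrib_left distrib_right mult.assoc right_diff_distrib left_diff_distrib sc_left[of "sc (p + inverse p)"])
  then show ?thesis unfolding chn_serre[OF p ij] by simp
qed

end

subsection \<open>The commuting action on the rows\<close>

abbreviation s1 :: "nat \<Rightarrow> nat \<Rightarrow> nat \<times> nat" where "s1 i c \<equiv> (i, c)"
abbreviation s2 :: "nat \<Rightarrow> nat \<Rightarrow> nat \<times> nat" where "s2 j a \<equiv> (a, j)"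

interpretation S1: sites s1 by unfold_locales auto
interpretation S2: sites s2 by unfold_locales auto

text \<open>The core of the duality: a 2 x 2 square of sites with \<open>a\<close>, \<open>b\<close>
  above \<open>c\<close>, \<open>d\<close>, vertical moves with parameter \<open>q\<close> and
  horizontal ones with parameter \<open>p\<close>. The proof runs through all occupations of the
  square, and \<open>p = - inverse q\<close> is what reconciles the two orders.\<close>

lemma local_square_commute:
  fixes q p :: "'k::field" and a b c d :: 's
  assumes ne: "distinct [a, b, c, d]" and q: "q \<noteq> 0" and p: "p = - inverse q"
    and ka: "ka = dg (\<lambda>S. q powi (of_bool (S b) - of_bool (S d)))"
    and kb: "kb = dg (\<lambda>S. p powi (of_bool (S c) - of_bool (S d)))"
  shows "((if u then mv a c else mv c a) * ka + (if u then mv b d else mv d b))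
     * ((if v then mv a b else mv b a) * kb + (if v then mv c d else mv d c))
    = ((if v then mv a b else mv b a) * kb + (if v then mv c d else mv d c))
     * ((if u then mv a c else mv c a) * ka + (if u then mv b d else mv d b))"
proof (rule lop_eqI)
  fix x :: "('s \<Rightarrow> bool) \<Rightarrow> 'k" and S0 :: "'s \<Rightarrow> bool"
  \<comment> \<open>The four sites are overwritten by Boolean variables, so that the occupations can
    be split into cases.\<close>
  obtain S al be ga \<delta> where S0: "S0 = S(a := al, b := be, c := ga, d := \<delta>)"
    by (metis fun_upd_triv)
  have ne': "a \<noteq> b" "a \<noteq> c" "a \<noteq> d" "b \<noteq> c" "b \<noteq> d" "c \<noteq> d" using ne by auto
  note ne'' = ne' ne'[symmetric]
  have tw: "f(d := \<delta>', a := al') = f(a := al', d := \<delta>')" "f(c := ga', a := al') = f(a := al', c := ga')"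
    "f(b := be', a := al') = f(a := al', b := be')" "f(c := ga', b := be') = f(b := be', c := ga')"
    "f(d := \<delta>', b := be') = f(b := be', d := \<delta>')" "f(d := \<delta>', c := ga') = f(c := ga', d := \<delta>')"
    for f :: "'s \<Rightarrow> bool" and al' be' ga' \<delta>' using ne'' by (auto simp: fun_eq_iff)
  have pi: "p powi (-1) = - q" "q powi (-1) = inverse q" using q p by (simp_all add: power_int_minus)
  show "ap (((if u then mv a c else mv c a) * ka + (if u then mv b d else mv d b))
     * ((if v then mv a b else mv b a) * kb + (if v then mv c d else mv d c))) x S0
    = ap (((if v then mv a b else mv b a) * kb + (if v then mv c d else mv d c))
     * ((if u then mv a c else mv c a) * ka + (if u then mv b d else mv d b))) x S0"
    unfolding S0 ka kb using ne'' q
    by (cases u; cases v; cases al; cases be; cases ga; cases \<delta>) (simp_all add: ap_mv tw pi p)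
qed

text \<open>A move inside a row between columns \<open>j\<close> and \<open>Suc j\<close> changes
  the two local weights by opposite amounts, so the product of the two Cartan factors commutes with
  it although the single factors need not.\<close>

lemma kk_loc_s2: "kloc q s1 i j * kloc q s1 i (Suc j) * loc s2 d j a = loc s2 d j a * (kloc q s1 i j * kloc q s1 i (Suc j))"
  (is ?A) and kk_loc_s1: "kloc q s2 j i * kloc q s2 j (Suc i) * loc s1 d i c = loc s1 d i c * (kloc q s2 j i * kloc q s2 j (Suc i))"
  (is ?B) if "q \<noteq> 0" for q :: "'k::field"
  unfolding kloc_def loc_def dg_mult using that
  by (auto simp: power_int_add[symmetric] intro!: mv_dg_shift[symmetric] arg_cong[where f = "\<lambda>t. q powi t"] simp: hloc_def)

lemma loc_s1_loc_s2: "c \<notin> {j, Suc j} \<or> a \<notin> {i, Suc i} \<Longrightarrow> loc s1 d i c * loc s2 d' j a = loc s2 d' j a * loc s1 d i c"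
  unfolding loc_def by (auto intro!: mv_commute)

lemma kloc_s1_loc_s2: "c \<notin> {j, Suc j} \<or> a \<notin> {i, Suc i} \<Longrightarrow> kloc p s1 i c * loc s2 d' j a = loc s2 d' j a * kloc p s1 i c"
  unfolding loc_def kloc_def by (auto intro!: mv_dg_shift[symmetric] simp: hloc_def)

lemma kloc_s2_loc_s1: "c \<notin> {j, Suc j} \<or> a \<notin> {i, Suc i} \<Longrightarrow> kloc p s2 j a * loc s1 d i c = loc s1 d i c * kloc p s2 j a"
  unfolding loc_def kloc_def by (auto intro!: mv_dg_shift[symmetric] simp: hloc_def)

lemma kloc_kloc: "kloc p s i c * kloc p' s' j a = kloc p' s' j a * kloc p s i c"
  by (simp add: kloc_def dg_commute)

lemma chn_Suc_Suc: "chn p s d (Suc (Suc c)) i = chn p s d c i * (kloc p s i c * kloc p s i (Suc c))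
    + (loc s d i c * kloc p s i (Suc c) + loc s d i (Suc c))"
  by (simp add: distrib_right mult.assoc)

text \<open>Columns \<open>j\<close>, \<open>Suc j\<close> of the first operator are gathered into
  \<open>A\<close>, rows \<open>i\<close>, \<open>Suc i\<close> of the second into \<open>B\<close>.
  These two meet in one square and commute by \<open>local_square_commute\<close>; all other pairs
  are disjoint or meet through a product of two Cartan factors as in
  \<open>kk_loc_s1\<close>.\<close>

lemma chn_s1_commute_chn_s2:
  fixes q p :: "'k::field"
  assumes q: "q \<noteq> 0" and p: "p = - inverse q" and i: "Suc i < m" and j: "Suc j < r"
  shows "chn q s1 d r i * chn p s2 d' m j = chn p s2 d' m j * chn q s1 d r i"
proof -
  have p0: "p \<noteq> 0" using q p by simp
  define A where "A = loc s1 d i j * kloc q s1 i (Suc j) + loc s1 d i (Suc j)"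
  define B where "B = loc s2 d' j i * kloc p s2 j (Suc i) + loc s2 d' j (Suc i)"
  have AB: "B * A = A * B"
    unfolding A_def B_def loc_def kloc_def hloc_def
    by (rule local_square_commute[symmetric, OF _ q p]) auto
  have Aa: "chn p s2 d' k j * A = A * chn p s2 d' k j" if "k \<le> i" for k
  proof (rule S2.chn_commuteI)
    fix c assume "c < k"
    then have c: "c \<notin> {i, Suc i}" using that by simp
    show "loc s2 d' j c * A = A * loc s2 d' j c" unfolding A_def
      using c by (intro commute_add[symmetric] commute_mult loc_s1_loc_s2 kloc_s1_loc_s2) auto
    show "kloc p s2 j c * A = A * kloc p s2 j c" unfolding A_def
      using c by (intro commute_add[symmetric] commute_mult kloc_s2_loc_s1[symmetric] kloc_kloc) auto
  qed
  have QA: "chn p s2 d' (Suc (Suc i) + k) j * A = A * chn p s2 d' (Suc (Suc i) + k) j" for k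
  proof (induction k)
    case 0
    have "kloc p s2 j i * kloc p s2 j (Suc i) * A = A * (kloc p s2 j i * kloc p s2 j (Suc i))"
      unfolding A_def by (intro commute_add[symmetric] commute_mult kk_loc_s1[symmetric] p0)
        (simp_all add: kloc_def dg_mult mult_ac)
    then show ?case unfolding chn_Suc_Suc add_0_right B_def[symmetric]
      by (rule commute_add[OF commute_mult[OF Aa[OF order.refl]] AB])
  next
    case (Suc k)
    have "loc s2 d' j (Suc (Suc i) + k) * A = A * loc s2 d' j (Suc (Suc i) + k)" unfolding A_def
      by (intro commute_add[symmetric] commute_mult loc_s1_loc_s2 kloc_s1_loc_s2) auto
    moreover have "kloc p s2 j (Suc (Suc i) + k) * A = A * kloc p s2 j (Suc (Suc i) + k)" unfolding A_def
      by (intro commute_add[symmetric] commute_mult kloc_s2_loc_s1[symmetric] kloc_kloc) auto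
    ultimately show ?case using Suc unfolding add_Suc_right chn.simps by (intro commute_add commute_mult)
  qed
  obtain k where m: "m = Suc (Suc i) + k" using i less_imp_Suc_add by (metis Suc_leI le_Suc_ex)
  let ?Q = "chn p s2 d' m j"
  have QA: "A * ?Q = ?Q * A" unfolding m using QA by metis
  have lQ: "loc s1 d i c * ?Q = ?Q * loc s1 d i c" and kQ: "kloc q s1 i c * ?Q = ?Q * kloc q s1 i c"
    if "c \<notin> {j, Suc j}" for c
    using that by (intro S2.chn_commuteI[symmetric] loc_s1_loc_s2[symmetric] kloc_s1_loc_s2[symmetric]
        kloc_s2_loc_s1 kloc_kloc; simp)+
  have kk: "kloc q s1 i j * kloc q s1 i (Suc j) * ?Q = ?Q * (kloc q s1 i j * kloc q s1 i (Suc j))"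
    by (intro S2.chn_commuteI[symmetric] kk_loc_s2[symmetric] q) (simp add: kloc_def dg_mult mult_ac)
  have "chn q s1 d (Suc (Suc j) + k) i * ?Q = ?Q * chn q s1 d (Suc (Suc j) + k) i" for k
  proof (induction k)
    case 0
    have "chn q s1 d j i * ?Q = ?Q * chn q s1 d j i"
      by (intro S1.chn_commuteI lQ kQ) auto
    then show ?case unfolding chn_Suc_Suc add_0_right A_def[symmetric]
      by (rule commute_add[OF commute_mult[OF _ kk] QA])
  next
    case (Suc k)
    then show ?case unfolding add_Suc_right chn.simps by (intro commute_add commute_mult lQ kQ) auto
  qed
  moreover obtain k where "r = Suc (Suc j) + k" using j less_imp_Suc_add by (metis Suc_leI le_Suc_ex)
  ultimately show ?thesis by metis
qed

lemma chn_s1_wts_s2: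
  assumes "Suc i < m"
  shows "chn q s1 d r i * dg (\<lambda>S. h (wts s2 m S)) = dg (\<lambda>S. h (wts s2 m S)) * chn q s1 d r i"
proof (rule S1.chn_commuteI)
  fix c
  have "wts s2 m (S((i, c) := al, (Suc i, c) := \<not> al)) = wts s2 m S" if "S (i, c) = (\<not> al)" "S (Suc i, c) = al" for S al
  proof
    fix k
    define g :: "(nat \<times> nat \<Rightarrow> bool) \<Rightarrow> int" where "g S' = (\<Sum>a\<in>{..<m} - {i} - {Suc i}. of_bool (S' (a, k)))" for S'
    have "wts s2 m S' k = of_bool (S' (i, k)) + of_bool (S' (Suc i, k)) + g S'"
      for S' using assms unfolding wts_def g_def
      by (subst sum.remove[of "{..<m}" i], simp, simp, subst sum.remove[of "{..<m} - {i}" "Suc i"]) auto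
    moreover have "g (S((i, c) := al, (Suc i, c) := \<not> al)) = g S"
      unfolding g_def by (rule sum.cong) auto
    ultimately show "wts s2 m (S((i, c) := al, (Suc i, c) := \<not> al)) k = wts s2 m S k"
      using that by (cases al) auto
  qed
  note W = this
  have 1: "wts s2 m (S((i, c) := False, (Suc i, c) := True)) = wts s2 m S" if "S (i, c)" "\<not> S (Suc i, c)" for S
    using W[of S False] that by simp
  have 2: "wts s2 m (S((Suc i, c) := False, (i, c) := True)) = wts s2 m S" if "S (Suc i, c)" "\<not> S (i, c)" for S
    using W[of S True] that by (subst fun_upd_twist) simp_all
  show "loc s1 d i c * dg (\<lambda>S. h (wts s2 m S)) = dg (\<lambda>S. h (wts s2 m S)) * loc s1 d i c"
    unfolding loc_def by (auto intro!: mv_dg_shift simp: 1 2)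
  show "kloc q s1 i c * dg (\<lambda>S. h (wts s2 m S)) = dg (\<lambda>S. h (wts s2 m S)) * kloc q s1 i c"
    by (simp add: kloc_def dg_commute)
qed

lemma chn_s2_wts_s1:
  assumes "Suc j < r"
  shows "chn q s2 d m j * dg (\<lambda>S. h (wts s1 r S)) = dg (\<lambda>S. h (wts s1 r S)) * chn q s2 d m j"
proof (rule S2.chn_commuteI)
  fix c
  have "wts s1 r (S((c, j) := al, (c, Suc j) := \<not> al)) = wts s1 r S" if "S (c, j) = (\<not> al)" "S (c, Suc j) = al" for S al
  proof
    fix k
    define g :: "(nat \<times> nat \<Rightarrow> bool) \<Rightarrow> int" where "g S' = (\<Sum>a\<in>{..<r} - {j} - {Suc j}. of_bool (S' (k, a)))" for S'
    have "wts s1 r S' k = of_bool (S' (k, j)) + of_bool (S' (k, Suc j)) + g S'"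
      for S' using assms unfolding wts_def g_def
      by (subst sum.remove[of "{..<r}" j], simp, simp, subst sum.remove[of "{..<r} - {j}" "Suc j"]) auto
    moreover have "g (S((c, j) := al, (c, Suc j) := \<not> al)) = g S"
      unfolding g_def by (rule sum.cong) auto
    ultimately show "wts s1 r (S((c, j) := al, (c, Suc j) := \<not> al)) k = wts s1 r S k"
      using that by (cases al) auto
  qed
  note W = this
  have 1: "wts s1 r (S((c, j) := False, (c, Suc j) := True)) = wts s1 r S" if "S (c, j)" "\<not> S (c, Suc j)" for S
    using W[of S False] that by simp
  have 2: "wts s1 r (S((c, Suc j) := False, (c, j) := True)) = wts s1 r S" if "S (c, Suc j)" "\<not> S (c, j)" for S
    using W[of S True] that by (subst fun_upd_twist) simp_all
  show "loc s2 d j c * dg (\<lambda>S. h (wts s1 r S)) = dg (\<lambda>S. h (wts s1 r S)) * loc s2 d j c"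
    unfolding loc_def by (auto intro!: mv_dg_shift simp: 1 2)
  show "kloc q s2 j c * dg (\<lambda>S. h (wts s1 r S)) = dg (\<lambda>S. h (wts s1 r S)) * kloc q s2 j c"
    by (simp add: kloc_def dg_commute)
qed

section \<open>Highest weight theory with contravariant forms\<close>

section \<open>Highest weight vectors\<close>

definition fw :: "(nat \<Rightarrow> ('b, 'k::field) lop) \<Rightarrow> nat list \<Rightarrow> ('b, 'k) lop" where
  "fw f w = prod_list (map f w)"

lemma fw_simps [simp]: "fw f [] = 1" "fw f (i # w) = f i * fw f w"
  by (simp_all add: fw_def)

definition Wd :: "nat \<Rightarrow> nat list set" where
  "Wd M = {w. \<forall>i\<in>set w. Suc i < M}"

lemma Wd_simps [simp]: "[] \<in> Wd M" "i # w \<in> Wd M \<longleftrightarrow> Suc i < M \<and> w \<in> Wd M"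
  by (auto simp: Wd_def)

primrec wtw :: "(nat \<Rightarrow> int) \<Rightarrow> nat list \<Rightarrow> nat \<Rightarrow> int" where
  "wtw kp [] = kp"
| "wtw kp (i # w) = (\<lambda>k. wtw kp w k - alpha i k)"

text \<open>\<open>EW p kp i w\<close> lists the terms of \<open>e\<^sub>i f\<^sub>w v\<close> as a combination of words applied to a highest
  weight vector \<open>v\<close> of weight \<open>kp\<close>.\<close>

primrec EW :: "'k::field \<Rightarrow> (nat \<Rightarrow> int) \<Rightarrow> nat \<Rightarrow> nat list \<Rightarrow> ('k \<times> nat list) list" where
  "EW p kp i [] = []"
| "EW p kp i (j # w) = map (\<lambda>(k, u). (k, j # u)) (EW p kp i w)
     @ (if i = j then [(qint p (hw (wtw kp w) i), w)] else [])"

text \<open>The contravariant form of the Verma module at \<open>q = 1\<close>, evaluated on words.\<close>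

primrec GG :: "(nat \<Rightarrow> int) \<Rightarrow> nat list \<Rightarrow> nat list \<Rightarrow> complex" where
  "GG kp [] = (\<lambda>w. if w = [] then 1 else 0)"
| "GG kp (i # u) = (\<lambda>w. \<Sum>(k, w')\<leftarrow>EW 1 kp i w. k * GG kp u w')"

lemma EW_Wd: "w \<in> Wd M \<Longrightarrow> (k, u) \<in> set (EW p kp i w) \<Longrightarrow> u \<in> Wd M"
  by (induction w arbitrary: k u) (auto split: if_splits)

text \<open>A list rather than a coefficient function, because the same word may occur several times
  in \<open>EW\<close>.\<close>

definition lcomb :: "('k::field \<times> 'w) list \<Rightarrow> ('w \<Rightarrow> 'b \<Rightarrow> 'k) \<Rightarrow> 'b \<Rightarrow> 'k" where
  "lcomb L Y = (\<lambda>S. \<Sum>(k, u)\<leftarrow>L. k * Y u S)"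

lemma lcomb_simps [simp]:
  "lcomb [] Y = (\<lambda>S. 0)" "lcomb ((k, u) # L) Y = (\<lambda>S. k * Y u S + lcomb L Y S)"
  by (simp_all add: lcomb_def)

lemma lcomb_append: "lcomb (L @ L') Y = (\<lambda>S. lcomb L Y S + lcomb L' Y S)"
  by (simp add: lcomb_def)

lemma ap_lcomb: "ap A (lcomb L Y) = lcomb L (\<lambda>u. ap A (Y u))"
proof (induction L)
  case (Cons a L)
  then show ?case by (cases a) (simp add: ap_add ap_scale)
qed simp

lemma lcomb_map: "lcomb (map (\<lambda>(k, u). (k, g u)) L) Y = lcomb L (\<lambda>u. Y (g u))"
  by (induction L) auto

lemma sum_list_case_zero: "(\<And>k u. (k, u) \<in> set L \<Longrightarrow> g k u = 0) \<Longrightarrow> (\<Sum>(k, u)\<leftarrow>L. g k u) = (0 :: 'k::field)"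
  by (induction L) auto

lemma sum_list_case_mult: "(\<Sum>(k, u)\<leftarrow>L. g k u * c) = (\<Sum>(k, u)\<leftarrow>L. g k u) * (c :: 'k::field)"
  by (induction L) (auto simp: distrib_right)

text \<open>The zero function has every weight, so no nonvanishing has to be checked when operators
  are applied.\<close>

definition has_wt :: "('b \<Rightarrow> nat \<Rightarrow> int) \<Rightarrow> (nat \<Rightarrow> int) \<Rightarrow> ('b \<Rightarrow> 'k::zero) \<Rightarrow> bool" where
  "has_wt wt kp x \<longleftrightarrow> (\<forall>S. x S \<noteq> 0 \<longrightarrow> wt S = kp)"

lemma has_wt_dg: "has_wt wt kp x \<Longrightarrow> ap (dg (\<lambda>S. h (wt S))) x = (\<lambda>S. h kp * x S)"
proof
  fix S assume "has_wt wt kp x"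
  then show "ap (dg (\<lambda>S. h (wt S))) x S = h kp * x S"
    unfolding has_wt_def by (cases "x S = 0") auto
qed

lemma has_wt_shift:
  assumes "\<And>h. A * dg (\<lambda>S. h (wt S)) = dg (\<lambda>S. h (\<lambda>k. wt S k - a k)) * A" and "has_wt wt kp x"
  shows "has_wt wt (\<lambda>k. kp k + a k) (ap A x)"
proof -
  \<comment> \<open>Multiplication by the indicator of the weight \<open>kp\<close> fixes
    \<open>x\<close>; moving it past \<open>A\<close> shows where \<open>ap A x\<close> can be
    nonzero.\<close>
  let ?h = "\<lambda>kp'. if kp' = kp then 1 else 0"
  have "x = ap (dg (\<lambda>S. ?h (wt S))) x" using has_wt_dg[OF assms(2), of ?h] by simp
  then have "ap A x = ap (A * dg (\<lambda>S. ?h (wt S))) x" by simp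
  also have "\<dots> = ap (dg (\<lambda>S. ?h (\<lambda>k. wt S k - a k)) * A) x" by (simp only: assms(1)[of ?h])
  also have "\<dots> = (\<lambda>S. ?h (\<lambda>k. wt S k - a k) * ap A x S)" by simp
  finally have eq: "ap A x = (\<lambda>S. ?h (\<lambda>k. wt S k - a k) * ap A x S)" .
  have "(\<lambda>k. wt S k - a k) = kp" if "ap A x S \<noteq> 0" for S
    using fun_cong[OF eq, of S] that by (cases "(\<lambda>k. wt S k - a k) = kp") auto
  then have "wt S k = kp k + a k" if "ap A x S \<noteq> 0" for S k
    using that by (metis diff_add_cancel)
  then show ?thesis unfolding has_wt_def by blast
qed

text \<open>The relations behind the highest weight argument. They hold for the exterior algebra
  with every nonzero parameter and, with \<open>p = 1\<close>, for tensor powers, so that both are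
  treated at once.\<close>

locale hwact =
  fixes M :: nat and p :: "'k::field" and wt :: "'b \<Rightarrow> nat \<Rightarrow> int" and e f :: "nat \<Rightarrow> ('b, 'k) lop"
  assumes e_f: "\<And>i j. Suc i < M \<Longrightarrow> Suc j < M \<Longrightarrow>
      e i * f j - f j * e i = (if i = j then dg (\<lambda>S. qint p (hw (wt S) i)) else 0)"
    and e_shift: "\<And>i h. Suc i < M \<Longrightarrow>
      e i * dg (\<lambda>S. h (wt S)) = dg (\<lambda>S. h (\<lambda>k. wt S k - alpha i k)) * e i"
    and f_shift: "\<And>i h. Suc i < M \<Longrightarrow>
      f i * dg (\<lambda>S. h (wt S)) = dg (\<lambda>S. h (\<lambda>k. wt S k - - alpha i k)) * f i"
begin

definition hwv :: "(nat \<Rightarrow> int) \<Rightarrow> ('b \<Rightarrow> 'k) \<Rightarrow> bool" where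
  "hwv kp v \<longleftrightarrow> has_wt wt kp v \<and> (\<forall>i. Suc i < M \<longrightarrow> ap (e i) v = (\<lambda>S. 0))"

lemma has_wt_e: "Suc i < M \<Longrightarrow> has_wt wt kp x \<Longrightarrow> has_wt wt (\<lambda>k. kp k + alpha i k) (ap (e i) x)"
  by (rule has_wt_shift) (rule e_shift)

lemma has_wt_f: "Suc i < M \<Longrightarrow> has_wt wt kp x \<Longrightarrow> has_wt wt (\<lambda>k. kp k - alpha i k) (ap (f i) x)"
  using has_wt_shift[of "f i" wt "\<lambda>k. - alpha i k", OF f_shift] by simp

lemma has_wt_word: "w \<in> Wd M \<Longrightarrow> has_wt wt kp v \<Longrightarrow> has_wt wt (wtw kp w) (ap (fw f w) v)"
  by (induction w) (auto intro: has_wt_f)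

lemma e_word:
  assumes "hwv kp v" and "Suc i < M" and "w \<in> Wd M"
  shows "ap (e i) (ap (fw f w) v) = lcomb (EW p kp i w) (\<lambda>u. ap (fw f u) v)"
  using assms(3)
proof (induction w)
  case Nil
  then show ?case using assms unfolding hwv_def by simp
next
  case (Cons j w)
  let ?y = "ap (fw f w) v"
  have wt: "has_wt wt (wtw kp w) ?y"
    using Cons assms has_wt_word unfolding hwv_def by auto
  have "e i * f j = f j * e i + (if i = j then dg (\<lambda>S. qint p (hw (wt S) i)) else 0)"
    using e_f[of i j] Cons assms by (simp add: algebra_simps)
  then have "ap (e i * f j) ?y = ap (f j * e i + (if i = j then dg (\<lambda>S. qint p (hw (wt S) i)) else 0)) ?y"
    by (simp only:)
  moreover have D: "qint p (hw (wt S) i) * ?y S = qint p (hw (wtw kp w) i) * ?y S" for S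
    using fun_cong[OF has_wt_dg[OF wt, of "\<lambda>kp. qint p (hw kp i)"], of S] by (simp only: ap_simps)
  ultimately have "ap (e i) (ap (f j) ?y)
      = (\<lambda>S. ap (f j) (ap (e i) ?y) S + (if i = j then qint p (hw (wtw kp w) i) * ?y S else 0))"
    by (cases "i = j") (simp_all only: ap_simps D if_True if_False simp_thms)
  then show ?case using Cons
    by (cases "i = j") (simp_all add: ap_lcomb lcomb_append lcomb_map)
qed

end

text \<open>Sesquilinear for \<open>cj = cnj\<close>, bilinear when \<open>cj\<close> is the
  identity. The first is positive and serves at \<open>q = 1\<close>; over C(q) the second still
  gives orthogonality of blocks.\<close>

definition form :: "('k::field \<Rightarrow> 'k) \<Rightarrow> 'b set \<Rightarrow> ('b \<Rightarrow> 'k) \<Rightarrow> ('b \<Rightarrow> 'k) \<Rightarrow> 'k" where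
  "form cj X x y = (\<Sum>S\<in>X. cj (x S) * y S)"

lemma form_scale: "form cj X x (\<lambda>S. c * y S) = c * form cj X x y"
  by (simp add: form_def sum_distrib_left mult_ac)

lemma form_add: "form cj X x (\<lambda>S. y S + z S) = form cj X x y + form cj X x z"
  by (simp add: form_def sum.distrib algebra_simps)

lemma form_diff: "form cj X x (\<lambda>S. y S - z S) = form cj X x y - form cj X x z"
  by (simp add: form_def sum_subtractf algebra_simps)

lemma form_sum: "form cj X x (\<lambda>S. \<Sum>i\<in>I. c i * y i S) = (\<Sum>i\<in>I. c i * form cj X x (y i))"
  unfolding form_def by (simp add: sum_distrib_left) (subst sum.swap, simp add: mult_ac)

lemma form_lcomb: "form cj X x (lcomb L Y) = (\<Sum>(k, u)\<leftarrow>L. k * form cj X x (Y u))"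
  by (induction L) (auto simp: form_add form_scale form_def[of _ _ _ "\<lambda>_. 0"])

lemma form_0 [simp]: "form cj X x (\<lambda>S. 0) = 0"
  by (simp add: form_def)

lemma supp_in_scale: "supp_in X x \<Longrightarrow> supp_in X (\<lambda>b. c * x b :: 'k::field)"
  and supp_in_sum: "(\<And>i. i \<in> I \<Longrightarrow> supp_in X (Y i)) \<Longrightarrow> supp_in X (\<lambda>b. \<Sum>i\<in>I. d i * Y i b :: 'k::field)"
  unfolding supp_in_def by auto

locale formact = hwact M p wt e f
  for M :: nat and p :: "'k::field" and wt :: "'b \<Rightarrow> nat \<Rightarrow> int" and e f :: "nat \<Rightarrow> ('b, 'k) lop" +
  fixes X :: "'b set" and cj :: "'k \<Rightarrow> 'k" and hh :: "nat \<Rightarrow> (nat \<Rightarrow> int) \<Rightarrow> 'k"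
  assumes fin: "finite X"
    and cj_add: "\<And>a b. cj (a + b) = cj a + cj b" and cj_mult: "\<And>a b. cj (a * b) = cj a * cj b"
    and cj_cj: "\<And>a. cj (cj a) = a" and cj_0: "cj 0 = 0"
    and supp_e: "\<And>i x. Suc i < M \<Longrightarrow> supp_in X x \<Longrightarrow> supp_in X (ap (e i) x)"
    and supp_f: "\<And>i x. Suc i < M \<Longrightarrow> supp_in X x \<Longrightarrow> supp_in X (ap (f i) x)"
    and adj: "\<And>i x y. Suc i < M \<Longrightarrow> supp_in X x \<Longrightarrow> supp_in X y \<Longrightarrow>
      form cj X (ap (f i) x) y = form cj X x (ap (dg (\<lambda>S. hh i (wt S)) * e i) y)"
begin

lemma form_sym: "cj (form cj X x y) = form cj X y x"
proof -
  have "cj (\<Sum>S\<in>A. cj (x S) * y S) = (\<Sum>S\<in>A. cj (y S) * x S)" if "finite A" for A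
    using that by (induction A rule: finite_induct) (simp_all add: cj_0 cj_add cj_mult cj_cj mult.commute)
  then show ?thesis unfolding form_def using fin .
qed

lemma supp_word: "w \<in> Wd M \<Longrightarrow> supp_in X v \<Longrightarrow> supp_in X (ap (fw f w) v)"
  by (induction w) (auto intro: supp_f)

lemma form_hwv_f:
  assumes "hwv kp v" and "supp_in X v" and "supp_in X y" and "Suc i < M"
  shows "form cj X v (ap (f i) y) = 0"
proof -
  have "form cj X (ap (f i) y) v = 0"
    using assms adj[of i y v] unfolding hwv_def by simp
  then show ?thesis using form_sym[of "ap (f i) y" v] cj_0 by simp
qed

lemma form_f_word:
  assumes "hwv kp z" and "supp_in X z" and "supp_in X y" and "Suc i < M" and "w \<in> Wd M"
  shows "form cj X (ap (f i) y) (ap (fw f w) z)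
    = hh i (\<lambda>a. wtw kp w a + alpha i a) * (\<Sum>(k, u)\<leftarrow>EW p kp i w. k * form cj X y (ap (fw f u) z))"
proof -
  have wt: "has_wt wt (\<lambda>a. wtw kp w a + alpha i a) (ap (e i) (ap (fw f w) z))"
    using assms has_wt_e has_wt_word unfolding hwv_def by blast
  show ?thesis
    using adj[OF assms(4,3) supp_word[OF assms(5,2)]] has_wt_dg[OF wt, of "hh i"]
    by (simp add: form_scale form_lcomb e_word[OF assms(1,4,5)])
qed

text \<open>By induction on the left word: the adjoint of \<open>f i\<close> is \<open>e i\<close>
  up to a diagonal factor, and by \<open>e_word\<close> it sends words on \<open>z\<close> to
  combinations of words on \<open>z\<close>. Once the left word is used up, a letter left on the
  right is moved over and annihilates \<open>x\<close>.\<close>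

lemma words_orthogonal:
  assumes x: "hwv kp x" "supp_in X x" and z: "hwv kp' z" "supp_in X z" and o: "form cj X x z = 0"
    and u: "u \<in> Wd M" and w: "w \<in> Wd M"
  shows "form cj X (ap (fw f u) x) (ap (fw f w) z) = 0"
  using u w
proof (induction u arbitrary: w)
  case Nil
  then show ?case using form_hwv_f[OF x] z o by (cases w) (auto intro: supp_word)
next
  case (Cons i u)
  have "(\<Sum>(k, w')\<leftarrow>EW p kp' i w. k * form cj X (ap (fw f u) x) (ap (fw f w') z)) = 0"
    using Cons by (intro sum_list_case_zero) (auto dest: EW_Wd[OF Cons.prems(2)])
  then show ?case using Cons form_f_word[OF z, of "ap (fw f u) x" i w] x supp_word by auto
qed

end

locale posact = formact M 1 wt e f X cnj "\<lambda>_ _. 1"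
  for M :: nat and wt :: "'b \<Rightarrow> nat \<Rightarrow> int" and e f :: "nat \<Rightarrow> ('b, complex) lop" and X :: "'b set"
begin

text \<open>Same induction as for \<open>words_orthogonal\<close>. The coefficients met on the way
  are those of \<open>GG\<close>, so the two vectors enter only through their common weight and the
  number \<open>form cnj X x z\<close>.\<close>

lemma words_gram:
  assumes x: "hwv kp x" "supp_in X x" and z: "hwv kp z" "supp_in X z"
    and u: "u \<in> Wd M" and w: "w \<in> Wd M"
  shows "form cnj X (ap (fw f u) x) (ap (fw f w) z) = GG kp u w * form cnj X x z"
  using u w
proof (induction u arbitrary: w)
  case Nil
  then show ?case using form_hwv_f[OF x] z by (cases w) (auto intro: supp_word)
next
  case (Cons i u)
  have "(\<Sum>(k, w')\<leftarrow>EW 1 kp i w. k * form cnj X (ap (fw f u) x) (ap (fw f w') z))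
      = (\<Sum>(k, w')\<leftarrow>EW 1 kp i w. k * GG kp u w' * form cnj X x z)"
    using Cons by (intro arg_cong[where f = sum_list] map_cong) (auto dest: EW_Wd[OF Cons.prems(2)])
  also have "\<dots> = GG kp (i # u) w * form cnj X x z"
    by (simp add: sum_list_case_mult)
  finally show ?case using Cons form_f_word[OF z, of "ap (fw f u) x" i w] x supp_word by auto
qed

end

lemma form_cnj_pos:
  assumes "finite X" and "supp_in X x" and "form cnj X x x = 0"
  shows "x = (\<lambda>S. 0)"
proof -
  have "form cnj X x x = of_real (\<Sum>S\<in>X. (cmod (x S))\<^sup>2)"
    unfolding form_def of_real_sum by (intro sum.cong refl) (metis complex_norm_square mult.commute)
  from trans[OF this[symmetric] assms(3)] have "(\<Sum>S\<in>X. (cmod (x S))\<^sup>2) = 0"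
    by (simp only: of_real_eq_0_iff)
  then have "\<forall>S\<in>X. x S = 0" using assms(1) by (subst (asm) sum_nonneg_eq_0_iff) auto
  then show ?thesis using assms(2) unfolding supp_in_def by auto
qed

text \<open>Independence modulo the radical of the contravariant form, that is, in the irreducible
  quotient of the Verma module, expressed without any realization of that quotient.\<close>

definition gg_indep :: "nat \<Rightarrow> (nat \<Rightarrow> int) \<Rightarrow> nat list set \<Rightarrow> bool" where
  "gg_indep M kp B \<longleftrightarrow> (\<forall>c. (\<forall>u\<in>Wd M. (\<Sum>w\<in>B. c w * GG kp u w) = 0) \<longrightarrow> (\<forall>w\<in>B. c w = 0))"

definition gg_basis :: "nat \<Rightarrow> (nat \<Rightarrow> int) \<Rightarrow> nat list set \<Rightarrow> bool" where
  "gg_basis M kp B \<longleftrightarrow> finite B \<and> B \<subseteq> Wd M \<and> gg_indep M kp B \<and>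
     (\<forall>w\<in>Wd M. \<exists>c. \<forall>u\<in>Wd M. GG kp u w = (\<Sum>w'\<in>B. c w' * GG kp u w'))"

lemma form_sum_left: "form cnj X (\<lambda>S. \<Sum>i\<in>I. c i * y i S) z = (\<Sum>i\<in>I. cnj (c i) * form cnj X (y i) z)"
  unfolding form_def by (simp add: sum_distrib_left sum_distrib_right) (subst sum.swap, simp add: mult_ac)

lemma form_self_sum_zero:
  assumes "finite X" and "\<And>w. w \<in> A \<Longrightarrow> supp_in X (Y w)"
    and "\<And>w. w \<in> A \<Longrightarrow> form cnj X (Y w) (\<lambda>S. \<Sum>w\<in>A. c w * Y w S) = 0"
  shows "(\<Sum>w\<in>A. c w * Y w S) = 0"
proof -
  let ?x = "\<lambda>S. \<Sum>w\<in>A. c w * Y w S"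
  have "form cnj X ?x ?x = (\<Sum>w\<in>A. cnj (c w) * form cnj X (Y w) ?x)" by (rule form_sum_left)
  then have "form cnj X ?x ?x = 0" using assms(3) by simp
  from form_cnj_pos[OF assms(1) _ this] assms(2) have "?x = (\<lambda>S. 0)" by (simp add: supp_in_sum)
  then show ?thesis by (rule fun_cong)
qed

context posact begin

text \<open>Positivity of the form makes linear relations between the words applied to a highest weight
  vector depend only on its weight.\<close>

lemma words_relation_iff:
  assumes z: "hwv kp z" "supp_in X z" "z \<noteq> (\<lambda>S. 0)" and A: "finite A" "A \<subseteq> Wd M"
  shows "(\<forall>S. (\<Sum>w\<in>A. c w * ap (fw f w) z S) = 0) \<longleftrightarrow> (\<forall>u\<in>Wd M. (\<Sum>w\<in>A. c w * GG kp u w) = 0)"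
proof -
  have nz: "form cnj X z z \<noteq> 0" using form_cnj_pos[OF fin z(2)] z(3) by blast
  have F: "form cnj X (ap (fw f u) z) (\<lambda>S. \<Sum>w\<in>A. c w * ap (fw f w) z S)
      = (\<Sum>w\<in>A. c w * GG kp u w) * form cnj X z z" if "u \<in> Wd M" for u
    using A that words_gram[OF z(1,2) z(1,2)]
    by (auto simp: form_sum sum_distrib_right mult.assoc intro!: sum.cong)
  show ?thesis
  proof
    assume "\<forall>S. (\<Sum>w\<in>A. c w * ap (fw f w) z S) = 0"
    then show "\<forall>u\<in>Wd M. (\<Sum>w\<in>A. c w * GG kp u w) = 0" using F nz by auto
  next
    assume "\<forall>u\<in>Wd M. (\<Sum>w\<in>A. c w * GG kp u w) = 0"
    then have "(\<Sum>w\<in>A. c w * ap (fw f w) z S) = 0" for S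
      using F A z supp_word by (intro form_self_sum_zero[OF fin]) auto
    then show "\<forall>S. (\<Sum>w\<in>A. c w * ap (fw f w) z S) = 0" by blast
  qed
qed

lemma words_span_iff:
  assumes z: "hwv kp z" "supp_in X z" "z \<noteq> (\<lambda>S. 0)" and B: "finite B" "B \<subseteq> Wd M" and w: "w \<in> Wd M"
  shows "(\<forall>S. ap (fw f w) z S = (\<Sum>w'\<in>B. c w' * ap (fw f w') z S))
    \<longleftrightarrow> (\<forall>u\<in>Wd M. GG kp u w = (\<Sum>w'\<in>B. c w' * GG kp u w'))"
proof -
  \<comment> \<open>\<open>w\<close> may itself belong to \<open>B\<close>, so its own coefficient
    and that of the expansion are subtracted instead of being separated by cases.\<close>
  let ?c = "\<lambda>x. (if x = w then 1 else 0) - (if x \<in> B then c x else 0)"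
  have S: "(\<Sum>x\<in>insert w B. ?c x * F x) = F w - (\<Sum>x\<in>B. c x * F x)" for F :: "nat list \<Rightarrow> complex"
  proof -
    have "(\<Sum>x\<in>insert w B. ?c x * F x)
        = (\<Sum>x\<in>insert w B. (if x = w then 1 else 0) * F x) - (\<Sum>x\<in>insert w B. (if x \<in> B then c x else 0) * F x)"
      by (simp add: left_diff_distrib sum_subtractf)
    also have "(\<Sum>x\<in>insert w B. (if x \<in> B then c x else 0) * F x) = (\<Sum>x\<in>B. c x * F x)"
      using B by (intro sum.mono_neutral_cong_right) auto
    also have "(\<Sum>x\<in>insert w B. (if x = w then 1 else 0) * F x) = F w"
      using B by (simp add: if_one_mult)
    finally show ?thesis .
  qed
  from words_relation_iff[OF z, of "insert w B" ?c] B w show ?thesis unfolding S by simp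
qed

lemma lin_indep_words_iff:
  assumes z: "hwv kp z" "supp_in X z" "z \<noteq> (\<lambda>S. 0)" and B: "finite B" "B \<subseteq> Wd M"
  shows "lin_indep B (\<lambda>w. ap (fw f w) z) \<longleftrightarrow> gg_indep M kp B"
  unfolding lin_indep_def gg_indep_def words_relation_iff[OF z B] ..

text \<open>One realization in a finite-dimensional space is enough, since
  \<open>words_span_iff\<close> and \<open>lin_indep_words_iff\<close> translate its properties back
  to \<open>GG\<close>.\<close>

lemma gg_basis_exists:
  assumes z: "hwv kp z" "supp_in X z" "z \<noteq> (\<lambda>S. 0)"
  shows "\<exists>B. gg_basis M kp B"
proof -
  have "card A \<le> card X" if "A \<subseteq> Wd M" "finite A" "lin_indep A (\<lambda>w. ap (fw f w) z)" for A
    using card_le_of_lin_indep_supp[OF fin that(2,3)] that(1) supp_word[OF _ z(2)] by blast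
  from finite_basis_exists[OF this]
  obtain B where B: "B \<subseteq> Wd M" "finite B" "lin_indep B (\<lambda>w. ap (fw f w) z)"
    "\<forall>w\<in>Wd M. in_span B (\<lambda>w. ap (fw f w) z) (ap (fw f w) z)" by blast
  have "\<exists>c. \<forall>u\<in>Wd M. GG kp u w = (\<Sum>w'\<in>B. c w' * GG kp u w')" if w: "w \<in> Wd M" for w
  proof -
    from B(4) w obtain c where "\<forall>S. ap (fw f w) z S = (\<Sum>w'\<in>B. c w' * ap (fw f w') z S)"
      unfolding in_span_def by blast
    with words_span_iff[OF z B(2,1) w, of c] show ?thesis by blast
  qed
  with B show ?thesis unfolding gg_basis_def using lin_indep_words_iff[OF z B(2,1)] by blast
qed

lemma in_span_basis_words:
  assumes z: "hwv kp z" "supp_in X z" "z \<noteq> (\<lambda>S. 0)" and B: "gg_basis M kp B" and w: "w \<in> Wd M"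
  shows "in_span B (\<lambda>w. ap (fw f w) z) (ap (fw f w) z)"
proof -
  from B w have B': "finite B" "B \<subseteq> Wd M" and "\<exists>c. \<forall>u\<in>Wd M. GG kp u w = (\<Sum>w'\<in>B. c w' * GG kp u w')"
    unfolding gg_basis_def by auto
  then obtain c where "\<forall>u\<in>Wd M. GG kp u w = (\<Sum>w'\<in>B. c w' * GG kp u w')" by blast
  then have "\<forall>S. ap (fw f w) z S = (\<Sum>w'\<in>B. c w' * ap (fw f w') z S)"
    using words_span_iff[OF z B' w, of c] by blast
  then show ?thesis unfolding in_span_def by blast
qed

end

section \<open>Two commuting families\<close>

locale comm2 =
  fixes M M' :: nat and wt wt' :: "'b \<Rightarrow> nat \<Rightarrow> int" and e f e' f' :: "nat \<Rightarrow> ('b, 'k::field) lop"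
  assumes ff': "\<And>i j. Suc i < M \<Longrightarrow> Suc j < M' \<Longrightarrow> f i * f' j = f' j * f i"
    and ef': "\<And>i j. Suc i < M \<Longrightarrow> Suc j < M' \<Longrightarrow> e i * f' j = f' j * e i"
    and fe': "\<And>i j. Suc i < M \<Longrightarrow> Suc j < M' \<Longrightarrow> f i * e' j = e' j * f i"
    and f_wt': "\<And>i h. Suc i < M \<Longrightarrow> f i * dg (\<lambda>S. h (wt' S)) = dg (\<lambda>S. h (wt' S)) * f i"
    and e_wt': "\<And>i h. Suc i < M \<Longrightarrow> e i * dg (\<lambda>S. h (wt' S)) = dg (\<lambda>S. h (wt' S)) * e i"
    and f'_wt: "\<And>j h. Suc j < M' \<Longrightarrow> f' j * dg (\<lambda>S. h (wt S)) = dg (\<lambda>S. h (wt S)) * f' j"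
    and e'_wt: "\<And>j h. Suc j < M' \<Longrightarrow> e' j * dg (\<lambda>S. h (wt S)) = dg (\<lambda>S. h (wt S)) * e' j"
begin

lemma word_commute: "w \<in> Wd M \<Longrightarrow> w' \<in> Wd M' \<Longrightarrow> fw f w * fw f' w' = fw f' w' * fw f w"
proof (induction w)
  case (Cons i w)
  have "f i * fw f' w' = fw f' w' * f i" using Cons(3)
    by (induction w') (use Cons ff' in \<open>auto intro!: commute_mult[symmetric]\<close>)
  with Cons show ?case by (auto intro: commute_mult)
qed simp

lemma e_word'_commute: "Suc i < M \<Longrightarrow> w' \<in> Wd M' \<Longrightarrow> e i * fw f' w' = fw f' w' * e i"
  by (induction w') (auto intro!: commute_mult[symmetric] simp: ef')

lemma e'_word_commute: "Suc j < M' \<Longrightarrow> w \<in> Wd M \<Longrightarrow> e' j * fw f w = fw f w * e' j"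
  by (induction w) (auto intro!: commute_mult[symmetric] simp: fe')

lemma has_wt_commute:
  assumes "\<And>h. A * dg (\<lambda>S. h (wt0 S)) = dg (\<lambda>S. h (wt0 S)) * A" and "has_wt wt0 kp x"
  shows "has_wt wt0 kp (ap A x)"
  using has_wt_shift[of A wt0 "\<lambda>_. 0" kp x] assms by simp

lemma has_wt_word': "w' \<in> Wd M' \<Longrightarrow> has_wt wt kp x \<Longrightarrow> has_wt wt kp (ap (fw f' w') x)"
  by (induction w') (auto intro!: has_wt_commute[OF f'_wt])

lemma has_wt'_word: "w \<in> Wd M \<Longrightarrow> has_wt wt' kp x \<Longrightarrow> has_wt wt' kp (ap (fw f w) x)"
  by (induction w) (auto intro!: has_wt_commute[OF f_wt'])

end

locale formact2 = A: formact M p wt e f X cj hh + B: formact M' p' wt' e' f' X cj hh'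
    + comm2 M M' wt wt' e f e' f'
  for M M' :: nat and p p' :: "'k::field" and wt wt' :: "'b \<Rightarrow> nat \<Rightarrow> int"
    and e f e' f' :: "nat \<Rightarrow> ('b, 'k) lop" and X :: "'b set" and cj hh hh'
begin

definition hw2 :: "(nat \<Rightarrow> int) \<Rightarrow> (nat \<Rightarrow> int) \<Rightarrow> ('b \<Rightarrow> 'k) \<Rightarrow> bool" where
  "hw2 kp kp' x \<longleftrightarrow> A.hwv kp x \<and> B.hwv kp' x \<and> supp_in X x"

lemma hwv_word':
  assumes "hw2 kp kp' x" and w': "w' \<in> Wd M'"
  shows "A.hwv kp (ap (fw f' w') x)" and "supp_in X (ap (fw f' w') x)"
proof -
  have "ap (e i) (ap (fw f' w') x) = (\<lambda>S. 0)" if "Suc i < M" for i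
    using assms that arg_cong[OF e_word'_commute[OF that w'], of "\<lambda>A. ap A x"]
    unfolding hw2_def A.hwv_def by simp
  then show "A.hwv kp (ap (fw f' w') x)"
    using assms has_wt_word'[OF w'] unfolding hw2_def A.hwv_def by auto
  show "supp_in X (ap (fw f' w') x)" using assms B.supp_word unfolding hw2_def by auto
qed

lemma hwv'_word:
  assumes "hw2 kp kp' x" and w: "w \<in> Wd M"
  shows "B.hwv kp' (ap (fw f w) x)" and "supp_in X (ap (fw f w) x)"
proof -
  have "ap (e' i) (ap (fw f w) x) = (\<lambda>S. 0)" if "Suc i < M'" for i
    using assms that arg_cong[OF e'_word_commute[OF that w], of "\<lambda>A. ap A x"]
    unfolding hw2_def B.hwv_def by simp
  then show "B.hwv kp' (ap (fw f w) x)"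
    using assms has_wt'_word[OF w] unfolding hw2_def B.hwv_def by auto
  show "supp_in X (ap (fw f w) x)" using assms A.supp_word unfolding hw2_def by auto
qed

definition word2 :: "('b \<Rightarrow> 'k) \<Rightarrow> nat list \<Rightarrow> nat list \<Rightarrow> 'b \<Rightarrow> 'k" where
  "word2 x w w' = ap (fw f w) (ap (fw f' w') x)"

lemma supp_word2: "hw2 kp kp' x \<Longrightarrow> w \<in> Wd M \<Longrightarrow> w' \<in> Wd M' \<Longrightarrow> supp_in X (word2 x w w')"
  unfolding word2_def by (intro A.supp_word hwv_word')

lemma has_wt_word2:
  assumes "hw2 kp kp' x" and "w \<in> Wd M" and "w' \<in> Wd M'"
  shows "has_wt wt (wtw kp w) (word2 x w w')" and "has_wt wt' (wtw kp' w') (word2 x w w')"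
proof -
  show "has_wt wt (wtw kp w) (word2 x w w')"
    using hwv_word'[OF assms(1,3)] A.has_wt_word[OF assms(2)] unfolding word2_def A.hwv_def by blast
  have "has_wt wt' (wtw kp' w') (ap (fw f' w') x)"
    using assms B.has_wt_word unfolding hw2_def B.hwv_def by blast
  then show "has_wt wt' (wtw kp' w') (word2 x w w')" unfolding word2_def by (rule has_wt'_word[OF assms(2)])
qed

lemma word2_orthogonal:
  assumes "hw2 kp kp' x" and "hw2 \<mu> \<mu>' z" and "form cj X x z = 0"
    and "u \<in> Wd M" "u' \<in> Wd M'" "w \<in> Wd M" "w' \<in> Wd M'"
  shows "form cj X (word2 x u u') (word2 z w w') = 0"
  unfolding word2_def
proof (rule A.words_orthogonal)
  show "form cj X (ap (fw f' u') x) (ap (fw f' w') z) = 0"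
    using assms by (intro B.words_orthogonal) (auto simp: hw2_def)
qed (use assms hwv_word' in auto)

end

locale posact2 = formact2 M M' 1 1 wt wt' e f e' f' X cnj "\<lambda>_ _. 1" "\<lambda>_ _. 1"
  for M M' :: nat and wt wt' :: "'b \<Rightarrow> nat \<Rightarrow> int" and e f e' f' :: "nat \<Rightarrow> ('b, complex) lop" and X :: "'b set"
begin

sublocale A1: posact M wt e f X ..
sublocale B1: posact M' wt' e' f' X ..

lemma word2_zero_if_form_zero:
  assumes "hw2 kp kp' x" and C: "finite C" "C \<subseteq> Wd M \<times> Wd M'"
    and "\<And>u u'. (u, u') \<in> C \<Longrightarrow> form cnj X (word2 x u u') (\<lambda>S. \<Sum>(w, w')\<in>C. c (w, w') * word2 x w w' S) = 0"
  shows "(\<Sum>(w, w')\<in>C. c (w, w') * word2 x w w' S) = 0"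
  using form_self_sum_zero[OF A.fin, of C "\<lambda>(w, w'). word2 x w w'" c S] assms supp_word2[OF assms(1)]
  by (force simp: case_prod_beta)

text \<open>The Gram matrix of the double words factors into two matrices \<open>GG\<close>. Pairing
  a relation with all \<open>word2 x u u'\<close> and using \<open>gg_indep\<close> for the first
  words shows that every partial sum \<open>z w\<close> is orthogonal to the words of the second
  family; positivity gives \<open>z w = 0\<close>, and independence of the second family settles the
  rest.\<close>

lemma lin_indep_word2:
  assumes x: "hw2 kp kp' x" "x \<noteq> (\<lambda>S. 0)" and B: "finite B" "B \<subseteq> Wd M" "gg_indep M kp B"
    and B': "finite B'" "B' \<subseteq> Wd M'" "gg_indep M' kp' B'"
  shows "lin_indep (B \<times> B') (\<lambda>(w, w'). word2 x w w')"
proof (rule lin_indepI)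
  fix c a assume z: "\<And>S. (\<Sum>a\<in>B \<times> B'. c a * (case a of (w, w') \<Rightarrow> word2 x w w') S) = 0" and a: "a \<in> B \<times> B'"
  define z where "z w = (\<lambda>S. \<Sum>w'\<in>B'. c (w, w') * ap (fw f' w') x S)" for w
  have x': "B.hwv kp' x" "supp_in X x" using x unfolding hw2_def by auto
  have eq: "(\<Sum>w\<in>B. ap (fw f w) (z w) S) = 0" for S
    using z[of S] by (simp add: z_def ap_sum sum.cartesian_product word2_def case_prod_beta)
  have "form cnj X (ap (fw f' u') x) (z w) = 0" if u': "u' \<in> Wd M'" and w: "w \<in> B" for u' w
  proof -
    have "(\<Sum>w\<in>B. form cnj X (ap (fw f' u') x) (z w) * GG kp u w) = 0" if u: "u \<in> Wd M" for u
    proof -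
      have "form cnj X (word2 x u u') (ap (fw f w) (z w)) = GG kp u w * form cnj X (ap (fw f' u') x) (z w)"
        if "w \<in> B" for w
      proof -
        have "form cnj X (word2 x u u') (ap (fw f w) (z w))
            = (\<Sum>w'\<in>B'. c (w, w') * form cnj X (word2 x u u') (ap (fw f w) (ap (fw f' w') x)))"
          by (simp add: z_def ap_sum form_sum)
        also have "\<dots> = (\<Sum>w'\<in>B'. c (w, w') * (GG kp u w * form cnj X (ap (fw f' u') x) (ap (fw f' w') x)))"
          unfolding word2_def using that B B' u u' hwv_word'[OF x(1)]
          by (intro sum.cong refl arg_cong2[where f = "(*)"] A1.words_gram) auto
        also have "\<dots> = GG kp u w * form cnj X (ap (fw f' u') x) (z w)"
          by (simp add: z_def form_sum sum_distrib_left mult_ac)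
        finally show ?thesis .
      qed
      then have "(\<Sum>w\<in>B. form cnj X (ap (fw f' u') x) (z w) * GG kp u w)
          = (\<Sum>w\<in>B. 1 * form cnj X (word2 x u u') (ap (fw f w) (z w)))"
        by (simp add: mult.commute)
      also have "\<dots> = form cnj X (word2 x u u') (\<lambda>S. \<Sum>w\<in>B. 1 * ap (fw f w) (z w) S)"
        by (rule form_sum[symmetric])
      finally show ?thesis using eq by simp
    qed
    with B(3) w show ?thesis unfolding gg_indep_def by metis
  qed
  then have zw: "z w S = 0" if "w \<in> B" for w S
    unfolding z_def using that B' x' B.supp_word
    by (intro form_self_sum_zero[OF B.fin]) (auto simp: z_def)
  have "lin_indep B' (\<lambda>w'. ap (fw f' w') x)"
    using B1.lin_indep_words_iff[OF x' x(2) B'(1,2)] B'(3) by simp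
  from lin_indepD[OF this, of "\<lambda>w'. c (fst a, w')" "snd a"] zw a
  show "c a = 0" unfolding z_def by auto
qed

text \<open>Different blocks are orthogonal, so pairing a relation with the words of one block
  leaves only the terms of that block, and positivity makes their sum zero.\<close>

lemma lin_indep_blocks:
  fixes x :: "'l \<Rightarrow> 'b \<Rightarrow> complex"
  assumes L: "finite L" and x: "\<And>l. l \<in> L \<Longrightarrow> hw2 (kp l) (kp' l) (x l) \<and> x l \<noteq> (\<lambda>S. 0)"
    and o: "\<And>l l'. l \<in> L \<Longrightarrow> l' \<in> L \<Longrightarrow> l \<noteq> l' \<Longrightarrow> form cnj X (x l) (x l') = 0"
    and B: "\<And>l. l \<in> L \<Longrightarrow> gg_basis M (kp l) (B l)" and B': "\<And>l. l \<in> L \<Longrightarrow> gg_basis M' (kp' l) (B' l)"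
  shows "lin_indep (Sigma L (\<lambda>l. B l \<times> B' l)) (\<lambda>(l, w, w'). word2 (x l) w w')"
proof (rule lin_indepI)
  fix c a assume z: "\<And>S. (\<Sum>a\<in>Sigma L (\<lambda>l. B l \<times> B' l). c a * (case a of (l, w, w') \<Rightarrow> word2 (x l) w w') S) = 0"
    and a: "a \<in> Sigma L (\<lambda>l. B l \<times> B' l)"
  obtain l0 w0 where a': "a = (l0, w0)" "l0 \<in> L" "w0 \<in> B l0 \<times> B' l0" using a by auto
  have f: "finite (B l \<times> B' l)" "B l \<times> B' l \<subseteq> Wd M \<times> Wd M'" if "l \<in> L" for l
    using B[OF that] B'[OF that] unfolding gg_basis_def by auto
  define z where "z l = (\<lambda>S. \<Sum>(w, w')\<in>B l \<times> B' l. c (l, w, w') * word2 (x l) w w' S)" for l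
  have "(\<Sum>l\<in>L. \<Sum>w\<in>B l \<times> B' l. c (l, w) * (case (l, w) of (l, w, w') \<Rightarrow> word2 (x l) w w') S)
      = (\<Sum>a\<in>Sigma L (\<lambda>l. B l \<times> B' l). c a * (case a of (l, w, w') \<Rightarrow> word2 (x l) w w') S)" for S
    using L f by (subst sum.Sigma) (auto simp: case_prod_beta)
  then have sz: "(\<Sum>l\<in>L. 1 * z l S) = 0" for S using z unfolding z_def by (simp add: case_prod_beta)
  have zz: "z l0 S = 0" for S unfolding z_def
  proof (rule word2_zero_if_form_zero[where c = "\<lambda>w. c (l0, w)", simplified])
    show "hw2 (kp l0) (kp' l0) (x l0)" using x a' by blast
    show "finite (B l0 \<times> B' l0)" "B l0 \<times> B' l0 \<subseteq> Wd M \<times> Wd M'" using f a' by auto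
    fix u u' assume u: "(u, u') \<in> B l0 \<times> B' l0"
    have "form cnj X (word2 (x l0) u u') (z l) = 0" if l: "l \<in> L" "l \<noteq> l0" for l
    proof -
      have "form cnj X (word2 (x l0) u u') (word2 (x l) w w') = 0" if "(w, w') \<in> B l \<times> B' l" for w w'
        using word2_orthogonal[of "kp l0" "kp' l0" "x l0" "kp l" "kp' l" "x l" u u' w w']
          x[OF l(1)] x[OF a'(2)] o[of l0 l] f[OF l(1)] f[OF a'(2)] that u l a' by blast
      then show ?thesis unfolding z_def case_prod_beta form_sum by (intro sum.neutral) auto
    qed
    then have "(\<Sum>l\<in>L. 1 * form cnj X (word2 (x l0) u u') (z l)) = form cnj X (word2 (x l0) u u') (z l0)"
      using L a' by (simp add: sum.remove[of L l0])
    moreover have "(\<Sum>l\<in>L. 1 * form cnj X (word2 (x l0) u u') (z l)) = 0"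
      unfolding form_sum[symmetric] sz by simp
    ultimately show "form cnj X (word2 (x l0) u u') (\<lambda>S. \<Sum>(w, w')\<in>B l0 \<times> B' l0. c (l0, w, w') * word2 (x l0) w w' S) = 0"
      unfolding z_def by simp
  qed
  have "lin_indep (B l0 \<times> B' l0) (\<lambda>(w, w'). word2 (x l0) w w')"
    using x[OF a'(2)] B[OF a'(2)] B'[OF a'(2)] unfolding gg_basis_def by (intro lin_indep_word2) auto
  from lin_indepD[OF this, of "\<lambda>w. c (l0, w)" w0] zz a'
  show "c a = 0" unfolding z_def by (auto simp: case_prod_beta)
qed

end

section \<open>Skew Howe duality and its specialization\<close>

section \<open>The exterior algebra as a module with two commuting actions\<close>

text \<open>States are predicates on a whole type of sites; those occupied only inside a finite
  \<open>P\<close> index a basis of the exterior algebra on \<open>P\<close>.\<close>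

definition Pst :: "'s set \<Rightarrow> ('s \<Rightarrow> bool) set" where
  "Pst P = {S. \<forall>p. S p \<longrightarrow> p \<in> P}"

lemma Pst_eq: "Pst P = (\<lambda>A p. p \<in> A) ` Pow P"
proof
  show "Pst P \<subseteq> (\<lambda>A p. p \<in> A) ` Pow P"
    unfolding Pst_def by (auto intro!: image_eqI[where x = "Collect _"])
qed (auto simp: Pst_def)

lemma finite_Pst: "finite P \<Longrightarrow> finite (Pst P)"
  and card_Pst: "finite P \<Longrightarrow> card (Pst P) = 2 ^ card P"
proof -
  assume P: "finite P"
  then show "finite (Pst P)" unfolding Pst_eq by simp
  have "inj_on (\<lambda>A p. p \<in> A) (Pow P)" by (auto simp: inj_on_def fun_eq_iff)
  then show "card (Pst P) = 2 ^ card P" unfolding Pst_eq by (simp add: card_image card_Pow P)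
qed

lemma supp_mv:
  assumes "p \<in> P" "p' \<in> P" "supp_in (Pst P) x"
  shows "supp_in (Pst P) (ap (mv p p') x)"
proof -
  have "S(p := False, p' := True) \<notin> Pst P" if "S \<notin> Pst P" for S
  proof -
    from that obtain r where "S r" "r \<notin> P" unfolding Pst_def by blast
    moreover then have "r \<noteq> p" "r \<noteq> p'" using assms by auto
    ultimately show ?thesis unfolding Pst_def by (auto intro!: exI[of _ r])
  qed
  then show ?thesis using assms(3) unfolding supp_in_def by (auto simp: ap_mv)
qed

lemma supp_dg: "supp_in X x \<Longrightarrow> supp_in X (ap (dg g) x)"
  unfolding supp_in_def by simp

lemma form_mv:
  assumes "p \<in> P" "p' \<in> P" "finite P" and cj0: "cj 0 = 0"
  shows "form cj (Pst P) (ap (mv p p') x) y = form cj (Pst P) x (ap (mv p' p) y)"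
proof (cases "p = p'")
  case True
  then show ?thesis by (simp add: form_def ap_mv cj0)
next
  case False
  have id: "S(p' := False, p := True) = S" if "S p" "\<not> S p'" for S p p'
    using that by (auto simp: fun_eq_iff)
  let ?A = "{S \<in> Pst P. S p \<and> \<not> S p'}" and ?B = "{S \<in> Pst P. S p' \<and> \<not> S p}"
  have "form cj (Pst P) (ap (mv p p') x) y = (\<Sum>S\<in>?A. cj (x (S(p := False, p' := True))) * y S)"
    unfolding form_def using finite_Pst[OF assms(3)]
    by (intro sum.mono_neutral_cong_right) (auto simp: ap_mv cj0)
  also have "\<dots> = (\<Sum>S\<in>?B. cj (x S) * y (S(p' := False, p := True)))"
    by (rule sum.reindex_bij_witness[of _ "\<lambda>S. S(p' := False, p := True)" "\<lambda>S. S(p := False, p' := True)"])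
       (use False assms in \<open>auto simp: Pst_def id\<close>)
  also have "\<dots> = form cj (Pst P) x (ap (mv p' p) y)"
    unfolding form_def using finite_Pst[OF assms(3)]
    by (intro sum.mono_neutral_cong_left) (auto simp: ap_mv)
  finally show ?thesis .
qed

lemma form_dg:
  assumes "\<And>S. cj (g S) = g S" and "\<And>a b. cj (a * b) = cj a * cj b"
  shows "form cj X (ap (dg g) x) y = form cj X x (ap (dg g) y)"
  unfolding form_def by (simp add: assms mult_ac)

lemma minus_one_powi_cases: "(-1::'k::field) powi n = (if even n then 1 else -1)"
  by (simp add: power_int_minus_left)

text \<open>This is the sign by which the untwisted row action misses the relations with parameter
  \<open>q\<close>; the twist by \<open>sgd\<close> compensates it.\<close>

lemma qint_neg_inverse:
  assumes "q \<noteq> 0"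
  shows "qint (- inverse q) a = - ((-1) powi a) * qint (q :: 'k::field) a"
proof -
  have pm: "(- inverse q) powi n = (-1) powi n * q powi (- n)" for n
    using assms by (simp add: minus_one_powi_cases power_int_minus_left power_int_minus power_int_inverse)
  show ?thesis
  proof (cases "q * q = 1")
    case True
    then have iq: "inverse q = q" using assms by (simp add: field_simps)
    then have "q powi (- n) = q powi n" for n by (metis power_int_inverse power_int_minus)
    from this[of "a - 1"] show ?thesis using True iq pm[of "a - 1"] unfolding qint_def
      by (simp add: minus_one_powi_cases)
  next
    case False
    have 1: "- inverse q * - inverse q \<noteq> 1"
      using False assms by (simp add: field_simps)
    have 2: "- inverse q - inverse (- inverse q) = q - inverse q" using assms by simp
    have 3: "(-1::'k) powi (- a) = (-1) powi a" by (simp add: minus_one_powi_cases)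
    show ?thesis unfolding qint_def pm 2 3 using 1 False by (simp add: algebra_simps minus_divide_left)
  qed
qed

text \<open>The twist by signs turns the action with parameter \<open>- 1 / q\<close>, the one that commutes with the
  action on the columns, into an action with parameter \<open>q\<close>.\<close>

definition sgd :: "(nat \<Rightarrow> nat \<Rightarrow> 's) \<Rightarrow> nat \<Rightarrow> nat \<Rightarrow> ('s \<Rightarrow> bool, 'k::field) lop" where
  "sgd s r k = dg (\<lambda>S. (-1) powi wts s r S k)"

definition E2 :: "'k::field \<Rightarrow> (nat \<Rightarrow> nat \<Rightarrow> 's) \<Rightarrow> nat \<Rightarrow> nat \<Rightarrow> ('s \<Rightarrow> bool, 'k) lop" where
  "E2 q s r j = chn (- inverse q) s True r j * sgd s r (Suc j)"

definition F2 :: "'k::field \<Rightarrow> (nat \<Rightarrow> nat \<Rightarrow> 's) \<Rightarrow> nat \<Rightarrow> nat \<Rightarrow> ('s \<Rightarrow> bool, 'k) lop" where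
  "F2 q s r j = fop (- inverse q) s r j * sgd s r j"

text \<open>The adjoint of \<open>fop\<close> is the raising operator followed by this diagonal
  factor. \<open>h2\<close> is its analogue for the twisted operators, where the powers of
  \<open>-1\<close> come from the twists in \<open>F2\<close> and \<open>E2\<close>. Both are
  constantly 1 at \<open>q = 1\<close>.\<close>

definition h1 :: "'k::field \<Rightarrow> nat \<Rightarrow> (nat \<Rightarrow> int) \<Rightarrow> 'k" where
  "h1 p i kp = p * p powi (- hw kp i)"

definition h2 :: "'k::field \<Rightarrow> nat \<Rightarrow> (nat \<Rightarrow> int) \<Rightarrow> 'k" where
  "h2 q i kp = h1 (- inverse q) i kp * (-1) powi kp i * (-1) powi (kp (Suc i) + 1)"

text \<open>An involutive automorphism that fixes the parameter: complex conjugation at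
  \<open>q = 1\<close>, the identity over C(q).\<close>

locale real_conj =
  fixes cj :: "'k::field \<Rightarrow> 'k" and q :: 'k
  assumes cj_add: "\<And>a b. cj (a + b) = cj a + cj b" and cj_mult: "\<And>a b. cj (a * b) = cj a * cj b"
    and cj_cj: "\<And>a. cj (cj a) = a" and cj_q: "cj q = q" and q: "q \<noteq> 0"
begin

lemma cj_0: "cj 0 = 0" and cj_1: "cj 1 = 1"
proof -
  show 0: "cj 0 = 0" using cj_add[of 0 0] by (metis add_0_right add_left_cancel)
  have "cj 1 * cj 1 = cj 1" using cj_mult[of 1 1] by simp
  moreover have "cj 1 \<noteq> 0" using cj_cj[of 1] 0 by force
  ultimately show "cj 1 = 1" by simp
qed

lemma cj_uminus: "cj (- a) = - cj a"
  using cj_add[of a "- a"] cj_0 by (simp add: eq_neg_iff_add_eq_0 add.commute)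

lemma cj_inverse: "cj (inverse a) = inverse (cj a)"
proof (cases "a = 0")
  case False
  then have "cj a * cj (inverse a) = 1" by (simp flip: cj_mult add: cj_1)
  then show ?thesis by (rule inverse_unique[symmetric])
qed (simp add: cj_0)

lemma cj_powi: "cj a = a \<Longrightarrow> cj (a powi n) = a powi n"
proof -
  have "cj (b ^ k) = cj b ^ k" for b k by (induction k) (simp_all add: cj_1 cj_mult)
  then show "cj a = a \<Longrightarrow> cj (a powi n) = a powi n" by (simp add: power_int_def cj_inverse)
qed

lemma neg_inverse: "real_conj cj (- inverse q)"
  by unfold_locales (simp_all add: cj_add cj_mult cj_cj cj_uminus cj_inverse cj_q q)

end

context sites begin

lemma loc_supp: "(\<And>i. i < M \<Longrightarrow> s i c \<in> P) \<Longrightarrow> Suc i < M \<Longrightarrow> supp_in (Pst P) x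
    \<Longrightarrow> supp_in (Pst P) (ap (loc s d i c) x)"
  unfolding loc_def by (auto intro!: supp_mv)

lemma supp_in_add: "supp_in X x \<Longrightarrow> supp_in X y \<Longrightarrow> supp_in X (\<lambda>b. x b + y b :: 'k::field)"
  unfolding supp_in_def by auto

lemma chn_supp: "(\<And>i c. i < M \<Longrightarrow> c < r \<Longrightarrow> s i c \<in> P) \<Longrightarrow> Suc i < M \<Longrightarrow> supp_in (Pst P) x
    \<Longrightarrow> supp_in (Pst P) (ap (chn p s d r i) x)"
proof (induction r arbitrary: x)
  case 0
  then show ?case by (simp add: supp_in_def)
next
  case (Suc r)
  have "supp_in (Pst P) (ap (loc s d i r) x)" by (rule loc_supp[of M]) (use Suc in auto)
  moreover have "supp_in (Pst P) (ap (chn p s d r i) (ap (kloc p s i r) x))"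
    by (rule Suc.IH) (use Suc in \<open>auto simp: kloc_def simp del: ap_simps intro!: supp_dg\<close>)
  ultimately show ?case by (auto intro: supp_in_add)
qed

lemma chn_adj:
  assumes cj: "real_conj cj p" and P: "finite P"
  shows "(\<And>i c. i < M \<Longrightarrow> c < r \<Longrightarrow> s i c \<in> P) \<Longrightarrow> Suc i < M
    \<Longrightarrow> form cj (Pst P) (ap (chn p s False r i) x) y = form cj (Pst P) x (ap (chn p s True r i) y)"
proof (induction r arbitrary: x y)
  case 0
  then show ?case by (simp add: form_def real_conj.cj_0[OF cj])
next
  case (Suc r)
  interpret real_conj cj p by fact
  let ?f = "form cj (Pst P)" and ?k = "kloc p s i r"
  have IH: "?f (ap (chn p s False r i) x) y = ?f x (ap (chn p s True r i) y)" for x y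
    by (rule Suc.IH) (use Suc.prems in auto)
  have k: "?f (ap ?k x) y = ?f x (ap ?k y)" for x y
    unfolding kloc_def by (rule form_dg) (auto simp: cj_powi cj_q cj_mult)
  have l: "?f (ap (loc s False i r) x) y = ?f x (ap (loc s True i r) y)" for x y
    unfolding loc_def using Suc.prems by (auto intro!: form_mv P cj_0)
  have "chn p s True r i * ?k = ?k * chn p s True r i" by (rule chn_kloc_commute) simp
  then have c: "ap (chn p s True r i) (ap ?k y) = ap ?k (ap (chn p s True r i) y)"
    by (simp flip: ap_simps(1))
  have "?f (\<lambda>b. a b + b' b) y = ?f a y + ?f b' y" for a b'
    by (simp add: form_def cj_add distrib_right sum.distrib)
  then show ?case using IH k l c by (simp add: form_add)
qed

lemma formact_chn:
  fixes p :: "'k::field"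
  assumes cj: "real_conj cj p" and P: "finite P" and s: "\<And>i c. i < M \<Longrightarrow> c < r \<Longrightarrow> s i c \<in> P"
  shows "formact M p (wts s r) (chn p s True r) (fop p s r) (Pst P) cj (h1 p)"
proof -
  interpret real_conj cj p by fact
  show ?thesis
  proof
    show "finite (Pst P)" by (rule finite_Pst[OF P])
    fix i assume i: "Suc i < M"
    show "chn p s True r i * fop p s r j - fop p s r j * chn p s True r i
      = (if i = j then dg (\<lambda>S. qint p (hw (wts s r S) i)) else 0)" for j
      by (rule chn_fop[OF q])
    show "chn p s True r i * dg (\<lambda>S. h (wts s r S)) = dg (\<lambda>S. h (\<lambda>k. wts s r S k - alpha i k)) * chn p s True r i" for h
      using chn_wts[of p True r i h] by simp
    show "fop p s r i * dg (\<lambda>S. h (wts s r S)) = dg (\<lambda>S. h (\<lambda>k. wts s r S k - - alpha i k)) * fop p s r i" for h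
      using fop_wts[of p r i h] by simp
    fix x y :: "('s \<Rightarrow> bool) \<Rightarrow> 'k"
    show "supp_in (Pst P) x \<Longrightarrow> supp_in (Pst P) (ap (chn p s True r i) x)"
      using s i by (rule chn_supp)
    show "supp_in (Pst P) x \<Longrightarrow> supp_in (Pst P) (ap (fop p s r i) x)"
      unfolding fop_def ap_simps(1) using s i supp_dg by (intro chn_supp)
    show "form cj (Pst P) (ap (fop p s r i) x) y
      = form cj (Pst P) x (ap (dg (\<lambda>S. h1 p i (wts s r S)) * chn p s True r i) y)"
    proof -
      have a: "form cj (Pst P) (ap (chn p s False r i) x) y = form cj (Pst P) x (ap (chn p s True r i) y)" for x y
        by (rule chn_adj[OF cj P]) (use s i in auto)
      show ?thesis unfolding fop_def h1_def ap_simps(1) a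
        by (rule form_dg) (auto simp: cj_powi cj_q cj_mult)
    qed
  qed (auto simp: cj_add cj_mult cj_cj cj_0)
qed

lemma sgd_move:
  fixes p :: "'k::field"
  assumes "A = chn p s d r i \<or> A = fop p s r i"
  shows "sgd s r k * A = sc (if k = i \<or> k = Suc i then -1 else 1) * (A * sgd s r k)"
proof -
  let ?c = "if k = i \<or> k = Suc i then -1 else 1 :: 'k"
  have 1: "A * sgd s r k = dg (\<lambda>S. ?c * (-1) powi wts s r S k) * A"
    using assms
  proof
    assume A: "A = chn p s d r i"
    show ?thesis unfolding A sgd_def chn_wts[of p d r i "\<lambda>kp. (-1) powi kp k"]
      by (intro arg_cong2[where f = "(*)"] arg_cong[where f = dg] ext)
         (auto simp: alpha_def minus_one_powi_cases)
  next
    assume A: "A = fop p s r i"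
    show ?thesis unfolding A sgd_def fop_wts[of p r i "\<lambda>kp. (-1) powi kp k"]
      by (intro arg_cong2[where f = "(*)"] arg_cong[where f = dg] ext)
         (auto simp: alpha_def minus_one_powi_cases)
  qed
  also have "dg (\<lambda>S. ?c * (-1) powi wts s r S k) = sc ?c * sgd s r k" by (simp add: sgd_def dg_mult)
  finally show ?thesis by (simp add: sc_sc mult.assoc dg_one)
qed

lemma formact_twisted:
  fixes q :: "'k::field"
  assumes cj: "real_conj cj q" and P: "finite P" and s: "\<And>i c. i < M \<Longrightarrow> c < r \<Longrightarrow> s i c \<in> P"
  shows "formact M q (wts s r) (E2 q s r) (F2 q s r) (Pst P) cj (h2 q)"
proof -
  interpret real_conj cj q by fact
  let ?p = "- inverse q"
  interpret R: real_conj cj ?p by (rule neg_inverse)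
  interpret A: formact M ?p "wts s r" "chn ?p s True r" "fop ?p s r" "Pst P" cj "h1 ?p"
    by (rule formact_chn[OF neg_inverse P s])
  have sgd_dg: "sgd s r k * dg g = dg g * sgd s r k" for k g by (simp add: sgd_def dg_commute)
  show ?thesis
  proof
    fix i assume i: "Suc i < M"
    show "E2 q s r i * dg (\<lambda>S. h (wts s r S)) = dg (\<lambda>S. h (\<lambda>k. wts s r S k - alpha i k)) * E2 q s r i" for h
      unfolding E2_def by (simp only: mult.assoc sgd_dg) (simp only: mult.assoc[symmetric] A.e_shift[OF i])
    show "F2 q s r i * dg (\<lambda>S. h (wts s r S)) = dg (\<lambda>S. h (\<lambda>k. wts s r S k - - alpha i k)) * F2 q s r i" for h
      unfolding F2_def by (simp only: mult.assoc sgd_dg) (simp only: mult.assoc[symmetric] A.f_shift[OF i])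
    fix x y :: "('s \<Rightarrow> bool) \<Rightarrow> 'k"
    show "supp_in (Pst P) x \<Longrightarrow> supp_in (Pst P) (ap (E2 q s r i) x)"
      unfolding E2_def sgd_def ap_simps(1) by (intro A.supp_e[OF i] supp_dg)
    show "supp_in (Pst P) x \<Longrightarrow> supp_in (Pst P) (ap (F2 q s r i) x)"
      unfolding F2_def sgd_def ap_simps(1) by (intro A.supp_f[OF i] supp_dg)
    have "form cj (Pst P) (ap (F2 q s r i) x) y = form cj (Pst P) (ap (sgd s r i) x)
        (ap (dg (\<lambda>S. h1 ?p i (wts s r S)) * chn ?p s True r i) y)" if "supp_in (Pst P) x" "supp_in (Pst P) y"
      unfolding F2_def ap_simps(1)[of "fop ?p s r i"] using that
      by (intro A.adj[OF i]) (auto simp: sgd_def simp del: ap_simps intro: supp_dg)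
    moreover have "form cj (Pst P) (ap (sgd s r i) x) z = form cj (Pst P) x (ap (sgd s r i) z)" for z
      unfolding sgd_def by (rule form_dg) (auto simp: cj_powi cj_uminus cj_1 cj_mult)
    moreover have "sgd s r i * (dg (\<lambda>S. h1 ?p i (wts s r S)) * chn ?p s True r i)
        = dg (\<lambda>S. h2 q i (wts s r S)) * E2 q s r i"
    proof -
      have "E2 q s r i = sc (-1) * (sgd s r (Suc i) * chn ?p s True r i)"
        unfolding E2_def by (subst sgd_move[where A = "chn ?p s True r i" and i = i]) (auto simp: sc_sc dg_one)
      moreover have "h2 q i kp * -1 * (-1) powi kp (Suc i) = (-1) powi kp i * h1 ?p i kp" for kp
        by (simp add: h2_def minus_one_powi_cases)
      ultimately show ?thesis by (simp only: sgd_def mult.assoc[symmetric] dg_mult)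
    qed
    ultimately show "supp_in (Pst P) x \<Longrightarrow> supp_in (Pst P) y \<Longrightarrow> form cj (Pst P) (ap (F2 q s r i) x) y
      = form cj (Pst P) x (ap (dg (\<lambda>S. h2 q i (wts s r S)) * E2 q s r i) y)"
      by (simp flip: ap_simps(1))
    fix j assume j: "Suc j < M"
    \<comment> \<open>Moving the twists to the right costs the sign \<open>?c\<close> in both orders
      of the two operators, so it factors out of the commutator.\<close>
    let ?E = "chn ?p s True r i" and ?F = "fop ?p s r j" and ?c = "sc (if j = i \<or> j = Suc i then -1 else 1) :: ('s \<Rightarrow> bool, 'k) lop"
    have c: "(if Suc i = j \<or> Suc i = Suc j then -1 else 1) = (if j = i \<or> j = Suc i then -1 else (1::'k))" by auto
    have "sgd s r (Suc i) * ?F = ?c * (?F * sgd s r (Suc i))"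
      using sgd_move[where A = ?F and i = j and k = "Suc i"] unfolding c by blast
    moreover have "E2 q s r i * F2 q s r j = ?E * (sgd s r (Suc i) * ?F) * sgd s r j"
      by (simp only: E2_def F2_def mult.assoc)
    ultimately have 1: "E2 q s r i * F2 q s r j = ?c * ((?E * ?F) * (sgd s r (Suc i) * sgd s r j))"
      by (simp only: mult.assoc sc_left[where A = ?E])
    have "sgd s r j * ?E = ?c * (?E * sgd s r j)" using sgd_move[where A = ?E and i = i and k = j] by blast
    moreover have "F2 q s r j * E2 q s r i = ?F * (sgd s r j * ?E) * sgd s r (Suc i)"
      by (simp only: E2_def F2_def mult.assoc)
    moreover have "sgd s r j * sgd s r (Suc i) = (sgd s r (Suc i) * sgd s r j :: ('s \<Rightarrow> bool, 'k) lop)"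
      by (simp add: sgd_def dg_commute)
    ultimately have 2: "F2 q s r j * E2 q s r i = ?c * ((?F * ?E) * (sgd s r (Suc i) * sgd s r j))"
      by (simp only: mult.assoc sc_left[where A = ?F])
    have "E2 q s r i * F2 q s r j - F2 q s r j * E2 q s r i
        = ?c * ((?E * ?F - ?F * ?E) * (sgd s r (Suc i) * sgd s r j))"
      unfolding 1 2 by (simp add: right_diff_distrib left_diff_distrib)
    \<comment> \<open>For \<open>i = j\<close> the sign \<open>?c\<close>, the two twists and the
      sign in \<open>qint_neg_inverse\<close> cancel.\<close>
    also have "\<dots> = (if i = j then dg (\<lambda>S. qint q (hw (wts s r S) i)) else 0)"
      unfolding A.e_f[OF i j] sgd_def
      by (auto simp: dg_mult qint_neg_inverse[OF q] hw_def minus_one_powi_cases intro!: arg_cong[where f = dg])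
    finally show "E2 q s r i * F2 q s r j - F2 q s r j * E2 q s r i
        = (if i = j then dg (\<lambda>S. qint q (hw (wts s r S) i)) else 0)" .
  qed (auto simp: cj_add cj_mult cj_cj cj_0 A.fin)
qed

text \<open>To contribute, the raising operator has to move a particle from level
  \<open>Suc i\<close> into an empty place of level \<open>i\<close>; the hypothesis excludes this
  in every column.\<close>

lemma chn_delta_zero:
  assumes "\<And>c. D (s (Suc i) c) \<Longrightarrow> D (s i c)"
  shows "ap (chn p s True r i) (delta D) = (\<lambda>S. 0)"
proof (induction r)
  case (Suc r)
  have "ap (kloc p s i r) (delta D) = (\<lambda>S. p powi hloc s i r D * delta D S)"
    unfolding kloc_def by (auto simp: delta_def)
  moreover have "ap (loc s True i r) (delta D) = (\<lambda>S. 0)"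
  proof -
    have "S(s i r := False, s (Suc i) r := True) \<noteq> D" for S
    proof
      assume *: "S(s i r := False, s (Suc i) r := True) = D"
      have "D (s (Suc i) r)" "\<not> D (s i r)" unfolding *[symmetric] by (simp_all add: inj)
      with assms show False by blast
    qed
    then show ?thesis unfolding loc_def by (intro ext) (simp add: ap_mv delta_def)
  qed
  ultimately show ?case using Suc by (simp add: ap_scale)
qed simp

end

abbreviation rect :: "nat \<Rightarrow> nat \<Rightarrow> (nat \<times> nat) set" where "rect m r \<equiv> {..<m} \<times> {..<r}"

text \<open>Only the untwisted operators have to be compared by
  \<open>chn_s1_commute_chn_s2\<close>: twists and diagonal factors are functions of the weights,
  which the other action preserves.\<close>

lemma ext_formact2:
  fixes q :: "'k::field"
  assumes cj: "real_conj cj q"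
  shows "formact2 m r q q (wts s1 r) (wts s2 m) (chn q s1 True r) (fop q s1 r) (E2 q s2 m) (F2 q s2 m)
    (Pst (rect m r)) cj (h1 q) (h2 q)"
proof -
  interpret real_conj cj q by fact
  interpret A: formact m q "wts s1 r" "chn q s1 True r" "fop q s1 r" "Pst (rect m r)" cj "h1 q"
    by (rule S1.formact_chn[OF cj]) auto
  interpret B: formact r q "wts s2 m" "E2 q s2 m" "F2 q s2 m" "Pst (rect m r)" cj "h2 q"
    by (rule S2.formact_twisted[OF cj]) auto
  let ?p = "- inverse q"
  have c1: "chn q s1 d r i * dg (\<lambda>S. h (wts s2 m S)) = dg (\<lambda>S. h (wts s2 m S)) * chn q s1 d r i"
    if "Suc i < m" for d i h using chn_s1_wts_s2[OF that] by blast
  have c2: "chn ?p s2 d m j * dg (\<lambda>S. h (wts s1 r S)) = dg (\<lambda>S. h (wts s1 r S)) * chn ?p s2 d m j"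
    if "Suc j < r" for d j h using chn_s2_wts_s1[OF that] by blast
  have c12: "chn q s1 d r i * chn ?p s2 d' m j = chn ?p s2 d' m j * chn q s1 d r i"
    if "Suc i < m" "Suc j < r" for i j d d'
    by (rule chn_s1_commute_chn_s2[OF q refl that])
  note d2 = c1[of _ _ "\<lambda>kp. ?p * ?p powi (- hw kp j)" for j] c1[of _ _ "\<lambda>kp. (-1) powi kp j" for j]
  note d1 = c2[of _ _ "\<lambda>kp. q * q powi (- hw kp i)" for i]
  show ?thesis
  proof
    fix i j assume i: "Suc i < m" and j: "Suc j < r"
    show "fop q s1 r i * F2 q s2 m j = F2 q s2 m j * fop q s1 r i"
      unfolding fop_def F2_def sgd_def using i j
      by (intro commute_mult commute_mult[symmetric] c12 d2 d1 d1[symmetric] dg_commute)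
    show "chn q s1 True r i * F2 q s2 m j = F2 q s2 m j * chn q s1 True r i"
      unfolding fop_def F2_def sgd_def using i j
      by (intro commute_mult[symmetric] commute_mult c12[symmetric] d2[symmetric])
    show "fop q s1 r i * E2 q s2 m j = E2 q s2 m j * fop q s1 r i"
      unfolding fop_def E2_def sgd_def using i j
      by (intro commute_mult commute_mult[symmetric] c12 d2 d1 d1[symmetric] dg_commute)
  next
    fix i h assume i: "Suc i < m"
    show "fop q s1 r i * dg (\<lambda>S. h (wts s2 m S)) = dg (\<lambda>S. h (wts s2 m S)) * fop q s1 r i"
      unfolding fop_def using c1[OF i] by (intro commute_mult dg_commute) auto
    show "chn q s1 True r i * dg (\<lambda>S. h (wts s2 m S)) = dg (\<lambda>S. h (wts s2 m S)) * chn q s1 True r i"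
      by (rule c1[OF i])
  next
    fix j h assume j: "Suc j < r"
    show "F2 q s2 m j * dg (\<lambda>S. h (wts s1 r S)) = dg (\<lambda>S. h (wts s1 r S)) * F2 q s2 m j"
      unfolding F2_def fop_def sgd_def using c2[OF j] by (intro commute_mult dg_commute) auto
    show "E2 q s2 m j * dg (\<lambda>S. h (wts s1 r S)) = dg (\<lambda>S. h (wts s1 r S)) * E2 q s2 m j"
      unfolding E2_def sgd_def using c2[OF j] by (intro commute_mult dg_commute) auto
  qed
qed

lemma real_conj_cnj: "real_conj cnj 1" and real_conj_id: "q \<noteq> 0 \<Longrightarrow> real_conj (\<lambda>x. x) q"
  by unfold_locales auto

lemma h1_1: "h1 1 = (\<lambda>_ _. 1)" and h2_1: "h2 1 = (\<lambda>_ _. 1)"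
  by (auto simp: fun_eq_iff h1_def h2_def hw_def minus_one_powi_cases)

text \<open>At \<open>q = 1\<close> the factors \<open>h1\<close> and \<open>h2\<close> are 1, so
  both actions are contravariant for the positive form.\<close>

lemma ext_posact2:
  "posact2 m r (wts s1 r) (wts s2 m) (chn 1 s1 True r) (fop 1 s1 r) (E2 1 s2 m) (F2 1 s2 m) (Pst (rect m r))"
  unfolding posact2_def using ext_formact2[OF real_conj_cnj, of m r] unfolding h1_1 h2_1 .

section \<open>Young diagrams as joint highest weight vectors\<close>

definition young :: "(nat \<Rightarrow> nat) \<Rightarrow> nat \<times> nat \<Rightarrow> bool" where
  "young al = (\<lambda>(i, c). c < al i)"

definition conjp :: "(nat \<Rightarrow> nat) \<Rightarrow> nat \<Rightarrow> nat" where
  "conjp al j = card {i. j < al i}"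

definition in_box :: "nat \<Rightarrow> nat \<Rightarrow> (nat \<Rightarrow> nat) \<Rightarrow> bool" where
  "in_box m r al \<longleftrightarrow> antimono al \<and> (\<forall>i. al i \<le> r) \<and> (\<forall>i\<ge>m. al i = 0)"

abbreviation iw :: "(nat \<Rightarrow> nat) \<Rightarrow> nat \<Rightarrow> int" where "iw al \<equiv> \<lambda>k. int (al k)"

text \<open>A diagram is closed upwards and to the left, which is the condition of
  \<open>chn_delta_zero\<close> for both actions; its row lengths and column lengths are the two
  weights.\<close>

lemma young_hw2:
  fixes q :: "'k::field"
  assumes cj: "real_conj cj q" and al: "in_box m r al"
  shows "formact2.hw2 m r (wts s1 r) (wts s2 m) (chn q s1 True r) (E2 q s2 m) (Pst (rect m r))
    (iw al) (iw (conjp al)) (delta (young al))"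
proof -
  interpret formact2 m r q q "wts s1 r" "wts s2 m" "chn q s1 True r" "fop q s1 r" "E2 q s2 m" "F2 q s2 m"
    "Pst (rect m r)" cj "h1 q" "h2 q" by (rule ext_formact2[OF cj])
  have m: "al (Suc i) \<le> al i" for i using al unfolding in_box_def antimono_def by simp
  have "wts s1 r (young al) i = int (al i)" for i
  proof -
    have "{..<r} \<inter> {c. c < al i} = {..<al i}" using al unfolding in_box_def by (auto intro: less_le_trans)
    then show ?thesis by (simp add: wts_def young_def)
  qed
  then have w1: "wts s1 r (young al) = iw al" by blast
  have "wts s2 m (young al) j = int (conjp al j)" for j
  proof -
    have "{..<m} \<inter> {a. j < al a} = {a. j < al a}" using al unfolding in_box_def
      by (auto intro!: Nat.gr0I) (metis not_le not_less_zero)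
    then show ?thesis by (simp add: wts_def young_def conjp_def)
  qed
  then have w2: "wts s2 m (young al) = iw (conjp al)" by blast
  have "has_wt (wts s1 r) (iw al) (delta (young al))" "has_wt (wts s2 m) (iw (conjp al)) (delta (young al))"
    unfolding has_wt_def delta_def using w1 w2 by auto
  moreover have "ap (chn q s1 True r i) (delta (young al)) = (\<lambda>S. 0)" for i
    using m[of i] by (intro S1.chn_delta_zero) (auto simp: young_def)
  moreover have "ap (E2 q s2 m j) (delta (young al)) = (\<lambda>S. 0)" for j
  proof -
    have "ap (sgd s2 m (Suc j)) (delta (young al)) = (\<lambda>S. (-1) powi wts s2 m (young al) (Suc j) * delta (young al) S :: 'k)"
      unfolding sgd_def by (auto simp: delta_def)
    moreover have "ap (chn (- inverse q) s2 True m j) (delta (young al)) = (\<lambda>S. 0)"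
      by (intro S2.chn_delta_zero) (auto simp: young_def)
    ultimately show ?thesis by (simp add: E2_def ap_scale)
  qed
  moreover have "supp_in (Pst (rect m r)) (delta (young al))"
  proof -
    have "i < m \<and> c < r" if "c < al i" for i c
      using al that unfolding in_box_def by (metis not_le not_less_zero less_le_trans)
    then have "young al \<in> Pst (rect m r)" unfolding Pst_def young_def by auto
    then show ?thesis unfolding supp_in_def delta_def by auto
  qed
  ultimately show ?thesis unfolding hw2_def A.hwv_def B.hwv_def by auto
qed

subsection \<open>Specialization of operators at \<open>q = 1\<close>\<close>

definition specializes :: "('b, ratfun) lop \<Rightarrow> ('b, complex) lop \<Rightarrow> bool" where
  "specializes A A' \<longleftrightarrow> (\<forall>x. (\<forall>S. regular_at_one (x S)) \<longrightarrow>
     (\<forall>S. regular_at_one (ap A x S)) \<and> (\<lambda>S. at_one (ap A x S)) = ap A' (\<lambda>S. at_one (x S)))"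

lemma specializes_mult: "specializes A A' \<Longrightarrow> specializes B B' \<Longrightarrow> specializes (A * B) (A' * B')"
  unfolding specializes_def by simp

lemma specializes_add: "specializes A A' \<Longrightarrow> specializes B B' \<Longrightarrow> specializes (A + B) (A' + B')"
  unfolding specializes_def by (auto simp: fun_eq_iff)

lemma specializes_0: "specializes 0 0"
  and specializes_1: "specializes 1 1"
  unfolding specializes_def by auto

lemma specializes_mv: "specializes (mv p p') (mv p p')"
  unfolding specializes_def by (auto simp: ap_mv fun_eq_iff)

lemma specializes_dg:
  assumes "\<And>S. regular_at_one (g S) \<and> at_one (g S) = g' S"
  shows "specializes (dg g) (dg g')"
  unfolding specializes_def using assms by auto

lemma specializes_loc: "specializes (loc s d i c) (loc s d i c)"
  unfolding loc_def by (simp add: specializes_mv)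

lemma specializes_chn:
  assumes "regular_at_one p" and "at_one p = p'" and "p' \<noteq> 0"
  shows "specializes (chn p s d r i) (chn p' s d r i)"
proof (induction r)
  case (Suc r)
  have "specializes (kloc p s i r) (kloc p' s i r)"
    unfolding kloc_def using assms regular_powi by (intro specializes_dg) auto
  with Suc show ?case
    by (auto intro!: specializes_add specializes_mult specializes_loc)
qed (simp add: specializes_0)

lemma specializes_fop:
  assumes "regular_at_one p" and "at_one p = p'" and "p' \<noteq> 0"
  shows "specializes (fop p s r i) (fop p' s r i)"
  unfolding fop_def using assms regular_powi
  by (intro specializes_mult specializes_chn specializes_dg) auto

lemma specializes_F2: "specializes (F2 qq s r j) (F2 1 s r j)"
proof -
  have "at_one (- inverse qq) = -1" "regular_at_one (- inverse qq)"
    using at_one_inverse[of qq] regular_inverse[of qq] by auto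
  moreover have "regular_at_one ((-1) powi n) \<and> at_one ((-1) powi n) = (-1) powi n" for n
    using regular_powi[of "-1" n] by simp
  ultimately show ?thesis unfolding F2_def sgd_def
    by (intro specializes_mult specializes_fop specializes_dg) auto
qed

lemma specializes_fw: "(\<And>i. specializes (f i) (f' i)) \<Longrightarrow> specializes (fw f w) (fw f' w)"
  by (induction w) (auto intro: specializes_mult specializes_1)

lemma specializesD:
  assumes "specializes A A'" and "\<And>S. regular_at_one (x S)"
  shows "regular_at_one (ap A x S)" and "at_one (ap A x S) = ap A' (\<lambda>S. at_one (x S)) S"
  using assms unfolding specializes_def by (auto simp: fun_eq_iff)

section \<open>Dimension count by semistandard tableaux\<close>

section \<open>Counting pairs of tableaux\<close>

text \<open>The shapes \<open>be\<close> for which \<open>al / be\<close> is a horizontal strip,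
  written as interlacing.\<close>

definition hs :: "(nat \<Rightarrow> nat) \<Rightarrow> (nat \<Rightarrow> nat) set" where
  "hs al = {be. \<forall>i. al (Suc i) \<le> be i \<and> be i \<le> al i}"

definition part :: "nat \<Rightarrow> (nat \<Rightarrow> nat) \<Rightarrow> bool" where
  "part L al \<longleftrightarrow> antimono al \<and> (\<forall>i\<ge>L. al i = 0)"

lemma partI: "(\<And>i. al (Suc i) \<le> al i) \<Longrightarrow> (\<And>i. i \<ge> L \<Longrightarrow> al i = 0) \<Longrightarrow> part L al"
  unfolding part_def by (simp add: antimono_iff_le_Suc)

lemma part_Suc: "part L al \<Longrightarrow> al (Suc i) \<le> al i"
  and part_zero: "part L al \<Longrightarrow> L \<le> i \<Longrightarrow> al i = 0"
  and part_mono: "part L al \<Longrightarrow> i \<le> j \<Longrightarrow> al j \<le> al i"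
  unfolding part_def antimono_def by auto

lemma hs_part: "part L al \<Longrightarrow> be \<in> hs al \<Longrightarrow> part L be"
  by (intro partI) (auto simp: hs_def dest: part_zero intro: le_trans, metis le_zero_eq part_zero)

text \<open>Shapes are 0 from \<open>L\<close> on, while elements of \<open>Pi\<^sub>E\<close> are
  undefined there; restriction translates between the two.\<close>

lemma bounded_functions_PiE:
  fixes L :: nat
  shows "bij_betw (\<lambda>al. restrict al {..<L}) {al. (\<forall>i<L. al i \<in> I i) \<and> (\<forall>i\<ge>L. al i = (0::nat))} (Pi\<^sub>E {..<L} I)"
proof (rule bij_betwI[where g = "\<lambda>f i. if i < L then f i else 0"])
  fix f assume "f \<in> Pi\<^sub>E {..<L} I"
  then show "restrict (\<lambda>i. if i < L then f i else 0) {..<L} = f"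
    by (auto simp: fun_eq_iff PiE_def extensional_def)
qed (auto simp: fun_eq_iff PiE_iff extensional_def not_less)

lemma card_bounded_functions:
  fixes L :: nat
  shows "card {al. (\<forall>i<L. al i \<in> I i) \<and> (\<forall>i\<ge>L. al i = (0::nat))} = (\<Prod>i<L. card (I i))"
  using bij_betw_same_card[OF bounded_functions_PiE[of L I]] card_PiE[of "{..<L}" I] by simp

lemma finite_bounded_functions:
  fixes L :: nat
  shows "(\<And>i. i < L \<Longrightarrow> finite (I i)) \<Longrightarrow> finite {al. (\<forall>i<L. al i \<in> I i) \<and> (\<forall>i\<ge>L. al i = (0::nat))}"
  using bij_betw_finite[OF bounded_functions_PiE[of L I]] finite_PiE[of "{..<L}" I] by simp

lemma finite_part_bounded: "finite {al. part L al \<and> (\<forall>i. al i \<le> b)}"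
  by (rule finite_subset[OF _ finite_bounded_functions[of L "\<lambda>_. {..b}"]]) (auto simp: part_def)

lemma finite_hs: "part L al \<Longrightarrow> finite (hs al)"
proof -
  assume a: "part L al"
  have "hs al \<subseteq> {be. part L be \<and> (\<forall>i. be i \<le> al 0)}"
    using hs_part[OF a] part_mono[OF a] unfolding hs_def by (auto intro: le_trans)
  then show ?thesis using finite_part_bounded finite_subset by blast
qed

lemma finite_cells: "part L al \<Longrightarrow> finite (cells al)"
proof -
  assume a: "part L al"
  have "cells al \<subseteq> {..<L} \<times> {..<al 0}"
    using part_zero[OF a] part_mono[OF a, of 0] unfolding cells_def
    by (auto intro: less_le_trans) (metis not_le not_less_zero)
  then show ?thesis by (rule finite_subset) simp
qed

lemma finite_ssyt: "part L al \<Longrightarrow> finite (ssyt al N)"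
  unfolding ssyt_def using finite_cells by (simp add: finite_PiE)

lemma ssyt_row_le: "T \<in> ssyt al N \<Longrightarrow> c \<le> c' \<Longrightarrow> c' < al r \<Longrightarrow> T (r, c) \<le> T (r, c')"
  by (cases "c = c'") (auto simp: ssyt_def cells_def)

lemma ssyt_col_less: "T \<in> ssyt al N \<Longrightarrow> r < r' \<Longrightarrow> c < al r' \<Longrightarrow> T (r, c) < T (r', c)"
  by (auto simp: ssyt_def cells_def)

lemma ssyt_less: "T \<in> ssyt al N \<Longrightarrow> c < al r \<Longrightarrow> T (r, c) < N"
  by (auto simp: ssyt_def cells_def PiE_iff)

lemma ssyt_undefined: "T \<in> ssyt al N \<Longrightarrow> \<not> c < al r \<Longrightarrow> T (r, c) = undefined"
  by (auto simp: ssyt_def cells_def PiE_iff extensional_def)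

lemma ssytI:
  assumes "\<And>r c. c < al r \<Longrightarrow> T (r, c) < N" and "\<And>r c. \<not> c < al r \<Longrightarrow> T (r, c) = undefined"
    and "\<And>r c c'. c < c' \<Longrightarrow> c' < al r \<Longrightarrow> T (r, c) \<le> T (r, c')"
    and "\<And>r r' c. r < r' \<Longrightarrow> c < al r' \<Longrightarrow> T (r, c) < T (r', c)"
  shows "T \<in> ssyt al N"
  using assms by (auto simp: ssyt_def cells_def PiE_iff extensional_def)

lemma ssyt_row_ge:
  assumes a: "part L al" and T: "T \<in> ssyt al N"
  shows "c < al r \<Longrightarrow> r \<le> T (r, c)"
proof (induction r)
  case (Suc r)
  then have "c < al r" using part_Suc[OF a, of r] by simp
  with Suc ssyt_col_less[OF T, of r "Suc r" c] show ?case by simp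
qed simp

lemma ssyt_empty_if_long:
  assumes "part L al" and "al N \<noteq> 0"
  shows "ssyt al N = {}"
  using ssyt_row_ge[OF assms(1), of _ N 0 N] ssyt_less[of _ al N 0 N] assms(2) by fastforce

lemma card_ssyt_0: "card (ssyt al 0) = (if al = (\<lambda>_. 0) then 1 else 0)"
proof (cases "al = (\<lambda>_. 0)")
  case True
  then have "cells al = {}" by (simp add: cells_def)
  then have "ssyt al 0 = {\<lambda>_. undefined}" by (simp add: ssyt_def)
  then show ?thesis using True by simp
next
  case False
  then obtain r where "0 < al r" by (auto simp: fun_eq_iff)
  then have "ssyt al 0 = {}" using ssyt_less[of _ al 0 0 r] by blast
  then show ?thesis using False by simp
qed

lemma card_ssyt_zero_shape: "card (ssyt (\<lambda>_. 0) N) = 1"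
  by (simp add: ssyt_def cells_def)

text \<open>The cells with the greatest entry \<open>N\<close> form a horizontal strip, and removing
  them leaves a tableau with smaller entries on a shape in \<open>hs al\<close>; \<open>g\<close>
  puts them back.\<close>

lemma card_ssyt_Suc:
  assumes a: "part L al"
  shows "card (ssyt al (Suc N)) = (\<Sum>be\<in>hs al. card (ssyt be N))"
proof -
  define b where "b T r = card {c. c < al r \<and> T (r, c) < N}" for T :: "nat \<times> nat \<Rightarrow> nat" and r
  define g where "g = (\<lambda>(be :: nat \<Rightarrow> nat, T :: nat \<times> nat \<Rightarrow> nat) (r, c).
    if c < be r then T (r, c) else if c < al r then N else undefined)"
  \<comment> \<open>Rows increase weakly, so the entries below \<open>N\<close> form an initial
    segment of the row, of length \<open>b T r\<close>.\<close>
  have b: "c < b T r \<longleftrightarrow> c < al r \<and> T (r, c) < N" if T: "T \<in> ssyt al (Suc N)" for T r c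
  proof -
    let ?A = "{c. c < al r \<and> T (r, c) < N}"
    have dc: "c' \<in> ?A" if "c \<in> ?A" "c' \<le> c" for c c'
      using ssyt_row_le[OF T, of c' c r] that by auto
    have "?A = {..<card ?A}"
    proof (rule ccontr)
      assume ne: "?A \<noteq> {..<card ?A}"
      have fin: "finite ?A" by simp
      show False
      proof (cases "\<exists>x\<in>?A. card ?A \<le> x")
        case True
        then obtain x where x: "x \<in> ?A" "card ?A \<le> x" by blast
        then have "{..x} \<subseteq> ?A" using dc by blast
        then have "card {..x} \<le> card ?A" by (rule card_mono[OF fin])
        with x show False by simp
      next
        case False
        then have "?A \<subseteq> {..<card ?A}" by auto
        then have "?A = {..<card ?A}" by (intro card_subset_eq) auto
        with ne show False by blast
      qed
    qed
    then show ?thesis unfolding b_def by blast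
  qed
  have "bij_betw (\<lambda>T. (b T, restrict T (cells (b T)))) (ssyt al (Suc N)) (SIGMA be:hs al. ssyt be N)"
  proof (rule bij_betwI[where g = g])
    show "(\<lambda>T. (b T, restrict T (cells (b T)))) \<in> ssyt al (Suc N) \<rightarrow> (SIGMA be:hs al. ssyt be N)"
    proof
      fix T assume T: "T \<in> ssyt al (Suc N)"
      have "b T r \<le> al r" for r using b[OF T, of "al r" r] by (meson less_irrefl not_le)
      moreover have "al (Suc r) \<le> b T r" for r
      proof (rule ccontr)
        assume "\<not> ?thesis"
        then have l: "b T r < al (Suc r)" by simp
        then have "T (r, b T r) < T (Suc r, b T r)" "T (Suc r, b T r) < Suc N"
          using ssyt_col_less[OF T] ssyt_less[OF T] by auto
        then have "b T r < b T r" using b[OF T, of "b T r" r] l part_Suc[OF a, of r] by simp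
        then show False by simp
      qed
      ultimately have 1: "b T \<in> hs al" unfolding hs_def by blast
      have m: "c < b T r" if "c < b T r'" "r \<le> r'" for c r r'
        using part_mono[OF hs_part[OF a 1] that(2)] that(1) by simp
      have "restrict T (cells (b T)) \<in> ssyt (b T) N"
      proof (rule ssytI)
        fix r c c' assume "c < c'" "c' < b T r"
        then show "restrict T (cells (b T)) (r, c) \<le> restrict T (cells (b T)) (r, c')"
          using b[OF T] ssyt_row_le[OF T, of c c' r] by (simp add: cells_def)
      next
        fix r r' c assume "r < r'" "c < b T r'"
        then show "restrict T (cells (b T)) (r, c) < restrict T (cells (b T)) (r', c)"
          using b[OF T] ssyt_col_less[OF T, of r r' c] m[of c r' r] by (simp add: cells_def)
      qed (use b[OF T] in \<open>auto simp: cells_def\<close>)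
      with 1 show "(b T, restrict T (cells (b T))) \<in> (SIGMA be:hs al. ssyt be N)" by simp
    qed
    have gS: "g (be, T) \<in> ssyt al (Suc N)" "b (g (be, T)) = be" if "be \<in> hs al" and T: "T \<in> ssyt be N" for be T
    proof -
      have le: "be r \<le> al r" "al (Suc r) \<le> be r" for r using that(1) unfolding hs_def by auto
      have be: "part L be" by (rule hs_part[OF a that(1)])
      show "g (be, T) \<in> ssyt al (Suc N)"
      proof (rule ssytI)
        show "c < al r \<Longrightarrow> g (be, T) (r, c) < Suc N" for r c
          using ssyt_less[OF T, of c r] by (auto simp: g_def)
        show "\<not> c < al r \<Longrightarrow> g (be, T) (r, c) = undefined" for r c using le(1)[of r] by (auto simp: g_def)
        show "c < c' \<Longrightarrow> c' < al r \<Longrightarrow> g (be, T) (r, c) \<le> g (be, T) (r, c')" for r c c'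
          using ssyt_row_le[OF T, of c c' r] ssyt_less[OF T, of c r] by (auto simp: g_def)
        show "r < r' \<Longrightarrow> c < al r' \<Longrightarrow> g (be, T) (r, c) < g (be, T) (r', c)" for r r' c
        proof -
          assume *: "r < r'" "c < al r'"
          then have "al r' \<le> al (Suc r)" using part_mono[OF a, of "Suc r" r'] by simp
          then have "c < be r" using * le(2)[of r] by simp
          then show ?thesis
            using * ssyt_col_less[OF T, of r r' c] ssyt_less[OF T, of c r] by (auto simp: g_def)
        qed
      qed
      have "{c. c < al r \<and> g (be, T) (r, c) < N} = {..<be r}" for r
        using le(1)[of r] ssyt_less[OF T, of _ r] by (auto simp: g_def intro: less_le_trans split: if_splits)
      then show "b (g (be, T)) = be" unfolding b_def by (simp add: fun_eq_iff)
    qed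
    show "g \<in> (SIGMA be:hs al. ssyt be N) \<rightarrow> ssyt al (Suc N)" using gS(1) by auto
    fix y assume "y \<in> (SIGMA be:hs al. ssyt be N)"
    then obtain be T where y: "y = (be, T)" "be \<in> hs al" "T \<in> ssyt be N" by blast
    have "restrict (g (be, T)) (cells be) = T"
      using ssyt_undefined[OF y(3)] by (auto simp: fun_eq_iff cells_def g_def)
    then show "(b (g y), restrict (g y) (cells (b (g y)))) = y" unfolding y(1) gS(2)[OF y(2,3)] by simp
  next
    fix T assume T: "T \<in> ssyt al (Suc N)"
    show "g (b T, restrict T (cells (b T))) = T"
    proof
      fix p :: "nat \<times> nat" obtain r c where p: "p = (r, c)" by force
      show "g (b T, restrict T (cells (b T))) p = T p"
        using b[OF T, of c r] ssyt_less[OF T, of c r] ssyt_undefined[OF T, of c r]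
        by (auto simp: p g_def cells_def)
    qed
  qed
  then have "card (ssyt al (Suc N)) = card (SIGMA be:hs al. ssyt be N)" by (rule bij_betw_same_card)
  also have "\<dots> = (\<Sum>be\<in>hs al. card (ssyt be N))"
    using finite_hs[OF a] finite_ssyt[OF hs_part[OF a]] by (intro card_SigmaI) auto
  finally show ?thesis .
qed

text \<open>The shapes that exceed \<open>ga\<close> by a vertical strip, kept within
  \<open>L\<close> rows.\<close>

definition vup :: "nat \<Rightarrow> (nat \<Rightarrow> nat) \<Rightarrow> (nat \<Rightarrow> nat) set" where
  "vup L ga = {al. part L al \<and> (\<forall>i. ga i \<le> al i \<and> al i \<le> Suc (ga i))}"

text \<open>Horizontal and vertical strips: there are twice as many \<open>al\<close> above \<open>be\<close> and \<open>ga\<close> as \<open>\<delta>\<close> below them.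
  Both sets are products of intervals with at most two elements; the free choices alternate.\<close>

lemma local_rule:
  assumes g: "part L ga" and b: "part L be" and b0: "be (L - 1) = 0" and L: "L > 0"
  shows "card {al \<in> vup L ga. be \<in> hs al} = 2 * card {\<delta> \<in> hs ga. be \<in> vup L \<delta>}"
proof -
  \<comment> \<open>With \<open>be\<close> and \<open>ga\<close> fixed, all conditions on
    \<open>al\<close> become one interval per row; likewise for \<open>\<delta>\<close> with
    \<open>J\<close>.\<close>
  define I where "I i = {max (ga i) (be i) .. (if i = 0 then Suc (ga i) else min (Suc (ga i)) (be (i - 1)))}" for i
  define J where "J i = {max (ga (Suc i)) (be i - 1) .. min (ga i) (be i)}" for i
  have A: "{al \<in> vup L ga. be \<in> hs al} = {al. (\<forall>i<L. al i \<in> I i) \<and> (\<forall>i\<ge>L. al i = 0)}" (is "?l = ?r")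
  proof
    show "?l \<subseteq> ?r"
    proof
      fix al assume "al \<in> ?l"
      then have *: "part L al" "\<And>i. ga i \<le> al i" "\<And>i. al i \<le> Suc (ga i)" "\<And>i. al (Suc i) \<le> be i" "\<And>i. be i \<le> al i"
        unfolding vup_def hs_def by auto
      have "al i \<in> I i" for i using *(2,3,5)[of i] *(4)[of "i - 1"] unfolding I_def by (cases i) auto
      with part_zero[OF *(1)] show "al \<in> ?r" by blast
    qed
    show "?r \<subseteq> ?l"
    proof
      fix al assume "al \<in> ?r"
      then have al: "\<And>i. i < L \<Longrightarrow> al i \<in> I i" "\<And>i. L \<le> i \<Longrightarrow> al i = 0" by auto
      have 1: "ga i \<le> al i \<and> al i \<le> Suc (ga i) \<and> be i \<le> al i" for i
        using al(1)[of i] al(2)[of i] part_zero[OF g, of i] part_zero[OF b, of i] unfolding I_def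
        by (cases "i < L"; cases "i = 0") auto
      have 2: "al (Suc i) \<le> be i" for i
        using al[of "Suc i"] unfolding I_def by (cases "Suc i < L") auto
      have "part L al" using 1 2 al(2) by (intro partI) (auto intro: le_trans)
      with 1 2 show "al \<in> ?l" unfolding vup_def hs_def by auto
    qed
  qed
  have B: "{\<delta> \<in> hs ga. be \<in> vup L \<delta>} = {\<delta>. (\<forall>i<L. \<delta> i \<in> J i) \<and> (\<forall>i\<ge>L. \<delta> i = 0)}" (is "?l = ?r")
  proof
    show "?l \<subseteq> ?r"
    proof
      fix \<delta> assume d: "\<delta> \<in> ?l"
      then have *: "\<And>i. \<delta> i \<le> ga i" "\<And>i. ga (Suc i) \<le> \<delta> i" "\<And>i. \<delta> i \<le> be i" "\<And>i. be i \<le> Suc (\<delta> i)"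
        unfolding vup_def hs_def by auto
      have "\<delta> i \<in> J i" for i using *[of i] unfolding J_def by auto
      with part_zero[OF hs_part[OF g, of \<delta>]] d show "\<delta> \<in> ?r" by blast
    qed
    show "?r \<subseteq> ?l"
    proof
      fix \<delta> assume "\<delta> \<in> ?r"
      then have de: "\<And>i. i < L \<Longrightarrow> \<delta> i \<in> J i" "\<And>i. L \<le> i \<Longrightarrow> \<delta> i = 0" by auto
      have "\<delta> i \<le> ga i \<and> ga (Suc i) \<le> \<delta> i \<and> \<delta> i \<le> be i \<and> be i \<le> Suc (\<delta> i)" for i
        using de[of i] part_zero[OF g, of i] part_zero[OF g, of "Suc i"] part_zero[OF b, of i]
        unfolding J_def by (cases "i < L") auto
      with b show "\<delta> \<in> ?l" unfolding vup_def hs_def by auto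
    qed
  qed
  have "(\<Prod>i<L. card (I i)) = 2 * (\<Prod>i<L. card (J i))"
  proof (cases "\<forall>i. ga (Suc i) \<le> be i \<and> be i \<le> Suc (ga i)")
    case True
    \<comment> \<open>\<open>h k\<close> carries a free choice from one row to the next: it is 2 at
      the top, where no row of \<open>be\<close> bounds \<open>al 0\<close> from above, and 1 at
      \<open>k = L\<close>, because \<open>be (L - 1) = 0\<close>.\<close>
    define h where "h k = (if k = 0 \<or> ga k < be (k - 1) then 2 else (1::nat))" for k
    have "(\<Prod>i<k. card (I i)) * h k = 2 * (\<Prod>i<k. card (J i))" for k
    proof (induction k)
      case (Suc k)
      have "card (I k) * h (Suc k) = h k * card (J k)"
      proof (cases k)
        case 0
        then show ?thesis using True[rule_format, of 0] part_Suc[OF g, of 0] unfolding I_def J_def h_def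
          by (cases "be 0 \<le> ga 0") auto
      next
        case (Suc k')
        then show ?thesis
          using True[rule_format, of k] True[rule_format, of k'] part_Suc[OF b, of k'] part_Suc[OF g, of k]
          unfolding I_def J_def h_def by (cases "be k \<le> ga k") auto
      qed
      with Suc show ?case by (simp add: mult_ac) (metis mult.assoc mult.commute)
    qed (simp add: h_def)
    from this[of L] show ?thesis using L b0 part_zero[OF g, of L] by (simp add: h_def)
  next
    case False
    \<comment> \<open>If \<open>be\<close> and \<open>ga\<close> are incompatible in some row, each
      of the two products contains an empty interval.\<close>
    then obtain i where i: "\<not> (ga (Suc i) \<le> be i \<and> be i \<le> Suc (ga i))" by blast
    have iL: "i < L"
    proof (rule ccontr)
      assume "\<not> ?thesis"
      then have "be i = 0" "ga (Suc i) = 0" using part_zero[OF b] part_zero[OF g] by auto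
      with i show False by simp
    qed
    have "card (J i) = 0" using i unfolding J_def by auto
    then have J0: "(\<Prod>i<L. card (J i)) = 0" using iL by auto
    have "\<exists>k<L. card (I k) = 0"
    proof (cases "be i \<le> Suc (ga i)")
      case True
      then have "ga (Suc i) > be i" using i by simp
      then have "Suc i < L" "card (I (Suc i)) = 0"
        using part_zero[OF g, of "Suc i"] by (force, simp add: I_def)
      then show ?thesis by blast
    next
      case False
      then have "card (I i) = 0" unfolding I_def by auto
      with iL show ?thesis by blast
    qed
    then have "(\<Prod>i<L. card (I i)) = 0" by auto
    with J0 show ?thesis by (simp only: mult_0_right)
  qed
  then show ?thesis unfolding A B card_bounded_functions .
qed

lemma sum_card_swap:
  assumes "finite A" and "finite Q" and "\<And>a. a \<in> A \<Longrightarrow> R a \<subseteq> Q"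
  shows "(\<Sum>a\<in>A. \<Sum>b\<in>R a. f b) = (\<Sum>b\<in>Q. card {a \<in> A. b \<in> R a} * (f b :: nat))"
proof -
  have "(\<Sum>a\<in>A. \<Sum>b\<in>R a. f b) = (\<Sum>a\<in>A. \<Sum>b\<in>Q. if b \<in> R a then f b else 0)"
    using assms by (intro sum.cong refl sum.mono_neutral_cong_left) auto
  also have "\<dots> = (\<Sum>b\<in>Q. \<Sum>a\<in>A. if b \<in> R a then f b else 0)" by (rule sum.swap)
  also have "\<dots> = (\<Sum>b\<in>Q. card {a \<in> A. b \<in> R a} * f b)"
    using assms(1) by (intro sum.cong refl) (simp add: sum.If_cases Int_def)
  finally show ?thesis .
qed

text \<open>The dual Pieri rule with all variables equal to 1: multiplying a Schur function in
  \<open>m\<close> variables by the sum of all elementary symmetric polynomials multiplies its value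
  by \<open>2 ^ m\<close>. Each step removes the horizontal strip of greatest entries and exchanges
  it with the vertical strip by \<open>local_rule\<close>, which contributes one factor 2. The bound
  \<open>Suc m \<le> L\<close> leaves a row to spare, so that shapes \<open>be\<close> violating the
  hypothesis of \<open>local_rule\<close> have no tableaux.\<close>

lemma sum_ssyt_vup:
  "Suc m \<le> L \<Longrightarrow> part L ga \<Longrightarrow> (\<Sum>al\<in>vup L ga. card (ssyt al m)) = 2 ^ m * card (ssyt ga m)"
proof (induction m arbitrary: ga)
  case 0
  have f: "finite (vup L ga)"
  proof (rule finite_subset[OF _ finite_part_bounded[of L "Suc (ga 0)"]], safe)
    fix al i assume "al \<in> vup L ga"
    then have "al i \<le> al 0" "al 0 \<le> Suc (ga 0)" using part_mono[of L al 0 i] unfolding vup_def by auto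
    then show "al i \<le> Suc (ga 0)" by simp
  qed (simp add: vup_def)
  have "(\<lambda>_. 0) \<in> vup L ga \<longleftrightarrow> ga = (\<lambda>_. 0)" unfolding vup_def part_def antimono_def by auto
  then show ?case using f by (simp add: card_ssyt_0)
next
  case (Suc m)
  let ?Q = "{be. part L be \<and> (\<forall>i. be i \<le> Suc (ga 0))}"
  have Q: "finite ?Q" by (rule finite_part_bounded)
  have vQ: "vup L \<delta> \<subseteq> ?Q" if "\<delta> 0 \<le> ga 0" for \<delta>
  proof safe
    fix al i assume "al \<in> vup L \<delta>"
    then have "al i \<le> al 0" "al 0 \<le> Suc (\<delta> 0)" using part_mono[of L al 0 i] unfolding vup_def by auto
    then show "al i \<le> Suc (ga 0)" using that by simp
  qed (simp add: vup_def)
  have hQ: "hs al \<subseteq> ?Q" if "al \<in> ?Q" for al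
    using hs_part[of L al] that unfolding hs_def by (auto intro: le_trans)
  have "(\<Sum>al\<in>vup L ga. card (ssyt al (Suc m))) = (\<Sum>al\<in>vup L ga. \<Sum>be\<in>hs al. card (ssyt be m))"
    by (intro sum.cong refl card_ssyt_Suc[of L]) (simp add: vup_def)
  also have "\<dots> = (\<Sum>be\<in>?Q. card {al \<in> vup L ga. be \<in> hs al} * card (ssyt be m))"
    using vQ[of ga] hQ by (intro sum_card_swap Q finite_subset[OF vQ Q]) auto
  also have "\<dots> = (\<Sum>be\<in>?Q. 2 * (card {\<delta> \<in> hs ga. be \<in> vup L \<delta>} * card (ssyt be m)))"
  proof (intro sum.cong refl)
    fix be assume b: "be \<in> ?Q"
    show "card {al \<in> vup L ga. be \<in> hs al} * card (ssyt be m) = 2 * (card {\<delta> \<in> hs ga. be \<in> vup L \<delta>} * card (ssyt be m))"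
    proof (cases "be (L - 1) = 0")
      case True
      then show ?thesis using local_rule[OF Suc.prems(2), of be] b Suc.prems(1) by simp
    next
      case False
      then have "be m \<noteq> 0" using part_mono[of L be m "L - 1"] b Suc.prems(1) by force
      then have "ssyt be m = {}" using ssyt_empty_if_long[of L be m] b by blast
      then show ?thesis by simp
    qed
  qed
  also have "\<dots> = 2 * (\<Sum>\<delta>\<in>hs ga. \<Sum>be\<in>vup L \<delta>. card (ssyt be m))"
    using finite_hs[OF Suc.prems(2)] Q vQ
    by (subst sum_card_swap[where Q = ?Q]) (auto simp: sum_distrib_left hs_def)
  also have "\<dots> = 2 * (\<Sum>\<delta>\<in>hs ga. 2 ^ m * card (ssyt \<delta> m))"
    using Suc hs_part[OF Suc.prems(2)] by simp
  also have "\<dots> = 2 ^ Suc m * card (ssyt ga (Suc m))"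
    unfolding card_ssyt_Suc[OF Suc.prems(2)] by (simp add: sum_distrib_left mult.assoc)
  finally show ?case .
qed

lemma less_conjp_iff:
  assumes "part L al"
  shows "i < conjp al j \<longleftrightarrow> j < al i"
proof -
  have sub: "{i. j < al i} \<subseteq> {..<L}" using part_zero[OF assms] by (metis lessThan_iff mem_Collect_eq not_le not_less_zero subsetI)
  then have fin: "finite {i. j < al i}" by (rule finite_subset) simp
  show ?thesis
  proof
    assume "j < al i"
    then have "{..i} \<subseteq> {i. j < al i}" using part_mono[OF assms] by (auto intro: less_le_trans)
    then have "card {..i} \<le> conjp al j" unfolding conjp_def by (rule card_mono[OF fin])
    then show "i < conjp al j" by simp
  next
    assume "i < conjp al j"
    show "j < al i"
    proof (rule ccontr)
      assume n: "\<not> j < al i"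
      have "{i. j < al i} \<subseteq> {..<i}"
      proof
        fix k assume "k \<in> {i. j < al i}"
        then have "al i < al k" using n by simp
        then show "k \<in> {..<i}" using part_mono[OF assms, of i k] by (cases "i \<le> k") auto
      qed
      then have "conjp al j \<le> card {..<i}" unfolding conjp_def by (intro card_mono) auto
      with \<open>i < conjp al j\<close> show False by simp
    qed
  qed
qed

lemma conjp_part:
  assumes "part L al" and "\<And>i. al i \<le> R"
  shows "part R (conjp al)"
proof (rule partI)
  show "conjp al (Suc i) \<le> conjp al i" for i
    using less_conjp_iff[OF assms(1), of "conjp al i"] by (metis Suc_lessD not_le less_irrefl)
  show "conjp al i = 0" if "R \<le> i" for i
    using less_conjp_iff[OF assms(1), of 0 i] assms(2)[of 0] that by (metis gr0I leD le_trans)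
qed

lemma nat_eq_iff_less: "(\<And>k. k < a \<longleftrightarrow> k < b) \<Longrightarrow> a = (b::nat)"
  by (metis less_irrefl linorder_neqE_nat)

lemma conjp_conjp:
  assumes "part L al"
  shows "conjp (conjp al) = al"
proof (intro ext nat_eq_iff_less)
  have "part (al 0) (conjp al)" using assms part_mono[OF assms, of 0] by (intro conjp_part) auto
  then show "k < conjp (conjp al) i \<longleftrightarrow> k < al i" for i k
    using less_conjp_iff assms by blast
qed

lemma hs_conjp_iff:
  assumes a: "part L al" and g: "part L ga"
  shows "conjp ga \<in> hs (conjp al) \<longleftrightarrow> al \<in> vup L ga"
proof
  assume h: "conjp ga \<in> hs (conjp al)"
  have 1: "ga i \<le> al i" for i
  proof (rule ccontr)
    assume "\<not> ?thesis"
    then have "i < conjp ga (al i)" using less_conjp_iff[OF g] by simp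
    also have "\<dots> \<le> conjp al (al i)" using h unfolding hs_def by blast
    finally show False using less_conjp_iff[OF a] by simp
  qed
  have 2: "al i \<le> Suc (ga i)" for i
  proof (rule ccontr)
    assume "\<not> ?thesis"
    then have "i < conjp al (Suc (ga i))" using less_conjp_iff[OF a] by simp
    also have "\<dots> \<le> conjp ga (ga i)" using h unfolding hs_def by blast
    finally show False using less_conjp_iff[OF g] by simp
  qed
  from 1 2 a show "al \<in> vup L ga" unfolding vup_def by blast
next
  assume v: "al \<in> vup L ga"
  then have v': "ga i \<le> al i" "al i \<le> Suc (ga i)" for i unfolding vup_def by auto
  have "conjp ga j \<le> conjp al j" for j
    using less_conjp_iff[OF g, of "conjp al j" j] less_conjp_iff[OF a, of "conjp al j" j] v'(1)[of "conjp al j"]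
    by (meson less_irrefl less_le_trans not_le)
  moreover have "conjp al (Suc j) \<le> conjp ga j" for j
    using less_conjp_iff[OF g, of "conjp ga j" j] less_conjp_iff[OF a, of "conjp ga j" "Suc j"] v'(2)[of "conjp ga j"]
    by (metis Suc_less_eq less_irrefl less_le_trans not_le)
  ultimately show "conjp ga \<in> hs (conjp al)" unfolding hs_def by blast
qed

text \<open>Conjugation exchanges horizontal and vertical strips, so the strip removed from
  \<open>conjp al\<close> becomes a vertical strip of \<open>al\<close>.\<close>

lemma card_ssyt_conjp_Suc:
  assumes a: "part L al"
  shows "card (ssyt (conjp al) (Suc r)) = (\<Sum>ga\<in>{ga. part L ga \<and> al \<in> vup L ga}. card (ssyt (conjp ga) r))"
proof -
  let ?R = "al 0"
  have le: "al i \<le> ?R" for i using part_mono[OF a, of 0] by simp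
  have ca: "part ?R (conjp al)" using le by (intro conjp_part[OF a]) auto
  have "card (ssyt (conjp al) (Suc r)) = (\<Sum>be\<in>hs (conjp al). card (ssyt be r))"
    by (rule card_ssyt_Suc[OF ca])
  also have "\<dots> = (\<Sum>ga\<in>{ga. part L ga \<and> al \<in> vup L ga}. card (ssyt (conjp ga) r))"
  proof (rule sum.reindex_bij_witness[of _ conjp conjp])
    fix ga assume g: "ga \<in> {ga. part L ga \<and> al \<in> vup L ga}"
    then show "conjp (conjp ga) = ga" using conjp_conjp by blast
    show "conjp ga \<in> hs (conjp al)" using g hs_conjp_iff[OF a] by blast
  next
    fix be assume b: "be \<in> hs (conjp al)"
    then have be: "part ?R be" using hs_part[OF ca] by blast
    show cc: "conjp (conjp be) = be" using conjp_conjp[OF be] .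
    have "be i \<le> L" for i
    proof -
      have "\<not> L < conjp al i" using less_conjp_iff[OF a, of L i] part_zero[OF a, of L] by simp
      then show ?thesis using b unfolding hs_def by (metis (mono_tags, lifting) mem_Collect_eq not_le le_trans)
    qed
    then have "part L (conjp be)" by (intro conjp_part[OF be])
    then show "conjp be \<in> {ga. part L ga \<and> al \<in> vup L ga}"
      using hs_conjp_iff[OF a, of "conjp be"] b cc by simp
    show "card (ssyt (conjp (conjp be)) r) = card (ssyt be r)" using cc by simp
  qed
  finally show ?thesis .
qed

text \<open>The dual Cauchy identity with all variables equal to 1, by induction on the second
  alphabet: each new letter splits off a vertical strip, and summing over it gives a factor
  \<open>2 ^ m\<close>.\<close>

theorem card_ssyt_pairs:
  "(\<Sum>al\<in>{al. in_box m r al}. card (ssyt al m) * card (ssyt (conjp al) r)) = 2 ^ (m * r)"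
proof -
  \<comment> \<open>One row more than tableaux with entries below \<open>m\<close> can have, as
    \<open>sum_ssyt_vup\<close> demands.\<close>
  define L where "L = Suc m"
  define Q where "Q = {al. part L al \<and> (\<forall>i. al i \<le> r)}"
  have Q: "finite Q" unfolding Q_def by (rule finite_part_bounded)
  have "k \<le> r \<Longrightarrow> (\<Sum>al\<in>Q. card (ssyt al m) * card (ssyt (conjp al) k)) = 2 ^ (m * k)" for k
  proof (induction k)
    case 0
    have "conjp (\<lambda>_. 0) = (\<lambda>_. 0)" by (simp add: conjp_def fun_eq_iff)
    then have "conjp al = (\<lambda>_. 0) \<longleftrightarrow> al = (\<lambda>_. 0)" if "part L al" for al
      using conjp_conjp[OF that] by metis
    then have "(\<Sum>al\<in>Q. card (ssyt al m) * card (ssyt (conjp al) 0))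
        = (\<Sum>al\<in>Q. if al = (\<lambda>_. 0) then card (ssyt al m) else 0)"
      by (intro sum.cong refl) (auto simp: card_ssyt_0 Q_def)
    also have "\<dots> = 1" using Q by (simp add: Q_def part_def antimono_def card_ssyt_zero_shape)
    finally show ?case by simp
  next
    case (Suc k)
    have "(\<Sum>al\<in>Q. card (ssyt al m) * card (ssyt (conjp al) (Suc k)))
        = (\<Sum>al\<in>Q. \<Sum>ga\<in>Q. if al \<in> vup L ga then card (ssyt al m) * card (ssyt (conjp ga) k) else 0)"
    proof (intro sum.cong refl)
      fix al assume al: "al \<in> Q"
      have "{ga. part L ga \<and> al \<in> vup L ga} = {ga \<in> Q. al \<in> vup L ga}"
        using al unfolding Q_def vup_def by (auto intro: le_trans)
      then show "card (ssyt al m) * card (ssyt (conjp al) (Suc k))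
          = (\<Sum>ga\<in>Q. if al \<in> vup L ga then card (ssyt al m) * card (ssyt (conjp ga) k) else 0)"
        using al Q card_ssyt_conjp_Suc[of L al k] unfolding Q_def
        by (simp add: sum.inter_filter[symmetric] sum_distrib_left)
    qed
    also have "\<dots> = (\<Sum>ga\<in>Q. \<Sum>al\<in>Q. if al \<in> vup L ga then card (ssyt al m) * card (ssyt (conjp ga) k) else 0)"
      by (rule sum.swap)
    also have "\<dots> = (\<Sum>ga\<in>Q. 2 ^ m * (card (ssyt ga m) * card (ssyt (conjp ga) k)))"
    proof (intro sum.cong refl)
      fix ga assume g: "ga \<in> Q"
      show "(\<Sum>al\<in>Q. if al \<in> vup L ga then card (ssyt al m) * card (ssyt (conjp ga) k) else 0)
          = 2 ^ m * (card (ssyt ga m) * card (ssyt (conjp ga) k))"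
      proof (cases "card (ssyt (conjp ga) k) = 0")
        case True
        then show ?thesis by (simp cong: if_cong)
      next
        case False
        have gp: "part L ga" using g unfolding Q_def by blast
        have "part (ga 0) (conjp ga)" using gp part_mono[OF gp, of 0] by (intro conjp_part) auto
        \<comment> \<open>A tableau on \<open>conjp ga\<close> with entries below \<open>k\<close>
          forces \<open>ga 0 \<le> k\<close>, so adding a vertical strip does not leave the bound
          \<open>r\<close>.\<close>
        then have "conjp ga k = 0" using False ssyt_empty_if_long by fastforce
        then have "ga 0 \<le> k" using less_conjp_iff[OF gp, of 0 k] by simp
        then have "vup L ga \<subseteq> Q"
        proof (intro subsetI)
          fix al assume al: "al \<in> vup L ga"
          then have "al i \<le> al 0" "al 0 \<le> Suc (ga 0)" for i using part_mono[of L al 0 i] unfolding vup_def by auto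
          then have "al i \<le> r" for i using \<open>ga 0 \<le> k\<close> Suc.prems by (meson Suc_le_mono le_trans)
          with al show "al \<in> Q" unfolding Q_def vup_def by blast
        qed
        then have "{al \<in> Q. al \<in> vup L ga} = vup L ga" by blast
        then have "(\<Sum>al\<in>Q. if al \<in> vup L ga then card (ssyt al m) * card (ssyt (conjp ga) k) else 0)
            = (\<Sum>al\<in>vup L ga. card (ssyt al m)) * card (ssyt (conjp ga) k)"
          using Q by (simp add: sum.inter_filter[symmetric] sum_distrib_right)
        then show ?thesis using sum_ssyt_vup[of m L ga] gp by (simp add: L_def)
      qed
    qed
    also have "\<dots> = 2 ^ (m * Suc k)" using Suc by (simp add: sum_distrib_left[symmetric] power_add)
    finally show ?case .
  qed
  from this[of r] have "(\<Sum>al\<in>Q. card (ssyt al m) * card (ssyt (conjp al) r)) = 2 ^ (m * r)" by simp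
  moreover have "(\<Sum>al\<in>{al. in_box m r al}. card (ssyt al m) * card (ssyt (conjp al) r))
      = (\<Sum>al\<in>Q. card (ssyt al m) * card (ssyt (conjp al) r))"
  proof (rule sum.mono_neutral_left[OF Q])
    show "{al. in_box m r al} \<subseteq> Q" unfolding in_box_def Q_def part_def L_def by auto
    show "\<forall>al\<in>Q - {al. in_box m r al}. card (ssyt al m) * card (ssyt (conjp al) r) = 0"
    proof
      fix al assume al: "al \<in> Q - {al. in_box m r al}"
      then have p: "part L al" and "\<not> (\<forall>i\<ge>m. al i = 0)" unfolding Q_def in_box_def part_def by auto
      then have "al m \<noteq> 0" using part_mono[OF p, of m] by force
      then show "card (ssyt al m) * card (ssyt (conjp al) r) = 0" using ssyt_empty_if_long[OF p] by simp
    qed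
  qed
  ultimately show ?thesis by simp
qed

lemma finite_in_box: "finite {al. in_box m r al}"
  by (rule finite_subset[OF _ finite_part_bounded[of m r]]) (auto simp: in_box_def part_def)

section \<open>The Weyl module inside a tensor power\<close>

section \<open>Tensor powers\<close>

text \<open>A function on the fillings \<open>u : C \<rightarrow> {..<N}\<close> is a tensor with one factor for each element of \<open>C\<close>.\<close>

lift_definition dloc :: "nat \<Rightarrow> 'c \<Rightarrow> (nat \<Rightarrow> nat \<Rightarrow> complex) \<Rightarrow> ('c \<Rightarrow> nat, complex) lop" is
  "\<lambda>N c Y x u. if u c < N then \<Sum>b<N. Y (u c) b * x (u(c := b)) else 0"
  by (auto simp: fun_eq_iff sum.distrib sum_distrib_left algebra_simps)

lemma ap_dloc: "ap (dloc N c Y) x u = (if u c < N then \<Sum>b<N. Y (u c) b * x (u(c := b)) else 0)"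
  by transfer simp

definition mm :: "nat \<Rightarrow> (nat \<Rightarrow> nat \<Rightarrow> complex) \<Rightarrow> (nat \<Rightarrow> nat \<Rightarrow> complex) \<Rightarrow> nat \<Rightarrow> nat \<Rightarrow> complex" where
  "mm N Y Z = (\<lambda>a b. \<Sum>k<N. Y a k * Z k b)"

text \<open>The action of the Lie algebra on the tensor power by the Leibniz rule.\<close>

definition DD :: "nat \<Rightarrow> 'c set \<Rightarrow> (nat \<Rightarrow> nat \<Rightarrow> complex) \<Rightarrow> ('c \<Rightarrow> nat, complex) lop" where
  "DD N C Y = (\<Sum>c\<in>C. dloc N c Y)"

definition un :: "nat \<Rightarrow> nat \<Rightarrow> nat \<Rightarrow> nat \<Rightarrow> complex" where
  "un a b = (\<lambda>k l. if k = a \<and> l = b then 1 else 0)"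

abbreviation fillings :: "nat \<Rightarrow> 'c set \<Rightarrow> ('c \<Rightarrow> nat) set" where
  "fillings N C \<equiv> C \<rightarrow>\<^sub>E {..<N}"

lemma dloc_mult: "dloc N c Y * dloc N c Z = dloc N c (mm N Y Z)"
proof (rule lop_eqI)
  fix x :: "('a \<Rightarrow> nat) \<Rightarrow> complex" and u
  have "(\<Sum>b<N. Y (u c) b * (\<Sum>b'<N. Z b b' * x (u(c := b')))) = (\<Sum>b'<N. mm N Y Z (u c) b' * x (u(c := b')))"
    unfolding mm_def by (simp add: sum_distrib_left sum_distrib_right mult.assoc) (rule sum.swap)
  then show "ap (dloc N c Y * dloc N c Z) x u = ap (dloc N c (mm N Y Z)) x u"
    by (simp add: ap_dloc)
qed

lemma dloc_commute:
  assumes "c \<noteq> c'"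
  shows "dloc N c Y * dloc N c' Z = dloc N c' Z * dloc N c Y"
proof (rule lop_eqI)
  fix x :: "('a \<Rightarrow> nat) \<Rightarrow> complex" and u
  have "(\<Sum>b<N. Y (u c) b * (\<Sum>b'<N. Z (u c') b' * x (u(c := b, c' := b'))))
      = (\<Sum>b'<N. Z (u c') b' * (\<Sum>b<N. Y (u c) b * x (u(c' := b', c := b))))"
    using assms by (simp add: sum_distrib_left fun_upd_twist mult.left_commute) (rule sum.swap)
  then show "ap (dloc N c Y * dloc N c' Z) x u = ap (dloc N c' Z * dloc N c Y) x u"
    using assms by (simp add: ap_dloc)
qed

lemma dloc_add: "dloc N c (\<lambda>a b. Y a b + Z a b) = dloc N c Y + dloc N c Z"
  and dloc_diff: "dloc N c (\<lambda>a b. Y a b - Z a b) = dloc N c Y - dloc N c Z"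
  and dloc_scale: "dloc N c (\<lambda>a b. k * Y a b) = sc k * dloc N c Y"
  by (rule lop_eqI, simp add: ap_dloc sum.distrib sum_subtractf sum_distrib_left algebra_simps)+

lemma dloc_cong: "(\<And>a b. a < N \<Longrightarrow> b < N \<Longrightarrow> Y a b = Z a b) \<Longrightarrow> dloc N c Y = dloc N c Z"
  by (rule lop_eqI) (simp add: ap_dloc)

lemma DD_cong: "(\<And>a b. a < N \<Longrightarrow> b < N \<Longrightarrow> Y a b = Z a b) \<Longrightarrow> DD N C Y = DD N C Z"
  unfolding DD_def by (intro sum.cong refl dloc_cong)

lemma DD_add: "DD N C (\<lambda>a b. Y a b + Z a b) = DD N C Y + DD N C Z"
  and DD_diff: "DD N C (\<lambda>a b. Y a b - Z a b) = DD N C Y - DD N C Z"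
  and DD_scale: "DD N C (\<lambda>a b. k * Y a b) = sc k * DD N C Y"
  unfolding DD_def by (simp_all add: dloc_add dloc_diff dloc_scale sum.distrib sum_subtractf sum_distrib_left)

lemma DD_zero: "DD N C (\<lambda>a b. 0) = 0"
  using DD_scale[of N C 0 "\<lambda>a b. 0"] by (simp add: dg_zero)

lemma DD_sum: "finite I \<Longrightarrow> DD N C (\<lambda>a b. \<Sum>i\<in>I. k i * Y i a b) = (\<Sum>i\<in>I. sc (k i) * DD N C (Y i))"
  by (induction I rule: finite_induct) (simp_all add: DD_add DD_scale DD_zero)

lemma DD_commutator: "DD N C Y * DD N C Z - DD N C Z * DD N C Y = DD N C (\<lambda>a b. mm N Y Z a b - mm N Z Y a b)"
proof (cases "finite C")
  case True
  have "DD N C Y * DD N C Z - DD N C Z * DD N C Y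
      = (\<Sum>c\<in>C. \<Sum>c'\<in>C. dloc N c Y * dloc N c' Z) - (\<Sum>c\<in>C. \<Sum>c'\<in>C. dloc N c' Z * dloc N c Y)"
    unfolding DD_def by (simp add: sum_product) (subst sum.swap, rule refl)
  also have "\<dots> = (\<Sum>c\<in>C. \<Sum>c'\<in>C. dloc N c Y * dloc N c' Z - dloc N c' Z * dloc N c Y)"
    by (simp add: sum_subtractf)
  also have "\<dots> = (\<Sum>c\<in>C. \<Sum>c'\<in>C. if c' = c then dloc N c (\<lambda>a b. mm N Y Z a b - mm N Z Y a b) else 0)"
    by (intro sum.cong refl) (auto simp: dloc_mult dloc_diff dloc_commute)
  also have "\<dots> = DD N C (\<lambda>a b. mm N Y Z a b - mm N Z Y a b)"
    unfolding DD_def using True by simp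
  finally show ?thesis .
qed (simp add: DD_def)

lemma mm_un: "b < N \<Longrightarrow> mm N (un a b) (un c d) = (if b = c then un a d else (\<lambda>_ _. 0))"
  unfolding mm_def un_def by (auto simp: fun_eq_iff if_one_mult)

lemma finite_fillings: "finite C \<Longrightarrow> finite (fillings N C)"
  by (rule finite_PiE) auto

lemma filling_upd: "c \<in> C \<Longrightarrow> b < N \<Longrightarrow> u c < N \<Longrightarrow> u(c := b) \<in> fillings N C \<longleftrightarrow> u \<in> fillings N C"
  by (auto simp: PiE_iff extensional_def)

lemma supp_dloc:
  assumes "c \<in> C" and "supp_in (fillings N C) x"
  shows "supp_in (fillings N C) (ap (dloc N c Y) x)"
  unfolding supp_in_def
proof (intro allI impI)
  fix u assume u: "u \<notin> fillings N C"
  show "ap (dloc N c Y) x u = 0"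
  proof (cases "u c < N")
    case True
    have "u(c := b) \<notin> fillings N C" if "b < N" for b
      using filling_upd[of c C b N u] assms(1) that True u by blast
    then show ?thesis using assms(2) by (simp add: ap_dloc supp_in_def)
  qed (simp add: ap_dloc)
qed

lemma supp_sum_op: "(\<And>i. i \<in> I \<Longrightarrow> supp_in X (ap (A i) x)) \<Longrightarrow> supp_in X (ap (\<Sum>i\<in>I. A i) x)"
  unfolding supp_in_def ap_sum_op by simp

lemma supp_DD: "supp_in (fillings N C) x \<Longrightarrow> supp_in (fillings N C) (ap (DD N C Y) x)"
  unfolding DD_def by (intro supp_sum_op supp_dloc)

lemma form_dloc:
  assumes C: "finite C" "c \<in> C"
  shows "form cnj (fillings N C) (ap (dloc N c Y) x) y
    = form cnj (fillings N C) x (ap (dloc N c (\<lambda>a b. cnj (Y b a))) y)"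
proof -
  define X where "X = fillings N C"
  have uc: "u c < N" if "u \<in> X" for u using that C(2) by (auto simp: PiE_iff X_def)
  have up: "u(c := b) \<in> X" if "u \<in> X" "b < N" for u b
    using filling_upd[of c C b N u] C(2) that uc[OF that(1)] unfolding X_def by blast
  have "form cnj X (ap (dloc N c Y) x) y = (\<Sum>(u, b)\<in>X \<times> {..<N}. cnj (Y (u c) b) * cnj (x (u(c := b))) * y u)"
    unfolding form_def sum.cartesian_product[symmetric]
    by (intro sum.cong refl) (simp add: ap_dloc uc sum_distrib_right)
  also have "\<dots> = (\<Sum>(u, b)\<in>X \<times> {..<N}. cnj (Y b (u c)) * cnj (x u) * y (u(c := b)))"
    by (rule sum.reindex_bij_witness[of _ "\<lambda>(u, b). (u(c := b), u c)" "\<lambda>(u, b). (u(c := b), u c)"])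
       (use uc up in \<open>auto simp: fun_upd_idem\<close>)
  also have "\<dots> = form cnj X x (ap (dloc N c (\<lambda>a b. cnj (Y b a))) y)"
    unfolding form_def sum.cartesian_product[symmetric]
    by (intro sum.cong refl) (simp add: ap_dloc uc sum_distrib_left mult_ac)
  finally show ?thesis unfolding X_def .
qed

lemma form_DD:
  assumes C: "finite C"
  shows "form cnj (fillings N C) (ap (DD N C Y) x) y
    = form cnj (fillings N C) x (ap (DD N C (\<lambda>a b. cnj (Y b a))) y)"
proof -
  have "form cnj (fillings N C) (ap (DD N C Y) x) y
      = (\<Sum>c\<in>C. form cnj (fillings N C) (ap (dloc N c Y) x) y)"
    using form_sum_left[where X = "fillings N C" and I = C and c = "\<lambda>_. 1" and y = "\<lambda>c. ap (dloc N c Y) x" and z = y] by (simp add: DD_def ap_sum_op)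
  also have "\<dots> = (\<Sum>c\<in>C. 1 * form cnj (fillings N C) x (ap (dloc N c (\<lambda>a b. cnj (Y b a))) y))"
    using form_dloc[OF C] by simp
  also have "\<dots> = form cnj (fillings N C) x (ap (DD N C (\<lambda>a b. cnj (Y b a))) y)"
    unfolding form_sum[symmetric] DD_def ap_sum_op by simp
  finally show ?thesis .
qed

text \<open>A bijection \<open>{..<N} \<rightarrow> {..<M} \<times> {..<M'}\<close> makes the matrices of size \<open>M\<close> act on the first factor
  of \<open>\<complex>\<^sup>N = \<complex>\<^sup>M \<otimes> \<complex>\<^sup>M\<^sup>'\<close>.\<close>

definition lft :: "(nat \<Rightarrow> nat) \<Rightarrow> (nat \<Rightarrow> nat) \<Rightarrow> (nat \<Rightarrow> nat \<Rightarrow> complex) \<Rightarrow> nat \<Rightarrow> nat \<Rightarrow> complex" where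
  "lft \<rho> \<rho>' Y = (\<lambda>k l. if \<rho>' k = \<rho>' l then Y (\<rho> k) (\<rho> l) else 0)"

definition wtl :: "nat \<Rightarrow> 'c set \<Rightarrow> (nat \<Rightarrow> nat) \<Rightarrow> ('c \<Rightarrow> nat) \<Rightarrow> nat \<Rightarrow> int" where
  "wtl N C \<rho> u a = (\<Sum>c\<in>C. of_bool (u c < N \<and> \<rho> (u c) = a))"

locale factor =
  fixes N M M' :: nat and \<rho> \<rho>' :: "nat \<Rightarrow> nat"
  assumes bij: "bij_betw (\<lambda>k. (\<rho> k, \<rho>' k)) {..<N} ({..<M} \<times> {..<M'})"
begin

lemma rho_less: "k < N \<Longrightarrow> \<rho> k < M" and rho'_less: "k < N \<Longrightarrow> \<rho>' k < M'"
  using bij_betwE[OF bij] by auto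

lemma rho_eq: "k < N \<Longrightarrow> l < N \<Longrightarrow> \<rho> k = \<rho> l \<Longrightarrow> \<rho>' k = \<rho>' l \<Longrightarrow> k = l"
  using bij unfolding bij_betw_def inj_on_def by auto

lemma sum_factor: "(\<Sum>k<N. g (\<rho> k) (\<rho>' k)) = (\<Sum>i<M. \<Sum>j<M'. g i j :: complex)"
  using sum.reindex_bij_betw[OF bij, of "\<lambda>(i, j). g i j"] by (simp add: sum.cartesian_product)

lemma mm_lft:
  assumes "a < N"
  shows "mm N (lft \<rho> \<rho>' Y) (lft \<rho> \<rho>' Z) a b = lft \<rho> \<rho>' (mm M Y Z) a b"
proof -
  have "mm N (lft \<rho> \<rho>' Y) (lft \<rho> \<rho>' Z) a b
      = (\<Sum>k<N. if \<rho>' k = \<rho>' a \<and> \<rho>' k = \<rho>' b then Y (\<rho> a) (\<rho> k) * Z (\<rho> k) (\<rho> b) else 0)"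
    unfolding mm_def lft_def by (intro sum.cong refl) auto
  also have "\<dots> = (\<Sum>i<M. \<Sum>j<M'. if j = \<rho>' a then (if \<rho>' a = \<rho>' b then Y (\<rho> a) i * Z i (\<rho> b) else 0) else 0)"
    by (subst sum_factor) (intro sum.cong refl, auto)
  also have "\<dots> = lft \<rho> \<rho>' (mm M Y Z) a b"
    using rho'_less[OF assms] by (simp add: lft_def mm_def)
  finally show ?thesis .
qed

lemma mm_lft_lft':
  assumes "a < N" and "b < N"
  shows "mm N (lft \<rho> \<rho>' Y) (lft \<rho>' \<rho> Z) a b = Y (\<rho> a) (\<rho> b) * Z (\<rho>' a) (\<rho>' b)"
    and "mm N (lft \<rho>' \<rho> Z) (lft \<rho> \<rho>' Y) a b = Y (\<rho> a) (\<rho> b) * Z (\<rho>' a) (\<rho>' b)"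
proof -
  have "mm N (lft \<rho> \<rho>' Y) (lft \<rho>' \<rho> Z) a b
      = (\<Sum>k<N. if \<rho> k = \<rho> b \<and> \<rho>' k = \<rho>' a then Y (\<rho> a) (\<rho> k) * Z (\<rho>' k) (\<rho>' b) else 0)"
    unfolding mm_def lft_def by (intro sum.cong refl) auto
  also have "\<dots> = (\<Sum>i<M. if i = \<rho> b then (\<Sum>j<M'. if j = \<rho>' a then Y (\<rho> a) i * Z j (\<rho>' b) else 0) else 0)"
    by (subst sum_factor) (intro sum.cong refl, auto)
  finally show "mm N (lft \<rho> \<rho>' Y) (lft \<rho>' \<rho> Z) a b = Y (\<rho> a) (\<rho> b) * Z (\<rho>' a) (\<rho>' b)"
    using rho_less[OF assms(2)] rho'_less[OF assms(1)] by simp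
  have "mm N (lft \<rho>' \<rho> Z) (lft \<rho> \<rho>' Y) a b
      = (\<Sum>k<N. if \<rho> k = \<rho> a \<and> \<rho>' k = \<rho>' b then Y (\<rho> k) (\<rho> b) * Z (\<rho>' a) (\<rho>' k) else 0)"
    unfolding mm_def lft_def by (intro sum.cong refl) auto
  also have "\<dots> = (\<Sum>i<M. if i = \<rho> a then (\<Sum>j<M'. if j = \<rho>' b then Y i (\<rho> b) * Z (\<rho>' a) j else 0) else 0)"
    by (subst sum_factor) (intro sum.cong refl, auto)
  finally show "mm N (lft \<rho>' \<rho> Z) (lft \<rho> \<rho>' Y) a b = Y (\<rho> a) (\<rho> b) * Z (\<rho>' a) (\<rho>' b)"
    using rho_less[OF assms(1)] rho'_less[OF assms(2)] by simp
qed

definition le :: "'c set \<Rightarrow> nat \<Rightarrow> ('c \<Rightarrow> nat, complex) lop" where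
  "le C i = DD N C (lft \<rho> \<rho>' (un i (Suc i)))"

definition lf :: "'c set \<Rightarrow> nat \<Rightarrow> ('c \<Rightarrow> nat, complex) lop" where
  "lf C i = DD N C (lft \<rho> \<rho>' (un (Suc i) i))"

lemma DD_lft_commutator:
  "DD N C (lft \<rho> \<rho>' Y) * DD N C (lft \<rho> \<rho>' Z) - DD N C (lft \<rho> \<rho>' Z) * DD N C (lft \<rho> \<rho>' Y)
    = DD N C (lft \<rho> \<rho>' (\<lambda>a b. mm M Y Z a b - mm M Z Y a b))"
  unfolding DD_commutator by (rule DD_cong) (auto simp: mm_lft, simp add: lft_def)

lemma DD_lft_lft'_commute:
  "DD N C (lft \<rho> \<rho>' Y) * DD N C (lft \<rho>' \<rho> Z) = DD N C (lft \<rho>' \<rho> Z) * DD N C (lft \<rho> \<rho>' Y)"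
proof -
  have "DD N C (lft \<rho> \<rho>' Y) * DD N C (lft \<rho>' \<rho> Z) - DD N C (lft \<rho>' \<rho> Z) * DD N C (lft \<rho> \<rho>' Y)
      = DD N C (\<lambda>a b. 0)"
    unfolding DD_commutator by (rule DD_cong) (simp add: mm_lft_lft')
  then show ?thesis by (simp add: DD_zero)
qed

lemma DD_lft_diag:
  fixes C :: "'c set"
  shows "DD N C (lft \<rho> \<rho>' (un a a)) = dg (\<lambda>u. of_int (wtl N C \<rho> u a))"
proof (rule lop_eqI)
  fix x :: "('c \<Rightarrow> nat) \<Rightarrow> complex" and u
  have "ap (dloc N c (lft \<rho> \<rho>' (un a a))) x u = of_bool (u c < N \<and> \<rho> (u c) = a) * x u" for c
  proof (cases "u c < N")
    case True
    have "ap (dloc N c (lft \<rho> \<rho>' (un a a))) x u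
        = (\<Sum>b<N. if b = u c then (if \<rho> (u c) = a then x (u(c := b)) else 0) else 0)"
      unfolding ap_dloc if_P[OF True]
    proof (intro sum.cong refl)
      fix b assume "b \<in> {..<N}"
      then show "lft \<rho> \<rho>' (un a a) (u c) b * x (u(c := b))
          = (if b = u c then (if \<rho> (u c) = a then x (u(c := b)) else 0) else 0)"
        using rho_eq[of b "u c"] True by (auto simp: lft_def un_def)
    qed
    then show ?thesis using True by simp
  qed (simp add: ap_dloc)
  then show "ap (DD N C (lft \<rho> \<rho>' (un a a))) x u = ap (dg (\<lambda>u. of_int (wtl N C \<rho> u a))) x u"
    unfolding DD_def ap_sum_op wtl_def by (simp add: sum_distrib_right[symmetric] del: sum_of_bool_eq)
qed

text \<open>The hypothesis says that every matrix unit occurring in \<open>Y\<close> shifts the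
  weight counted through \<open>\<sigma>\<close> by the same amount. With \<open>s = 0\<close> this
  gives commutation with the weights of the other factor.\<close>

lemma DD_dg_shift:
  fixes C :: "'c set"
  assumes C: "finite C"
    and Y: "\<And>k l. k < N \<Longrightarrow> l < N \<Longrightarrow> Y k l \<noteq> 0 \<Longrightarrow> (\<lambda>a. of_bool (\<sigma> l = a) - of_bool (\<sigma> k = a)) = s"
  shows "DD N C Y * dg (\<lambda>u. h (wtl N C \<sigma> u)) = dg (\<lambda>u. h (\<lambda>k. wtl N C \<sigma> u k + s k)) * DD N C Y"
proof -
  have "dloc N c Y * dg (\<lambda>u. h (wtl N C \<sigma> u)) = dg (\<lambda>u. h (\<lambda>k. wtl N C \<sigma> u k + s k)) * dloc N c Y"
    if c: "c \<in> C" for c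
  proof (rule lop_eqI)
    fix x :: "('c \<Rightarrow> nat) \<Rightarrow> complex" and u
    have "wtl N C \<sigma> (u(c := b)) = (\<lambda>k. wtl N C \<sigma> u k + s k)" if "u c < N" "b < N" "Y (u c) b \<noteq> 0" for b
    proof
      fix k
      have R: "wtl N C \<sigma> v k = of_bool (v c < N \<and> \<sigma> (v c) = k) + (\<Sum>c'\<in>C - {c}. of_bool (v c' < N \<and> \<sigma> (v c') = k))" for v
        unfolding wtl_def by (rule sum.remove[OF C c])
      have "(\<Sum>c'\<in>C - {c}. of_bool ((u(c := b)) c' < N \<and> \<sigma> ((u(c := b)) c') = k))
          = (\<Sum>c'\<in>C - {c}. of_bool (u c' < N \<and> \<sigma> (u c') = k) :: int)" by (rule sum.cong) auto
      then show "wtl N C \<sigma> (u(c := b)) k = wtl N C \<sigma> u k + s k"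
        using fun_cong[OF Y[OF that(1,2,3)], of k] that by (simp only: R fun_upd_same) auto
    qed
    then show "ap (dloc N c Y * dg (\<lambda>u. h (wtl N C \<sigma> u))) x u
        = ap (dg (\<lambda>u. h (\<lambda>k. wtl N C \<sigma> u k + s k)) * dloc N c Y) x u"
      by (auto simp: ap_dloc sum_distrib_left mult_ac intro!: sum.cong)
  qed
  then show ?thesis unfolding DD_def by (simp add: sum_distrib_left sum_distrib_right)
qed

lemma le_shift:
  assumes "finite C"
  shows "le C i * dg (\<lambda>u. h (wtl N C \<rho> u)) = dg (\<lambda>u. h (\<lambda>k. wtl N C \<rho> u k - alpha i k)) * le C i"
    and "lf C i * dg (\<lambda>u. h (wtl N C \<rho> u)) = dg (\<lambda>u. h (\<lambda>k. wtl N C \<rho> u k - - alpha i k)) * lf C i"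
  using DD_dg_shift[OF assms, of "lft \<rho> \<rho>' (un i (Suc i))" \<rho> "\<lambda>k. - alpha i k" h]
    DD_dg_shift[OF assms, of "lft \<rho> \<rho>' (un (Suc i) i)" \<rho> "alpha i" h]
  unfolding le_def lf_def
  by (auto simp: lft_def un_def alpha_def fun_eq_iff split: if_splits)

lemma le_shift':
  assumes "finite C"
  shows "le C i * dg (\<lambda>u. h (wtl N C \<rho>' u)) = dg (\<lambda>u. h (wtl N C \<rho>' u)) * le C i"
    and "lf C i * dg (\<lambda>u. h (wtl N C \<rho>' u)) = dg (\<lambda>u. h (wtl N C \<rho>' u)) * lf C i"
  using DD_dg_shift[OF assms, of "lft \<rho> \<rho>' (un i (Suc i))" \<rho>' "\<lambda>k. 0" h]
    DD_dg_shift[OF assms, of "lft \<rho> \<rho>' (un (Suc i) i)" \<rho>' "\<lambda>k. 0" h]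
  unfolding le_def lf_def
  by (auto simp: lft_def un_def fun_eq_iff split: if_splits)

lemma tensor_posact:
  assumes C: "finite C"
  shows "posact M (wtl N C \<rho>) (le C) (lf C) (fillings N C)"
proof
  show "finite (fillings N C)" by (rule finite_fillings[OF C])
  fix i assume i: "Suc i < M"
  show "le C i * dg (\<lambda>S. h (wtl N C \<rho> S)) = dg (\<lambda>S. h (\<lambda>k. wtl N C \<rho> S k - alpha i k)) * le C i" for h
    by (rule le_shift[OF C])
  show "lf C i * dg (\<lambda>S. h (wtl N C \<rho> S)) = dg (\<lambda>S. h (\<lambda>k. wtl N C \<rho> S k - - alpha i k)) * lf C i" for h
    by (rule le_shift[OF C])
  show "supp_in (fillings N C) x \<Longrightarrow> supp_in (fillings N C) (ap (le C i) x)"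
    and "supp_in (fillings N C) x \<Longrightarrow> supp_in (fillings N C) (ap (lf C i) x)" for x
    unfolding le_def lf_def by (rule supp_DD, assumption)+
  have "(\<lambda>a b. cnj (lft \<rho> \<rho>' (un (Suc i) i) b a)) = lft \<rho> \<rho>' (un i (Suc i))"
    by (auto simp: lft_def un_def fun_eq_iff)
  then show "form cnj (fillings N C) (ap (lf C i) x) y
      = form cnj (fillings N C) x (ap (dg (\<lambda>S. 1) * le C i) y)" for x y
    unfolding le_def lf_def by (simp add: form_DD[OF C])
  fix j assume j: "Suc j < M"
  have "le C i * lf C j - lf C j * le C i
      = DD N C (lft \<rho> \<rho>' (\<lambda>a b. mm M (un i (Suc i)) (un (Suc j) j) a b - mm M (un (Suc j) j) (un i (Suc i)) a b))"
    unfolding le_def lf_def by (rule DD_lft_commutator)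
  also have "\<dots> = (if i = j then dg (\<lambda>S. qint 1 (hw (wtl N C \<rho> S) i)) else 0)"
  proof (cases "i = j")
    case True
    have "lft \<rho> \<rho>' (\<lambda>a b. un i i a b - un (Suc i) (Suc i) a b)
        = (\<lambda>a b. lft \<rho> \<rho>' (un i i) a b - lft \<rho> \<rho>' (un (Suc i) (Suc i)) a b)"
      by (auto simp: lft_def fun_eq_iff)
    then show ?thesis using True i j
      by (simp add: mm_un DD_diff DD_lft_diag dg_diff qint_def hw_def)
  next
    case False
    have "lft \<rho> \<rho>' (\<lambda>a b. 0) = (\<lambda>a b. 0)" by (auto simp: lft_def fun_eq_iff)
    then show ?thesis using False i j by (simp add: mm_un DD_zero)
  qed
  finally show "le C i * lf C j - lf C j * le C i = (if i = j then dg (\<lambda>S. qint 1 (hw (wtl N C \<rho> S) i)) else 0)" .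
qed auto

end

lemma factor_swap: "factor N M M' \<rho> \<rho>' \<Longrightarrow> factor N M' M \<rho>' \<rho>"
  unfolding factor_def
proof -
  assume b: "bij_betw (\<lambda>k. (\<rho> k, \<rho>' k)) {..<N} ({..<M} \<times> {..<M'})"
  have "bij_betw prod.swap ({..<M} \<times> {..<M'}) ({..<M'} \<times> {..<M})"
    by (rule bij_betw_byWitness[where f' = prod.swap]) auto
  from bij_betw_trans[OF b this] show "bij_betw (\<lambda>k. (\<rho>' k, \<rho> k)) {..<N} ({..<M'} \<times> {..<M})"
    by (simp add: o_def)
qed

lemma (in factor) tensor_posact2:
  assumes C: "finite C"
  shows "posact2 M M' (wtl N C \<rho>) (wtl N C \<rho>') (le C) (lf C)
    (factor.le N \<rho>' \<rho> C) (factor.lf N \<rho>' \<rho> C) (fillings N C)"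
proof -
  interpret F: factor N M' M \<rho>' \<rho> by (rule factor_swap) unfold_locales
  interpret A: posact M "wtl N C \<rho>" "le C" "lf C" "fillings N C" by (rule tensor_posact[OF C])
  interpret B: posact M' "wtl N C \<rho>'" "F.le C" "F.lf C" "fillings N C" by (rule F.tensor_posact[OF C])
  show ?thesis
    by unfold_locales
       (auto simp: le_shift'[OF C] F.le_shift'[OF C],
        simp_all add: le_def lf_def F.le_def F.lf_def DD_lft_lft'_commute)
qed

section \<open>The highest weight vector in a tensor power and semistandard tableaux\<close>

text \<open>With a second factor of dimension 1, the first factor acts by all \<open>N x N\<close>
  matrices, so the results on factors also cover \<open>gl_N\<close> itself.\<close>

lemma factor_id: "factor N N 1 (\<lambda>k. k) (\<lambda>_. 0)"
  unfolding factor_def by (rule bij_betw_byWitness[where f' = fst]) auto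

lemma lft_id [simp]: "lft (\<lambda>k. k) (\<lambda>_. 0) Y = Y"
  by (simp add: lft_def)

locale shape =
  fixes lam :: "nat \<Rightarrow> nat" and N :: nat
  assumes part: "part N lam"
begin

abbreviation "C \<equiv> cells lam"
abbreviation "X \<equiv> fillings N C"
abbreviation "D Y \<equiv> DD N C Y"

sublocale F: factor N N 1 "\<lambda>k. k" "\<lambda>_. 0" by (rule factor_id)

lemma finC: "finite C" by (rule finite_cells[OF part])

sublocale P: posact N "wtl N C (\<lambda>k. k)" "F.le C" "F.lf C" X
  by (rule F.tensor_posact[OF finC])

lemma le_eq: "F.le C i = D (un i (Suc i))" and lf_eq: "F.lf C i = D (un (Suc i) i)"
  by (simp_all add: F.le_def F.lf_def)

lemma mem_C: "(a, j) \<in> C \<longleftrightarrow> j < lam a"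
  by (simp add: cells_def)

lemma C_row_less: "c \<in> C \<Longrightarrow> fst c < N"
  using part_zero[OF part] by (cases c) (auto simp: mem_C not_le[symmetric])

lemma C_up: "(a, j) \<in> C \<Longrightarrow> a' \<le> a \<Longrightarrow> (a', j) \<in> C"
  using part_mono[OF part] by (auto simp: mem_C intro: less_le_trans)

definition colperm :: "(nat \<times> nat \<Rightarrow> nat \<times> nat) set" where
  "colperm = {\<pi>. \<pi> permutes C \<and> (\<forall>c. snd (\<pi> c) = snd c)}"

definition asym :: "((nat \<times> nat \<Rightarrow> nat) \<Rightarrow> complex) \<Rightarrow> (nat \<times> nat \<Rightarrow> nat) \<Rightarrow> complex" where
  "asym x u = (\<Sum>\<pi>\<in>colperm. of_int (sign \<pi>) * x (u \<circ> \<pi>))"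

definition rowf :: "nat \<times> nat \<Rightarrow> nat" where
  "rowf = restrict fst C"

text \<open>The filling of each cell by its row index, antisymmetrized along the columns: in each
  column this is a wedge of the first basis vectors.\<close>

definition hvec :: "(nat \<times> nat \<Rightarrow> nat) \<Rightarrow> complex" where
  "hvec = asym (delta rowf)"

lemma finite_colperm: "finite colperm"
  unfolding colperm_def by (rule finite_subset[OF _ finite_permutations[OF finC]]) auto

lemma colperm_mem: "\<pi> \<in> colperm \<Longrightarrow> \<pi> c \<in> C \<longleftrightarrow> c \<in> C"
  unfolding colperm_def using permutes_in_image[of \<pi> C c] by blast

lemma colperm_snd: "\<pi> \<in> colperm \<Longrightarrow> snd (\<pi> c) = snd c"
  unfolding colperm_def by blast

lemma comp_filling: "\<pi> \<in> colperm \<Longrightarrow> u \<circ> \<pi> \<in> X \<longleftrightarrow> u \<in> X"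
proof -
  assume p: "\<pi> \<in> colperm"
  then have P: "\<pi> permutes C" unfolding colperm_def by blast
  have 1: "u \<circ> \<pi> \<in> X" if "u \<in> X" "\<pi> permutes C" for u and \<pi> :: "nat \<times> nat \<Rightarrow> nat \<times> nat"
  proof (rule PiE_I)
    fix c assume "c \<in> C"
    then have "\<pi> c \<in> C" using permutes_in_image[OF that(2)] by blast
    with that(1) show "(u \<circ> \<pi>) c \<in> {..<N}" by auto
  next
    fix c assume c: "c \<notin> C"
    then have "\<pi> c = c" using that(2) unfolding permutes_def by blast
    with that(1) c show "(u \<circ> \<pi>) c = undefined" by auto
  qed
  have "u = (u \<circ> \<pi>) \<circ> inv_into UNIV \<pi>" using permutes_inv_o[OF P] by (simp add: comp_assoc)
  then show ?thesis using 1[OF _ P] 1[OF _ permutes_inv[OF P]] by metis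
qed

text \<open>Permuting the tensor factors commutes with an action that treats all factors
  alike.\<close>

lemma DD_asym: "ap (D Y) (asym x) = asym (ap (D Y) x)"
proof
  fix u
  have 1: "ap (D Y) (\<lambda>v. x (v \<circ> \<pi>)) u = ap (D Y) x (u \<circ> \<pi>)" if p: "\<pi> \<in> colperm" for \<pi>
  proof -
    have P: "\<pi> permutes C" using p unfolding colperm_def by blast
    then have inj: "inj \<pi>" and bij: "bij_betw \<pi> C C" using permutes_inj permutes_imp_bij by blast+
    have upd: "(u(\<pi> c := b)) \<circ> \<pi> = (u \<circ> \<pi>)(c := b)" for c b
      using inj by (auto simp: fun_eq_iff inj_eq)
    have "ap (D Y) (\<lambda>v. x (v \<circ> \<pi>)) u = (\<Sum>c\<in>C. ap (dloc N (\<pi> c) Y) (\<lambda>v. x (v \<circ> \<pi>)) u)"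
      unfolding DD_def ap_sum_op by (rule sum.reindex_bij_betw[OF bij, symmetric])
    also have "\<dots> = (\<Sum>c\<in>C. ap (dloc N c Y) x (u \<circ> \<pi>))"
      by (intro sum.cong refl) (simp add: ap_dloc upd)
    finally show ?thesis unfolding DD_def ap_sum_op .
  qed
  have "ap (D Y) (asym x) u = (\<Sum>\<pi>\<in>colperm. of_int (sign \<pi>) * ap (D Y) (\<lambda>v. x (v \<circ> \<pi>)) u)"
    unfolding asym_def[abs_def] ap_sum ..
  also have "\<dots> = asym (ap (D Y) x) u" unfolding asym_def by (intro sum.cong refl) (simp add: 1)
  finally show "ap (D Y) (asym x) u = asym (ap (D Y) x) u" .
qed

lemma asym_sum: "asym (\<lambda>u. \<Sum>i\<in>I. k i * y i u) = (\<lambda>u. \<Sum>i\<in>I. k i * asym (y i) u)"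
  unfolding asym_def by (auto simp: sum_distrib_left mult_ac intro!: ext) (subst sum.swap, simp)

text \<open>Composition with \<open>\<tau>\<close> permutes the column group and reverses the sign
  of every term.\<close>

lemma asym_zero:
  assumes t: "\<tau> \<in> colperm" "sign \<tau> = -1" and x: "\<And>u. x (u \<circ> \<tau>) = x u"
  shows "asym x = (\<lambda>u. 0)"
proof
  fix u
  have T: "\<tau> permutes C" using t unfolding colperm_def by blast
  have per: "permutation \<pi>" if "\<pi> \<in> colperm" for \<pi>
    using that finC permutation_permutes unfolding colperm_def by blast
  have bij: "bij_betw (\<lambda>\<pi>. \<pi> \<circ> \<tau>) colperm colperm"
  proof (rule bij_betw_byWitness[where f' = "\<lambda>\<pi>. \<pi> \<circ> inv_into UNIV \<tau>"])
    have "snd (inv_into UNIV \<tau> c) = snd c" for c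
      using colperm_snd[OF t(1), of "inv_into UNIV \<tau> c"] permutes_inverses(1)[OF T] by simp
    then have "\<pi> \<circ> inv_into UNIV \<tau> \<in> colperm" if "\<pi> \<in> colperm" for \<pi>
      using that permutes_compose[OF permutes_inv[OF T], of \<pi>] by (simp add: colperm_def del: split_paired_All)
    then show "(\<lambda>\<pi>. \<pi> \<circ> inv_into UNIV \<tau>) ` colperm \<subseteq> colperm" by blast
    have "\<pi> \<circ> \<tau> \<in> colperm" if "\<pi> \<in> colperm" for \<pi>
      using that t permutes_compose[OF T, of \<pi>] by (simp add: colperm_def del: split_paired_All)
    then show "(\<lambda>\<pi>. \<pi> \<circ> \<tau>) ` colperm \<subseteq> colperm" by blast
  qed (auto simp: comp_assoc permutes_inv_o[OF T])
  have "asym x u = (\<Sum>\<pi>\<in>colperm. of_int (sign (\<pi> \<circ> \<tau>)) * x (u \<circ> (\<pi> \<circ> \<tau>)))"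
    unfolding asym_def by (rule sum.reindex_bij_betw[OF bij, symmetric])
  also have "\<dots> = (\<Sum>\<pi>\<in>colperm. - (of_int (sign \<pi>) * x (u \<circ> \<pi>)))"
    using t x per by (intro sum.cong refl) (simp add: sign_compose comp_assoc[symmetric])
  also have "\<dots> = - asym x u" by (simp add: asym_def sum_negf)
  finally show "asym x u = 0" by simp
qed

lemma rowf_X: "rowf \<in> X"
  unfolding rowf_def using C_row_less by auto

lemma supp_asym: "supp_in X x \<Longrightarrow> supp_in X (asym x)"
  unfolding supp_in_def asym_def using comp_filling by (auto intro!: sum.neutral)

lemma supp_hvec: "supp_in X hvec"
  unfolding hvec_def using rowf_X by (intro supp_asym) (auto simp: supp_in_def delta_def)

lemma D_un_apply:
  assumes "u \<in> X" and "b < N"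
  shows "ap (D (un a b)) x u = (\<Sum>c\<in>C. if u c = a then x (u(c := b)) else 0)"
  unfolding DD_def ap_sum_op using assms
  by (intro sum.cong refl) (auto simp: ap_dloc un_def if_one_mult PiE_iff)

text \<open>\<open>un a b\<close> turns one entry \<open>b\<close> of the filling into
  \<open>a\<close>. The column already holds an \<open>a\<close> above it, so the new filling is
  fixed by a transposition in that column, and antisymmetrization kills it.\<close>

lemma D_un_hvec:
  assumes ab: "a < b" "b < N"
  shows "ap (D (un a b)) hvec = (\<lambda>u. 0)"
proof -
  let ?R = "{c \<in> C. fst c = b}"
  have "ap (D (un a b)) (delta rowf) u = (\<Sum>c\<in>?R. 1 * delta (rowf(c := a)) u)" for u
  proof (cases "u \<in> X")
    case True
    have "(if u c = a then delta rowf (u(c := b)) else 0) = (if fst c = b then delta (rowf(c := a)) u else (0::complex))"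
      if c: "c \<in> C" for c
    proof -
      have "u c = a \<and> u(c := b) = rowf \<longleftrightarrow> fst c = b \<and> u = rowf(c := a)"
      proof -
        have rc: "rowf c = fst c" using c by (simp add: rowf_def)
        show ?thesis
        proof
          assume *: "u c = a \<and> u(c := b) = rowf"
          then have "rowf c = b" by (metis fun_upd_same)
          moreover have "u = rowf(c := a)" using * by (metis fun_upd_triv fun_upd_upd)
          ultimately show "fst c = b \<and> u = rowf(c := a)" using rc by simp
        next
          assume "fst c = b \<and> u = rowf(c := a)"
          then show "u c = a \<and> u(c := b) = rowf" using rc by (metis fun_upd_same fun_upd_triv fun_upd_upd)
        qed
      qed
      moreover have "(if u c = a then delta rowf (u(c := b)) else 0) = (of_bool (u c = a \<and> u(c := b) = rowf) :: complex)"
        unfolding delta_def of_bool_def by auto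
      moreover have "(if fst c = b then delta (rowf(c := a)) u else 0) = (of_bool (fst c = b \<and> u = rowf(c := a)) :: complex)"
        unfolding delta_def of_bool_def by auto
      ultimately show ?thesis by (simp only:)
    qed
    then show ?thesis unfolding D_un_apply[OF True ab(2)] using finC
      by (simp add: sum.inter_filter)
  next
    case False
    have "supp_in X (delta rowf :: _ \<Rightarrow> complex)" using rowf_X by (auto simp: supp_in_def delta_def)
    then have "ap (D (un a b)) (delta rowf) u = 0" using supp_DD False unfolding supp_in_def by blast
    moreover have "rowf(c := a) \<in> X" if "c \<in> ?R" for c
      using rowf_X that ab by (auto simp: PiE_iff extensional_def)
    then have "u \<noteq> rowf(c := a)" if "c \<in> ?R" for c using False that by blast
    then have "(\<Sum>c\<in>?R. 1 * delta (rowf(c := a)) u) = (0::complex)"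
      by (intro sum.neutral ballI) (simp add: delta_def)
    ultimately show ?thesis by simp
  qed
  then have "ap (D (un a b)) hvec = (\<lambda>u. \<Sum>c\<in>?R. 1 * asym (delta (rowf(c := a))) u)"
    unfolding hvec_def DD_asym asym_sum[symmetric] by presburger
  moreover have "asym (delta (rowf(c := a))) = (\<lambda>u. 0)" if c: "c \<in> ?R" for c
  proof -
    have "c = (b, snd c)" using that by (simp add: prod_eq_iff)
    moreover define j where "j = snd c"
    ultimately have c: "c = (b, j)" "(b, j) \<in> C" using that by auto
    then have c': "(a, j) \<in> C" using C_up ab(1) by simp
    let ?t = "Transposition.transpose (a, j) (b, j)"
    have t: "?t \<in> colperm"
      unfolding colperm_def using permutes_swap_id[OF c' c(2)] by (auto simp: Transposition.transpose_def)
    have inv: "(rowf(c := a)) \<circ> ?t = rowf(c := a)"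
      using c c' by (auto simp: fun_eq_iff Transposition.transpose_def rowf_def)
    have tt: "?t \<circ> ?t = id" by (simp add: fun_eq_iff)
    have "u \<circ> ?t = rowf(c := a) \<longleftrightarrow> u = rowf(c := a)" for u
      using inv tt by (metis comp_assoc comp_id)
    then have "delta (rowf(c := a)) (u \<circ> ?t) = (delta (rowf(c := a)) u :: complex)" for u
      by (simp add: delta_def)
    moreover have "sign ?t = -1" using ab by (simp add: sign_swap_id)
    ultimately show ?thesis using asym_zero[OF t] by blast
  qed
  ultimately show ?thesis by simp
qed

lemma wtl_comp:
  assumes "\<pi> \<in> colperm"
  shows "wtl N C \<rho> (u \<circ> \<pi>) = wtl N C \<rho> u"
proof
  fix a
  have "bij_betw \<pi> C C" using assms permutes_imp_bij unfolding colperm_def by blast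
  from sum.reindex_bij_betw[OF this, of "\<lambda>c. of_bool (u c < N \<and> \<rho> (u c) = a) :: int"]
  show "wtl N C \<rho> (u \<circ> \<pi>) a = wtl N C \<rho> u a"
    unfolding wtl_def comp_apply .
qed

lemma wtl_rowf: "wtl N C (\<lambda>k. k) rowf = iw lam"
proof
  fix a
  have "{c \<in> C. rowf c < N \<and> rowf c = a} = (\<lambda>j. (a, j)) ` {..<lam a}"
    using C_row_less by (fastforce simp: rowf_def mem_C)
  then have "card {c \<in> C. rowf c < N \<and> rowf c = a} = lam a" by (simp add: card_image inj_on_def)
  moreover have "wtl N C (\<lambda>k. k) rowf a = int (card {c \<in> C. rowf c < N \<and> rowf c = a})"
    unfolding wtl_def using finC by (simp add: Int_def)
  ultimately show "wtl N C (\<lambda>k. k) rowf a = int (lam a)" by simp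
qed

lemma hvec_hwv: "P.hwv (iw lam) hvec"
proof -
  have "wtl N C (\<lambda>k. k) u = iw lam" if "hvec u \<noteq> 0" for u
  proof -
    from that have "\<exists>\<pi>\<in>colperm. of_int (sign \<pi>) * delta rowf (u \<circ> \<pi>) \<noteq> (0::complex)"
      unfolding hvec_def asym_def by (meson sum.neutral)
    then obtain \<pi> where "\<pi> \<in> colperm" "delta rowf (u \<circ> \<pi>) \<noteq> (0::complex)" by auto
    then show ?thesis using wtl_comp[of \<pi> "\<lambda>k. k" u] wtl_rowf by (auto simp: delta_def split: if_splits)
  qed
  then show ?thesis unfolding P.hwv_def has_wt_def using D_un_hvec by (auto simp: le_eq)
qed

lemma colperm_id_if_fst:
  assumes "\<pi> \<in> colperm" and "\<And>c. c \<in> C \<Longrightarrow> fst (\<pi> c) = fst c"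
  shows "\<pi> = id"
proof
  fix c show "\<pi> c = id c"
  proof (cases "c \<in> C")
    case True
    then show ?thesis using assms(2)[OF True] colperm_snd[OF assms(1), of c] by (simp add: prod_eq_iff)
  next
    case False
    then show ?thesis using assms(1) permutes_not_in[of \<pi> C c] unfolding colperm_def by simp
  qed
qed

lemma id_colperm: "id \<in> colperm"
  unfolding colperm_def by (auto simp: permutes_id)

lemma hvec_nonzero: "hvec \<noteq> (\<lambda>u. 0)"
proof -
  have "\<pi> = id" if "\<pi> \<in> colperm" "rowf \<circ> \<pi> = rowf" for \<pi>
  proof (rule colperm_id_if_fst[OF that(1)])
    fix c assume c: "c \<in> C"
    then have "\<pi> c \<in> C" using colperm_mem[OF that(1)] by blast
    then show "fst (\<pi> c) = fst c" using fun_cong[OF that(2), of c] c by (simp add: rowf_def)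
  qed
  then have "hvec rowf = (\<Sum>\<pi>\<in>colperm. if \<pi> = id then 1 else 0)"
    unfolding hvec_def asym_def by (intro sum.cong refl) (auto simp: delta_def sign_id)
  also have "\<dots> = 1" using finite_colperm id_colperm by simp
  finally have "hvec rowf = 1" .
  then show ?thesis by (metis zero_neq_one)
qed

text \<open>The submodule generated by \<open>hvec\<close>, given as the span of the lowering words.
  Stability under the raising operators will come from \<open>e_word\<close>, under all of
  \<open>gl_N\<close> from commutators.\<close>

definition inW :: "((nat \<times> nat \<Rightarrow> nat) \<Rightarrow> complex) \<Rightarrow> bool" where
  "inW x \<longleftrightarrow> (\<exists>A c. finite A \<and> A \<subseteq> Wd N \<and> (\<forall>S. x S = (\<Sum>w\<in>A. c w * ap (fw (F.lf C) w) hvec S)))"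

lemma inW_word: "w \<in> Wd N \<Longrightarrow> inW (ap (fw (F.lf C) w) hvec)"
  unfolding inW_def by (intro exI[of _ "{w}"] exI[of _ "\<lambda>_. 1"]) simp

lemma inW_scale: "inW x \<Longrightarrow> inW (\<lambda>S. k * x S)"
proof -
  assume "inW x"
  then obtain A c where "finite A" "A \<subseteq> Wd N" "\<forall>S. x S = (\<Sum>w\<in>A. c w * ap (fw (F.lf C) w) hvec S)"
    unfolding inW_def by blast
  then show ?thesis unfolding inW_def
    by (intro exI[of _ A] exI[of _ "\<lambda>w. k * c w"]) (simp add: sum_distrib_left mult.assoc)
qed

lemma inW_add: "inW x \<Longrightarrow> inW y \<Longrightarrow> inW (\<lambda>S. x S + y S)"
proof -
  assume "inW x" "inW y"
  then obtain A c B d where A: "finite A" "A \<subseteq> Wd N" "\<forall>S. x S = (\<Sum>w\<in>A. c w * ap (fw (F.lf C) w) hvec S)"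
    and B: "finite B" "B \<subseteq> Wd N" "\<forall>S. y S = (\<Sum>w\<in>B. d w * ap (fw (F.lf C) w) hvec S)"
    unfolding inW_def by blast
  have ext: "(\<Sum>w\<in>A \<union> B. (if w \<in> G then k w else 0) * Z w) = (\<Sum>w\<in>G. k w * Z w)" if "G \<subseteq> A \<union> B"
    for G and k Z :: "nat list \<Rightarrow> complex"
    using that A(1) B(1) by (intro sum.mono_neutral_cong_right) auto
  have "x S + y S = (\<Sum>w\<in>A \<union> B. ((if w \<in> A then c w else 0) + (if w \<in> B then d w else 0)) * ap (fw (F.lf C) w) hvec S)" for S
    unfolding distrib_right sum.distrib using A B by (simp add: ext)
  then show ?thesis unfolding inW_def using A B
    by (intro exI[of _ "A \<union> B"] exI[of _ "\<lambda>w. (if w \<in> A then c w else 0) + (if w \<in> B then d w else 0)"]) auto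
qed

lemma inW_0: "inW (\<lambda>S. 0)"
  unfolding inW_def by (intro exI[of _ "{}"]) simp

lemma inW_sum: "(\<And>i. i \<in> I \<Longrightarrow> inW (y i)) \<Longrightarrow> inW (\<lambda>S. \<Sum>i\<in>I. k i * y i S)"
proof (induction I rule: infinite_finite_induct)
  case (insert j I)
  then have "inW (\<lambda>S. k j * y j S + (\<Sum>i\<in>I. k i * y i S))" by (intro inW_add inW_scale) auto
  with insert show ?case by simp
qed (simp_all add: inW_0)

lemma inW_diff: "inW x \<Longrightarrow> inW y \<Longrightarrow> inW (\<lambda>S. x S - y S)"
  using inW_add[OF _ inW_scale, of x y "-1"] by simp

lemma inW_supp: "inW x \<Longrightarrow> supp_in X x"
proof -
  assume "inW x"
  then obtain A c where A: "A \<subseteq> Wd N" "x = (\<lambda>S. \<Sum>w\<in>A. c w * ap (fw (F.lf C) w) hvec S)"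
    unfolding inW_def by blast
  then show ?thesis unfolding A(2) using P.supp_word[OF _ supp_hvec] by (intro supp_in_sum) blast
qed

lemma inW_ap:
  assumes "\<And>w. w \<in> Wd N \<Longrightarrow> inW (ap A (ap (fw (F.lf C) w) hvec))" and "inW x"
  shows "inW (ap A x)"
proof -
  from assms(2) obtain B c where B: "finite B" "B \<subseteq> Wd N" "x = (\<lambda>S. \<Sum>w\<in>B. c w * ap (fw (F.lf C) w) hvec S)"
    unfolding inW_def by blast
  show ?thesis unfolding B(3) ap_sum by (rule inW_sum) (use B assms in auto)
qed

lemma inW_lcomb: "(\<And>k u. (k, u) \<in> set L \<Longrightarrow> inW (Y u)) \<Longrightarrow> inW (lcomb L Y)"
proof (induction L)
  case (Cons a L)
  obtain k u where a: "a = (k, u)" by force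
  have "inW (\<lambda>S. k * Y u S + lcomb L Y S)"
    by (intro inW_add inW_scale Cons.IH Cons.prems[of k u]) (use a Cons.prems in auto)
  then show ?case using a by simp
qed (simp add: inW_0)

lemma inW_simple:
  assumes "Suc i < N" and "inW x"
  shows "inW (ap (D (un (Suc i) i)) x)" and "inW (ap (D (un i (Suc i))) x)"
proof -
  show "inW (ap (D (un (Suc i) i)) x)"
    using inW_word[of "i # _"] assms by (intro inW_ap[OF _ assms(2)]) (simp add: lf_eq)
  have "inW (ap (F.le C i) x)"
  proof (rule inW_ap[OF _ assms(2)])
    fix w assume w: "w \<in> Wd N"
    show "inW (ap (F.le C i) (ap (fw (F.lf C) w) hvec))"
      unfolding P.e_word[OF hvec_hwv assms(1) w]
      by (rule inW_lcomb, rule inW_word, rule EW_Wd[OF w])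
  qed
  then show "inW (ap (D (un i (Suc i))) x)" by (simp add: le_eq)
qed

lemma inW_diag: "inW x \<Longrightarrow> inW (ap (D (un a a)) x)"
proof (rule inW_ap)
  fix w assume w: "w \<in> Wd N"
  have "has_wt (wtl N C (\<lambda>k. k)) (wtw (iw lam) w) (ap (fw (F.lf C) w) hvec)"
    using P.has_wt_word[OF w] hvec_hwv unfolding P.hwv_def by blast
  from has_wt_dg[OF this, of "\<lambda>kp. of_int (kp a)"]
  show "inW (ap (D (un a a)) (ap (fw (F.lf C) w) hvec))"
    using F.DD_lft_diag[of C a] inW_scale[OF inW_word[OF w]] by simp
qed

text \<open>Induction on the distance of \<open>a\<close> and \<open>b\<close>, writing a matrix
  unit as the commutator \<open>[E_ac, E_cb]\<close> with \<open>c\<close> just below the larger of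
  the two indices.\<close>

lemma inW_un: "a < N \<Longrightarrow> b < N \<Longrightarrow> inW x \<Longrightarrow> inW (ap (D (un a b)) x)"
proof (induction "if a < b then b - a else a - b" arbitrary: a b x rule: less_induct)
  case less
  have comm: "inW (ap (D (un a b)) x)" if c: "c < N" "a \<noteq> b" and 1: "\<And>x. inW x \<Longrightarrow> inW (ap (D (un a c)) x)"
    and 2: "\<And>x. inW x \<Longrightarrow> inW (ap (D (un c b)) x)" for c
  proof -
    have "D (un a c) * D (un c b) - D (un c b) * D (un a c) = D (un a b)"
      unfolding DD_commutator using c less.prems by (simp add: mm_un)
    from arg_cong[OF this, of "\<lambda>A. ap A x"]
    have eq: "ap (D (un a b)) x = (\<lambda>S. ap (D (un a c)) (ap (D (un c b)) x) S - ap (D (un c b)) (ap (D (un a c)) x) S)"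
      by simp
    show ?thesis unfolding eq by (intro inW_diff 1 2 less.prems(3))
  qed
  consider "a = b" | "a < b" "b = Suc a" | "a < b" "b \<noteq> Suc a" | "b < a" "a = Suc b" | "b < a" "a \<noteq> Suc b" by linarith
  then show ?case
  proof cases
    case 1 then show ?thesis using inW_diag less.prems by simp
  next
    case 2 then show ?thesis using inW_simple less.prems by simp
  next
    case 3
    then obtain c where c: "b = Suc c" "a < c" by (cases b) auto
    show ?thesis
      by (rule comm[of c]; (rule less.hyps)?) (use c less.prems in auto)
  next
    case 4 then show ?thesis using inW_simple less.prems by simp
  next
    case 5
    then obtain c where c: "a = Suc c" "b < c" by (cases a) auto
    show ?thesis
      by (rule comm[of c]; (rule less.hyps)?) (use c less.prems in auto)
  qed
qed

lemma D_expand: "D Y = (\<Sum>i\<in>{..<N} \<times> {..<N}. sc (Y (fst i) (snd i)) * D (un (fst i) (snd i)))"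
proof -
  have "D Y = D (\<lambda>k l. \<Sum>i\<in>{..<N} \<times> {..<N}. Y (fst i) (snd i) * un (fst i) (snd i) k l)"
  proof (rule DD_cong)
    fix k l assume "k < N" "l < N"
    have "(\<Sum>i\<in>{..<N} \<times> {..<N}. Y (fst i) (snd i) * un (fst i) (snd i) k l)
        = (\<Sum>i\<in>{..<N} \<times> {..<N}. if i = (k, l) then Y k l else 0)"
      by (intro sum.cong refl) (auto simp: un_def split: if_splits)
    also have "\<dots> = Y k l" using \<open>k < N\<close> \<open>l < N\<close> by simp
    finally show "Y k l = (\<Sum>i\<in>{..<N} \<times> {..<N}. Y (fst i) (snd i) * un (fst i) (snd i) k l)" by simp
  qed
  then show ?thesis by (simp add: DD_sum)
qed

lemma inW_D:
  assumes "inW x"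
  shows "inW (ap (D Y) x)"
proof -
  have "ap (D Y) x = (\<lambda>S. \<Sum>i\<in>{..<N} \<times> {..<N}. Y (fst i) (snd i) * ap (D (un (fst i) (snd i))) x S)"
    by (simp add: D_expand[of Y] ap_sum_op)
  then show ?thesis using assms by (auto intro!: inW_sum inW_un)
qed

end

subsection \<open>Independent vectors indexed by semistandard tableaux\<close>

context shape begin

definition cnt :: "(nat \<times> nat \<Rightarrow> nat) \<Rightarrow> nat \<Rightarrow> nat \<Rightarrow> nat" where
  "cnt u a b = card {j. j < lam a \<and> u (a, j) = b}"

text \<open>The symmetrized tensor of all fillings with the same row contents as \<open>t\<close>, and its image
  under the column antisymmetrizer.\<close>

definition rsum :: "(nat \<times> nat \<Rightarrow> nat) \<Rightarrow> (nat \<times> nat \<Rightarrow> nat) \<Rightarrow> complex" where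
  "rsum t u = of_bool (u \<in> X \<and> cnt u = cnt t)"

definition tvec :: "(nat \<times> nat \<Rightarrow> nat) \<Rightarrow> (nat \<times> nat \<Rightarrow> nat) \<Rightarrow> complex" where
  "tvec t = asym (rsum t)"

lemma cnt_upd:
  assumes "(a0, j0) \<in> C"
  shows "int (cnt (u((a0, j0) := x)) a b)
    = int (cnt u a b) - of_bool (a = a0 \<and> u (a0, j0) = b) + of_bool (a = a0 \<and> x = b)"
proof (cases "a = a0")
  case False
  then show ?thesis by (simp add: cnt_def)
next
  case True
  have j0: "j0 < lam a0" using assms mem_C by simp
  have R: "cnt v a0 b = of_bool (v (a0, j0) = b) + card {j. j < lam a0 \<and> j \<noteq> j0 \<and> v (a0, j) = b}" for v
  proof -
    have "{j. j < lam a0 \<and> v (a0, j) = b}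
        = (if v (a0, j0) = b then {j0} else {}) \<union> {j. j < lam a0 \<and> j \<noteq> j0 \<and> v (a0, j) = b}"
      using j0 by auto
    then show ?thesis unfolding cnt_def by (simp add: card_Un_disjoint)
  qed
  have "{j. j < lam a0 \<and> j \<noteq> j0 \<and> (u((a0, j0) := x)) (a0, j) = b} = {j. j < lam a0 \<and> j \<noteq> j0 \<and> u (a0, j) = b}" by auto
  then show ?thesis unfolding True R[of "u((a0, j0) := x)"] R[of u] by simp
qed

lemma cnt_pos: "(a, j) \<in> C \<Longrightarrow> 0 < cnt u a (u (a, j))"
  unfolding cnt_def by (subst card_gt_0_iff) (auto simp: mem_C)

text \<open>The operator replaces one \<open>a\<close> by \<open>b\<close>. Because \<open>t\<close>
  has no entry \<open>a\<close> outside row \<open>a\<close>, only changes in that row lead to the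
  contents of \<open>t\<close>, and a filling with those contents arises once for each
  \<open>b\<close> in its row \<open>a\<close>.\<close>

lemma rsum_step:
  assumes t: "t \<in> X" and c0: "(a, j0) \<in> C" and tb: "t (a, j0) = b" and ab: "a \<noteq> b"
    and lt: "\<And>a' j. (a', j) \<in> C \<Longrightarrow> a' \<noteq> a \<Longrightarrow> t (a', j) \<noteq> a" and aN: "a < N"
  shows "ap (D (un b a)) (rsum (t((a, j0) := a))) = (\<lambda>u. of_nat (cnt t a b) * rsum t u)"
proof
  fix u
  let ?t = "t((a, j0) := a)"
  show "ap (D (un b a)) (rsum ?t) u = of_nat (cnt t a b) * rsum t u"
  proof (cases "u \<in> X")
    case False
    have "supp_in X (rsum ?t)" unfolding supp_in_def rsum_def by auto
    then have "ap (D (un b a)) (rsum ?t) u = 0" using supp_DD False unfolding supp_in_def by blast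
    then show ?thesis using False by (simp add: rsum_def)
  next
    case True
    have "(if u c = b then rsum ?t (u(c := a)) else 0) = (if u c = b \<and> fst c = a then rsum t u else 0)"
      if c: "c \<in> C" for c
    proof (cases "u c = b")
      case uc: True
      obtain a' j where c': "c = (a', j)" by force
      have Xc: "u(c := a) \<in> X" using True aN c by (auto simp: PiE_iff extensional_def)
      show ?thesis
      proof (cases "a' = a")
        case a': True
        have "cnt (u(c := a)) = cnt ?t \<longleftrightarrow> cnt u = cnt t"
        proof -
          have "int (cnt (u(c := a)) x y) = int (cnt ?t x y) \<longleftrightarrow> int (cnt u x y) = int (cnt t x y)" for x y
            using cnt_upd[of a j u a x y] cnt_upd[OF c0, of t a x y] c c' a' uc tb by auto
          then show ?thesis by (simp add: fun_eq_iff)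
        qed
        then show ?thesis using uc a' c' True Xc by (simp add: rsum_def)
      next
        case a': False
        have "cnt (u(c := a)) a' a > 0" using cnt_pos[of a' j "u(c := a)"] c c' by simp
        moreover have "{j. j < lam a' \<and> ?t (a', j) = a} = {}" using lt[of a'] a' by (auto simp: mem_C)
        then have "cnt ?t a' a = 0" unfolding cnt_def by simp
        ultimately have "cnt (u(c := a)) \<noteq> cnt ?t" by auto
        then show ?thesis using uc a' c' by (simp add: rsum_def)
      qed
    qed simp
    then have "ap (D (un b a)) (rsum ?t) u = (\<Sum>c\<in>C. if u c = b \<and> fst c = a then rsum t u else 0)"
      unfolding D_un_apply[OF True aN] by (intro sum.cong refl) simp
    also have "\<dots> = of_nat (card {c \<in> C. u c = b \<and> fst c = a}) * rsum t u"
      using finC by (simp add: sum.If_cases Int_def)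
    also have "{c \<in> C. u c = b \<and> fst c = a} = (\<lambda>j. (a, j)) ` {j. j < lam a \<and> u (a, j) = b}"
      by (auto simp: mem_C)
    then have "card {c \<in> C. u c = b \<and> fst c = a} = cnt u a b"
      unfolding cnt_def by (simp add: card_image inj_on_def)
    finally have fin: "ap (D (un b a)) (rsum ?t) u = of_nat (cnt u a b) * rsum t u" .
    show ?thesis
    proof (cases "cnt u = cnt t")
      case True
      then show ?thesis by (simp only: fin)
    next
      case False
      then have "rsum t u = 0" by (simp add: rsum_def)
      then show ?thesis by (simp only: fin mult_zero_right)
    qed
  qed
qed

text \<open>By induction on the total excess of the entries over their row indices. In the first row
  \<open>a\<close> with an excess, one entry is reset to \<open>a\<close> and recovered by
  \<open>rsum_step\<close>; the rows above hold only their own index and those below only entries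
  greater than \<open>a\<close>, so no other row contains \<open>a\<close>.\<close>

lemma inW_tvec:
  assumes "t \<in> X" and "\<And>c. c \<in> C \<Longrightarrow> fst c \<le> t c"
  shows "inW (tvec t)"
  using assms
proof (induction "\<Sum>c\<in>C. t c - fst c" arbitrary: t rule: less_induct)
  case less
  show ?case
  proof (cases "\<exists>c\<in>C. fst c < t c")
    case False
    have tc: "t c = fst c" if "c \<in> C" for c
      using False less.prems(2)[OF that] that by (metis le_neq_implies_less)
    have t: "t = rowf"
    proof
      fix c :: "nat \<times> nat"
      show "t c = rowf c"
        using tc[of c] PiE_arb[OF less.prems(1), of c] by (cases "c \<in> C") (simp_all add: rowf_def)
    qed
    have "u = rowf" if u: "u \<in> X" "cnt u = cnt rowf" for u
    proof
      fix c :: "nat \<times> nat"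
      obtain a j where c: "c = (a, j)" by force
      show "u c = rowf c"
      proof (cases "c \<in> C")
        case True
        then have "0 < cnt rowf a (u (a, j))" using cnt_pos[of a j u] u c by simp
        then obtain j' where "j' < lam a" "rowf (a, j') = u (a, j)" unfolding cnt_def
          by (metis (mono_tags, lifting) card.empty empty_Collect_eq less_nat_zero_code)
        then show ?thesis using True c by (simp add: rowf_def mem_C)
      next
        case False
        then show ?thesis using PiE_arb[OF u(1), of c] by (simp add: rowf_def)
      qed
    qed
    then have "u \<in> X \<and> cnt u = cnt rowf \<longleftrightarrow> u = rowf" for u using rowf_X by blast
    then have "rsum t = delta rowf" unfolding t rsum_def delta_def of_bool_def by (simp only:)
    then show ?thesis using inW_word[of "[]"] unfolding tvec_def hvec_def by simp
  next
    case True
    define a where "a = (LEAST a. \<exists>j. (a, j) \<in> C \<and> a < t (a, j))"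
    have ex: "\<exists>a j. (a, j) \<in> C \<and> a < t (a, j)" using True by force
    obtain j where j: "(a, j) \<in> C" "a < t (a, j)" using LeastI_ex[OF ex] unfolding a_def by blast
    have low: "t (a', j') = a'" if "(a', j') \<in> C" "a' < a" for a' j'
      using not_less_Least[OF that(2)[unfolded a_def]] that less.prems(2)[of "(a', j')"] by force
    let ?b = "t (a, j)" and ?t = "t((a, j) := a)"
    have aN: "a < N" using C_row_less[OF j(1)] by simp
    have tX: "?t \<in> X" using less.prems(1) aN j by (auto simp: PiE_iff extensional_def)
    have "inW (tvec ?t)"
    proof (rule less.hyps)
      show "(\<Sum>c\<in>C. ?t c - fst c) < (\<Sum>c\<in>C. t c - fst c)"
        using j by (intro sum_strict_mono_ex1[OF finC]) auto
      show "\<And>c. c \<in> C \<Longrightarrow> fst c \<le> ?t c" using less.prems(2) by auto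
    qed (rule tX)
    then have "inW (ap (D (un ?b a)) (tvec ?t))" by (rule inW_D)
    moreover have "t (a', j') \<noteq> a" if "(a', j') \<in> C" "a' \<noteq> a" for a' j'
      using low[OF that(1)] less.prems(2)[OF that(1)] that(2) by (cases "a' < a") auto
    then have "ap (D (un ?b a)) (rsum ?t) = (\<lambda>u. of_nat (cnt t a ?b) * rsum t u)"
      using j by (intro rsum_step[OF less.prems(1) j(1) refl _ _ aN]) auto
    then have "ap (D (un ?b a)) (tvec ?t) = (\<lambda>u. of_nat (cnt t a ?b) * tvec t u)"
      unfolding tvec_def DD_asym by (auto simp: asym_def sum_distrib_left mult_ac)
    ultimately have "inW (\<lambda>u. (1 / of_nat (cnt t a ?b)) * (of_nat (cnt t a ?b) * tvec t u))"
      using inW_scale by metis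
    moreover have "cnt t a ?b > 0" by (rule cnt_pos[OF j(1)])
    ultimately show ?thesis by simp
  qed
qed

text \<open>Column sums do not change under column permutations; compared lexicographically they
  order the tableaux so that the vectors \<open>tvec\<close> become unitriangular.\<close>

definition ckey :: "(nat \<times> nat \<Rightarrow> nat) \<Rightarrow> nat \<Rightarrow> nat" where
  "ckey u j = (\<Sum>c\<in>{c \<in> C. snd c = j}. u c)"

lemma ckey_comp: "\<pi> \<in> colperm \<Longrightarrow> ckey (u \<circ> \<pi>) = ckey u"
proof
  fix j assume p: "\<pi> \<in> colperm"
  then have P: "\<pi> permutes C" unfolding colperm_def by blast
  have "bij_betw \<pi> {c \<in> C. snd c = j} {c \<in> C. snd c = j}"
  proof (rule bij_betw_imageI)
    show "inj_on \<pi> {c \<in> C. snd c = j}" using permutes_inj[OF P] by (meson inj_on_subset subset_UNIV)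
    have "c \<in> \<pi> ` {c \<in> C. snd c = j}" if "c \<in> C" "snd c = j" for c
    proof -
      have "\<pi> (inv_into UNIV \<pi> c) = c" using permutes_inverses(1)[OF P] by simp
      then show ?thesis
        using that colperm_mem[OF p, of "inv_into UNIV \<pi> c"] colperm_snd[OF p, of "inv_into UNIV \<pi> c"]
        by (intro image_eqI[of _ _ "inv_into UNIV \<pi> c"]) auto
    qed
    then show "\<pi> ` {c \<in> C. snd c = j} = {c \<in> C. snd c = j}"
      using colperm_mem[OF p] colperm_snd[OF p] by fastforce
  qed
  from sum.reindex_bij_betw[OF this, of u] show "ckey (u \<circ> \<pi>) j = ckey u j"
    unfolding ckey_def by simp
qed

lemma ssyt_X: "t \<in> ssyt lam N \<Longrightarrow> t \<in> X"
  by (simp add: ssyt_def)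

text \<open>Rows of \<open>t\<close> increase weakly, so \<open>t\<close> uses up the contents of a
  row from the smallest entry on. A filling with the same row contents that agrees with
  \<open>t\<close> before column \<open>j\<close> has only entries at least \<open>t (a, j)\<close>
  left.\<close>

lemma same_contents_column_ge:
  assumes t: "t \<in> ssyt lam N" and u: "cnt u = cnt t"
    and eq: "\<And>j' a. (a, j') \<in> C \<Longrightarrow> j' < j \<Longrightarrow> u (a, j') = t (a, j')" and c: "(a, j) \<in> C"
  shows "t (a, j) \<le> u (a, j)"
proof (rule ccontr)
  assume "\<not> ?thesis"
  then have lt: "u (a, j) < t (a, j)" by simp
  let ?x = "u (a, j)"
  have "j' < j" if "j' < lam a" "t (a, j') = ?x" for j'
  proof (rule ccontr)
    assume "\<not> ?thesis"
    then have "t (a, j) \<le> t (a, j')" using ssyt_row_le[OF t, of j j' a] that by simp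
    with that lt show False by simp
  qed
  then have "{j'. j' < lam a \<and> t (a, j') = ?x} \<subseteq> {j'. j' < lam a \<and> u (a, j') = ?x} - {j}"
    using eq by (auto simp: mem_C)
  then have "cnt t a ?x \<le> card ({j'. j' < lam a \<and> u (a, j') = ?x} - {j})"
    unfolding cnt_def by (intro card_mono) auto
  also have "\<dots> < cnt u a ?x" unfolding cnt_def using c by (intro psubset_card_mono) (auto simp: mem_C)
  finally show False using u by simp
qed

text \<open>In the first column where the two fillings differ,
  \<open>same_contents_column_ge\<close> makes every entry of \<open>u\<close> at least that of
  \<open>t\<close>, so the column sum grows strictly.\<close>

lemma same_contents_key_less:
  assumes t: "t \<in> ssyt lam N" and uX: "u \<in> X" and u: "cnt u = cnt t" and ne: "u \<noteq> t"
  shows "\<exists>j < lam 0. ckey t j < ckey u j \<and> (\<forall>j' < j. ckey t j' = ckey u j')"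
proof -
  let ?P = "\<lambda>j. \<exists>a. (a, j) \<in> C \<and> u (a, j) \<noteq> t (a, j)"
  have "\<exists>c. u c \<noteq> t c" using ne by auto
  then obtain c where "u c \<noteq> t c" by blast
  moreover from this have "c \<in> C" using uX ssyt_X[OF t] by (metis PiE_arb)
  ultimately have ex: "\<exists>j. ?P j" by (cases c) auto
  define j where "j = (LEAST j. ?P j)"
  obtain a where a: "(a, j) \<in> C" "u (a, j) \<noteq> t (a, j)" using LeastI_ex[OF ex] unfolding j_def by blast
  have eq: "u (a', j') = t (a', j')" if "(a', j') \<in> C" "j' < j" for a' j'
    using not_less_Least[OF that(2)[unfolded j_def]] that(1) by blast
  have ge: "t (a', j) \<le> u (a', j)" if "(a', j) \<in> C" for a'
    by (rule same_contents_column_ge[OF t u]) (use eq that in auto)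
  have "ckey t j < ckey u j" unfolding ckey_def
  proof (rule sum_strict_mono_ex1)
    show "\<exists>c\<in>{c \<in> C. snd c = j}. t c < u c"
      using a ge[OF a(1)] by (intro bexI[of _ "(a, j)"]) auto
    show "\<forall>c\<in>{c \<in> C. snd c = j}. t c \<le> u c" using ge by (metis (mono_tags, lifting) mem_Collect_eq prod.collapse)
  qed (use finC in simp)
  moreover have "ckey t j' = ckey u j'" if "j' < j" for j'
    unfolding ckey_def using eq that by (intro sum.cong) auto
  moreover have "j < lam 0" using a part_mono[OF part, of 0 a] by (simp add: mem_C)
  ultimately show ?thesis by blast
qed

text \<open>The first moved cell \<open>(a, j)\<close> of a column goes to a cell further down and
  is itself the image of a cell further down. Strict increase of both tableaux along the column then
  gives \<open>t (a, j) < t (a, j)\<close>.\<close>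

lemma column_permuted_ssyt_eq:
  assumes t: "t \<in> ssyt lam N" and t': "t' \<in> ssyt lam N" and p: "\<pi> \<in> colperm" and eq: "t' \<circ> \<pi> = t"
  shows "\<pi> = id"
proof (rule colperm_id_if_fst[OF p])
  have P: "\<pi> permutes C" using p unfolding colperm_def by blast
  have "\<pi> (a, j) = (a, j)" if "(a, j) \<in> C" for a j
    using that
  proof (induction a rule: less_induct)
    case (less a)
    have IH: "\<pi> (y, j) = (y, j)" if "y < a" for y using less that C_up[OF less.prems, of y] by simp
    obtain x where x: "\<pi> (a, j) = (x, j)" using colperm_snd[OF p, of "(a, j)"] by (cases "\<pi> (a, j)") auto
    obtain y where y: "\<pi> (y, j) = (a, j)"
    proof -
      have "\<pi> (inv_into UNIV \<pi> (a, j)) = (a, j)" using permutes_inverses(1)[OF P] by simp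
      moreover from this have "snd (inv_into UNIV \<pi> (a, j)) = j" using colperm_snd[OF p, of "inv_into UNIV \<pi> (a, j)"] by simp
      ultimately show ?thesis using that[of "fst (inv_into UNIV \<pi> (a, j))"] by (metis prod.collapse)
    qed
    have inj: "\<pi> c = \<pi> c' \<Longrightarrow> c = c'" for c c' using permutes_inj[OF P] by (auto dest: injD)
    have xC: "(x, j) \<in> C" using colperm_mem[OF p, of "(a, j)"] x less.prems by simp
    have yC: "(y, j) \<in> C" using colperm_mem[OF p, of "(y, j)"] y less.prems by simp
    show ?case
    proof (cases "x = a")
      case False
      then have "a < x" using IH[of x] inj[of "(x, j)" "(a, j)"] x by (cases "x < a") auto
      then have 1: "t' (a, j) < t' (x, j)" using ssyt_col_less[OF t'] xC by (simp add: mem_C)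
      have "y \<noteq> a" using False x y by auto
      then have "a < y" using IH[of y] y by (cases "y < a") auto
      then have 2: "t (a, j) < t (y, j)" using ssyt_col_less[OF t] yC by (simp add: mem_C)
      have "t (a, j) = t' (x, j)" "t (y, j) = t' (a, j)" using x y by (simp_all flip: eq)
      with 1 2 show ?thesis by simp
    qed (use x in simp)
  qed
  then show "fst (\<pi> c) = fst c" if "c \<in> C" for c using that by (cases c) auto
qed

lemma tvec_nonzeroE:
  assumes "tvec t t' \<noteq> 0"
  obtains \<pi> where "\<pi> \<in> colperm" "t' \<circ> \<pi> \<in> X" "cnt (t' \<circ> \<pi>) = cnt t"
proof -
  have "\<exists>\<pi>\<in>colperm. of_int (sign \<pi>) * rsum t (t' \<circ> \<pi>) \<noteq> 0"
    using assms unfolding tvec_def asym_def by (meson sum.neutral)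
  then show ?thesis using that by (auto simp: rsum_def)
qed

lemma tvec_less:
  assumes t: "t \<in> ssyt lam N" and t': "t' \<in> ssyt lam N" and ne: "t \<noteq> t'" and nz: "tvec t t' \<noteq> 0"
  shows "(map (ckey t) [0..<lam 0], map (ckey t') [0..<lam 0]) \<in> lex less_than"
proof -
  obtain \<pi> where p: "\<pi> \<in> colperm" "t' \<circ> \<pi> \<in> X" "cnt (t' \<circ> \<pi>) = cnt t" using tvec_nonzeroE[OF nz] .
  have "t' \<circ> \<pi> \<noteq> t" using column_permuted_ssyt_eq[OF t t' p(1)] ne by auto
  from same_contents_key_less[OF t p(2,3) this] obtain j where j: "j < lam 0" "ckey t j < ckey t' j"
    "\<forall>j'<j. ckey t j' = ckey t' j'" unfolding ckey_comp[OF p(1)] by blast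
  have "[0..<lam 0] = [0..<j] @ j # [Suc j..<lam 0]"
    using j(1) upt_add_eq_append[of 0 j "lam 0 - j"] by (simp add: upt_conv_Cons)
  then have sp: "map f [0..<lam 0] = map f [0..<j] @ f j # map f [Suc j..<lam 0]" for f :: "nat \<Rightarrow> nat" by simp
  have eq: "map (ckey t') [0..<j] = map (ckey t) [0..<j]" using j(3) by simp
  have "\<exists>xys x y xs' ys'. map (ckey t) [0..<lam 0] = xys @ x # xs' \<and> map (ckey t') [0..<lam 0] = xys @ y # ys'
      \<and> (x, y) \<in> less_than"
    using sp[of "ckey t"] sp[of "ckey t'"] eq j(2) unfolding less_than_iff by metis
  then show ?thesis unfolding lex_conv by (simp only: mem_Collect_eq case_prod_conv length_map)
qed

lemma tvec_self:
  assumes t: "t \<in> ssyt lam N"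
  shows "tvec t t = 1"
proof -
  have "\<pi> = id" if p: "\<pi> \<in> colperm" "t \<circ> \<pi> \<in> X" "cnt (t \<circ> \<pi>) = cnt t" for \<pi>
  proof (cases "t \<circ> \<pi> = t")
    case True
    then show ?thesis using column_permuted_ssyt_eq[OF t t p(1)] by blast
  next
    case False
    from same_contents_key_less[OF t p(2,3) False] show ?thesis unfolding ckey_comp[OF p(1)] by blast
  qed
  then have "tvec t t = (\<Sum>\<pi>\<in>colperm. if \<pi> = id then 1 else 0)"
    unfolding tvec_def asym_def rsum_def using ssyt_X[OF t] by (intro sum.cong refl) (auto simp: sign_id)
  then show ?thesis using finite_colperm id_colperm by simp
qed

text \<open>Unitriangularity: evaluated at a least tableau with nonzero coefficient, a relation
  leaves that coefficient alone.\<close>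

lemma lin_indep_tvec: "lin_indep (ssyt lam N) tvec"
proof (rule lin_indepI, rule ccontr)
  fix c a assume z: "\<And>u. (\<Sum>t\<in>ssyt lam N. c t * tvec t u) = 0" and a: "a \<in> ssyt lam N" "c a \<noteq> 0"
  let ?r = "inv_image (lex less_than) (\<lambda>t. map (ckey t) [0..<lam 0])"
  have "wf ?r" by (intro wf_inv_image wf_lex wf_less_than)
  from wfE_min[OF this, of a "{t \<in> ssyt lam N. c t \<noteq> 0}"] a
  obtain t0 where t0: "t0 \<in> ssyt lam N" "c t0 \<noteq> 0"
    and min: "\<And>t. (t, t0) \<in> ?r \<Longrightarrow> t \<in> ssyt lam N \<Longrightarrow> c t = 0" by auto
  have "c t * tvec t t0 = (if t = t0 then c t0 else 0)" if "t \<in> ssyt lam N" for t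
    using tvec_self[OF t0(1)] tvec_less[OF that t0(1)] min[of t] that by (auto simp: in_inv_image)
  then have "(\<Sum>t\<in>ssyt lam N. c t * tvec t t0) = c t0"
    using finite_ssyt[OF part, of N] t0 by simp
  with z t0 show False by simp
qed

lemma inW_tvec_ssyt: "t \<in> ssyt lam N \<Longrightarrow> inW (tvec t)"
  using ssyt_row_ge[OF part] by (intro inW_tvec ssyt_X) (auto simp: cells_def)

lemma inW_in_span:
  assumes "gg_basis N (iw lam) B" and "inW x"
  shows "in_span B (\<lambda>w. ap (fw (F.lf C) w) hvec) x"
proof -
  from assms(2) obtain A c where A: "finite A" "A \<subseteq> Wd N" "\<forall>S. x S = (\<Sum>w\<in>A. c w * ap (fw (F.lf C) w) hvec S)"
    unfolding inW_def by blast
  have "in_span A (\<lambda>w. ap (fw (F.lf C) w) hvec) x" using A(3) unfolding in_span_def by blast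
  then show ?thesis
    by (rule in_span_trans[OF A(1)]) (use A P.in_span_basis_words[OF hvec_hwv supp_hvec hvec_nonzero assms(1)] in blast)
qed

text \<open>One half of the dimension formula; the other half comes from counting pairs of tableaux
  in the exterior algebra.\<close>

lemma card_ssyt_le:
  assumes "gg_basis N (iw lam) B"
  shows "card (ssyt lam N) \<le> card B"
  using assms inW_in_span[OF assms inW_tvec_ssyt] finite_ssyt[OF part] lin_indep_tvec
  by (intro card_le_of_lin_indep_in_span) (auto simp: gg_basis_def)

end

section \<open>Quantized irreducible modules\<close>

section \<open>Lifting words from \<open>q = 1\<close> to generic \<open>q\<close>\<close>

context posact begin

text \<open>The analogue of \<open>words_relation_iff\<close> for the lists produced by
  \<open>EW\<close>. The right-hand side depends on the weight alone, which lets a relation found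
  for one highest weight vector be used for another.\<close>

lemma lcomb_relation_iff:
  assumes z: "hwv kp z" "supp_in X z" "z \<noteq> (\<lambda>S. 0)" and B: "finite B" "B \<subseteq> Wd M"
    and L: "\<And>k u. (k, u) \<in> set L \<Longrightarrow> u \<in> Wd M"
  shows "(\<forall>S. lcomb L (\<lambda>w. ap (fw f w) z) S = (\<Sum>w\<in>B. c w * ap (fw f w) z S))
    \<longleftrightarrow> (\<forall>u\<in>Wd M. (\<Sum>(k, w)\<leftarrow>L. k * GG kp u w) = (\<Sum>w\<in>B. c w * GG kp u w))"
proof -
  let ?Y = "\<lambda>w. ap (fw f w) z"
  let ?d = "\<lambda>S. lcomb L ?Y S - (\<Sum>w\<in>B. c w * ?Y w S)"
  have nz: "form cnj X z z \<noteq> 0" using form_cnj_pos[OF fin z(2)] z(3) by blast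
  have F: "form cnj X (?Y u) ?d = ((\<Sum>(k, w)\<leftarrow>L. k * GG kp u w) - (\<Sum>w\<in>B. c w * GG kp u w)) * form cnj X z z"
    if u: "u \<in> Wd M" for u
  proof -
    have "(\<Sum>(k, w)\<leftarrow>L. k * form cnj X (?Y u) (?Y w)) = (\<Sum>(k, w)\<leftarrow>L. k * GG kp u w * form cnj X z z)"
      using words_gram[OF z(1,2) z(1,2) u] by (intro arg_cong[where f = sum_list] map_cong refl) (auto dest: L)
    moreover have "(\<Sum>w\<in>B. c w * form cnj X (?Y u) (?Y w)) = (\<Sum>w\<in>B. c w * GG kp u w * form cnj X z z)"
      using words_gram[OF z(1,2) z(1,2) u] B by (intro sum.cong refl) (auto simp: mult.assoc)
    ultimately show ?thesis
      by (simp add: form_diff form_sum form_lcomb sum_list_case_mult sum_distrib_right left_diff_distrib)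
  qed
  show ?thesis
  proof
    assume "\<forall>S. lcomb L ?Y S = (\<Sum>w\<in>B. c w * ?Y w S)"
    then have "?d = (\<lambda>S. 0)" by simp
    then have d0: "form cnj X (?Y u) ?d = 0" for u by (simp only: form_0)
    show "\<forall>u\<in>Wd M. (\<Sum>(k, w)\<leftarrow>L. k * GG kp u w) = (\<Sum>w\<in>B. c w * GG kp u w)"
    proof
      fix u assume "u \<in> Wd M"
      from F[OF this] nz show "(\<Sum>(k, w)\<leftarrow>L. k * GG kp u w) = (\<Sum>w\<in>B. c w * GG kp u w)"
        unfolding d0 by simp
    qed
  next
    assume R: "\<forall>u\<in>Wd M. (\<Sum>(k, w)\<leftarrow>L. k * GG kp u w) = (\<Sum>w\<in>B. c w * GG kp u w)"
    have 0: "form cnj X ?d (?Y u) = 0" if "u \<in> Wd M" for u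
      using F[OF that] R that form_sym[of "?Y u" ?d] by simp
    have "(\<Sum>(k, w)\<leftarrow>L. k * form cnj X ?d (?Y w)) = 0"
      using 0 by (intro sum_list_case_zero) (auto dest: L)
    moreover have "(\<Sum>w\<in>B. c w * form cnj X ?d (?Y w)) = 0"
      using 0 B by (intro sum.neutral) auto
    ultimately have dd: "form cnj X ?d ?d = 0" by (simp add: form_diff form_sum form_lcomb)
    have "supp_in X (lcomb L ?Y)"
      unfolding supp_in_def lcomb_def
    proof (intro allI impI sum_list_case_zero)
      fix b k u assume "b \<notin> X" "(k, u) \<in> set L"
      then show "k * ?Y u b = 0" using supp_word[OF L z(2)] unfolding supp_in_def by auto
    qed
    moreover have "supp_in X (\<lambda>S. \<Sum>w\<in>B. c w * ?Y w S)"
      using supp_word z B by (intro supp_in_sum) auto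
    ultimately have "supp_in X ?d" unfolding supp_in_def by simp
    from form_cnj_pos[OF fin this dd] have "?d S = 0" for S by (rule fun_cong)
    then show "\<forall>S. lcomb L ?Y S = (\<Sum>w\<in>B. c w * ?Y w S)" by simp
  qed
qed

end

lemma sum_alpha: "(\<Sum>k\<le>i. alpha j k) = (if i = j then 1 else 0)"
  by (induction i) (auto simp: alpha_def)

lemma sum_wtw: "(\<Sum>k\<le>i. wtw kp w k) = (\<Sum>k\<le>i. kp k) - int (count_list w i)"
  by (induction w) (auto simp: sum_subtractf sum_alpha)

text \<open>By \<open>sum_wtw\<close> every letter lowers a partial sum of the weight.\<close>

lemma wtw_eq_self: "wtw kp w = kp \<Longrightarrow> w = []"
proof (rule ccontr)
  assume "wtw kp w = kp" "w \<noteq> []"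
  then obtain i where "i \<in> set w" by (meson last_in_set)
  then have "count_list w i \<noteq> 0" by (simp add: count_list_0_iff)
  with sum_wtw[of kp w i] \<open>wtw kp w = kp\<close> show False by simp
qed

text \<open>One choice for each highest weight, shared by the exterior algebra and the tensor power;
  this is possible because \<open>gg_basis\<close> refers to no realization.\<close>

definition Bs :: "nat \<Rightarrow> (nat \<Rightarrow> nat) \<Rightarrow> nat list set" where
  "Bs m al = (SOME B. gg_basis m (iw al) B)"

lemma in_box_part: "in_box m r al \<longleftrightarrow> part m al \<and> al 0 \<le> r"
  unfolding in_box_def part_def antimono_def by (auto intro: le_trans)

lemma delta_nonzero: "delta b \<noteq> (\<lambda>S. 0::'k::zero_neq_one)"
  by (auto simp: delta_def fun_eq_iff)

lemma in_box_conjp: "in_box m r al \<Longrightarrow> in_box r m (conjp al)"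
proof -
  assume "in_box m r al"
  then have a: "part m al" "\<And>i. al i \<le> r" unfolding in_box_def part_def by auto
  have "\<not> m < conjp al 0" using less_conjp_iff[OF a(1), of m 0] part_zero[OF a(1), of m] by simp
  then show ?thesis unfolding in_box_part using conjp_part[OF a] by simp
qed

text \<open>The exterior algebra on the narrowest rectangle with \<open>m\<close> rows that holds
  the diagram provides a highest weight vector of weight \<open>al\<close>.\<close>

lemma gg_basis_Bs:
  assumes "part m al"
  shows "gg_basis m (iw al) (Bs m al)"
proof -
  interpret posact2 m "al 0" "wts s1 (al 0)" "wts s2 m" "chn 1 s1 True (al 0)" "fop 1 s1 (al 0)" "E2 1 s2 m" "F2 1 s2 m"
    "Pst (rect m (al 0))" by (rule ext_posact2)
  have "in_box m (al 0) al" using assms in_box_part by blast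
  from young_hw2[OF real_conj_cnj this] have "A.hwv (iw al) (delta (young al))" "supp_in (Pst (rect m (al 0))) (delta (young al) :: _ \<Rightarrow> complex)"
    unfolding hw2_def by auto
  from A1.gg_basis_exists[OF this delta_nonzero] show ?thesis
    unfolding Bs_def by (rule someI_ex)
qed

lemma young_inj: "young al = young be \<Longrightarrow> al = be"
proof
  fix i assume "young al = young be"
  then have "c < al i \<longleftrightarrow> c < be i" for c by (metis (no_types, lifting) case_prod_conv young_def)
  then show "al i = be i" by (rule nat_eq_iff_less)
qed

definition IY :: "nat \<Rightarrow> nat \<Rightarrow> ((nat \<Rightarrow> nat) \<times> nat list \<times> nat list) set" where
  "IY m r = Sigma {al. in_box m r al} (\<lambda>al. Bs m al \<times> Bs r (conjp al))"

definition YY :: "'k::field \<Rightarrow> nat \<Rightarrow> nat \<Rightarrow> (nat \<Rightarrow> nat) \<times> nat list \<times> nat list \<Rightarrow> (nat \<times> nat \<Rightarrow> bool) \<Rightarrow> 'k" where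
  "YY q m r = (\<lambda>(al, w, w'). ap (fw (fop q s1 r) w) (ap (fw (F2 q s2 m) w') (delta (young al))))"

lemma form_delta: "form cj X (delta b) x = (if b \<in> X then cj 1 * x b else 0)" if "finite X" "cj 0 = 0"
proof -
  have "form cj X (delta b) x = (\<Sum>S\<in>X. if S = b then cj 1 * x S else 0)"
    unfolding form_def delta_def using that(2) by (intro sum.cong refl) simp
  then show ?thesis using that(1) by simp
qed

lemma form_delta_orthogonal: "b \<noteq> b' \<Longrightarrow> cj 0 = 0 \<Longrightarrow> form cj X (delta b) (delta b') = 0"
  unfolding form_def delta_def by (intro sum.neutral) auto

lemma finite_IY: "finite (IY m r)"
proof -
  have "finite (Bs m al \<times> Bs r (conjp al))" if "in_box m r al" for al
    using gg_basis_Bs[of m al] gg_basis_Bs[of r "conjp al"] that in_box_conjp[OF that]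
    unfolding in_box_part gg_basis_def by auto
  then show ?thesis unfolding IY_def using finite_in_box by auto
qed

lemma lin_indep_YY_1: "lin_indep (IY m r) (YY (1::complex) m r)"
proof -
  interpret posact2 m r "wts s1 r" "wts s2 m" "chn 1 s1 True r" "fop 1 s1 r" "E2 1 s2 m" "F2 1 s2 m"
    "Pst (rect m r)" by (rule ext_posact2)
  have "lin_indep (Sigma {al. in_box m r al} (\<lambda>al. Bs m al \<times> Bs r (conjp al)))
      (\<lambda>(al, w, w'). word2 (delta (young al)) w w')"
  proof (rule lin_indep_blocks[where kp = iw and kp' = "\<lambda>al. iw (conjp al)" and x = "\<lambda>al. delta (young al)"
        and L = "{al. in_box m r al}" and B = "Bs m" and B' = "\<lambda>al. Bs r (conjp al)"])
    fix al assume a: "al \<in> {al. in_box m r al}"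
    then have "in_box m r al" by simp
    from conjI[OF young_hw2[OF real_conj_cnj this] delta_nonzero]
    show "hw2 (iw al) (iw (conjp al)) (delta (young al)) \<and> delta (young al) \<noteq> (\<lambda>S. 0::complex)" .
    show "gg_basis m (iw al) (Bs m al)" "gg_basis r (iw (conjp al)) (Bs r (conjp al))"
      using a gg_basis_Bs in_box_conjp unfolding in_box_part by auto
    fix be assume "be \<in> {al. in_box m r al}" "al \<noteq> be"
    then have "young al \<noteq> young be" using young_inj by blast
    then show "form cnj (Pst (rect m r)) (delta (young al)) (delta (young be)) = 0"
      by (rule form_delta_orthogonal) simp
  qed (rule finite_in_box)
  then show ?thesis unfolding IY_def YY_def word2_def .
qed

lemma YY_supp:
  fixes q :: "'k::field"
  assumes "q \<noteq> 0" and "y \<in> IY m r"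
  shows "supp_in (Pst (rect m r)) (YY q m r y)"
proof -
  interpret formact2 m r q q "wts s1 r" "wts s2 m" "chn q s1 True r" "fop q s1 r" "E2 q s2 m" "F2 q s2 m"
    "Pst (rect m r)" "\<lambda>x. x" "h1 q" "h2 q" by (rule ext_formact2[OF real_conj_id[OF assms(1)]])
  obtain al w w' where y: "y = (al, w, w')" "in_box m r al" "w \<in> Bs m al" "w' \<in> Bs r (conjp al)"
    using assms(2) unfolding IY_def by auto
  then have "w \<in> Wd m" "w' \<in> Wd r"
    using gg_basis_Bs[of m al] gg_basis_Bs[of r "conjp al"] in_box_conjp[OF y(2)]
    unfolding in_box_part gg_basis_def by auto
  from supp_word2[OF young_hw2[OF real_conj_id[OF assms(1)] y(2)] this]
  show ?thesis unfolding YY_def y word2_def by simp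
qed

lemma card_Pst_rect: "card (Pst (rect m r)) = 2 ^ (m * r)"
  by (subst card_Pst) simp_all

text \<open>A squeeze: each block has at least as many words as there are pairs of tableaux, these
  pairs add up to \<open>2 ^ (m * r)\<close>, and independence at \<open>q = 1\<close> allows no
  more words than that. Hence equality holds in every block and, the factors being nonzero, for each
  word basis.\<close>

lemma card_IY_eq: "card (IY m r) = 2 ^ (m * r)"
  and card_Bs: "part m al \<Longrightarrow> card (Bs m al) = card (ssyt al m)"
proof -
  have le: "card (ssyt al m) \<le> card (Bs m al)" if "part m al" for al m
    using shape.card_ssyt_le[OF shape.intro[OF that] gg_basis_Bs[OF that]] .
  have C: "card (IY m r) = (\<Sum>al\<in>{al. in_box m r al}. card (Bs m al) * card (Bs r (conjp al)))" for r
  proof -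
    have "finite (Bs m al)" "finite (Bs r (conjp al))" if "in_box m r al" for al
      using gg_basis_Bs[of m al] gg_basis_Bs[of r "conjp al"] that in_box_conjp[OF that]
      unfolding in_box_part gg_basis_def by auto
    then show ?thesis unfolding IY_def using finite_in_box
      by (subst card_SigmaI) (simp_all add: card_cartesian_product)
  qed
  have up: "card (IY m r) \<le> 2 ^ (m * r)" for r
    unfolding card_Pst_rect[symmetric]
    by (rule card_le_of_lin_indep_supp[OF _ finite_IY lin_indep_YY_1]) (simp_all add: finite_Pst YY_supp)
  have lo: "card (ssyt al m) * card (ssyt (conjp al) r) \<le> card (Bs m al) * card (Bs r (conjp al))"
    if "in_box m r al" for al r
    using le that in_box_conjp[OF that] unfolding in_box_part by (intro mult_le_mono) auto
  show "card (IY m r) = 2 ^ (m * r)"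
  proof (rule antisym[OF up])
    show "2 ^ (m * r) \<le> card (IY m r)"
      unfolding C card_ssyt_pairs[symmetric] using lo by (intro sum_mono) auto
  qed
  \<comment> \<open>The empty word pairs to 1 with itself in \<open>GG\<close>, so a word basis is
    never empty; this permits cancelling a factor below.\<close>
  have nz: "card (Bs m al) \<noteq> 0" if p: "part m al" for m al
  proof
    assume "card (Bs m al) = 0"
    then have "Bs m al = {}" using gg_basis_Bs[OF p] unfolding gg_basis_def by simp
    then have "\<forall>u\<in>Wd m. GG (iw al) u [] = 0" using gg_basis_Bs[OF p] unfolding gg_basis_def by force
    from bspec[OF this, of "[]"] show False by simp
  qed
  show "card (Bs m al) = card (ssyt al m)" if p: "part m al"
  proof (rule antisym[OF _ le[OF p]])
    let ?r = "al 0"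
    have b: "in_box m ?r al" using p in_box_part by blast
    have cp: "part ?r (conjp al)" using in_box_conjp[OF b] in_box_part by blast
    let ?A = "\<lambda>be. card (ssyt be m) * card (ssyt (conjp be) ?r)"
    let ?B = "\<lambda>be. card (Bs m be) * card (Bs ?r (conjp be))"
    have "(\<Sum>be\<in>{be. in_box m ?r be}. ?B be) \<le> (\<Sum>be\<in>{be. in_box m ?r be}. ?A be)"
      using up[of ?r] unfolding C card_ssyt_pairs .
    note le' = this
    have "?B al \<le> ?A al"
    proof (rule ccontr)
      assume "\<not> ?B al \<le> ?A al"
      then have lt: "?A al < ?B al" by (simp only: not_le)
      have "(\<Sum>be\<in>{be. in_box m ?r be}. ?A be) < (\<Sum>be\<in>{be. in_box m ?r be}. ?B be)"
      proof (rule sum_strict_mono_ex1[OF finite_in_box])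
        show "\<forall>be\<in>{be. in_box m ?r be}. ?A be \<le> ?B be" using lo by blast
        show "\<exists>be\<in>{be. in_box m ?r be}. ?A be < ?B be" by (rule bexI[of _ al], rule lt) (simp add: b)
      qed
      with le' show False by linarith
    qed
    then have 1: "card (Bs m al) * card (Bs ?r (conjp al)) \<le> card (ssyt al m) * card (Bs ?r (conjp al))"
      using le[OF cp] by (meson le_trans mult_le_mono2)
    then show "card (Bs m al) \<le> card (ssyt al m)" using nz[OF cp] by simp
  qed
qed

lemma delta_regular: "regular_at_one (delta b S)" and delta_at_one: "at_one (delta b S) = delta b S"
  by (auto simp: delta_def)

lemma YY_regular: "regular_at_one (YY qq m r y S)"
  and YY_at_one: "at_one (YY qq m r y S) = YY 1 m r y S"
proof -
  obtain al w w' where y: "y = (al, w, w')" by (cases y) auto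
  have 1: "specializes (fw (fop qq s1 r) w) (fw (fop 1 s1 r) w)"
    by (intro specializes_fw specializes_fop) auto
  have 2: "specializes (fw (F2 qq s2 m) w') (fw (F2 1 s2 m) w')"
    by (intro specializes_fw specializes_F2)
  have "specializes (fw (fop qq s1 r) w * fw (F2 qq s2 m) w') (fw (fop 1 s1 r) w * fw (F2 1 s2 m) w')"
    by (rule specializes_mult[OF 1 2])
  from specializesD[OF this delta_regular[of "young al"]]
  show "regular_at_one (YY qq m r y S)" "at_one (YY qq m r y S) = YY 1 m r y S"
    unfolding YY_def y delta_at_one by simp_all
qed

lemma lin_indep_YY: "lin_indep (IY m r) (YY qq m r)"
  by (rule lin_indep_of_at_one[OF finite_IY]) (simp_all add: YY_regular YY_at_one lin_indep_YY_1)

text \<open>The words stay independent over C(q) and are as many as the states, so they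
  span.\<close>

lemma span_YY: "supp_in (Pst (rect m r)) x \<Longrightarrow> in_span (IY m r) (YY qq m r) x"
  by (rule in_span_of_card_eq[OF finite_Pst finite_IY lin_indep_YY YY_supp]) (simp_all add: card_IY_eq card_Pst_rect)

text \<open>The blocks of the exterior algebra are orthogonal and all of it is spanned by the words,
  hence a vector in the block of \<open>al\<close> with the column weight of the highest weight vector is a combination
  of the basis words, with coefficients that are regular at \<open>q = 1\<close>.\<close>

lemma word_expansion:
  assumes a: "in_box m r al" and x: "\<And>S. regular_at_one (x S)"
    and xL: "x = lcomb L (\<lambda>u. ap (fw (fop qq s1 r) u) (delta (young al)))"
    and L: "\<And>k u. (k, u) \<in> set L \<Longrightarrow> u \<in> Wd m"
  shows "\<exists>c. (\<forall>u\<in>Bs m al. regular_at_one (c u)) \<and>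
    (\<forall>S. x S = (\<Sum>u\<in>Bs m al. c u * ap (fw (fop qq s1 r) u) (delta (young al)) S))"
proof -
  note rc = real_conj_id[OF qq_nonzero]
  interpret formact2 m r qq qq "wts s1 r" "wts s2 m" "chn qq s1 True r" "fop qq s1 r" "E2 qq s2 m" "F2 qq s2 m"
    "Pst (rect m r)" "\<lambda>x. x" "h1 qq" "h2 qq" by (rule ext_formact2[OF rc])
  let ?X = "Pst (rect m r)" and ?v = "\<lambda>al. delta (young al) :: (nat \<times> nat \<Rightarrow> bool) \<Rightarrow> ratfun"
    and ?bil = "form (\<lambda>x. x) (Pst (rect m r)) :: ((nat \<times> nat \<Rightarrow> bool) \<Rightarrow> ratfun) \<Rightarrow> _"
  have Wd: "w \<in> Wd m" "w' \<in> Wd r" "in_box m r be" if "(be, w, w') \<in> IY m r" for be w w'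
  proof -
    from that have b: "in_box m r be" "w \<in> Bs m be" "w' \<in> Bs r (conjp be)" unfolding IY_def by auto
    then show "w \<in> Wd m" "w' \<in> Wd r" "in_box m r be"
      using gg_basis_Bs[of m be] gg_basis_Bs[of r "conjp be"] in_box_conjp[OF b(1)]
      unfolding in_box_part gg_basis_def by auto
  qed
  have hw: "hw2 (iw be) (iw (conjp be)) (?v be)" if "in_box m r be" for be by (rule young_hw2[OF rc that])
  have YYw: "YY qq m r (be, w, w') = word2 (?v be) w w'" for be w w' by (simp add: YY_def word2_def)
  have xw: "x = lcomb L (\<lambda>u. word2 (?v al) u [])" unfolding xL word2_def by simp
  have suppx: "supp_in ?X x" unfolding supp_in_def xw lcomb_def
  proof (intro allI impI sum_list_case_zero)
    fix b k u assume "b \<notin> ?X" "(k, u) \<in> set L"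
    then show "k * word2 (?v al) u [] b = 0"
      using supp_word2[OF hw[OF a] L, of k u "[]"] unfolding supp_in_def by auto
  qed
  from span_YY[OF suppx] obtain c where c: "\<And>S. x S = (\<Sum>y\<in>IY m r. c y * YY qq m r y S)"
    unfolding in_span_def by blast
  have "lin_indep (IY m r) (\<lambda>y S. at_one (YY qq m r y S))" unfolding YY_at_one by (rule lin_indep_YY_1)
  from regular_coefficients[OF finite_IY YY_regular this x c]
  have reg: "\<forall>y\<in>IY m r. regular_at_one (c y)" .
  define Ia where "Ia = {y \<in> IY m r. fst y = al}"
  define Ib where "Ib = {y \<in> IY m r. fst y \<noteq> al}"
  have fI: "finite Ia" "finite Ib" unfolding Ia_def Ib_def using finite_IY by auto
  have split: "(\<Sum>y\<in>IY m r. g y) = (\<Sum>y\<in>Ia. g y) + (\<Sum>y\<in>Ib. g y)" for g :: "_ \<Rightarrow> ratfun"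
    unfolding Ia_def Ib_def using finite_IY by (subst sum.union_disjoint[symmetric]) (auto intro!: sum.cong)
  have IaE: "\<exists>u u'. y = (al, u, u') \<and> (al, u, u') \<in> IY m r" if "y \<in> Ia" for y
    using that unfolding Ia_def by (cases y) auto
  \<comment> \<open>\<open>z\<close> is the part of \<open>x\<close> outside the block of
    \<open>al\<close>; it turns out to be orthogonal to everything.\<close>
  define z where "z = (\<lambda>S. \<Sum>y\<in>Ib. c y * YY qq m r y S)"
  have zx: "z = (\<lambda>S. x S - (\<Sum>y\<in>Ia. c y * YY qq m r y S))"
    unfolding z_def c split by simp
  have orth: "?bil (YY qq m r y) (word2 (?v ga) u u') = 0"
    if "y \<in> IY m r" "in_box m r ga" "fst y \<noteq> ga" "u \<in> Wd m" "u' \<in> Wd r" for y ga u u'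
  proof -
    obtain be w w' where y: "y = (be, w, w')" by (cases y) auto
    have "young be \<noteq> young ga" using that(3) young_inj[of be ga] unfolding y by auto
    then have "?bil (?v be) (?v ga) = 0" by (rule form_delta_orthogonal) simp
    then show ?thesis using Wd[of be w w'] that unfolding y YYw
      by (intro word2_orthogonal[OF hw hw]) auto
  qed
  \<comment> \<open>The words of the block of \<open>al\<close> are orthogonal to every term of
    \<open>z\<close>; for the remaining words, \<open>z\<close> is rewritten as \<open>x\<close>
    minus terms of that block.\<close>
  have zperp: "?bil (YY qq m r y) z = 0" if y: "y \<in> IY m r" for y
  proof (cases "fst y = al")
    case True
    have "?bil (YY qq m r y) (YY qq m r y') = 0" if "y' \<in> Ib" for y'
    proof -
      obtain ga u u' where y': "y' = (ga, u, u')" by (cases y') auto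
      with that have "(ga, u, u') \<in> IY m r" "ga \<noteq> al" unfolding Ib_def by auto
      then show ?thesis using orth[OF y, of ga u u'] Wd[of ga u u'] True unfolding y' YYw by auto
    qed
    then show ?thesis unfolding z_def form_sum by (intro sum.neutral) auto
  next
    case False
    have "?bil (YY qq m r y) x = 0" unfolding xw form_lcomb
      using orth[OF y a False L] by (intro sum_list_case_zero) auto
    moreover have "?bil (YY qq m r y) (YY qq m r y') = 0" if "y' \<in> Ia" for y'
    proof -
      obtain u u' where y': "y' = (al, u, u')" "(al, u, u') \<in> IY m r" using IaE[of y'] \<open>y' \<in> Ia\<close> by blast
      then show ?thesis using orth[OF y a False, of u u'] Wd[of al u u'] unfolding y'(1) YYw by auto
    qed
    then have "?bil (YY qq m r y) (\<lambda>S. \<Sum>y\<in>Ia. c y * YY qq m r y S) = 0"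
      unfolding form_sum by (intro sum.neutral) auto
    ultimately show ?thesis unfolding zx form_diff by simp
  qed
  \<comment> \<open>Pairing with \<open>delta S\<close> reads off the value at \<open>S\<close>, so
    the bilinear form is nondegenerate; this takes the place of positivity.\<close>
  have z0: "z S = 0" for S
  proof (cases "S \<in> ?X")
    case True
    then have "supp_in ?X (delta S :: _ \<Rightarrow> ratfun)" by (auto simp: supp_in_def delta_def)
    from span_YY[OF this] obtain d where d: "delta S = (\<lambda>S'. \<Sum>y\<in>IY m r. d y * YY qq m r y S')"
      unfolding in_span_def by auto
    have "?bil z (delta S) = 0" unfolding d form_sum
    proof (intro sum.neutral ballI)
      fix y assume "y \<in> IY m r"
      then show "d y * ?bil z (YY qq m r y) = 0" using zperp[of y] A.form_sym[of "YY qq m r y" z] by simp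
    qed
    then have "?bil (delta S) z = 0" using A.form_sym[of z "delta S"] by simp
    then show ?thesis using True by (simp add: form_delta A.fin)
  next
    case False
    have "supp_in ?X z" unfolding z_def
      by (rule supp_in_sum) (auto simp: Ib_def YY_supp)
    with False show ?thesis unfolding supp_in_def by blast
  qed
  have xa: "x S = (\<Sum>y\<in>Ia. c y * YY qq m r y S)" for S using fun_cong[OF zx, of S] z0[of S] by simp
  \<comment> \<open>Only terms with empty second word can remain, because \<open>x\<close> has the
    highest weight for the second action and a nonempty word would lower it.\<close>
  define Ie where "Ie = {y \<in> Ia. snd (snd y) = []}"
  have xe: "x S = (\<Sum>y\<in>Ie. c y * YY qq m r y S)" for S
  proof (cases "wts s2 m S = iw (conjp al)")
    case True
    have "c y * YY qq m r y S = 0" if y: "y \<in> Ia - Ie" for y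
    proof -
      obtain u u' where y': "y = (al, u, u')" "(al, u, u') \<in> IY m r" "u' \<noteq> []"
        using IaE[of y] y unfolding Ie_def by auto
      have "has_wt (wts s2 m) (wtw (iw (conjp al)) u') (YY qq m r y)"
        unfolding y' YYw using has_wt_word2(2)[OF hw[OF a]] Wd[OF y'(2)] by blast
      then show ?thesis using True wtw_eq_self[of "iw (conjp al)" u'] y'(3) unfolding has_wt_def by auto
    qed
    then show ?thesis unfolding xa using fI by (intro sum.mono_neutral_right) (auto simp: Ie_def)
  next
    case False
    have W: "word2 (?v al) u [] S = 0" if "u \<in> Wd m" for u
      using has_wt_word2(2)[OF hw[OF a] that, of "[]"] False unfolding has_wt_def by auto
    have "x S = 0" unfolding xw lcomb_def using W by (intro sum_list_case_zero) (auto dest: L)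
    moreover have "(\<Sum>y\<in>Ie. c y * YY qq m r y S) = 0"
    proof (intro sum.neutral ballI)
      fix y assume "y \<in> Ie"
      then obtain u where y: "y = (al, u, [])" "(al, u, []) \<in> IY m r" using IaE[of y] unfolding Ie_def by auto
      then show "c y * YY qq m r y S = 0" using W[of u] Wd[of al u "[]"] unfolding y YYw by auto
    qed
    ultimately show ?thesis by simp
  qed
  \<comment> \<open>Should the empty word be missing from the second basis, \<open>Ie\<close> is
    empty and all coefficients are 0.\<close>
  define c' where "c' u = (if [] \<in> Bs r (conjp al) then c (al, u, []) else 0)" for u
  have Ie: "Ie = (if [] \<in> Bs r (conjp al) then (\<lambda>u. (al, u, [])) ` Bs m al else {})"
    using a unfolding Ie_def Ia_def IY_def by force
  have "x S = (\<Sum>u\<in>Bs m al. c' u * ap (fw (fop qq s1 r) u) (?v al) S)" for S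
    unfolding xe Ie c'_def by (auto simp: sum.reindex inj_on_def YY_def)
  moreover have "regular_at_one (c' u)" if "u \<in> Bs m al" for u
    using reg a that unfolding c'_def IY_def by auto
  ultimately show ?thesis by blast
qed

section \<open>Matrices of operators with respect to a family of functions\<close>

definition rep :: "nat \<Rightarrow> (nat \<Rightarrow> 'b \<Rightarrow> 'k::field) \<Rightarrow> ('b, 'k) lop \<Rightarrow> 'k mat \<Rightarrow> bool" where
  "rep d Y A M \<longleftrightarrow> M \<in> carrier_mat d d \<and> (\<forall>j<d. \<forall>x. ap A (Y j) x = (\<Sum>i<d. M $$ (i, j) * Y i x))"

lemma repI: "M \<in> carrier_mat d d \<Longrightarrow> (\<And>j x. j < d \<Longrightarrow> ap A (Y j) x = (\<Sum>i<d. M $$ (i, j) * Y i x)) \<Longrightarrow> rep d Y A M"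
  unfolding rep_def by blast

lemma rep_carrier: "rep d Y A M \<Longrightarrow> M \<in> carrier_mat d d"
  unfolding rep_def by blast

lemma rep_ap: "rep d Y A M \<Longrightarrow> j < d \<Longrightarrow> ap A (Y j) = (\<lambda>x. \<Sum>i<d. M $$ (i, j) * Y i x)"
  unfolding rep_def by blast

lemma rep_mult:
  assumes A: "rep d Y A M" and B: "rep d Y B M'"
  shows "rep d Y (A * B) (M * M')"
proof (rule repI)
  have c: "M \<in> carrier_mat d d" "M' \<in> carrier_mat d d" using rep_carrier assms by blast+
  then show "M * M' \<in> carrier_mat d d" by simp
  fix j x assume j: "j < d"
  have "ap (A * B) (Y j) x = (\<Sum>k<d. M' $$ (k, j) * ap A (Y k) x)"
    unfolding ap_simps(1) rep_ap[OF B j] ap_sum ..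
  also have "\<dots> = (\<Sum>k<d. \<Sum>i<d. M $$ (i, k) * M' $$ (k, j) * Y i x)"
    using rep_ap[OF A] by (intro sum.cong refl) (simp add: sum_distrib_left mult_ac)
  also have "\<dots> = (\<Sum>i<d. (\<Sum>k<d. M $$ (i, k) * M' $$ (k, j)) * Y i x)"
    unfolding sum_distrib_right by (rule sum.swap)
  also have "\<dots> = (\<Sum>i<d. (M * M') $$ (i, j) * Y i x)"
    using c j by (intro sum.cong refl arg_cong2[where f = "(*)"]) (simp_all add: scalar_prod_def atLeast0LessThan)
  finally show "ap (A * B) (Y j) x = (\<Sum>i<d. (M * M') $$ (i, j) * Y i x)" .
qed

lemma rep_add: "rep d Y A M \<Longrightarrow> rep d Y B M' \<Longrightarrow> rep d Y (A + B) (M + M')"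
  unfolding rep_def by (auto simp: distrib_right sum.distrib)

lemma rep_diff: "rep d Y A M \<Longrightarrow> rep d Y B M' \<Longrightarrow> rep d Y (A - B) (M - M')"
  unfolding rep_def by (auto simp: left_diff_distrib sum_subtractf)

lemma rep_sc: "rep d Y A M \<Longrightarrow> rep d Y (sc c * A) (c \<cdot>\<^sub>m M)"
  unfolding rep_def by (auto simp: sum_distrib_left mult.assoc)

lemma rep_0: "rep d Y 0 (0\<^sub>m d d)"
  unfolding rep_def by auto

lemma rep_diag:
  assumes "\<And>j x. j < d \<Longrightarrow> ap A (Y j) x = g j * Y j x"
  shows "rep d Y A (mat_diag d g)"
proof (rule repI)
  fix j x assume j: "j < d"
  have "(\<Sum>i<d. mat_diag d g $$ (i, j) * Y i x) = (\<Sum>i<d. if i = j then g j * Y j x else 0)"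
    using j by (intro sum.cong refl) (auto simp: mat_diag_def)
  then show "ap A (Y j) x = (\<Sum>i<d. mat_diag d g $$ (i, j) * Y i x)" using assms[OF j] j by simp
qed (simp add: mat_diag_def)

lemma rep_1: "rep d Y 1 (1\<^sub>m d)"
  using rep_diag[of d 1 Y "\<lambda>_. 1"] by (simp add: mat_diag_one)

lemma rep_unique:
  assumes ind: "lin_indep {..<d} Y" and A: "rep d Y A M" and B: "rep d Y B M'"
    and eq: "\<And>j. j < d \<Longrightarrow> ap A (Y j) = ap B (Y j)"
  shows "M = M'"
proof (rule eq_matI)
  have c: "M \<in> carrier_mat d d" "M' \<in> carrier_mat d d" using rep_carrier A B by blast+
  then show "dim_row M = dim_row M'" "dim_col M = dim_col M'" by auto
  fix i j assume "i < dim_row M'" "j < dim_col M'"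
  with c have ij: "i < d" "j < d" by auto
  have "(\<Sum>i<d. M $$ (i, j) * Y i x) = (\<Sum>i<d. M' $$ (i, j) * Y i x)" for x
    using fun_cong[OF eq[OF ij(2)], of x] unfolding rep_ap[OF A ij(2)] rep_ap[OF B ij(2)] .
  from lin_indep_coeffs_eq[OF ind this] ij show "M $$ (i, j) = M' $$ (i, j)" by simp
qed

lemma rep_eq: "lin_indep {..<d} Y \<Longrightarrow> rep d Y A M \<Longrightarrow> rep d Y B M' \<Longrightarrow> A = B \<Longrightarrow> M = M'"
  by (rule rep_unique) auto

section \<open>The quantum modules\<close>

definition wv :: "'k::field \<Rightarrow> nat \<Rightarrow> (nat \<Rightarrow> nat) \<Rightarrow> nat list \<Rightarrow> (nat \<times> nat \<Rightarrow> bool) \<Rightarrow> 'k" where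
  "wv q r al w = ap (fw (fop q s1 r) w) (delta (young al))"

lemma wv_regular: "regular_at_one (wv qq r al w S)" and wv_at_one: "at_one (wv qq r al w S) = wv 1 r al w S"
proof -
  have "specializes (fw (fop qq s1 r) w) (fw (fop 1 s1 r) w)"
    by (intro specializes_fw specializes_fop) auto
  from specializesD[OF this delta_regular[of "young al"]]
  show "regular_at_one (wv qq r al w S)" "at_one (wv qq r al w S) = wv 1 r al w S"
    unfolding wv_def delta_at_one by simp_all
qed

lemma Bs_facts:
  assumes "part m al"
  shows "finite (Bs m al)" "Bs m al \<subseteq> Wd m" "gg_indep m (iw al) (Bs m al)" "w \<in> Bs m al \<Longrightarrow> w \<in> Wd m"
  using gg_basis_Bs[OF assms] unfolding gg_basis_def by auto

lemma young_hwv: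
  fixes q :: "'k::field"
  assumes "real_conj cj q" and "in_box m r al"
  shows "hwact.hwv m (wts s1 r) (chn q s1 True r) (iw al) (delta (young al))"
    and "supp_in (Pst (rect m r)) (delta (young al) :: _ \<Rightarrow> 'k)"
proof -
  interpret formact2 m r q q "wts s1 r" "wts s2 m" "chn q s1 True r" "fop q s1 r" "E2 q s2 m" "F2 q s2 m"
    "Pst (rect m r)" cj "h1 q" "h2 q" by (rule ext_formact2[OF assms(1)])
  show "hwact.hwv m (wts s1 r) (chn q s1 True r) (iw al) (delta (young al))"
    "supp_in (Pst (rect m r)) (delta (young al) :: _ \<Rightarrow> 'k)"
    using young_hw2[OF assms] unfolding hw2_def by auto
qed

lemma hwact_ext: "q \<noteq> 0 \<Longrightarrow> hwact m q (wts s1 r) (chn q s1 True r) (fop q s1 r)"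
proof -
  assume "q \<noteq> 0"
  interpret formact2 m r q q "wts s1 r" "wts s2 m" "chn q s1 True r" "fop q s1 r" "E2 q s2 m" "F2 q s2 m"
    "Pst (rect m r)" "\<lambda>x. x" "h1 q" "h2 q" by (rule ext_formact2[OF real_conj_id[OF \<open>q \<noteq> 0\<close>]])
  show ?thesis by unfold_locales
qed

lemma posact_ext: "posact m (wts s1 r) (chn 1 s1 True r) (fop 1 s1 r) (Pst (rect m r))"
proof -
  interpret posact2 m r "wts s1 r" "wts s2 m" "chn 1 s1 True r" "fop 1 s1 r" "E2 1 s2 m" "F2 1 s2 m"
    "Pst (rect m r)" by (rule ext_posact2)
  show ?thesis by unfold_locales
qed

lemma lin_indep_wv_1:
  assumes b: "in_box m r al"
  shows "lin_indep (Bs m al) (wv (1::complex) r al)"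
proof -
  interpret posact m "wts s1 r" "chn 1 s1 True r" "fop 1 s1 r" "Pst (rect m r)" by (rule posact_ext)
  have p: "part m al" using b in_box_part by blast
  show ?thesis
    using lin_indep_words_iff[OF young_hwv[OF real_conj_cnj b] delta_nonzero Bs_facts(1,2)[OF p]] Bs_facts(3)[OF p]
    unfolding wv_def[abs_def] by simp
qed

lemma lin_indep_wv: "in_box m r al \<Longrightarrow> lin_indep (Bs m al) (wv qq r al)"
  using Bs_facts(1)[of m al] in_box_part[of m r al]
  by (intro lin_indep_of_at_one) (auto simp: wv_regular wv_at_one lin_indep_wv_1)

text \<open>Matrix entries of a generator in the word basis, chosen through
  \<open>word_expansion\<close>, which guarantees their regularity at \<open>q = 1\<close>.\<close>

definition ecoef :: "(nat \<times> nat \<Rightarrow> bool, ratfun) lop \<Rightarrow> nat \<Rightarrow> nat \<Rightarrow> (nat \<Rightarrow> nat) \<Rightarrow> nat list \<Rightarrow> nat list \<Rightarrow> ratfun" where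
  "ecoef A m r al w = (SOME c. (\<forall>u\<in>Bs m al. regular_at_one (c u)) \<and>
     (\<forall>S. ap A (wv qq r al w) S = (\<Sum>u\<in>Bs m al. c u * wv qq r al u S)))"

lemma ecoef_lcomb:
  assumes b: "in_box m r al" and sp: "specializes A A'"
    and L: "ap A (wv qq r al w) = lcomb L (wv qq r al)" "\<forall>(k, u)\<in>set L. u \<in> Wd m"
  shows "\<And>u. u \<in> Bs m al \<Longrightarrow> regular_at_one (ecoef A m r al w u)"
    and "\<And>S. ap A (wv qq r al w) S = (\<Sum>u\<in>Bs m al. ecoef A m r al w u * wv qq r al u S)"
    and "\<And>S. ap A' (wv 1 r al w) S = (\<Sum>u\<in>Bs m al. at_one (ecoef A m r al w u) * wv 1 r al u S)"
proof -
  note D = specializesD[OF sp wv_regular]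
  have "\<exists>c. (\<forall>u\<in>Bs m al. regular_at_one (c u)) \<and>
    (\<forall>S. ap A (wv qq r al w) S = (\<Sum>u\<in>Bs m al. c u * ap (fw (fop qq s1 r) u) (delta (young al)) S))"
    by (rule word_expansion[OF b D(1), where L = L]) (use L in \<open>auto simp: wv_def[abs_def]\<close>)
  from someI_ex[OF this[folded wv_def]]
  have 1: "\<forall>u\<in>Bs m al. regular_at_one (ecoef A m r al w u)"
    and 2: "\<forall>S. ap A (wv qq r al w) S = (\<Sum>u\<in>Bs m al. ecoef A m r al w u * wv qq r al u S)"
    unfolding ecoef_def by blast+
  show "regular_at_one (ecoef A m r al w u)" if "u \<in> Bs m al" for u using 1 that by blast
  show "ap A (wv qq r al w) S = (\<Sum>u\<in>Bs m al. ecoef A m r al w u * wv qq r al u S)" for S using 2 by blast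
  fix S
  have "at_one (ap A (wv qq r al w) S) = (\<Sum>u\<in>Bs m al. at_one (ecoef A m r al w u) * wv 1 r al u S)"
    unfolding spec[OF 2, of S] using 1 wv_regular by (simp add: at_one_sum wv_at_one)
  moreover have "at_one (ap A (wv qq r al w) S) = ap A' (\<lambda>S. at_one (wv qq r al w S)) S"
    by (rule specializesD(2)[OF sp wv_regular])
  ultimately show "ap A' (wv 1 r al w) S = (\<Sum>u\<in>Bs m al. at_one (ecoef A m r al w u) * wv 1 r al u S)"
    unfolding wv_at_one by simp
qed

abbreviation Eq :: "nat \<Rightarrow> nat \<Rightarrow> (nat \<times> nat \<Rightarrow> bool, ratfun) lop" where "Eq r i \<equiv> chn qq s1 True r i"
abbreviation Fq :: "nat \<Rightarrow> nat \<Rightarrow> (nat \<times> nat \<Rightarrow> bool, ratfun) lop" where "Fq r i \<equiv> fop qq s1 r i"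

lemma e_wv:
  assumes "q \<noteq> 0" and b: "in_box m r al" and "Suc i < m" and "w \<in> Wd m"
  shows "ap (chn q s1 True r i) (wv q r al w) = lcomb (EW q (iw al) i w) (wv q r al)"
proof -
  interpret hwact m q "wts s1 r" "chn q s1 True r" "fop q s1 r" by (rule hwact_ext[OF assms(1)])
  show ?thesis unfolding wv_def[abs_def]
    by (rule e_word[OF young_hwv(1)[OF real_conj_id[OF assms(1)] b] assms(3,4)])
qed

lemma specializes_Eq: "specializes (Eq r i) (chn 1 s1 True r i)"
  and specializes_Fq: "specializes (Fq r i) (fop 1 s1 r i)"
  by (intro specializes_chn specializes_fop; simp)+

lemma ecoef_E:
  assumes b: "in_box m r al" and i: "Suc i < m" and w: "w \<in> Bs m al"
  shows "\<And>u. u \<in> Bs m al \<Longrightarrow> regular_at_one (ecoef (Eq r i) m r al w u)"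
    and "\<And>S. ap (Eq r i) (wv qq r al w) S = (\<Sum>u\<in>Bs m al. ecoef (Eq r i) m r al w u * wv qq r al u S)"
    and "\<And>S. lcomb (EW 1 (iw al) i w) (wv 1 r al) S = (\<Sum>u\<in>Bs m al. at_one (ecoef (Eq r i) m r al w u) * wv 1 r al u S)"
proof -
  have wd: "w \<in> Wd m" using b w Bs_facts(4) in_box_part by blast
  have "\<forall>(k, u)\<in>set (EW qq (iw al) i w). u \<in> Wd m" using EW_Wd[OF wd] by blast
  note L = ecoef_lcomb[OF b specializes_Eq e_wv[OF qq_nonzero b i wd] this]
  show "\<And>u. u \<in> Bs m al \<Longrightarrow> regular_at_one (ecoef (Eq r i) m r al w u)"
    "\<And>S. ap (Eq r i) (wv qq r al w) S = (\<Sum>u\<in>Bs m al. ecoef (Eq r i) m r al w u * wv qq r al u S)"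
    by (rule L(1), assumption) (rule L(2))
  show "\<And>S. lcomb (EW 1 (iw al) i w) (wv 1 r al) S = (\<Sum>u\<in>Bs m al. at_one (ecoef (Eq r i) m r al w u) * wv 1 r al u S)"
    unfolding e_wv[OF one_neq_zero b i wd, symmetric] by (rule L(3))
qed

lemma ecoef_F:
  assumes b: "in_box m r al" and i: "Suc i < m" and w: "w \<in> Bs m al"
  shows "\<And>u. u \<in> Bs m al \<Longrightarrow> regular_at_one (ecoef (Fq r i) m r al w u)"
    and "\<And>S. ap (Fq r i) (wv qq r al w) S = (\<Sum>u\<in>Bs m al. ecoef (Fq r i) m r al w u * wv qq r al u S)"
    and "\<And>S. wv 1 r al (i # w) S = (\<Sum>u\<in>Bs m al. at_one (ecoef (Fq r i) m r al w u) * wv 1 r al u S)"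
proof -
  have wd: "w \<in> Wd m" using b w Bs_facts(4) in_box_part by blast
  have 1: "ap (Fq r i) (wv qq r al w) = lcomb [(1, i # w)] (wv qq r al)"
    by (simp add: wv_def)
  have 2: "\<forall>(k, u)\<in>set [(1 :: ratfun, i # w)]. u \<in> Wd m" using i wd by simp
  note L = ecoef_lcomb[OF b specializes_Fq 1 2]
  show "\<And>u. u \<in> Bs m al \<Longrightarrow> regular_at_one (ecoef (Fq r i) m r al w u)"
    "\<And>S. ap (Fq r i) (wv qq r al w) S = (\<Sum>u\<in>Bs m al. ecoef (Fq r i) m r al w u * wv qq r al u S)"
    by (rule L(1), assumption) (rule L(2))
  show "\<And>S. wv 1 r al (i # w) S = (\<Sum>u\<in>Bs m al. at_one (ecoef (Fq r i) m r al w u) * wv 1 r al u S)"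
    using L(3) by (simp add: wv_def)
qed

context posact begin

text \<open>The coefficients are found in the exterior algebra, specialized to \<open>q = 1\<close>,
  translated into a relation for \<open>GG\<close> and from there to the vector \<open>z\<close>,
  which has the same weight as the diagram.\<close>

lemma e_at_one:
  assumes z: "hwv (iw al) z" "supp_in X z" "z \<noteq> (\<lambda>S. 0)" and b: "in_box M r al" and i: "Suc i < M" and w: "w \<in> Bs M al"
  shows "ap (e i) (ap (fw f w) z) S = (\<Sum>u\<in>Bs M al. at_one (ecoef (Eq r i) M r al w u) * ap (fw f u) z S)"
proof -
  interpret Q: posact M "wts s1 r" "chn 1 s1 True r" "fop 1 s1 r" "Pst (rect M r)" by (rule posact_ext)
  have p: "part M al" using b in_box_part by blast
  have wd: "w \<in> Wd M" using Bs_facts(4)[OF p w] .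
  have "\<forall>S. lcomb (EW 1 (iw al) i w) (\<lambda>u. ap (fw (fop 1 s1 r) u) (delta (young al))) S
      = (\<Sum>u\<in>Bs M al. at_one (ecoef (Eq r i) M r al w u) * ap (fw (fop 1 s1 r) u) (delta (young al)) S)"
    using ecoef_E(3)[OF b i w] unfolding wv_def[abs_def] by blast
  moreover have "(\<forall>S. lcomb (EW 1 (iw al) i w) (\<lambda>u. ap (fw (fop 1 s1 r) u) (delta (young al))) S
        = (\<Sum>u\<in>Bs M al. at_one (ecoef (Eq r i) M r al w u) * ap (fw (fop 1 s1 r) u) (delta (young al)) S))
      \<longleftrightarrow> (\<forall>u\<in>Wd M. (\<Sum>(k, w')\<leftarrow>EW 1 (iw al) i w. k * GG (iw al) u w')
        = (\<Sum>w'\<in>Bs M al. at_one (ecoef (Eq r i) M r al w w') * GG (iw al) u w'))"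
    by (rule Q.lcomb_relation_iff[OF young_hwv[OF real_conj_cnj b] delta_nonzero Bs_facts(1,2)[OF p]])
       (erule EW_Wd[OF wd])
  moreover have "(\<forall>S. lcomb (EW 1 (iw al) i w) (\<lambda>u. ap (fw f u) z) S
        = (\<Sum>u\<in>Bs M al. at_one (ecoef (Eq r i) M r al w u) * ap (fw f u) z S))
      \<longleftrightarrow> (\<forall>u\<in>Wd M. (\<Sum>(k, w')\<leftarrow>EW 1 (iw al) i w. k * GG (iw al) u w')
        = (\<Sum>w'\<in>Bs M al. at_one (ecoef (Eq r i) M r al w w') * GG (iw al) u w'))"
    by (rule lcomb_relation_iff[OF z Bs_facts(1,2)[OF p]]) (erule EW_Wd[OF wd])
  ultimately show ?thesis unfolding e_word[OF z(1) i wd] by blast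
qed

lemma f_at_one:
  assumes z: "hwv (iw al) z" "supp_in X z" "z \<noteq> (\<lambda>S. 0)" and b: "in_box M r al" and i: "Suc i < M" and w: "w \<in> Bs M al"
  shows "ap (f i) (ap (fw f w) z) S = (\<Sum>u\<in>Bs M al. at_one (ecoef (Fq r i) M r al w u) * ap (fw f u) z S)"
proof -
  interpret Q: posact M "wts s1 r" "chn 1 s1 True r" "fop 1 s1 r" "Pst (rect M r)" by (rule posact_ext)
  have p: "part M al" using b in_box_part by blast
  have wd: "i # w \<in> Wd M" using Bs_facts(4)[OF p w] i by simp
  have "\<forall>S. ap (fw (fop 1 s1 r) (i # w)) (delta (young al)) S
      = (\<Sum>u\<in>Bs M al. at_one (ecoef (Fq r i) M r al w u) * ap (fw (fop 1 s1 r) u) (delta (young al)) S)"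
    using ecoef_F(3)[OF b i w] unfolding wv_def[abs_def] by blast
  then have "\<forall>u\<in>Wd M. GG (iw al) u (i # w) = (\<Sum>w'\<in>Bs M al. at_one (ecoef (Fq r i) M r al w w') * GG (iw al) u w')"
    by (rule iffD1[OF Q.words_span_iff[OF young_hwv[OF real_conj_cnj b] delta_nonzero Bs_facts(1,2)[OF p] wd]])
  then have "\<forall>S. ap (fw f (i # w)) z S = (\<Sum>u\<in>Bs M al. at_one (ecoef (Fq r i) M r al w u) * ap (fw f u) z S)"
    by (rule iffD2[OF words_span_iff[OF z Bs_facts(1,2)[OF p] wd]])
  then show ?thesis by simp
qed

end

text \<open>The operator on a direct sum of copies, one for each element of the type
  \<open>'t\<close>.\<close>

lift_definition lifto :: "('b, 'k::field) lop \<Rightarrow> ('t \<times> 'b, 'k) lop" is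
  "\<lambda>f x (s, S). f (\<lambda>S. x (s, S)) S"
  by (auto simp: fun_eq_iff)

lemma ap_lifto: "ap (lifto A) x (s, S) = ap A (\<lambda>S. x (s, S)) S"
  by transfer simp

lemma lifto_mult: "lifto (A * B) = lifto A * lifto B"
  and lifto_add: "lifto (A + B) = lifto A + lifto B"
  and lifto_diff: "lifto (A - B) = lifto A - lifto B"
  and lifto_0: "lifto 0 = 0"
  and lifto_sc: "lifto (sc c) = sc c"
  by (rule lop_eqI; case_tac b; simp add: ap_lifto)+

text \<open>A direct sum of quantized modules for one factor: \<open>T\<close> labels the summands,
  which may share a highest weight, and \<open>k < d\<close> stands for a summand together with a
  word of its basis. In the application the label includes the word of the other factor.\<close>

locale blocks =
  fixes m r d :: nat and T :: "'t set" and al :: "'t \<Rightarrow> nat \<Rightarrow> nat" and t :: "nat \<Rightarrow> 't" and w :: "nat \<Rightarrow> nat list"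
  assumes box: "\<And>s. s \<in> T \<Longrightarrow> in_box m r (al s)" and finT: "finite T"
    and bij: "bij_betw (\<lambda>k. (t k, w k)) {..<d} (Sigma T (\<lambda>s. Bs m (al s)))"
begin

definition Y :: "nat \<Rightarrow> 't \<times> (nat \<times> nat \<Rightarrow> bool) \<Rightarrow> ratfun" where
  "Y k = (\<lambda>(s, S). if s = t k then wv qq r (al (t k)) (w k) S else 0)"

definition bm :: "(nat \<times> nat \<Rightarrow> bool, ratfun) lop \<Rightarrow> ratfun mat" where
  "bm A = mat d d (\<lambda>(a, b). if t a = t b then ecoef A m r (al (t b)) (w b) (w a) else 0)"

definition kk :: "nat \<Rightarrow> nat \<Rightarrow> int" where
  "kk i k = wtw (iw (al (t k))) (w k) i"

definition ops :: uq_ops where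
  "ops = \<lparr>opE = (\<lambda>i. bm (Eq r i)), opF = (\<lambda>i. bm (Fq r i)),
     opK = (\<lambda>i. mat_diag d (\<lambda>k. qq powi kk i k)), opL = (\<lambda>i. mat_diag d (\<lambda>k. qq powi (- kk i k)))\<rparr>"

lemma tw: "k < d \<Longrightarrow> t k \<in> T" "k < d \<Longrightarrow> w k \<in> Bs m (al (t k))"
  using bij_betwE[OF bij] by auto

lemma sum_blocks: "(\<Sum>k<d. g (t k) (w k)) = (\<Sum>s\<in>T. \<Sum>u\<in>Bs m (al s). g s u :: 'k::comm_monoid_add)"
proof -
  have "(\<Sum>k<d. g (t k) (w k)) = (\<Sum>(s, u)\<in>Sigma T (\<lambda>s. Bs m (al s)). g s u)"
    using sum.reindex_bij_betw[OF bij, of "\<lambda>(s, u). g s u"] by simp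
  also have "\<dots> = (\<Sum>s\<in>T. \<Sum>u\<in>Bs m (al s). g s u)"
    using finT box Bs_facts(1) in_box_part by (subst sum.Sigma) auto
  finally show ?thesis .
qed

lemma sum_block:
  assumes "s0 \<in> T"
  shows "(\<Sum>k<d. if t k = s0 then g (w k) else 0) = (\<Sum>u\<in>Bs m (al s0). g u :: 'k::comm_monoid_add)"
proof -
  have "(\<Sum>k<d. if t k = s0 then g (w k) else 0) = (\<Sum>s\<in>T. \<Sum>u\<in>Bs m (al s). if s = s0 then g u else 0)"
    by (rule sum_blocks)
  also have "\<dots> = (\<Sum>s\<in>T. if s = s0 then (\<Sum>u\<in>Bs m (al s). g u) else 0)" by (intro sum.cong refl) auto
  finally show ?thesis using assms finT by simp
qed

lemma lin_indep_Y: "lin_indep {..<d} Y"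
proof (rule lin_indepI)
  fix c b assume z: "\<And>x. (\<Sum>a<d. c a * Y a x) = 0" and "b \<in> {..<d}"
  then have b: "b < d" by simp
  define h where "h = inv_into {..<d} (\<lambda>k. (t k, w k))"
  have h: "h (t a, w a) = a" if "a < d" for a
    unfolding h_def using inv_into_f_f[of "\<lambda>k. (t k, w k)" "{..<d}" a] bij that by (auto simp: bij_betw_def)
  have h': "h (t b, w a) = a" if "a < d" "t a = t b" for a using h[OF that(1)] that(2) by simp
  have "(\<Sum>u\<in>Bs m (al (t b)). c (h (t b, u)) * wv qq r (al (t b)) u S) = 0" for S
  proof -
    have "(\<Sum>a<d. c a * Y a (t b, S)) = (\<Sum>a<d. if t a = t b then c (h (t b, w a)) * wv qq r (al (t b)) (w a) S else 0)"
      using h' by (intro sum.cong refl) (auto simp: Y_def)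
    then show ?thesis using z[of "(t b, S)"] sum_block[OF tw(1)[OF b], of "\<lambda>u. c (h (t b, u)) * wv qq r (al (t b)) u S"] by simp
  qed
  from lin_indepD[OF lin_indep_wv[OF box[OF tw(1)[OF b]]] this tw(2)[OF b]] h[OF b] show "c b = 0" by simp
qed

lemma rep_bm:
  assumes "\<And>s u S. s \<in> T \<Longrightarrow> u \<in> Bs m (al s) \<Longrightarrow>
    ap A (wv qq r (al s) u) S = (\<Sum>v\<in>Bs m (al s). ecoef A m r (al s) u v * wv qq r (al s) v S)"
  shows "rep d Y (lifto A) (bm A)"
proof (rule repI)
  fix j and x :: "'t \<times> (nat \<times> nat \<Rightarrow> bool)" assume j: "j < d"
  obtain s S where x: "x = (s, S)" by force
  have "(\<Sum>i<d. bm A $$ (i, j) * Y i (s, S))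
      = (\<Sum>i<d. if t i = t j then (if s = t j then ecoef A m r (al (t j)) (w j) (w i) * wv qq r (al (t j)) (w i) S else 0) else 0)"
    using j by (intro sum.cong refl) (auto simp: bm_def Y_def)
  also have "\<dots> = (\<Sum>u\<in>Bs m (al (t j)). if s = t j then ecoef A m r (al (t j)) (w j) u * wv qq r (al (t j)) u S else 0)"
    by (rule sum_block[OF tw(1)[OF j]])
  also have "\<dots> = ap (lifto A) (Y j) (s, S)"
  proof (cases "s = t j")
    case True
    then have "(\<lambda>S. Y j (s, S)) = wv qq r (al (t j)) (w j)" by (simp add: Y_def)
    then show ?thesis using assms[OF tw[OF j]] True by (simp add: ap_lifto)
  next
    case False
    then have "(\<lambda>S. Y j (s, S)) = (\<lambda>S. 0)" by (simp add: Y_def)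
    then show ?thesis using False by (simp add: ap_lifto)
  qed
  finally show "ap (lifto A) (Y j) x = (\<Sum>i<d. bm A $$ (i, j) * Y i x)" unfolding x ..
qed (simp add: bm_def)

abbreviation "W \<equiv> wts s1 r"

lemma rep_E: "Suc i < m \<Longrightarrow> rep d Y (lifto (Eq r i)) (bm (Eq r i))"
  by (rule rep_bm) (rule ecoef_E(2)[OF box])

lemma rep_F: "Suc i < m \<Longrightarrow> rep d Y (lifto (Fq r i)) (bm (Fq r i))"
  by (rule rep_bm) (rule ecoef_F(2)[OF box])

lemma rep_dg: "rep d Y (lifto (dg (\<lambda>S. h (W S)))) (mat_diag d (\<lambda>k. h (\<lambda>i. kk i k)))"
proof (rule rep_diag)
  fix j and x :: "'t \<times> (nat \<times> nat \<Rightarrow> bool)" assume j: "j < d"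
  interpret hwact m qq W "Eq r" "Fq r" by (rule hwact_ext) simp
  have b: "in_box m r (al (t j))" using box tw(1)[OF j] by blast
  have "w j \<in> Wd m" using tw(2)[OF j] Bs_facts(4) b in_box_part by blast
  from has_wt_word[OF this] young_hwv(1)[OF real_conj_id[OF qq_nonzero] b]
  have "has_wt W (wtw (iw (al (t j))) (w j)) (wv qq r (al (t j)) (w j))"
    unfolding wv_def hwv_def by blast
  from has_wt_dg[OF this, of h] 
  have "h (W S) * wv qq r (al (t j)) (w j) S = h (\<lambda>i. kk i j) * wv qq r (al (t j)) (w j) S" for S
    unfolding kk_def by (simp add: fun_eq_iff)
  then show "ap (lifto (dg (\<lambda>S. h (W S)))) (Y j) x = h (\<lambda>i. kk i j) * Y j x"
    by (cases x) (simp add: ap_lifto Y_def)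
qed

lemma rep_K: "rep d Y (lifto (dg (\<lambda>S. qq powi W S i))) (mat_diag d (\<lambda>k. qq powi kk i k))"
  and rep_L: "rep d Y (lifto (dg (\<lambda>S. qq powi (- W S i)))) (mat_diag d (\<lambda>k. qq powi (- kk i k)))"
  by (rule rep_dg)+

lemma rep_lifto_sc: "rep d Y (lifto A) M \<Longrightarrow> rep d Y (lifto (sc c * A)) (c \<cdot>\<^sub>m M)"
  and rep_lifto_mult: "rep d Y (lifto A) M \<Longrightarrow> rep d Y (lifto B) M' \<Longrightarrow> rep d Y (lifto (A * B)) (M * M')"
  and rep_lifto_add: "rep d Y (lifto A) M \<Longrightarrow> rep d Y (lifto B) M' \<Longrightarrow> rep d Y (lifto (A + B)) (M + M')"
  and rep_lifto_diff: "rep d Y (lifto A) M \<Longrightarrow> rep d Y (lifto B) M' \<Longrightarrow> rep d Y (lifto (A - B)) (M - M')"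
  unfolding lifto_mult lifto_add lifto_diff lifto_sc by (intro rep_sc rep_mult rep_add rep_diff; assumption)+

lemma rep_lifto_0: "rep d Y (lifto 0) (0\<^sub>m d d)"
  unfolding lifto_0 by (rule rep_0)

lemmas rep_rules = rep_lifto_mult rep_lifto_add rep_lifto_diff rep_lifto_sc rep_lifto_0 rep_K rep_L

lemma rep_lifto_eq: "rep d Y (lifto A) M \<Longrightarrow> rep d Y (lifto B) M' \<Longrightarrow> A = B \<Longrightarrow> M = M'"
  using rep_eq[OF lin_indep_Y] by blast

lemma alpha_kdelta: "alpha i k = kdelta k i - kdelta k (i + 1)"
  by (auto simp: alpha_def kdelta_def)

text \<open>Matrices with respect to the independent family \<open>Y\<close> are unique, so each
  defining relation follows from an operator identity on the exterior algebra;
  \<open>rep_rules\<close> computes the matrix of either side.\<close>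

lemma uq_module_ops: "uq_module m d ops"
  unfolding uq_module_def
proof (intro conjI allI impI)
  interpret H: hwact m qq W "Eq r" "Fq r" by (rule hwact_ext) simp
  let ?K = "\<lambda>i. dg (\<lambda>S. qq powi W S i) :: (nat \<times> nat \<Rightarrow> bool, ratfun) lop"
  let ?L = "\<lambda>i. dg (\<lambda>S. qq powi (- W S i)) :: (nat \<times> nat \<Rightarrow> bool, ratfun) lop"
  show "gens m ops \<subseteq> carrier_mat d d" unfolding gens_def ops_def bm_def mat_diag_def by auto
  show "opK ops i * opL ops i = 1\<^sub>m d" "opL ops i * opK ops i = 1\<^sub>m d" if "i < m" for i
    unfolding ops_def by (simp_all add: mat_diag_diag power_int_minus mat_diag_one)
  show "opK ops i * opK ops j = opK ops j * opK ops i" for i j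
    unfolding ops_def by (simp add: mat_diag_diag mult.commute)
  have KAL: "?K i * A * ?L i = sc (qq powi a) * A"
    if s: "A * dg (\<lambda>S. qq powi (- W S i)) = dg (\<lambda>S. qq powi (- (W S i - a))) * A" for A i a
  proof -
    have "?K i * A * ?L i = ?K i * dg (\<lambda>S. qq powi (- (W S i - a))) * A" by (simp only: mult.assoc s)
    also have "?K i * dg (\<lambda>S. qq powi (- (W S i - a))) = sc (qq powi a)"
      unfolding dg_mult by (simp add: power_int_add[symmetric])
    finally show ?thesis .
  qed
  show "opK ops i * opE ops j * opL ops i = qq powi (kdelta i j - kdelta i (j + 1)) \<cdot>\<^sub>m opE ops j"
    if j: "j + 1 < m" for i j
  proof -
    have "?K i * Eq r j * ?L i = sc (qq powi (alpha j i)) * Eq r j"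
      by (rule KAL) (use H.e_shift[of j "\<lambda>kp. qq powi (- kp i)"] j in simp)
    moreover have "kdelta i j - kdelta i (j + 1) = alpha j i" by (simp add: alpha_kdelta)
    ultimately have eq: "?K i * Eq r j * ?L i = sc (qq powi (kdelta i j - kdelta i (j + 1))) * Eq r j" by simp
    show ?thesis unfolding ops_def uq_ops.simps
      by (rule rep_lifto_eq[OF _ _ eq]; intro rep_rules rep_E; use j in simp)
  qed
  show "opK ops i * opF ops j * opL ops i = qq powi (- kdelta i j + kdelta i (j + 1)) \<cdot>\<^sub>m opF ops j"
    if j: "j + 1 < m" for i j
  proof -
    have "?K i * Fq r j * ?L i = sc (qq powi (- alpha j i)) * Fq r j"
      by (rule KAL) (use H.f_shift[of j "\<lambda>kp. qq powi (- kp i)"] j in simp)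
    moreover have "- kdelta i j + kdelta i (j + 1) = - alpha j i" by (simp add: alpha_kdelta)
    ultimately have eq: "?K i * Fq r j * ?L i = sc (qq powi (- kdelta i j + kdelta i (j + 1))) * Fq r j" by simp
    show ?thesis unfolding ops_def uq_ops.simps
      by (rule rep_lifto_eq[OF _ _ eq]; intro rep_rules rep_F; use j in simp)
  qed
  show "opE ops i * opF ops j - opF ops j * opE ops i =
      (if i = j then (1 / (qq - inverse qq)) \<cdot>\<^sub>m (opK ops i * opL ops (i + 1) - opL ops i * opK ops (i + 1)) else 0\<^sub>m d d)"
    if ij: "i + 1 < m \<and> j + 1 < m" for i j
  proof (cases "i = j")
    case False
    have eq: "Eq r i * Fq r j - Fq r j * Eq r i = 0" using H.e_f[of i j] ij False by simp
    show ?thesis unfolding ops_def uq_ops.simps if_not_P[OF False]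
      by (rule rep_lifto_eq[OF _ _ eq]; intro rep_rules rep_F rep_E; use ij in simp)
  next
    case True
    have "qint qq (hw (W S) i) = 1 / (qq - inverse qq) * (qq powi W S i * qq powi (- W S (i + 1)) - qq powi (- W S i) * qq powi W S (i + 1))" for S
      using qq_square_ne_1 by (simp add: qint_def hw_def power_int_add[symmetric])
    then have eq: "Eq r i * Fq r j - Fq r j * Eq r i = sc (1 / (qq - inverse qq)) * (?K i * ?L (i + 1) - ?L i * ?K (i + 1))"
      using H.e_f[of i j] ij True by (simp add: dg_mult dg_diff)
    show ?thesis unfolding ops_def uq_ops.simps if_P[OF True]
      by (rule rep_lifto_eq[OF _ _ eq]; intro rep_rules rep_F rep_E; use ij in simp)
  qed
  show "opE ops i * opE ops j = opE ops j * opE ops i" "opF ops i * opF ops j = opF ops j * opF ops i"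
    if ij: "i + 1 < m \<and> j + 1 < m \<and> (i + 1 < j \<or> j + 1 < i)" for i j
  proof -
    have eq: "Eq r i * Eq r j = Eq r j * Eq r i" using ij by (intro S1.chn_commute_far) auto
    show "opE ops i * opE ops j = opE ops j * opE ops i" unfolding ops_def uq_ops.simps
      by (rule rep_lifto_eq[OF _ _ eq]; intro rep_rules rep_E; use ij in simp)
    have eq: "Fq r i * Fq r j = Fq r j * Fq r i" using ij by (intro S1.fop_commute_far) auto
    show "opF ops i * opF ops j = opF ops j * opF ops i" unfolding ops_def uq_ops.simps
      by (rule rep_lifto_eq[OF _ _ eq]; intro rep_rules rep_F; use ij in simp)
  qed
  show "serre d (opE ops i) (opE ops j)" "serre d (opF ops i) (opF ops j)"
    if ij: "i + 1 < m \<and> j + 1 < m \<and> (j = i + 1 \<or> i = j + 1)" for i j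
  proof -
    have ij': "j = Suc i \<or> i = Suc j" using ij by auto
    note s = S1.chn_serre[OF qq_nonzero ij', where d = True and r = r] S1.fop_serre[OF qq_nonzero ij', where r = r]
    show "serre d (opE ops i) (opE ops j)" unfolding ops_def uq_ops.simps serre_def
      by (rule rep_lifto_eq[OF _ _ s(1)]; intro rep_rules rep_E; use ij in simp)
    show "serre d (opF ops i) (opF ops j)" unfolding ops_def uq_ops.simps serre_def
      by (rule rep_lifto_eq[OF _ _ s(2)]; intro rep_rules rep_F; use ij in simp)
  qed
qed

end

section \<open>The Weyl module as a representation of the general linear group\<close>

section \<open>Orthogonal projections\<close>

lemma form_add_left: "form cnj X (\<lambda>S. x S + y S) z = form cnj X x z + form cnj X y z"
  by (simp add: form_def distrib_right sum.distrib)

lemma cnj_form: "cnj (form cnj X x y) = form cnj X y x"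
  by (simp add: form_def mult.commute)

text \<open>The vectors may be dependent, so no Gram matrix is inverted; one vector at a time is
  made orthogonal to the others.\<close>

lemma orthogonal_projection:
  assumes X: "finite X" and A: "finite A" and Y: "\<And>a. a \<in> A \<Longrightarrow> supp_in X (Y a)" and x: "supp_in X x"
  shows "\<exists>c. \<forall>a\<in>A. form cnj X (Y a) (\<lambda>S. x S - (\<Sum>b\<in>A. c b * Y b S)) = 0"
  using A Y x
proof (induction A arbitrary: x rule: finite_induct)
  case (insert a A)
  have Ya: "supp_in X (Y a)" and YA: "\<And>b. b \<in> A \<Longrightarrow> supp_in X (Y b)" using insert.prems by auto
  obtain c1 where c1: "\<forall>b\<in>A. form cnj X (Y b) (\<lambda>S. Y a S - (\<Sum>b\<in>A. c1 b * Y b S)) = 0"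
    using insert.IH[OF YA Ya] by blast
  obtain c2 where c2: "\<forall>b\<in>A. form cnj X (Y b) (\<lambda>S. x S - (\<Sum>b\<in>A. c2 b * Y b S)) = 0"
    using insert.IH[OF YA insert.prems(2)] by blast
  define z where "z = (\<lambda>S. Y a S - (\<Sum>b\<in>A. c1 b * Y b S))"
  define y where "y = (\<lambda>S. x S - (\<Sum>b\<in>A. c2 b * Y b S))"
  \<comment> \<open>If \<open>z\<close> is zero, the quotient has the default value 0 and there is
    nothing to correct.\<close>
  define k where "k = form cnj X z y / form cnj X z z"
  define c where "c b = (if b = a then k else c2 b - k * c1 b)" for b
  have "(\<Sum>b\<in>A. c b * Y b S) = (\<Sum>b\<in>A. c2 b * Y b S) - k * (\<Sum>b\<in>A. c1 b * Y b S)" for S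
  proof -
    have "(\<Sum>b\<in>A. c b * Y b S) = (\<Sum>b\<in>A. c2 b * Y b S - k * (c1 b * Y b S))"
      using insert.hyps by (intro sum.cong refl) (auto simp: c_def left_diff_distrib mult.assoc)
    then show ?thesis by (simp add: sum_subtractf sum_distrib_left)
  qed
  then have res: "(\<lambda>S. x S - (\<Sum>b\<in>insert a A. c b * Y b S)) = (\<lambda>S. y S - k * z S)"
    using insert.hyps by (auto simp: y_def z_def c_def algebra_simps)
  have suppz: "supp_in X z"
    using Ya YA supp_in_sum[of A X Y c1] unfolding z_def supp_in_def by auto
  have zz: "form cnj X z y - k * form cnj X z z = 0"
  proof (cases "form cnj X z z = 0")
    case True
    then have "z = (\<lambda>S. 0)" by (rule form_cnj_pos[OF X suppz])
    then show ?thesis by (simp add: form_def)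
  qed (simp add: k_def)
  have bA: "form cnj X (Y b) (\<lambda>S. y S - k * z S) = 0" if "b \<in> A" for b
    using c1 c2 that by (simp add: form_diff form_scale y_def[symmetric] z_def[symmetric])
  have "Y a = (\<lambda>S. z S + (\<Sum>b\<in>A. c1 b * Y b S))" by (simp add: z_def)
  then have "form cnj X (Y a) (\<lambda>S. y S - k * z S)
      = form cnj X z (\<lambda>S. y S - k * z S) + (\<Sum>b\<in>A. cnj (c1 b) * form cnj X (Y b) (\<lambda>S. y S - k * z S))"
    by (metis (no_types) form_add_left form_sum_left)
  also have "\<dots> = 0" using bA zz by (simp add: form_diff form_scale)
  finally show ?case using bA unfolding res[symmetric] by (intro exI[of _ c]) auto
qed simp

text \<open>Coordinates as explicit linear functionals: matrix entries become finite sums of values,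
  to which regularity in the group element and differentiation apply term by term.\<close>

lemma dual_functionals:
  assumes X: "finite X" and A: "finite A" and Y: "\<And>a. a \<in> A \<Longrightarrow> supp_in X (Y a)" and ind: "lin_indep A Y"
  shows "\<exists>kp. \<forall>a\<in>A. \<forall>b\<in>A. (\<Sum>u\<in>X. kp a u * Y b u) = (if b = a then 1 else (0::complex))"
proof -
  have "\<exists>kp. \<forall>b\<in>A. (\<Sum>u\<in>X. kp u * Y b u) = (if b = a then 1 else 0)" if a: "a \<in> A" for a
  proof -
    have fA: "finite (A - {a})" using A by simp
    have "\<exists>c. \<forall>b\<in>A - {a}. form cnj X (Y b) (\<lambda>S. Y a S - (\<Sum>b\<in>A - {a}. c b * Y b S)) = 0"
      using a Y by (intro orthogonal_projection[OF X fA]) auto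
    then obtain c where c: "\<forall>b\<in>A - {a}. form cnj X (Y b) (\<lambda>S. Y a S - (\<Sum>b\<in>A - {a}. c b * Y b S)) = 0" ..
    define z where "z = (\<lambda>S. Y a S - (\<Sum>b\<in>A - {a}. c b * Y b S))"
    have zb: "form cnj X z (Y b) = 0" if "b \<in> A - {a}" for b
      using c that cnj_form[of X "Y b" z] unfolding z_def by auto
    have nz: "form cnj X z z \<noteq> 0"
    proof
      assume 0: "form cnj X z z = 0"
      have sz: "supp_in X z" unfolding z_def supp_in_def using Y a unfolding supp_in_def by (auto intro!: sum.neutral)
      have z0: "z S = 0" for S using form_cnj_pos[OF X sz 0] by simp
      have "(\<Sum>b\<in>A. (if b = a then 1 else - c b) * Y b S) = z S" for S
      proof -
        have "(\<Sum>b\<in>A. (if b = a then 1 else - c b) * Y b S) = Y a S + (\<Sum>b\<in>A - {a}. (if b = a then 1 else - c b) * Y b S)"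
          using A a by (subst sum.remove[of A a]) auto
        also have "(\<Sum>b\<in>A - {a}. (if b = a then 1 else - c b) * Y b S) = (\<Sum>b\<in>A - {a}. - (c b * Y b S))"
          by (intro sum.cong refl) auto
        finally show ?thesis by (simp add: z_def sum_negf)
      qed
      then have "(\<Sum>b\<in>A. (if b = a then 1 else - c b) * Y b S) = 0" for S using z0 by simp
      from lin_indepD[OF ind this a] show False by simp
    qed
    have "Y a = (\<lambda>S. z S + (\<Sum>b\<in>A - {a}. c b * Y b S))" by (simp add: z_def)
    then have "form cnj X z (Y a) = form cnj X z z + (\<Sum>b\<in>A - {a}. c b * form cnj X z (Y b))"
      by (metis (no_types) form_add form_sum)
    then have za: "form cnj X z (Y a) = form cnj X z z" using zb by simp
    have "(\<Sum>u\<in>X. (cnj (z u) / form cnj X z z) * Y b u) = form cnj X z (Y b) / form cnj X z z" for b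
      by (simp add: form_def sum_divide_distrib)
    then have "\<forall>b\<in>A. (\<Sum>u\<in>X. (cnj (z u) / form cnj X z z) * Y b u) = (if b = a then 1 else 0)"
      using za zb nz by auto
    then show ?thesis by (intro exI[of _ "\<lambda>u. cnj (z u) / form cnj X z z"])
  qed
  then have "\<forall>a\<in>A. \<exists>kp. \<forall>b\<in>A. (\<Sum>u\<in>X. kp u * Y b u) = (if b = a then 1 else 0)" by blast
  then show ?thesis by (rule bchoice)
qed

section \<open>Newton's identities for commuting operators\<close>

text \<open>Elementary symmetric polynomials. The group acts on the tensor power by the top one in
  the commuting operators on the single factors, the Lie algebra by power sums; Newton's identities
  lead from the latter to the former.\<close>

primrec el :: "'a::ring_1 list \<Rightarrow> nat \<Rightarrow> 'a" where
  "el [] k = (if k = 0 then 1 else 0)"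
| "el (x # xs) k = el xs k + (case k of 0 \<Rightarrow> 0 | Suc j \<Rightarrow> x * el xs j)"

definition psum :: "'a::ring_1 list \<Rightarrow> nat \<Rightarrow> 'a" where
  "psum xs i = sum_list (map (\<lambda>x. x ^ i) xs)"

text \<open>\<open>rr xs k i\<close> is the sum of \<open>x\<^sup>i\<close> times the \<open>k\<close>-th elementary symmetric polynomial of the other entries.\<close>

primrec rr :: "'a::ring_1 list \<Rightarrow> nat \<Rightarrow> nat \<Rightarrow> 'a" where
  "rr [] k i = 0"
| "rr (x # xs) k i = x ^ i * el xs k + rr xs k i + (case k of 0 \<Rightarrow> 0 | Suc j \<Rightarrow> x * rr xs j i)"

definition comm_list :: "'a::ring_1 list \<Rightarrow> bool" where
  "comm_list xs \<longleftrightarrow> (\<forall>x\<in>set xs. \<forall>y\<in>set xs. x * y = y * x)"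

lemma comm_el: "(\<And>y. y \<in> set xs \<Longrightarrow> x * y = y * x) \<Longrightarrow> x * el xs k = el xs k * x"
proof (induction xs arbitrary: k)
  case (Cons y xs)
  then have 1: "x * el xs j = el xs j * x" and 2: "x * y = y * x" for j by auto
  have "x * (y * el xs j) = y * el xs j * x" for j
    by (simp only: mult.assoc[symmetric] 2) (simp only: mult.assoc 1)
  then show ?case using 1 by (cases k) (simp_all add: distrib_left distrib_right)
qed auto

text \<open>Each product of \<open>Suc k\<close> entries is counted once for each of them.\<close>

lemma rr_one: "rr xs k (Suc 0) = of_nat (Suc k) * el xs (Suc k)"
proof (induction xs arbitrary: k)
  case (Cons x xs)
  have c: "x * (of_nat j * el xs j) = of_nat j * (x * el xs j)" for j :: nat
    by (metis mult.assoc mult_of_nat_commute)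
  show ?case
    by (cases k) (simp_all only: rr.simps el.simps nat.case Cons.IH c, simp_all add: algebra_simps)
qed simp

text \<open>The product is split according to whether the entry from the power sum also occurs in
  the product from \<open>el\<close>; if it does, its exponent grows by one.\<close>

lemma el_psum:
  assumes "comm_list xs"
  shows "el xs k * psum xs i = rr xs k i + (case k of 0 \<Rightarrow> 0 | Suc j \<Rightarrow> rr xs j (Suc i))"
  using assms
proof (induction xs arbitrary: k)
  case Nil
  then show ?case by (auto simp: psum_def split: nat.split)
next
  case (Cons x xs)
  have cl: "comm_list xs" using Cons.prems unfolding comm_list_def by auto
  have x: "x * el xs j = el xs j * x" for j
    by (rule comm_el, rule Cons.prems[unfolded comm_list_def, rule_format]) simp_all
  have xi: "el xs j * x ^ i = x ^ i * el xs j" for j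
    by (rule power_commuting_commutes[OF x, symmetric])
  have ps: "psum (x # xs) i = x ^ i + psum xs i" by (simp add: psum_def)
  have IH: "el xs j * psum xs i = rr xs j i + (case j of 0 \<Rightarrow> 0 | Suc l \<Rightarrow> rr xs l (Suc i))" for j
    by (rule Cons.IH[OF cl])
  show ?case
  proof (cases k)
    case 0
    then show ?thesis by (simp add: ps distrib_left xi IH)
  next
    case (Suc l)
    have "el (x # xs) k * psum (x # xs) i
        = x ^ i * el xs k + el xs k * psum xs i + (x * (x ^ i * el xs l) + x * (el xs l * psum xs i))"
      unfolding ps Suc by (simp only: el.simps nat.case distrib_left distrib_right xi mult.assoc ac_simps)
    also have "\<dots> = rr (x # xs) k i + (case k of 0 \<Rightarrow> 0 | Suc j \<Rightarrow> rr (x # xs) j (Suc i))"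
      unfolding IH Suc by (cases l) (simp_all add: distrib_left mult.assoc)
    finally show ?thesis .
  qed
qed

lemma el_zero_above: "length xs < k \<Longrightarrow> el xs k = 0"
  by (induction xs arbitrary: k) (auto split: nat.split)

lemma el_0 [simp]: "el xs 0 = 1"
  by (induction xs) auto

lemma el_length: "el xs (length xs) = prod_list xs"
  by (induction xs) (auto simp: el_zero_above)

lemma prod_one_plus: "length xs \<le> n \<Longrightarrow> prod_list (map (\<lambda>x. 1 + x) xs) = (\<Sum>k\<le>n. el xs k)"
proof (induction xs arbitrary: n)
  case Nil
  then show ?case by simp
next
  case (Cons x xs)
  then obtain l where n: "n = Suc l" "length xs \<le> l" by (cases n) auto
  have "(\<Sum>k\<le>Suc l. el (x # xs) k) = (\<Sum>k\<le>Suc l. el xs k) + (\<Sum>k\<le>Suc l. case k of 0 \<Rightarrow> 0 | Suc j \<Rightarrow> x * el xs j)"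
    by (simp only: el.simps sum.distrib)
  also have "(\<Sum>k\<le>Suc l. case k of 0 \<Rightarrow> 0 | Suc j \<Rightarrow> x * el xs j) = x * (\<Sum>k\<le>l. el xs k)"
    by (subst sum.atMost_Suc_shift) (simp add: sum_distrib_left)
  also have "(\<Sum>k\<le>Suc l. el xs k) = (\<Sum>k\<le>l. el xs k)" using Cons.IH[of l] Cons.IH[of "Suc l"] n by simp
  finally show ?case using Cons.IH[OF n(2)] n by (simp add: distrib_right)
qed

lemma ap_of_nat: "ap (of_nat n * A) x = (\<lambda>S. of_nat n * ap A x S)"
  by (induction n) (simp_all add: distrib_right)

lemma comm_list_dloc: "comm_list (map (\<lambda>c. dloc N c g) l)"
proof -
  have "dloc N c g * dloc N c' g = dloc N c' g * dloc N c g" for c c'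
    by (cases "c = c'") (auto intro: dloc_commute)
  then show ?thesis unfolding comm_list_def by auto
qed

section \<open>The tensor power of a matrix\<close>

context shape begin

definition cs :: "(nat \<times> nat) list" where
  "cs = (SOME l. distinct l \<and> set l = C)"

lemma cs: "distinct cs" "set cs = C"
  using someI_ex[OF finite_distinct_list[OF finC, unfolded conj_commute[of "set _ = _"]]] unfolding cs_def by auto

definition TT :: "(nat \<Rightarrow> nat \<Rightarrow> complex) \<Rightarrow> (nat \<times> nat \<Rightarrow> nat, complex) lop" where
  "TT g = prod_list (map (\<lambda>c. dloc N c g) cs)"

lemma TT_cong: "(\<And>a b. a < N \<Longrightarrow> b < N \<Longrightarrow> g a b = h a b) \<Longrightarrow> TT g = TT h"
proof -
  assume "\<And>a b. a < N \<Longrightarrow> b < N \<Longrightarrow> g a b = h a b"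
  then have "dloc N c g = dloc N c h" for c :: "nat \<times> nat" by (rule dloc_cong)
  then show ?thesis unfolding TT_def by simp
qed

lemma TT_mult: "TT g * TT h = TT (mm N g h)"
proof -
  have "prod_list (map (\<lambda>c. dloc N c g) l) * prod_list (map (\<lambda>c. dloc N c h) l)
      = prod_list (map (\<lambda>c. dloc N c (mm N g h)) l)" if "distinct l" for l :: "(nat \<times> nat) list"
    using that
  proof (induction l)
    case (Cons c l)
    have "prod_list (map (\<lambda>c. dloc N c g) l') * dloc N c h = dloc N c h * prod_list (map (\<lambda>c. dloc N c g) l')"
      if "c \<notin> set l'" for l'
      using that by (induction l') (auto intro!: commute_mult dloc_commute)
    with Cons.prems have e: "prod_list (map (\<lambda>c. dloc N c g) l) * dloc N c h
        = dloc N c h * prod_list (map (\<lambda>c. dloc N c g) l)" by simp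
    have "prod_list (map (\<lambda>c. dloc N c g) (c # l)) * prod_list (map (\<lambda>c. dloc N c h) (c # l))
        = dloc N c g * (prod_list (map (\<lambda>c. dloc N c g) l) * dloc N c h) * prod_list (map (\<lambda>c. dloc N c h) l)"
      by (simp add: mult.assoc)
    also have "\<dots> = (dloc N c g * dloc N c h)
        * (prod_list (map (\<lambda>c. dloc N c g) l) * prod_list (map (\<lambda>c. dloc N c h) l))"
      unfolding e by (simp add: mult.assoc)
    finally show ?case using Cons by (simp add: dloc_mult)
  qed simp
  then show ?thesis unfolding TT_def using cs(1) .
qed

lemma dloc_diag:
  assumes "c \<in> C" and "supp_in X x"
  shows "ap (dloc N c (\<lambda>a b. if a = b then t a else 0)) x = (\<lambda>u. t (u c) * x u)"
proof
  fix u
  show "ap (dloc N c (\<lambda>a b. if a = b then t a else 0)) x u = t (u c) * x u"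
  proof (cases "u c < N")
    case True
    have "(\<Sum>b<N. (if u c = b then t (u c) else 0) * x (u(c := b))) = (\<Sum>b<N. if b = u c then t (u c) * x (u(c := b)) else 0)"
      by (intro sum.cong refl) auto
    then show ?thesis using True by (simp add: ap_dloc)
  next
    case False
    then have "u \<notin> X" using assms(1) by (auto simp: PiE_iff)
    then show ?thesis using False assms(2) by (simp add: ap_dloc supp_in_def)
  qed
qed

lemma TT_diag:
  assumes "supp_in X x"
  shows "ap (TT (\<lambda>a b. if a = b then t a else 0)) x = (\<lambda>u. (\<Prod>c\<in>C. t (u c)) * x u)"
proof -
  have "ap (prod_list (map (\<lambda>c. dloc N c (\<lambda>a b. if a = b then t a else 0)) l)) x
      = (\<lambda>u. prod_list (map (\<lambda>c. t (u c)) l) * x u)" if "set l \<subseteq> C" for l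
    using that
  proof (induction l)
    case (Cons c l)
    have "supp_in X (\<lambda>u. prod_list (map (\<lambda>c. t (u c)) l) * x u)" using assms unfolding supp_in_def by auto
    with Cons show ?case by (simp add: dloc_diag mult.assoc)
  qed simp
  from this[of cs] show ?thesis unfolding TT_def using cs by (simp add: prod.distinct_set_conv_list[OF cs(1), unfolded cs(2)])
qed

lemma TT_one: "supp_in X x \<Longrightarrow> ap (TT (\<lambda>a b. if a = b then 1 else 0)) x = x"
  using TT_diag[of x "\<lambda>_. 1"] by simp

text \<open>\<open>gp g j\<close> is the matrix power with exponent \<open>Suc j\<close>, matching
  the power sum of that exponent in \<open>psum_dloc\<close>.\<close>

primrec gp :: "(nat \<Rightarrow> nat \<Rightarrow> complex) \<Rightarrow> nat \<Rightarrow> nat \<Rightarrow> nat \<Rightarrow> complex" where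
  "gp g 0 = g"
| "gp g (Suc j) = mm N g (gp g j)"

lemma psum_dloc: "psum (map (\<lambda>c. dloc N c g) cs) (Suc j) = D (gp g j)"
proof -
  have "dloc N c g ^ Suc j = dloc N c (gp g j)" for c :: "nat \<times> nat"
    by (induction j) (simp_all add: dloc_mult[symmetric])
  then show ?thesis unfolding psum_def DD_def
    by (simp add: sum.distinct_set_conv_list[OF cs(1), unfolded cs(2)] o_def del: power_Suc)
qed

text \<open>Newton's identities, solved for \<open>el\<close> by dividing by \<open>Suc k\<close>:
  what is stable under the Lie algebra is stable under all elementary symmetric functions of the
  operators on the factors. The sums \<open>rr\<close> are carried along in the induction.\<close>

lemma el_invariant:
  assumes P: "\<And>x Y. P x \<Longrightarrow> P (ap (D Y) x)" and sc: "\<And>x k. P x \<Longrightarrow> P (\<lambda>S. k * x S)"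
    and diff: "\<And>x y. P x \<Longrightarrow> P y \<Longrightarrow> P (\<lambda>S. x S - y S)"
  shows "P x \<Longrightarrow> P (ap (el (map (\<lambda>c. dloc N c g) cs) k) x)"
proof -
  let ?l = "map (\<lambda>c. dloc N c g) cs"
  have cl: "comm_list ?l" by (rule comm_list_dloc)
  have "(P x \<longrightarrow> P (ap (el ?l k) x)) \<and> (\<forall>i. P x \<longrightarrow> P (ap (rr ?l k (Suc i)) x))" for x
  proof (induction k arbitrary: x)
    case 0
    have "rr ?l 0 (Suc i) = psum ?l (Suc i)" for i using el_psum[OF cl, of 0 "Suc i"] by simp
    then show ?case using P unfolding psum_dloc by simp
  next
    case (Suc k)
    have e: "P (ap (el ?l (Suc k)) x)" if "P x" for x
    proof -
      have "of_nat (Suc k) * el ?l (Suc k) = rr ?l k (Suc 0)" by (rule rr_one[symmetric])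
      then have "ap (of_nat (Suc k) * el ?l (Suc k)) x = ap (rr ?l k (Suc 0)) x" by (simp only:)
      then have "ap (rr ?l k (Suc 0)) x = (\<lambda>S. of_nat (Suc k) * ap (el ?l (Suc k)) x S)" unfolding ap_of_nat ..
      moreover have "P (\<lambda>S. inverse (of_nat (Suc k)) * ap (rr ?l k (Suc 0)) x S)" using Suc that sc by blast
      moreover have "inverse (of_nat (Suc k)) * (of_nat (Suc k) * y) = y" for y :: complex
        by (simp del: of_nat_Suc add: mult.assoc[symmetric])
      ultimately show ?thesis by (simp only:)
    qed
    have "P (ap (rr ?l (Suc k) (Suc i)) x)" if x: "P x" for i
    proof -
      have "rr ?l (Suc k) (Suc i) = el ?l (Suc k) * D (gp g i) - rr ?l k (Suc (Suc i))"
        using el_psum[OF cl, of "Suc k" "Suc i"] unfolding psum_dloc by simp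
      from arg_cong[OF this, of "\<lambda>A. ap A x"]
      have "ap (rr ?l (Suc k) (Suc i)) x = (\<lambda>S. ap (el ?l (Suc k)) (ap (D (gp g i)) x) S - ap (rr ?l k (Suc (Suc i))) x S)"
        by (simp only: ap_simps)
      then show ?thesis using diff[OF e[OF P[OF x]]] Suc[of x] x by simp
    qed
    with e show ?case by blast
  qed
  then show "P x \<Longrightarrow> P (ap (el ?l k) x)" by blast
qed

lemma inW_TT: "inW x \<Longrightarrow> inW (ap (TT g) x)"
  unfolding TT_def el_length[symmetric] by (rule el_invariant[where P = inW]) (auto intro: inW_D inW_scale inW_diff)

lemma el_hvec:
  assumes "\<And>i. ap (D (gp g i)) hvec = (\<lambda>S. 0)"
  shows "ap (el (map (\<lambda>c. dloc N c g) cs) (Suc k)) hvec = (\<lambda>S. 0)"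
proof -
  let ?l = "map (\<lambda>c. dloc N c g) cs"
  have cl: "comm_list ?l" by (rule comm_list_dloc)
  have R: "ap (rr ?l k (Suc i)) hvec = (\<lambda>S. 0)" for i
  proof (induction k arbitrary: i)
    case 0
    have "rr ?l 0 (Suc i) = psum ?l (Suc i)" using el_psum[OF cl, of 0 "Suc i"] by simp
    then show ?case using assms unfolding psum_dloc by simp
  next
    case (Suc k)
    have "rr ?l (Suc k) (Suc i) = el ?l (Suc k) * D (gp g i) - rr ?l k (Suc (Suc i))"
      using el_psum[OF cl, of "Suc k" "Suc i"] unfolding psum_dloc by simp
    from arg_cong[OF this, of "\<lambda>A. ap A hvec"] show ?case by (simp only: ap_simps assms Suc ap_zero) simp
  qed
  have "ap (of_nat (Suc k) * el ?l (Suc k)) hvec = ap (rr ?l k (Suc 0)) hvec" by (simp only: rr_one)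
  then have "of_nat (Suc k) * ap (el ?l (Suc k)) hvec S = 0" for S
    unfolding ap_of_nat R by (rule fun_cong)
  then show ?thesis by (metis mult_eq_0_iff of_nat_eq_0_iff nat.distinct(2))
qed

lemma D_upper_hvec:
  assumes "\<And>a b. a < N \<Longrightarrow> b < N \<Longrightarrow> b \<le> a \<Longrightarrow> Y a b = 0"
  shows "ap (D Y) hvec = (\<lambda>S. 0)"
proof -
  have "Y a b * ap (D (un a b)) hvec S = 0" if "a < N" "b < N" for a b S
    using assms[OF that] D_un_hvec[of a b] that by (cases "b \<le> a") auto
  then show ?thesis unfolding D_expand[of Y] ap_sum_op by (intro ext sum.neutral) auto
qed

text \<open>With \<open>g = 1 + Y\<close> the tensor power is the sum of all \<open>el\<close> in
  the operators of \<open>Y\<close>. The powers of \<open>Y\<close> are strictly upper triangular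
  and kill \<open>hvec\<close>, hence by Newton's identities so does every \<open>el\<close> of
  positive degree.\<close>

lemma TT_unipotent:
  assumes u: "\<And>a b. a < N \<Longrightarrow> b < N \<Longrightarrow> b \<le> a \<Longrightarrow> g a b = (if a = b then 1 else 0)"
  shows "ap (TT g) hvec = hvec"
proof -
  define Y where "Y a b = g a b - (if a = b then 1 else 0)" for a b
  let ?l = "map (\<lambda>c. dloc N c Y) cs"
  have Y0: "Y a b = 0" if "a < N" "b < N" "b \<le> a" for a b using u[OF that] unfolding Y_def by simp
  have gp0: "gp Y i a b = 0" if "a < N" "b < N" "b \<le> a" for i a b
    using that
  proof (induction i arbitrary: a b)
    case (Suc i)
    have "Y a k * gp Y i k b = 0" if "k < N" for k
      using Y0[of a k] Suc.IH[of k b] Suc.prems that by (cases "k \<le> a") auto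
    then show ?case unfolding gp.simps mm_def by (intro sum.neutral) auto
  qed (simp add: Y0)
  \<comment> \<open>The identity matrix acts as the identity only on functions supported in the
    fillings, so the support is carried along.\<close>
  have d1: "ap (dloc N c g) x = ap (1 + dloc N c Y) x" if "c \<in> C" "supp_in X x" for c x
  proof -
    have "dloc N c g = dloc N c (\<lambda>a b. (if a = b then 1 else 0) + Y a b)" by (rule dloc_cong) (simp add: Y_def)
    then show ?thesis using dloc_diag[OF that, of "\<lambda>_. 1"] by (simp add: dloc_add)
  qed
  have "ap (prod_list (map (\<lambda>c. dloc N c g) l)) hvec = ap (prod_list (map (\<lambda>c. 1 + dloc N c Y) l)) hvec
      \<and> supp_in X (ap (prod_list (map (\<lambda>c. dloc N c g) l)) hvec)" if "set l \<subseteq> C" for l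
    using that by (induction l) (auto simp: supp_hvec d1 intro!: S1.supp_in_add supp_dloc)
  then have "ap (TT g) hvec = ap (prod_list (map (\<lambda>x. 1 + x) ?l)) hvec"
    unfolding TT_def using cs(2) by (simp add: o_def)
  also have "\<dots> = (\<lambda>S. \<Sum>k\<le>length ?l. ap (el ?l k) hvec S)"
    by (simp only: prod_one_plus[OF order_refl] ap_sum_op)
  also have "\<dots> = hvec"
  proof
    fix S
    have "ap (el ?l k) hvec S = (if k = 0 then hvec S else 0)" for k
      using el_hvec[of Y] D_upper_hvec[OF gp0] by (cases k) auto
    then show "(\<Sum>k\<le>length ?l. ap (el ?l k) hvec S) = hvec S" by simp
  qed
  finally show ?thesis .
qed

lemma TT_torus:
  "ap (TT (\<lambda>a b. if a = b then t a else 0)) hvec = (\<lambda>u. (\<Prod>i<N. t i ^ lam i) * hvec u)"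
proof
  fix u
  have "(\<Prod>c\<in>C. t (u c)) = (\<Prod>i<N. t i ^ lam i)" if nz: "hvec u \<noteq> 0"
  proof -
    have uX: "u \<in> X" using supp_hvec nz unfolding supp_in_def by blast
    have wt: "wtl N C (\<lambda>k. k) u = iw lam" using hvec_hwv nz unfolding P.hwv_def has_wt_def by blast
    have card: "card {c \<in> C. u c = i} = lam i" if "i < N" for i
    proof -
      have "{c \<in> C. u c < N \<and> u c = i} = {c \<in> C. u c = i}" using that by auto
      then have "wtl N C (\<lambda>k. k) u i = int (card {c \<in> C. u c = i})"
        unfolding wtl_def using finC by (simp add: Int_def)
      then show ?thesis using fun_cong[OF wt, of i] by simp
    qed
    have "(\<Prod>c\<in>C. t (u c)) = (\<Prod>i<N. \<Prod>c\<in>{c \<in> C. u c = i}. t (u c))"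
      using uX finC by (intro prod.group[symmetric]) (auto simp: PiE_iff)
    also have "\<dots> = (\<Prod>i<N. t i ^ lam i)" using card by (intro prod.cong refl) simp
    finally show ?thesis .
  qed
  then show "ap (TT (\<lambda>a b. if a = b then t a else 0)) hvec u = (\<Prod>i<N. t i ^ lam i) * hvec u"
    using TT_diag[OF supp_hvec, of t] by (cases "hvec u = 0") auto
qed

lemma TT_regular: "(\<lambda>g. ap (TT (\<lambda>a b. g $$ (a, b))) x u) \<in> regular_functions N"
proof -
  have s: "finite I \<Longrightarrow> (\<And>i. i \<in> I \<Longrightarrow> f i \<in> regular_functions N) \<Longrightarrow> (\<lambda>g. \<Sum>i\<in>I. f i g) \<in> regular_functions N" for I :: "nat set" and f
    by (induction I rule: finite_induct) (auto intro: regular_functions.intros)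
  have "\<forall>u. (\<lambda>g. ap (prod_list (map (\<lambda>c. dloc N c (\<lambda>a b. g $$ (a, b))) l)) x u) \<in> regular_functions N" for l :: "(nat \<times> nat) list"
  proof (induction l)
    case Nil
    then show ?case by (auto intro: regular_functions.const)
  next
    case (Cons c l)
    show ?case
    proof
      fix u :: "nat \<times> nat \<Rightarrow> nat"
      have "(\<lambda>g. \<Sum>b<N. g $$ (u c, b) * ap (prod_list (map (\<lambda>c. dloc N c (\<lambda>a b. g $$ (a, b))) l)) x (u(c := b))) \<in> regular_functions N"
        if "u c < N" using Cons that by (intro s regular_functions.mult regular_functions.coord) auto
      then show "(\<lambda>g. ap (prod_list (map (\<lambda>c. dloc N c (\<lambda>a b. g $$ (a, b))) (c # l))) x u) \<in> regular_functions N"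
        by (cases "u c < N") (auto simp: ap_dloc intro: regular_functions.const)
    qed
  qed
  then show ?thesis unfolding TT_def by blast
qed

text \<open>The product rule along the list of factors, each of which acts as the identity at
  \<open>z = 0\<close>.\<close>

lemma TT_derivative:
  assumes x: "supp_in X x"
  shows "((\<lambda>z. ap (TT (\<lambda>a b. (if a = b then 1 else 0) + z * Y a b)) x u) has_field_derivative ap (D Y) x u) (at 0)"
proof -
  let ?g = "\<lambda>z a b. (if a = b then 1 else 0) + z * Y a b"
  let ?P = "\<lambda>l z. ap (prod_list (map (\<lambda>c. dloc N c (?g z)) l)) x"
  have g0: "?g 0 = (\<lambda>a b. if a = b then 1 else 0)" by simp
  have d1: "ap (dloc N c (?g 0)) y = y" if "c \<in> C" "supp_in X y" for c y
    using dloc_diag[OF that, of "\<lambda>_. 1"] by simp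
  have P0: "?P l 0 = x" if "set l \<subseteq> C" for l
    using that d1 x by (induction l) auto
  have "\<forall>u. ((\<lambda>z. ?P l z u) has_field_derivative (\<Sum>c\<leftarrow>l. ap (dloc N c Y) x u)) (at 0)" if "set l \<subseteq> C" for l
    using that
  proof (induction l)
    case (Cons c l)
    have c: "c \<in> C" and l: "set l \<subseteq> C" using Cons.prems by auto
    let ?y = "\<lambda>u. \<Sum>c\<leftarrow>l. ap (dloc N c Y) x u"
    have sy: "supp_in X ?y" using l x
    proof (induction l)
      case (Cons c l)
      then show ?case using supp_dloc[of c C N x Y] by (auto simp: supp_in_def)
    qed (simp add: supp_in_def)
    show ?case
    proof
      fix u
      have IH: "((\<lambda>z. ?P l z v) has_field_derivative ?y v) (at 0)" for v using Cons.IH[OF l] by blast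
      have "((\<lambda>z. \<Sum>b<N. ?g z (u c) b * ?P l z (u(c := b))) has_field_derivative
          (\<Sum>b<N. ?g 0 (u c) b * ?y (u(c := b)) + Y (u c) b * ?P l 0 (u(c := b)))) (at 0)"
        by (rule DERIV_sum, rule DERIV_mult', auto intro!: derivative_eq_intros IH[simplified])
      moreover have "(\<Sum>b<N. ?g 0 (u c) b * ?y (u(c := b)) + Y (u c) b * ?P l 0 (u(c := b)))
          = ap (dloc N c (?g 0)) ?y u + ap (dloc N c Y) x u" if "u c < N"
        using that unfolding P0[OF l] by (simp add: ap_dloc sum.distrib)
      ultimately have "((\<lambda>z. ap (dloc N c (?g z)) (?P l z) u) has_field_derivative
          ?y u + ap (dloc N c Y) x u) (at 0)"
        unfolding d1[OF c sy]
      proof (cases "u c < N")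
        case False
        then have "u \<notin> X" using c by (auto simp: PiE_iff)
        then have "?y u = 0" using sy unfolding supp_in_def by blast
        then show ?thesis using False by (simp add: ap_dloc)
      qed (simp add: ap_dloc[of _ _ "?g _"])
      then show "((\<lambda>z. ?P (c # l) z u) has_field_derivative (\<Sum>c\<leftarrow>c # l. ap (dloc N c Y) x u)) (at 0)"
        by (simp add: add.commute)
    qed
  qed simp
  from this[of cs] show ?thesis unfolding TT_def DD_def ap_sum_op using cs
    by (simp add: sum.distinct_set_conv_list[OF cs(1), unfolded cs(2)])
qed

end

section \<open>The Weyl module\<close>

lemma in_span_diff_scale:
  assumes "in_span A Y x" and "in_span A Y y"
  shows "in_span A Y (\<lambda>S. x S - k * y S)"
proof -
  obtain c e where "\<And>S. x S = (\<Sum>a\<in>A. c a * Y a S)" "\<And>S. y S = (\<Sum>a\<in>A. e a * Y a S)"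
    using assms unfolding in_span_def by blast
  then show ?thesis
    by (intro in_spanI[where c = "\<lambda>a. c a - k * e a"])
       (simp add: left_diff_distrib sum_subtractf sum_distrib_left mult.assoc)
qed

text \<open>The determinant is a polynomial in \<open>z\<close> with value 1 at 0.\<close>

lemma eventually_GL:
  assumes X: "X \<in> carrier_mat N N"
  shows "\<forall>\<^sub>F z in nhds 0. 1\<^sub>m N + z \<cdot>\<^sub>m X \<in> GL N"
proof -
  let ?f = "\<lambda>z. \<Sum>p\<in>{p. p permutes {0..<N}}. signof p * (\<Prod>i = 0..<N. (if i = p i then 1 else 0) + z * X $$ (i, p i))"
  have det: "det (1\<^sub>m N + z \<cdot>\<^sub>m X) = ?f z" for z
  proof -
    have c: "1\<^sub>m N + z \<cdot>\<^sub>m X \<in> carrier_mat N N" using X by simp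
    show ?thesis unfolding det_def'[OF c]
    proof (intro sum.cong refl arg_cong2[where f = "(*)"] prod.cong)
      fix p i assume "p \<in> {p. p permutes {0..<N}}" "i \<in> {0..<N}"
      then have "i < N" "p i < N" using permutes_in_image[of p "{0..<N}" i] by auto
      then show "(1\<^sub>m N + z \<cdot>\<^sub>m X) $$ (i, p i) = (if i = p i then 1 else 0) + z * X $$ (i, p i)" using X by simp
    qed
  qed
  have "isCont ?f 0" by (intro continuous_intros)
  then have lim: "(?f \<longlongrightarrow> ?f 0) (nhds 0)"
    unfolding isCont_def by (rule iffD1[OF tendsto_at_iff_tendsto_nhds[of ?f 0]])
  have "?f 0 = det (1\<^sub>m N + 0 \<cdot>\<^sub>m X)" by (rule det[symmetric])
  moreover have "1\<^sub>m N + 0 \<cdot>\<^sub>m X = 1\<^sub>m N" using X by (intro eq_matI) auto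
  ultimately have "?f 0 \<noteq> 0" by simp
  with lim have "\<forall>\<^sub>F z in nhds 0. ?f z \<noteq> 0" by (rule tendsto_imp_eventually_ne)
  then show ?thesis
  proof (rule eventually_mono)
    fix z assume "?f z \<noteq> 0"
    then have nz: "det (1\<^sub>m N + z \<cdot>\<^sub>m X) \<noteq> 0" unfolding det .
    have c: "1\<^sub>m N + z \<cdot>\<^sub>m X \<in> carrier_mat N N" using X by simp
    from det_non_zero_imp_unit[OF c nz, where b = undefined] obtain B where
      "B \<in> carrier_mat N N" "B * (1\<^sub>m N + z \<cdot>\<^sub>m X) = 1\<^sub>m N" "(1\<^sub>m N + z \<cdot>\<^sub>m X) * B = 1\<^sub>m N"
      unfolding Units_def ring_mat_def by auto
    then show "1\<^sub>m N + z \<cdot>\<^sub>m X \<in> GL N"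
      unfolding GL_def invertible_mat_def inverts_mat_def
      by (intro CollectI conjI exI[of _ B]) (use c X in auto)
  qed
qed

locale weyl_frame = shape lam N for lam :: "nat \<Rightarrow> nat" and N :: nat +
  fixes d :: nat and Z :: "nat \<Rightarrow> (nat \<times> nat \<Rightarrow> nat) \<Rightarrow> complex"
  assumes ZW: "\<And>j. j < d \<Longrightarrow> inW (Z j)" and ind: "lin_indep {..<d} Z"
    and span: "\<And>x. inW x \<Longrightarrow> in_span {..<d} Z x"
begin

definition kap :: "nat \<Rightarrow> (nat \<times> nat \<Rightarrow> nat) \<Rightarrow> complex" where
  "kap = (SOME kp. \<forall>a\<in>{..<d}. \<forall>b\<in>{..<d}. (\<Sum>u\<in>X. kp a u * Z b u) = (if b = a then 1 else 0))"

lemma kap: "a < d \<Longrightarrow> b < d \<Longrightarrow> (\<Sum>u\<in>X. kap a u * Z b u) = (if b = a then 1 else 0)"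
proof -
  assume ab: "a < d" "b < d"
  have "\<exists>kp. \<forall>a\<in>{..<d}. \<forall>b\<in>{..<d}. (\<Sum>u\<in>X. kp a u * Z b u) = (if b = a then 1 else 0)"
    by (rule dual_functionals[OF P.fin _ _ ind]) (auto intro: inW_supp ZW)
  from someI_ex[OF this, folded kap_def] ab show ?thesis by blast
qed

definition cm :: "(nat \<times> nat \<Rightarrow> nat, complex) lop \<Rightarrow> complex mat" where
  "cm A = mat d d (\<lambda>(i, j). \<Sum>u\<in>X. kap i u * ap A (Z j) u)"

lemma rep_cm:
  assumes A: "\<And>x. inW x \<Longrightarrow> inW (ap A x)"
  shows "rep d Z A (cm A)"
proof (rule repI)
  fix j x assume j: "j < d"
  from span[OF A[OF ZW[OF j]]] obtain c where c: "\<And>S. ap A (Z j) S = (\<Sum>k<d. c k * Z k S)"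
    unfolding in_span_def by blast
  have "cm A $$ (i, j) = c i" if i: "i < d" for i
  proof -
    have "cm A $$ (i, j) = (\<Sum>u\<in>X. \<Sum>k<d. c k * (kap i u * Z k u))"
      using i j by (simp add: cm_def c sum_distrib_left mult.left_commute)
    also have "\<dots> = (\<Sum>k<d. c k * (\<Sum>u\<in>X. kap i u * Z k u))"
      unfolding sum_distrib_left by (rule sum.swap)
    also have "\<dots> = (\<Sum>k<d. if k = i then c k else 0)" using i by (intro sum.cong refl) (simp add: kap)
    finally show ?thesis using i by simp
  qed
  then show "ap A (Z j) x = (\<Sum>i<d. cm A $$ (i, j) * Z i x)" unfolding c by (intro sum.cong) auto
qed (simp add: cm_def)

abbreviation mf :: "complex mat \<Rightarrow> nat \<Rightarrow> nat \<Rightarrow> complex" where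
  "mf g \<equiv> \<lambda>a b. g $$ (a, b)"

definition rho :: "complex mat \<Rightarrow> complex mat" where
  "rho g = cm (TT (mf g))"

lemma rep_rho: "rep d Z (TT (mf g)) (rho g)"
  unfolding rho_def by (rule rep_cm) (rule inW_TT)

lemma rep_D: "rep d Z (D Y) (cm (D Y))"
  by (rule rep_cm) (rule inW_D)

definition ev :: "complex vec \<Rightarrow> (nat \<times> nat \<Rightarrow> nat) \<Rightarrow> complex" where
  "ev v = (\<lambda>S. \<Sum>j<d. v $ j * Z j S)"

lemma ev_rep:
  assumes M: "rep d Z A M" and v: "v \<in> carrier_vec d"
  shows "ap A (ev v) = ev (M *\<^sub>v v)"
proof
  fix S
  have c: "M \<in> carrier_mat d d" by (rule rep_carrier[OF M])
  have "ap A (ev v) S = (\<Sum>j<d. \<Sum>i<d. M $$ (i, j) * v $ j * Z i S)"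
    unfolding ev_def ap_sum by (intro sum.cong refl) (simp add: rep_ap[OF M] sum_distrib_left mult_ac)
  also have "\<dots> = (\<Sum>i<d. (\<Sum>j<d. M $$ (i, j) * v $ j) * Z i S)"
    unfolding sum_distrib_right by (rule sum.swap)
  also have "\<dots> = ev (M *\<^sub>v v) S"
    unfolding ev_def using c v by (intro sum.cong refl) (simp add: scalar_prod_def atLeast0LessThan)
  finally show "ap A (ev v) S = ev (M *\<^sub>v v) S" .
qed

lemma ev_inj:
  assumes "v \<in> carrier_vec d" "w \<in> carrier_vec d" "ev v = ev w"
  shows "v = w"
proof (rule eq_vecI)
  fix i assume "i < dim_vec w"
  then have i: "i \<in> {..<d}" using assms by auto
  have "(\<Sum>j<d. v $ j * Z j S) = (\<Sum>j<d. w $ j * Z j S)" for S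
    using fun_cong[OF assms(3), of S] unfolding ev_def .
  from lin_indep_coeffs_eq[OF ind this i] show "v $ i = w $ i" .
qed (use assms in auto)

lemma ev_surj:
  assumes "inW x"
  obtains v where "v \<in> carrier_vec d" "ev v = x"
proof -
  from span[OF assms] obtain c where c: "\<And>S. x S = (\<Sum>k<d. c k * Z k S)" unfolding in_span_def by blast
  show ?thesis by (rule that[of "vec d c"]) (auto simp: ev_def c)
qed

lemma inW_ev: "inW (ev v)"
  unfolding ev_def by (rule inW_sum) (auto intro: ZW)

lemma ev_0: "ev (0\<^sub>v d) = (\<lambda>S. 0)"
  by (simp add: ev_def)

lemma ev_add: "v \<in> carrier_vec d \<Longrightarrow> w \<in> carrier_vec d \<Longrightarrow> ev (v + w) = (\<lambda>S. ev v S + ev w S)"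
  by (simp add: ev_def distrib_right sum.distrib)

lemma ev_smult: "v \<in> carrier_vec d \<Longrightarrow> ev (k \<cdot>\<^sub>v v) = (\<lambda>S. k * ev v S)"
  by (simp add: ev_def sum_distrib_left mult.assoc)

lemma supp_ev: "supp_in X (ev v)"
  by (rule inW_supp[OF inW_ev])

lemma gl_differential_rho:
  assumes Y: "Y \<in> carrier_mat N N"
  shows "gl_differential N d rho Y = cm (D (mf Y))"
proof (rule eq_matI)
  fix i j assume "i < dim_row (cm (D (mf Y)))" "j < dim_col (cm (D (mf Y)))"
  then have ij: "i < d" "j < d" by (auto simp: cm_def)
  have "rho (1\<^sub>m N + z \<cdot>\<^sub>m Y) $$ (i, j)
      = (\<Sum>u\<in>X. kap i u * ap (TT (\<lambda>a b. (if a = b then 1 else 0) + z * mf Y a b)) (Z j) u)" for z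
  proof -
    have "TT (mf (1\<^sub>m N + z \<cdot>\<^sub>m Y)) = TT (\<lambda>a b. (if a = b then 1 else 0) + z * mf Y a b)"
      using Y by (intro TT_cong) auto
    then show ?thesis using ij by (simp add: rho_def cm_def)
  qed
  moreover have "((\<lambda>z. \<Sum>u\<in>X. kap i u * ap (TT (\<lambda>a b. (if a = b then 1 else 0) + z * mf Y a b)) (Z j) u)
      has_field_derivative (\<Sum>u\<in>X. kap i u * ap (D (mf Y)) (Z j) u)) (at 0)"
    by (intro DERIV_sum DERIV_cmult TT_derivative inW_supp ZW ij)
  ultimately show "gl_differential N d rho Y $$ (i, j) = cm (D (mf Y)) $$ (i, j)"
    using ij by (simp add: gl_differential_def cm_def DERIV_imp_deriv)
qed (simp_all add: gl_differential_def cm_def)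

lemma mf_one: "TT (mf (1\<^sub>m N)) = TT (\<lambda>a b. if a = b then 1 else 0)"
  by (rule TT_cong) simp

lemma GL_rep_rho: "GL_rep N d rho"
  unfolding GL_rep_def
proof (intro conjI ballI allI impI)
  show "rho g \<in> carrier_mat d d" for g by (rule rep_carrier[OF rep_rho])
  show "rho (1\<^sub>m N) = 1\<^sub>m d"
    by (rule rep_unique[OF ind rep_rho rep_1]) (simp add: mf_one TT_one inW_supp ZW)
  show "rho (g * h) = rho g * rho h" if "g \<in> GL N" "h \<in> GL N" for g h
  proof (rule rep_eq[OF ind rep_rho rep_mult[OF rep_rho rep_rho]])
    have "TT (mf (g * h)) = TT (mm N (mf g) (mf h))"
      using that unfolding GL_def by (intro TT_cong) (auto simp: mm_def scalar_prod_def atLeast0LessThan)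
    then show "TT (mf (g * h)) = TT (mf g) * TT (mf h)" by (simp add: TT_mult)
  qed
  fix i j assume ij: "i < d" "j < d"
  have "(\<lambda>g. \<Sum>u\<in>X. kap i u * ap (TT (mf g)) (Z j) u) \<in> regular_functions N"
  proof -
    have "finite B \<Longrightarrow> (\<lambda>g. \<Sum>u\<in>B. kap i u * ap (TT (mf g)) (Z j) u) \<in> regular_functions N" for B
    proof (induction B rule: finite_induct)
      case (insert u B)
      from regular_functions.add[OF regular_functions.mult[OF regular_functions.const[of "kap i u"] TT_regular[of "Z j" u]] insert.IH]
      show ?case using insert.hyps by simp
    qed (simp add: regular_functions.const)
    then show ?thesis using P.fin .
  qed
  then show "\<exists>f\<in>regular_functions N. \<forall>g\<in>GL N. rho g $$ (i, j) = f g"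
    by (rule bexI[rotated]) (simp add: rho_def cm_def ij)
qed

lemma inW_hvec: "inW hvec"
  using inW_word[of "[]"] by simp

lemma highest_weight_rho: "highest_weight N d rho lam"
proof -
  obtain v where v: "v \<in> carrier_vec d" "ev v = hvec" using ev_surj[OF inW_hvec] .
  show ?thesis unfolding highest_weight_def
  proof (intro bexI[of _ v] conjI allI impI ballI v(1))
    show "v \<noteq> 0\<^sub>v d" using v hvec_nonzero ev_0 by auto
    fix t :: "nat \<Rightarrow> complex" assume "\<forall>i<N. t i \<noteq> 0"
    have "TT (mf (mat_diag N t)) = TT (\<lambda>a b. if a = b then t a else 0)"
      by (rule TT_cong) (auto simp: mat_diag_def)
    then have "ev (rho (mat_diag N t) *\<^sub>v v) = ev ((\<Prod>i<N. t i ^ lam i) \<cdot>\<^sub>v v)"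
      using ev_rep[OF rep_rho v(1), of "mat_diag N t"] TT_torus[of t] v by (simp add: ev_smult)
    then show "rho (mat_diag N t) *\<^sub>v v = (\<Prod>i<N. t i ^ lam i) \<cdot>\<^sub>v v"
      by (rule ev_inj[OF mult_mat_vec_carrier[OF rep_carrier[OF rep_rho] v(1)], rotated]) (use v in simp)
  next
    fix u :: "complex mat" assume u: "u \<in> carrier_mat N N" "upper_triangular u \<and> (\<forall>i<N. u $$ (i, i) = 1)"
    have "ap (TT (mf u)) hvec = hvec"
    proof (rule TT_unipotent)
      fix a b assume "a < N" "b < N" "b \<le> a"
      then show "mf u a b = (if a = b then 1 else 0)"
        using u unfolding upper_triangular_def by (cases "a = b") auto
    qed
    then have "ev (rho u *\<^sub>v v) = ev v" using ev_rep[OF rep_rho v(1), of u] v by simp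
    then show "rho u *\<^sub>v v = v"
      by (rule ev_inj[OF mult_mat_vec_carrier[OF rep_carrier[OF rep_rho] v(1)], rotated]) (use v in simp)
  qed
qed

text \<open>Nonempty words have a different weight, so only multiples of \<open>hvec\<close> have
  weight \<open>lam\<close>.\<close>

lemma highest_weight_space:
  assumes p: "inW p" and wt: "\<And>a. a < N \<Longrightarrow> ap (D (un a a)) p = (\<lambda>S. of_nat (lam a) * p S)"
  obtains k where "p = (\<lambda>S. k * hvec S)"
proof -
  let ?w = "wtl N C (\<lambda>k. k)"
  from p obtain A c where A: "finite A" "A \<subseteq> Wd N" "\<And>S. p S = (\<Sum>w\<in>A. c w * ap (fw (F.lf C) w) hvec S)"
    unfolding inW_def by blast
  have pw: "?w S = iw lam" if "p S \<noteq> 0" for S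
  proof
    fix a show "?w S a = int (lam a)"
    proof (cases "a < N")
      case True
      have "of_int (?w S a) * p S = of_nat (lam a) * p S"
        using fun_cong[OF wt[OF True], of S] F.DD_lft_diag[of C a] by simp
      then have "(of_int (?w S a) :: complex) = of_int (int (lam a))" using that by simp
      then show ?thesis by (simp only: of_int_eq_iff)
    next
      case False
      then have "?w S a = 0" unfolding wtl_def by (intro sum.neutral) auto
      then show ?thesis using part_zero[OF part] False by simp
    qed
  qed
  have "p S = (if [] \<in> A then c [] else 0) * hvec S" for S
  proof (cases "?w S = iw lam")
    case True
    have "c w * ap (fw (F.lf C) w) hvec S = 0" if "w \<in> A - {[]}" for w
    proof -
      have "has_wt ?w (wtw (iw lam) w) (ap (fw (F.lf C) w) hvec)"
        using P.has_wt_word[of w] hvec_hwv that A unfolding P.hwv_def by blast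
      then show ?thesis using wtw_eq_self[of "iw lam" w] True that unfolding has_wt_def by auto
    qed
    then have "p S = (\<Sum>w\<in>A \<inter> {[]}. c w * ap (fw (F.lf C) w) hvec S)"
      unfolding A(3) using A(1) by (intro sum.mono_neutral_right) auto
    then show ?thesis by auto
  next
    case False
    then have "p S = 0" "hvec S = 0" using pw[of S] hvec_hwv unfolding P.hwv_def has_wt_def by blast+
    then show ?thesis by simp
  qed
  then show ?thesis by (intro that ext)
qed

text \<open>A subspace stable under the group is stable under the Lie algebra, hence so is its orthogonal
  complement. The highest weight vector lies in one of the two, because its weight space is a line.\<close>

lemma GL_irreducible_rho: "GL_irreducible N d rho"
  unfolding GL_irreducible_def
proof (intro conjI allI impI)
  show "0 < d"
  proof (rule ccontr)
    assume "\<not> 0 < d"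
    then have "hvec = (\<lambda>S. 0)" using span[OF inW_hvec] unfolding in_span_def by auto
    then show False using hvec_nonzero by simp
  qed
  fix U :: "complex vec set"
  assume "VectorSpace.subspace class_ring U (module_vec TYPE(complex) d)
    \<and> (\<forall>g\<in>GL N. \<forall>u\<in>U. rho g *\<^sub>v u \<in> U)"
  then have sub: "LinearCombinations.submodule class_ring U (module_vec TYPE(complex) d)"
    and stable: "\<And>g u. g \<in> GL N \<Longrightarrow> u \<in> U \<Longrightarrow> rho g *\<^sub>v u \<in> U"
    unfolding VectorSpace.subspace_def by auto
  have Uc: "U \<subseteq> carrier_vec d" and U0: "0\<^sub>v d \<in> U"
    and Uadd: "\<And>v w. v \<in> U \<Longrightarrow> w \<in> U \<Longrightarrow> v + w \<in> U" and Usm: "\<And>c v. v \<in> U \<Longrightarrow> c \<cdot>\<^sub>v v \<in> U"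
    using sub unfolding LinearCombinations.submodule_def by (auto simp: module_vec_def)
  have comb: "\<exists>u\<in>U. ev u = (\<lambda>S. \<Sum>b\<in>B. c b * ev b S)" if "finite B" "B \<subseteq> U" for B c
    using that
  proof (induction B rule: finite_induct)
    case empty
    then show ?case using U0 ev_0 by auto
  next
    case (insert b B)
    then obtain u where u: "u \<in> U" "ev u = (\<lambda>S. \<Sum>b\<in>B. c b * ev b S)" by auto
    have "c b \<cdot>\<^sub>v b + u \<in> U" "c b \<cdot>\<^sub>v b \<in> carrier_vec d" "u \<in> carrier_vec d" "b \<in> carrier_vec d"
      using Uadd Usm u insert Uc by auto
    then show ?case using u insert by (intro bexI[of _ "c b \<cdot>\<^sub>v b + u"]) (simp_all add: ev_add ev_smult)
  qed
  have "card A \<le> card X" if "A \<subseteq> U" "finite A" "lin_indep A ev" for A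
    by (rule card_le_of_lin_indep_supp[OF P.fin that(2,3) supp_ev])
  from finite_basis_exists[OF this] obtain B where B: "B \<subseteq> U" "finite B" "lin_indep B ev"
    "\<forall>u\<in>U. in_span B ev (ev u)" by blast
  have sp_ev: "\<exists>u\<in>U. x = ev u" if "in_span B ev x" for x
  proof -
    from that obtain c where x: "x = (\<lambda>S. \<Sum>b\<in>B. c b * ev b S)" unfolding in_span_def by auto
    from comb[OF B(2,1), of c] obtain u where u: "u \<in> U" "ev u = (\<lambda>S. \<Sum>b\<in>B. c b * ev b S)" by blast
    show ?thesis by (rule bexI[OF _ u(1)]) (simp only: u(2) x)
  qed
  define perp where "perp x \<longleftrightarrow> (\<forall>b\<in>B. form cnj X (ev b) x = 0)" for x
  have perp_sp: "form cnj X x y = 0" if "perp y" "in_span B ev x" for x y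
  proof -
    from that(2) obtain c where "x = (\<lambda>S. \<Sum>b\<in>B. c b * ev b S)" unfolding in_span_def by auto
    then show ?thesis using that(1) unfolding perp_def by (simp add: form_sum_left)
  qed
  have zero: "x = (\<lambda>S. 0)" if "perp x" "in_span B ev x" for x
  proof -
    from sp_ev[OF that(2)] obtain u where "x = ev u" by blast
    then show ?thesis using form_cnj_pos[OF P.fin supp_ev] perp_sp[OF that] by blast
  qed
  \<comment> \<open>\<open>y\<close> is the part of \<open>ap (D Y) x\<close> orthogonal to the
    subspace. For small \<open>z\<close> the group elements \<open>1 + z Y\<close> keep
    \<open>x\<close> in the subspace, so the pairing of \<open>y\<close> with their images of
    \<open>x\<close> vanishes near 0, and so does its derivative, the pairing of \<open>y\<close>
    with \<open>ap (D Y) x\<close>.\<close>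
  have spD: "in_span B ev (ap (D Y) x)" if x: "in_span B ev x" for x Y
  proof -
    obtain u where u: "u \<in> U" "x = ev u" using sp_ev[OF x] by blast
    let ?x = "ap (D Y) (ev u)"
    have sx: "supp_in X ?x" by (rule supp_DD[OF supp_ev])
    obtain c where c: "\<forall>b\<in>B. form cnj X (ev b) (\<lambda>S. ?x S - (\<Sum>b\<in>B. c b * ev b S)) = 0"
      using orthogonal_projection[where Y = ev, OF P.fin B(2) supp_ev sx] by blast
    define y where "y = (\<lambda>S. ?x S - (\<Sum>b\<in>B. c b * ev b S))"
    have py: "perp y" using c unfolding perp_def y_def by blast
    have ys: "form cnj X y x' = 0" if "in_span B ev x'" for x'
      using perp_sp[OF py that] cnj_form[of X x' y] by simp
    let ?Y = "mat N N (\<lambda>(a, b). Y a b)"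
    let ?g = "\<lambda>z a b. (if a = b then 1 else 0) + z * Y a b"
    have "\<forall>\<^sub>F z in nhds 0. form cnj X y (ap (TT (?g z)) (ev u)) = 0"
    proof (rule eventually_mono[OF eventually_GL])
      show "?Y \<in> carrier_mat N N" by simp
      fix z assume g: "1\<^sub>m N + z \<cdot>\<^sub>m ?Y \<in> GL N"
      have "TT (?g z) = TT (mf (1\<^sub>m N + z \<cdot>\<^sub>m ?Y))" by (rule TT_cong) simp
      then have "ap (TT (?g z)) (ev u) = ev (rho (1\<^sub>m N + z \<cdot>\<^sub>m ?Y) *\<^sub>v u)"
        using ev_rep[OF rep_rho] u Uc by auto
      then show "form cnj X y (ap (TT (?g z)) (ev u)) = 0"
        using ys B(4) stable[OF g u(1)] by simp
    qed
    moreover have "((\<lambda>z. form cnj X y (ap (TT (?g z)) (ev u))) has_field_derivative form cnj X y ?x) (at 0)"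
      unfolding form_def by (intro DERIV_sum DERIV_cmult TT_derivative supp_ev)
    ultimately have "((\<lambda>z. 0) has_field_derivative form cnj X y ?x) (at (0::complex))"
      using DERIV_cong_ev[of 0 0 "\<lambda>z. form cnj X y (ap (TT (?g z)) (ev u))" "\<lambda>z. 0" "form cnj X y ?x"] by blast
    then have "form cnj X y ?x = 0" using DERIV_unique[OF _ DERIV_const] by blast
    moreover have "form cnj X y (\<lambda>S. \<Sum>b\<in>B. c b * ev b S) = 0" by (rule ys) (rule in_spanI, rule refl)
    ultimately have "form cnj X y (\<lambda>S. ?x S - (\<Sum>b\<in>B. c b * ev b S)) = 0" unfolding form_diff by simp
    from this[folded y_def] have yy: "form cnj X y y = 0" .
    have "supp_in X y" using sx supp_ev unfolding y_def supp_in_def by simp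
    from form_cnj_pos[OF P.fin this yy] have "y S = 0" for S by (rule fun_cong)
    then have "?x S = (\<Sum>b\<in>B. c b * ev b S)" for S unfolding y_def by simp
    then show ?thesis unfolding u(2) by (rule in_spanI)
  qed
  have perpD: "perp (ap (D Y) x)" if "perp x" for x Y
    unfolding perp_def
  proof
    fix b assume b: "b \<in> B"
    have "form cnj X (ev b) (ap (D Y) x) = form cnj X (ap (D (\<lambda>a b. cnj (Y b a))) (ev b)) x"
      using form_DD[OF finC, of N "\<lambda>a b. cnj (Y b a)" "ev b" x] by simp
    also have "\<dots> = 0" by (rule perp_sp[OF that spD[OF in_span_base[OF B(2) b]]])
    finally show "form cnj X (ev b) (ap (D Y) x) = 0" .
  qed
  obtain c where c: "\<forall>b\<in>B. form cnj X (ev b) (\<lambda>S. hvec S - (\<Sum>b\<in>B. c b * ev b S)) = 0"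
    using orthogonal_projection[where Y = ev, OF P.fin B(2) supp_ev supp_hvec] by blast
  \<comment> \<open>The projection \<open>p\<close> of \<open>hvec\<close> again has weight
    \<open>lam\<close>, since the subspace and its orthogonal complement are both stable; hence it
    is a multiple of \<open>hvec\<close>.\<close>
  define p where "p = (\<lambda>S. \<Sum>b\<in>B. c b * ev b S)"
  define q where "q = (\<lambda>S. hvec S - p S)"
  have sp: "in_span B ev p" unfolding p_def by (rule in_spanI, rule refl)
  have pq: "perp q" using c unfolding perp_def q_def p_def by blast
  have inWp: "inW p" unfolding p_def by (rule inW_sum) (rule inW_ev)
  obtain k where k: "p = (\<lambda>S. k * hvec S)"
  proof (rule highest_weight_space[OF inWp])
    fix a assume "a < N"
    let ?A = "D (un a a)"
    have h: "ap ?A hvec = (\<lambda>S. of_nat (lam a) * hvec S)"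
      using has_wt_dg[of "wtl N C (\<lambda>k. k)" "iw lam" hvec "\<lambda>kp. of_int (kp a)"] hvec_hwv F.DD_lft_diag[of C a]
      unfolding P.hwv_def by simp
    let ?r = "\<lambda>S. ap ?A p S - of_nat (lam a) * p S"
    have 1: "in_span B ev ?r" by (rule in_span_diff_scale[OF spD[OF sp] sp])
    have "ap ?A q = (\<lambda>S. of_nat (lam a) * hvec S - ap ?A p S)" unfolding q_def ap_diff h ..
    then have r: "?r = (\<lambda>S. of_nat (lam a) * q S - ap ?A q S)" by (simp add: q_def algebra_simps)
    have 2: "perp ?r"
      unfolding r using pq perpD[OF pq, of "un a a"] unfolding perp_def by (simp add: form_diff form_scale)
    have "?r = (\<lambda>S. 0)" by (rule zero[OF 2 1])
    then have "?r S = 0" for S by (rule fun_cong)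
    then show "ap ?A p = (\<lambda>S. of_nat (lam a) * p S)" by (intro ext) simp
  qed
  show "U = {0\<^sub>v d} \<or> U = carrier_vec d"
  proof (cases "k = 0")
    case False
    \<comment> \<open>The constant \<open>1 - 1 / k\<close> turns the difference into
      \<open>p\<close> divided by \<open>k\<close>, which is \<open>hvec\<close>.\<close>
    have hv: "(\<lambda>S. p S - (1 - 1 / k) * p S) = hvec" using False by (simp add: k left_diff_distrib)
    have h: "in_span B ev hvec" using in_span_diff_scale[OF sp sp, of "1 - 1 / k"] unfolding hv .
    have words: "in_span B ev (ap (fw (F.lf C) w) hvec)" if "w \<in> Wd N" for w
      using that by (induction w) (auto simp: h lf_eq intro: spD)
    have W: "in_span B ev x" if "inW x" for x
    proof -
      from that obtain A c where "finite A" "A \<subseteq> Wd N" "\<forall>S. x S = (\<Sum>w\<in>A. c w * ap (fw (F.lf C) w) hvec S)"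
        unfolding inW_def by blast
      moreover from this(3) have "x = (\<lambda>S. \<Sum>w\<in>A. c w * ap (fw (F.lf C) w) hvec S)" by blast
      ultimately show ?thesis
        using in_span_sum[of A B ev "\<lambda>w. ap (fw (F.lf C) w) hvec" c] words by blast
    qed
    have "v \<in> U" if v: "v \<in> carrier_vec d" for v
    proof -
      obtain u where "u \<in> U" "ev v = ev u" using sp_ev[OF W[OF inW_ev]] by blast
      then show ?thesis using ev_inj[OF v] Uc by blast
    qed
    then show ?thesis using Uc by blast
  next
    case True
    \<comment> \<open>Now \<open>hvec\<close> is orthogonal to the subspace, hence so is everything
      it generates, and the subspace is zero.\<close>
    then have "q = hvec" unfolding q_def k by simp
    then have h: "perp hvec" using pq by simp
    have pw: "perp (ap (fw (F.lf C) w) hvec)" if "w \<in> Wd N" for w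
      using that by (induction w) (auto simp: h lf_eq intro: perpD)
    have W: "perp x" if "inW x" for x
    proof -
      from that obtain A c where A: "A \<subseteq> Wd N" "\<forall>S. x S = (\<Sum>w\<in>A. c w * ap (fw (F.lf C) w) hvec S)"
        unfolding inW_def by blast
      from A(2) have x: "x = (\<lambda>S. \<Sum>w\<in>A. c w * ap (fw (F.lf C) w) hvec S)" by blast
      show ?thesis unfolding perp_def x form_sum
      proof (intro ballI sum.neutral)
        fix b w assume "b \<in> B" "w \<in> A"
        then show "c w * form cnj X (ev b) (ap (fw (F.lf C) w) hvec) = 0"
          using pw[of w] A(1) unfolding perp_def by auto
      qed
    qed
    have "u = 0\<^sub>v d" if u: "u \<in> U" for u
    proof -
      have "ev u = (\<lambda>S. 0)" by (rule zero[OF W[OF inW_ev] B(4)[rule_format, OF u]])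
      then show ?thesis using ev_inj[of u "0\<^sub>v d"] u Uc ev_0 by auto
    qed
    then show ?thesis using U0 by blast
  qed
qed

lemma weyl_module_rho: "weyl_module N lam d rho"
  unfolding weyl_module_def using GL_rep_rho GL_irreducible_rho highest_weight_rho by blast

end

section \<open>Decomposition under the two factors and comparison at \<open>q = 1\<close>\<close>

section \<open>Decomposition under the product of two general linear algebras\<close>

lemma form_cnj_self: "form cnj X x x = of_real (\<Sum>S\<in>X. (cmod (x S))\<^sup>2)"
  unfolding form_def of_real_sum by (intro sum.cong refl) (metis complex_norm_square mult.commute)

text \<open>The squared norm of \<open>ap (f i) x\<close> is \<open>hw kp i\<close> times that of
  \<open>x\<close>, so this number is not negative.\<close>

lemma (in posact) hwv_dominant:
  assumes x: "hwv kp x" "supp_in X x" "x \<noteq> (\<lambda>S. 0)" and i: "Suc i < M"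
  shows "kp (Suc i) \<le> kp i"
proof -
  let ?n = "\<lambda>y. \<Sum>S\<in>X. (cmod (y S))\<^sup>2"
  have "form cnj X (ap (fw f [i]) x) (ap (fw f [i]) x) = GG kp [i] [i] * form cnj X x x"
    using i by (intro words_gram x) auto
  then have "complex_of_real (?n (ap (f i) x)) = of_int (hw kp i) * of_real (?n x)"
    unfolding form_cnj_self by (simp add: qint_def)
  then have eq: "?n (ap (f i) x) = of_int (hw kp i) * ?n x"
    by (metis of_real_eq_iff of_real_mult of_real_of_int_eq)
  have "form cnj X x x \<noteq> 0" using form_cnj_pos[OF fin x(2)] x(3) by blast
  then have "?n x \<noteq> 0" unfolding form_cnj_self of_real_eq_0_iff .
  moreover have "0 \<le> ?n x" "0 \<le> ?n (ap (f i) x)" by (intro sum_nonneg; simp)+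
  ultimately have "0 \<le> (of_int (hw kp i) :: real)" unfolding eq
    by (metis less_eq_real_def mult_neg_pos not_le)
  then show ?thesis by (simp add: hw_def)
qed

context posact2 begin

lemma words_expand:
  assumes x: "B.hwv kp' x" "supp_in X x" and B: "gg_basis M' kp' B'" and u: "u \<in> Wd M'"
  shows "\<exists>c. \<forall>S. ap (fw f' u) x S = (\<Sum>w\<in>B'. c w * ap (fw f' w) x S)"
proof (cases "x = (\<lambda>S. 0)")
  case False
  then show ?thesis using B1.in_span_basis_words[OF x False B u] unfolding in_span_def by blast
qed (auto intro: exI[of _ "\<lambda>_. 0"])

lemma words_expand':
  assumes x: "A.hwv kp x" "supp_in X x" and B: "gg_basis M kp B" and u: "u \<in> Wd M"
  shows "\<exists>c. \<forall>S. ap (fw f u) x S = (\<Sum>w\<in>B. c w * ap (fw f w) x S)"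
proof (cases "x = (\<lambda>S. 0)")
  case False
  then show ?thesis using A1.in_span_basis_words[OF x False B u] unfolding in_span_def by blast
qed (auto intro: exI[of _ "\<lambda>_. 0"])

lemma word2_in_span:
  assumes x: "hw2 kp kp' x" and B: "gg_basis M kp B" and B': "gg_basis M' kp' B'"
    and u: "u \<in> Wd M" "u' \<in> Wd M'"
  shows "in_span (B \<times> B') (\<lambda>(w, w'). word2 x w w') (word2 x u u')"
proof -
  obtain c where c: "\<forall>S. ap (fw f u) (ap (fw f' u') x) S = (\<Sum>w\<in>B. c w * ap (fw f w) (ap (fw f' u') x) S)"
    using words_expand'[OF hwv_word'[OF x u(2)] B u(1)] by blast
  have "B.hwv kp' x" "supp_in X x" using x unfolding hw2_def by auto
  from words_expand[OF this B' u(2)] obtain c' where "\<forall>S. ap (fw f' u') x S = (\<Sum>w\<in>B'. c' w * ap (fw f' w) x S)"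
    by blast
  then have c': "ap (fw f' u') x = (\<lambda>S. \<Sum>w\<in>B'. c' w * ap (fw f' w) x S)" by blast
  have "word2 x u u' S = (\<Sum>w\<in>B. \<Sum>w'\<in>B'. c w * c' w' * word2 x w w' S)" for S
  proof -
    have "word2 x u u' S = (\<Sum>w\<in>B. c w * ap (fw f w) (ap (fw f' u') x) S)"
      using c unfolding word2_def by blast
    then show ?thesis unfolding c' ap_sum by (simp add: sum_distrib_left mult.assoc word2_def)
  qed
  then show ?thesis
    by (intro in_spanI[where c = "\<lambda>(w, w'). c w * c' w'"]) (simp add: sum.cartesian_product case_prod_beta)
qed

end

locale weyl_tensor = shape lam N + G: factor N M M' \<rho> \<rho>'
  for lam :: "nat \<Rightarrow> nat" and N M M' :: nat and \<rho> \<rho>' :: "nat \<Rightarrow> nat"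
begin

sublocale H: factor N M' M \<rho>' \<rho>
  by (rule factor_swap) unfold_locales

sublocale Q: posact2 M M' "wtl N C \<rho>" "wtl N C \<rho>'" "G.le C" "G.lf C" "H.le C" "H.lf C" X
  by (rule G.tensor_posact2[OF finC])

lemma wtl_id_sum: "wtl N C \<sigma> u a = (\<Sum>k<N. of_bool (\<sigma> k = a) * wtl N C (\<lambda>k. k) u k)"
proof -
  have "(\<Sum>k<N. of_bool (\<sigma> k = a) * of_bool (u c < N \<and> u c = k)) = (of_bool (u c < N \<and> \<sigma> (u c) = a) :: int)" for c
  proof -
    have "(\<Sum>k<N. of_bool (\<sigma> k = a) * of_bool (u c < N \<and> u c = k))
        = (\<Sum>k<N. if k = u c then of_bool (\<sigma> (u c) = a) else (0::int))"
      by (intro sum.cong refl) auto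
    then show ?thesis by simp
  qed
  then show ?thesis unfolding wtl_def sum_distrib_left by (subst sum.swap) simp
qed

text \<open>The two weights are functions of the weight for \<open>gl_N\<close>, and the words are
  weight vectors for the latter.\<close>

lemma inW_weight_dg: "inW x \<Longrightarrow> inW (ap (dg (\<lambda>S. h (wtl N C \<rho> S) (wtl N C \<rho>' S))) x)"
proof (rule inW_ap)
  fix w assume w: "w \<in> Wd N"
  let ?W = "wtl N C (\<lambda>k. k)"
  let ?p = "\<lambda>\<sigma> kp a. \<Sum>k<N. of_bool (\<sigma> k = a) * kp k"
  have "has_wt ?W (wtw (iw lam) w) (ap (fw (F.lf C) w) hvec)"
    using P.has_wt_word[OF w] hvec_hwv unfolding P.hwv_def by blast
  from has_wt_dg[OF this, of "\<lambda>kp. h (?p \<rho> kp) (?p \<rho>' kp)"]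
  show "inW (ap (dg (\<lambda>S. h (wtl N C \<rho> S) (wtl N C \<rho>' S))) (ap (fw (F.lf C) w) hvec))"
    using inW_scale[OF inW_word[OF w]] unfolding wtl_id_sum[of \<rho>, abs_def] wtl_id_sum[of \<rho>', abs_def] by simp
qed

lemma wtl_nonneg: "0 \<le> wtl N C \<sigma> u a"
  unfolding wtl_def by (intro sum_nonneg) auto

text \<open>Weights count entries, so they are nonnegative and vanish beyond the size of the factor;
  dominance comes from \<open>hwv_dominant\<close>.\<close>

lemma weight_partition:
  assumes x: "Q.hw2 kp kp' x" "x \<noteq> (\<lambda>S. 0)"
  shows "\<exists>al. part M al \<and> kp = iw al" and "\<exists>be. part M' be \<and> kp' = iw be"
proof -
  from x(2) obtain S where S: "x S \<noteq> 0" by auto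
  have hw: "Q.A.hwv kp x" "Q.B.hwv kp' x" "supp_in X x" using x(1) unfolding Q.hw2_def by auto
  have k: "wtl N C \<rho> S = kp" "wtl N C \<rho>' S = kp'"
    using hw S unfolding Q.A.hwv_def Q.B.hwv_def has_wt_def by auto
  have e: "iw (\<lambda>a. nat (wtl N C \<sigma> S a)) = wtl N C \<sigma> S" for \<sigma> using wtl_nonneg by auto
  have z: "wtl N C \<rho> S a = 0" if "M \<le> a" for a
    unfolding wtl_def using G.rho_less that by (intro sum.neutral) fastforce
  have z': "wtl N C \<rho>' S a = 0" if "M' \<le> a" for a
    unfolding wtl_def using G.rho'_less that by (intro sum.neutral) fastforce
  have "wtl N C \<rho> S (Suc i) \<le> wtl N C \<rho> S i" for i
    using Q.A1.hwv_dominant[OF hw(1,3) x(2), of i] z[of "Suc i"] wtl_nonneg[of \<rho> S i] unfolding k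
    by (cases "Suc i < M") auto
  then have "part M (\<lambda>a. nat (wtl N C \<rho> S a))" using z by (intro partI) (auto intro: nat_mono)
  then show "\<exists>al. part M al \<and> kp = iw al" using e[of \<rho>] unfolding k by metis
  have "wtl N C \<rho>' S (Suc i) \<le> wtl N C \<rho>' S i" for i
    using Q.B1.hwv_dominant[OF hw(2,3) x(2), of i] z'[of "Suc i"] wtl_nonneg[of \<rho>' S i] unfolding k
    by (cases "Suc i < M'") auto
  then have "part M' (\<lambda>a. nat (wtl N C \<rho>' S a))" using z' by (intro partI) (auto intro: nat_mono)
  then show "\<exists>be. part M' be \<and> kp' = iw be" using e[of \<rho>'] unfolding k by metis
qed

text \<open>Every raising operator of either family increases this number by 1, by
  \<open>sum_mult_alpha\<close>.\<close>

definition ht :: "(nat \<Rightarrow> int) \<Rightarrow> (nat \<Rightarrow> int) \<Rightarrow> int" where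
  "ht kp kp' = - (\<Sum>a<M. int a * kp a) - (\<Sum>a<M'. int a * kp' a)"

lemma sum_mult_alpha: "Suc i < K \<Longrightarrow> (\<Sum>a<K. int a * (kp a + alpha i a)) = (\<Sum>a<K. int a * kp a) - 1"
proof -
  assume i: "Suc i < K"
  have "(\<Sum>a<K. int a * alpha i a) = (\<Sum>a<K. if a = i then int i else 0) - (\<Sum>a<K. if a = Suc i then int (Suc i) else 0)"
    unfolding sum_subtractf[symmetric] by (intro sum.cong refl) (auto simp: alpha_def)
  also have "\<dots> = -1" using i by simp
  finally show ?thesis by (simp add: distrib_left sum.distrib)
qed

text \<open>A nonzero weight vector of greatest height is a highest weight vector.\<close>

lemma highest_weight_vector_exists:
  assumes inX: "\<And>x. U x \<Longrightarrow> supp_in X x" and wtp: "\<And>x h. U x \<Longrightarrow> U (ap (dg (\<lambda>S. of_bool (h (wtl N C \<rho> S) (wtl N C \<rho>' S)))) x)"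
    and e: "\<And>x i. Suc i < M \<Longrightarrow> U x \<Longrightarrow> U (ap (G.le C i) x)" and e': "\<And>x i. Suc i < M' \<Longrightarrow> U x \<Longrightarrow> U (ap (H.le C i) x)"
    and y: "U y" "y \<noteq> (\<lambda>S. 0)"
  shows "\<exists>x kp kp'. U x \<and> x \<noteq> (\<lambda>S. 0) \<and> Q.hw2 kp kp' x"
proof -
  let ?w = "wtl N C \<rho>" and ?w' = "wtl N C \<rho>'"
  let ?P = "\<lambda>S x. S \<in> X \<and> U x \<and> x S \<noteq> 0 \<and> has_wt ?w (?w S) x \<and> has_wt ?w' (?w' S) x"
  let ?K = "{ht (?w S) (?w' S) | S x. ?P S x}"
  have fK: "finite ?K" by (rule finite_subset[OF _ finite_imageI[OF P.fin, of "\<lambda>S. ht (?w S) (?w' S)"]]) auto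
  from y(2) obtain S0 where S0: "y S0 \<noteq> 0" by auto
  define y0 where "y0 = ap (dg (\<lambda>S. of_bool (?w S = ?w S0 \<and> ?w' S = ?w' S0))) y"
  have "?P S0 y0"
    using wtp[OF y(1), of "\<lambda>kp kp'. kp = ?w S0 \<and> kp' = ?w' S0"] S0 inX[OF y(1)]
    unfolding y0_def has_wt_def supp_in_def by auto
  then have "?K \<noteq> {}" by blast
  then have "Max ?K \<in> ?K" by (rule Max_in[OF fK])
  then obtain S x where S: "?P S x" and M: "Max ?K = ht (?w S) (?w' S)" by auto
  have le: "ht (?w S') (?w' S') \<le> ht (?w S) (?w' S)" if "?P S' x'" for S' x'
    unfolding M[symmetric] by (rule Max_ge[OF fK]) (use that in blast)
  have 1: "ap (G.le C i) x = (\<lambda>S. 0)" if i: "Suc i < M" for i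
  proof (rule ccontr)
    assume "ap (G.le C i) x \<noteq> (\<lambda>S. 0)"
    then obtain S' where S': "ap (G.le C i) x S' \<noteq> 0" by auto
    have U': "U (ap (G.le C i) x)" using e[OF i] S by blast
    have w: "has_wt ?w (\<lambda>k. ?w S k + alpha i k) (ap (G.le C i) x)" using Q.A.has_wt_e[OF i] S by blast
    have w': "has_wt ?w' (?w' S) (ap (G.le C i) x)" by (rule Q.has_wt_commute, rule Q.e_wt'[OF i]) (use S in blast)
    have eq: "?w S' = (\<lambda>k. ?w S k + alpha i k)" "?w' S' = ?w' S" using w w' S' unfolding has_wt_def by auto
    have "S' \<in> X" using inX[OF U'] S' unfolding supp_in_def by blast
    then have "ht (?w S') (?w' S') \<le> ht (?w S) (?w' S)" using U' S' w w' eq by (intro le[of _ "ap (G.le C i) x"]) simp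
    then show False unfolding eq ht_def sum_mult_alpha[OF i] by simp
  qed
  have 2: "ap (H.le C i) x = (\<lambda>S. 0)" if i: "Suc i < M'" for i
  proof (rule ccontr)
    assume "ap (H.le C i) x \<noteq> (\<lambda>S. 0)"
    then obtain S' where S': "ap (H.le C i) x S' \<noteq> 0" by auto
    have U': "U (ap (H.le C i) x)" using e'[OF i] S by blast
    have w: "has_wt ?w' (\<lambda>k. ?w' S k + alpha i k) (ap (H.le C i) x)" using Q.B.has_wt_e[OF i] S by blast
    have w': "has_wt ?w (?w S) (ap (H.le C i) x)" by (rule Q.has_wt_commute, rule Q.e'_wt[OF i]) (use S in blast)
    have eq: "?w' S' = (\<lambda>k. ?w' S k + alpha i k)" "?w S' = ?w S" using w w' S' unfolding has_wt_def by auto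
    have "S' \<in> X" using inX[OF U'] S' unfolding supp_in_def by blast
    then have "ht (?w S') (?w' S') \<le> ht (?w S) (?w' S)" using U' S' w w' eq by (intro le[of _ "ap (H.le C i) x"]) simp
    then show False unfolding eq ht_def sum_mult_alpha[OF i] by simp
  qed
  have "Q.hw2 (?w S) (?w' S) x"
    using 1 2 S inX unfolding Q.hw2_def Q.A.hwv_def Q.B.hwv_def by blast
  then show ?thesis using S by auto
qed

definition hwfam :: "((nat \<times> nat \<Rightarrow> nat) \<Rightarrow> complex) set \<Rightarrow> bool" where
  "hwfam L \<longleftrightarrow> finite L \<and> (\<forall>x\<in>L. inW x \<and> x \<noteq> (\<lambda>S. 0) \<and> (\<exists>kp kp'. Q.hw2 kp kp' x)) \<and>
     (\<forall>x\<in>L. \<forall>y\<in>L. x \<noteq> y \<longrightarrow> form cnj X x y = 0)"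

lemma hwfam_card: "hwfam L \<Longrightarrow> card L \<le> card X"
proof -
  assume L: "hwfam L"
  have "lin_indep L (\<lambda>x. x)"
  proof (rule lin_indepI)
    fix c a assume z: "\<And>b. (\<Sum>x\<in>L. c x * x b) = 0" and a: "a \<in> L"
    have "(\<Sum>x\<in>L. c x * form cnj X a x) = form cnj X a (\<lambda>S. \<Sum>x\<in>L. c x * x S)" by (rule form_sum[symmetric])
    then have "(\<Sum>x\<in>L. c x * form cnj X a x) = 0" unfolding z by simp
    moreover have "(\<Sum>x\<in>L. c x * form cnj X a x) = (\<Sum>x\<in>L. if x = a then c a * form cnj X a a else 0)"
      using L a unfolding hwfam_def by (intro sum.cong refl) auto
    moreover have "form cnj X a a \<noteq> 0"
      using form_cnj_pos[OF P.fin, of a] inW_supp L a unfolding hwfam_def by blast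
    ultimately show "c a = 0" using L a unfolding hwfam_def by simp
  qed
  then show ?thesis
    by (intro card_le_of_lin_indep_supp[OF P.fin]) (use L inW_supp in \<open>auto simp: hwfam_def\<close>)
qed

lemma inW_word2: "inW x \<Longrightarrow> inW (Q.word2 x u u')"
proof -
  have "inW y \<Longrightarrow> inW (ap (fw (G.lf C) u) y)" "inW y \<Longrightarrow> inW (ap (fw (H.lf C) u') y)" for y
    by (induction u, auto simp: G.lf_def intro: inW_D) (induction u', auto simp: H.lf_def intro: inW_D)
  then show "inW x \<Longrightarrow> inW (Q.word2 x u u')" unfolding Q.word2_def by blast
qed

text \<open>A largest orthogonal family of joint highest weight vectors generates everything:
  otherwise the orthogonal complement of what it generates, being stable under raising operators and
  weight projections, would contain another such vector.\<close>

theorem decomposition: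
  obtains L al be where "hwfam L" and "\<And>x. x \<in> L \<Longrightarrow> part M (al x)" and "\<And>x. x \<in> L \<Longrightarrow> part M' (be x)"
    and "\<And>x. x \<in> L \<Longrightarrow> Q.hw2 (iw (al x)) (iw (be x)) x"
    and "\<And>y. inW y \<Longrightarrow> in_span (Sigma L (\<lambda>x. Bs M (al x) \<times> Bs M' (be x))) (\<lambda>(x, w, w'). Q.word2 x w w') y"
proof -
  have "hwfam {}" by (simp add: hwfam_def)
  from ex_has_greatest_nat[of hwfam "{}" card "card X + 1", OF this] hwfam_card
  obtain L where L: "hwfam L" and max: "\<And>L'. hwfam L' \<Longrightarrow> card L' \<le> card L" by (metis less_Suc_eq_le Suc_eq_plus1)
  have "\<forall>x\<in>L. \<exists>p. part M (fst p) \<and> part M' (snd p) \<and> Q.hw2 (iw (fst p)) (iw (snd p)) x"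
  proof
    fix x assume "x \<in> L"
    then obtain kp kp' where x: "Q.hw2 kp kp' x" "x \<noteq> (\<lambda>S. 0)" using L unfolding hwfam_def by blast
    obtain al be where "part M al" "kp = iw al" "part M' be" "kp' = iw be" using weight_partition[OF x] by blast
    then show "\<exists>p. part M (fst p) \<and> part M' (snd p) \<and> Q.hw2 (iw (fst p)) (iw (snd p)) x"
      using x(1) by (intro exI[of _ "(al, be)"]) simp
  qed
  from bchoice[OF this] obtain p where
    p: "\<And>x. x \<in> L \<Longrightarrow> part M (fst (p x)) \<and> part M' (snd (p x)) \<and> Q.hw2 (iw (fst (p x))) (iw (snd (p x))) x" by blast
  define al be where "al x = fst (p x)" and "be x = snd (p x)" for x
  have q: "part M (al x)" "part M' (be x)" "Q.hw2 (iw (al x)) (iw (be x)) x" if "x \<in> L" for x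
    using p[OF that] unfolding al_def be_def by auto
  let ?I = "Sigma L (\<lambda>x. Bs M (al x) \<times> Bs M' (be x))" and ?Y = "\<lambda>(x, w, w'). Q.word2 x w w'"
  have finL: "finite L" using L unfolding hwfam_def by blast
  have finI: "finite ?I" using finL Bs_facts(1) q by auto
  have Wd: "x \<in> L" "w \<in> Wd M" "w' \<in> Wd M'" if "(x, w, w') \<in> ?I" for x w w'
    using that q Bs_facts(4)[of M "al x" w] Bs_facts(4)[of M' "be x" w'] by auto
  have suppY: "supp_in X (?Y a)" if "a \<in> ?I" for a
    using that L by (cases a) (auto simp: hwfam_def intro!: inW_supp inW_word2)
  have "in_span ?I ?Y y" if y: "inW y" for y
  proof -
    obtain c where c: "\<forall>a\<in>?I. form cnj X (?Y a) (\<lambda>S. y S - (\<Sum>b\<in>?I. c b * ?Y b S)) = 0"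
      using orthogonal_projection[where Y = ?Y, OF P.fin finI suppY inW_supp[OF y]] by blast
    define r where "r = (\<lambda>S. y S - (\<Sum>b\<in>?I. c b * ?Y b S))"
    have inWr: "inW r" unfolding r_def
      using L Wd(1) by (intro inW_diff y inW_sum) (auto simp: hwfam_def intro!: inW_word2)
    \<comment> \<open>Orthogonality to all words and not only to the basis words, since stability
      under a raising operator uses words with one more letter.\<close>
    define U where "U z \<longleftrightarrow> inW z \<and> (\<forall>x\<in>L. \<forall>u\<in>Wd M. \<forall>u'\<in>Wd M'. form cnj X (Q.word2 x u u') z = 0)" for z
    have Ur: "U r" unfolding U_def
    proof (intro conjI inWr ballI)
      fix x u u' assume x: "x \<in> L" and u: "u \<in> Wd M" "u' \<in> Wd M'"
      from Q.word2_in_span[OF q(3)[OF x] gg_basis_Bs[OF q(1)[OF x]] gg_basis_Bs[OF q(2)[OF x]] u]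
      obtain e where "\<forall>S. Q.word2 x u u' S = (\<Sum>a\<in>Bs M (al x) \<times> Bs M' (be x). e a * (case a of (w, w') \<Rightarrow> Q.word2 x w w') S)"
        unfolding in_span_def by blast
      then have e: "Q.word2 x u u' = (\<lambda>S. \<Sum>a\<in>Bs M (al x) \<times> Bs M' (be x). e a * (case a of (w, w') \<Rightarrow> Q.word2 x w w') S)"
        by blast
      show "form cnj X (Q.word2 x u u') r = 0"
        unfolding e form_sum_left using c x by (intro sum.neutral) (auto simp: r_def)
    qed
    have "r = (\<lambda>S. 0)"
    proof (rule ccontr)
      assume nz: "r \<noteq> (\<lambda>S. 0)"
      have "\<exists>x kp kp'. U x \<and> x \<noteq> (\<lambda>S. 0) \<and> Q.hw2 kp kp' x"
      proof (rule highest_weight_vector_exists[where U = U, OF _ _ _ _ Ur nz])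
        show "U x \<Longrightarrow> supp_in X x" for x unfolding U_def using inW_supp by blast
        show "U (ap (dg (\<lambda>S. of_bool (h (wtl N C \<rho> S) (wtl N C \<rho>' S)))) z)" if z: "U z" for z h
          unfolding U_def
        proof (intro conjI ballI)
          show "inW (ap (dg (\<lambda>S. of_bool (h (wtl N C \<rho> S) (wtl N C \<rho>' S)))) z)"
            using z inW_weight_dg[of z "\<lambda>a b. of_bool (h a b)"] unfolding U_def by blast
          fix x u u' assume x: "x \<in> L" and u: "u \<in> Wd M" "u' \<in> Wd M'"
          have wt: "wtl N C \<rho> S = wtw (iw (al x)) u" "wtl N C \<rho>' S = wtw (iw (be x)) u'" if "Q.word2 x u u' S \<noteq> 0" for S
            using Q.has_wt_word2[OF q(3)[OF x] u] that unfolding has_wt_def by auto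
          have "form cnj X (Q.word2 x u u') (ap (dg (\<lambda>S. of_bool (h (wtl N C \<rho> S) (wtl N C \<rho>' S)))) z)
              = of_bool (h (wtw (iw (al x)) u) (wtw (iw (be x)) u')) * form cnj X (Q.word2 x u u') z"
            unfolding form_def sum_distrib_left
          proof (intro sum.cong refl)
            fix S
            show "cnj (Q.word2 x u u' S) * ap (dg (\<lambda>S. of_bool (h (wtl N C \<rho> S) (wtl N C \<rho>' S)))) z S
                = of_bool (h (wtw (iw (al x)) u) (wtw (iw (be x)) u')) * (cnj (Q.word2 x u u' S) * z S)"
              using wt[of S] by (cases "Q.word2 x u u' S = 0") auto
          qed
          then show "form cnj X (Q.word2 x u u') (ap (dg (\<lambda>S. of_bool (h (wtl N C \<rho> S) (wtl N C \<rho>' S)))) z) = 0"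
            using z x u unfolding U_def by simp
        qed
        show "U (ap (G.le C i) z)" if i: "Suc i < M" and z: "U z" for z i
          unfolding U_def
        proof (intro conjI ballI)
          show "inW (ap (G.le C i) z)" using z unfolding U_def G.le_def by (blast intro: inW_D)
          fix x u u' assume x: "x \<in> L" and u: "u \<in> Wd M" "u' \<in> Wd M'"
          have "form cnj X (Q.word2 x u u') (ap (G.le C i) z) = form cnj X (ap (G.lf C i) (Q.word2 x u u')) z"
            using Q.A.adj[OF i, of "Q.word2 x u u'" z] Q.supp_word2[OF q(3)[OF x] u] z inW_supp
            unfolding U_def by simp
          also have "ap (G.lf C i) (Q.word2 x u u') = Q.word2 x (i # u) u'" by (simp add: Q.word2_def)
          finally show "form cnj X (Q.word2 x u u') (ap (G.le C i) z) = 0" using z x u i unfolding U_def by simp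
        qed
        show "U (ap (H.le C i) z)" if i: "Suc i < M'" and z: "U z" for z i
          unfolding U_def
        proof (intro conjI ballI)
          show "inW (ap (H.le C i) z)" using z unfolding U_def H.le_def by (blast intro: inW_D)
          fix x u u' assume x: "x \<in> L" and u: "u \<in> Wd M" "u' \<in> Wd M'"
          have "form cnj X (Q.word2 x u u') (ap (H.le C i) z) = form cnj X (ap (H.lf C i) (Q.word2 x u u')) z"
            using Q.B.adj[OF i, of "Q.word2 x u u'" z] Q.supp_word2[OF q(3)[OF x] u] z inW_supp
            unfolding U_def by simp
          also have "ap (H.lf C i) (Q.word2 x u u') = Q.word2 x u (i # u')"
            using arg_cong[OF Q.word_commute[of u "[i]"], of "\<lambda>A. ap A (ap (fw (H.lf C) u') x)"] u i
            by (simp add: Q.word2_def)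
          finally show "form cnj X (Q.word2 x u u') (ap (H.le C i) z) = 0" using z x u i unfolding U_def by simp
        qed
      qed
      then obtain x where x: "U x" "x \<noteq> (\<lambda>S. 0)" "\<exists>kp kp'. Q.hw2 kp kp' x" by blast
      have o: "form cnj X y x = 0" if "y \<in> L" for y
      proof -
        have "Q.word2 y [] [] = y" by (simp add: Q.word2_def)
        moreover have "form cnj X (Q.word2 y [] []) x = 0" using x(1) that unfolding U_def by force
        ultimately show ?thesis by simp
      qed
      have o': "form cnj X x y = 0" if "y \<in> L" for y using o[OF that] cnj_form[of X y x] by simp
      have "form cnj X x x \<noteq> 0" using form_cnj_pos[OF P.fin, of x] x inW_supp unfolding U_def by blast
      then have "x \<notin> L" using o by blast
      moreover have "hwfam (insert x L)" using L x o o' unfolding hwfam_def U_def by auto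
      ultimately show False using max[of "insert x L"] finL by simp
    qed
    then have "r S = 0" for S by simp
    then show ?thesis unfolding r_def by (intro in_spanI[where c = c]) simp
  qed
  then show ?thesis using that[of L al be] L q by blast
qed

end

section \<open>Comparison at \<open>q = 1\<close>\<close>

lemma lin_indep_reindex:
  assumes h: "bij_betw h A B" and ind: "lin_indep B Y"
  shows "lin_indep A (\<lambda>a. Y (h a))"
proof (rule lin_indepI)
  fix c a assume z: "\<And>b. (\<Sum>a\<in>A. c a * Y (h a) b) = 0" and a: "a \<in> A"
  have inv: "inv_into A h (h x) = x" if "x \<in> A" for x
    using h that by (simp add: bij_betw_def)
  have "(\<Sum>y\<in>B. c (inv_into A h y) * Y y b) = 0" for b
  proof -
    have "(\<Sum>y\<in>B. c (inv_into A h y) * Y y b) = (\<Sum>a\<in>A. c (inv_into A h (h a)) * Y (h a) b)"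
      by (rule sum.reindex_bij_betw[OF h, symmetric])
    also have "\<dots> = (\<Sum>a\<in>A. c a * Y (h a) b)" using inv by (intro sum.cong refl) simp
    finally show ?thesis using z by simp
  qed
  from lin_indepD[OF ind this, of "h a"] show "c a = 0" using inv[OF a] bij_betwE[OF h] a by simp
qed

lemma in_span_reindex:
  assumes h: "bij_betw h A B" and s: "in_span B Y x"
  shows "in_span A (\<lambda>a. Y (h a)) x"
proof -
  from s obtain c where "\<And>b. x b = (\<Sum>y\<in>B. c y * Y y b)" unfolding in_span_def by blast
  then have "x b = (\<Sum>a\<in>A. c (h a) * Y (h a) b)" for b
    using sum.reindex_bij_betw[OF h, of "\<lambda>y. c y * Y y b"] by simp
  then show ?thesis by (rule in_spanI)
qed

text \<open>No inequality between fibres can be strict, since the totals agree.\<close>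

lemma card_fibers_eq:
  assumes A: "finite A" and B: "finite B" and c: "card A = card B"
    and le: "\<And>\<omega>. card {b \<in> B. w' b = \<omega>} \<le> card {a \<in> A. w a = \<omega>}"
  shows "card {a \<in> A. w a = \<omega>} = card {b \<in> B. w' b = \<omega>}"
proof (rule ccontr)
  assume ne: "\<not> ?thesis"
  let ?O = "insert \<omega> (w ` A \<union> w' ` B)"
  have fO: "finite ?O" using A B by simp
  have 1: "(\<Sum>\<omega>\<in>?O. card {x \<in> G. v x = \<omega>}) = card G" if "finite G" "v ` G \<subseteq> ?O" for G and v :: "'x \<Rightarrow> _"
    using sum.group[OF that(1) fO that(2), of "\<lambda>_. 1::nat"] by simp
  have "(\<Sum>\<omega>\<in>?O. card {b \<in> B. w' b = \<omega>}) < (\<Sum>\<omega>\<in>?O. card {a \<in> A. w a = \<omega>})"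
  proof (rule sum_strict_mono_ex1[OF fO])
    show "\<forall>\<omega>\<in>?O. card {b \<in> B. w' b = \<omega>} \<le> card {a \<in> A. w a = \<omega>}" using le by blast
    show "\<exists>\<omega>\<in>?O. card {b \<in> B. w' b = \<omega>} < card {a \<in> A. w a = \<omega>}"
      using ne le[of \<omega>] by (intro bexI[of _ \<omega>]) auto
  qed
  moreover have "(\<Sum>\<omega>\<in>?O. card {b \<in> B. w' b = \<omega>}) = card B" by (rule 1[OF B]) auto
  moreover have "(\<Sum>\<omega>\<in>?O. card {a \<in> A. w a = \<omega>}) = card A" by (rule 1[OF A]) auto
  ultimately show False using c by simp
qed

lemma (in posact) e_at_one':
  assumes z: "hwv (iw al) z" "supp_in X z" and b: "in_box M r al" and i: "Suc i < M" and w: "w \<in> Bs M al"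
  shows "ap (e i) (ap (fw f w) z) S = (\<Sum>u\<in>Bs M al. at_one (ecoef (Eq r i) M r al w u) * ap (fw f u) z S)"
    and "ap (f i) (ap (fw f w) z) S = (\<Sum>u\<in>Bs M al. at_one (ecoef (Fq r i) M r al w u) * ap (fw f u) z S)"
proof -
  have "ap (e i) (ap (fw f w) z) S = (\<Sum>u\<in>Bs M al. at_one (ecoef (Eq r i) M r al w u) * ap (fw f u) z S)
    \<and> ap (f i) (ap (fw f w) z) S = (\<Sum>u\<in>Bs M al. at_one (ecoef (Fq r i) M r al w u) * ap (fw f u) z S)"
  proof (cases "z = (\<lambda>S. 0)")
    case True
    then show ?thesis by simp
  next
    case False
    from e_at_one[OF z False b i w] f_at_one[OF z False b i w] show ?thesis by blast
  qed
  then show "ap (e i) (ap (fw f w) z) S = (\<Sum>u\<in>Bs M al. at_one (ecoef (Eq r i) M r al w u) * ap (fw f u) z S)"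
    "ap (f i) (ap (fw f w) z) S = (\<Sum>u\<in>Bs M al. at_one (ecoef (Fq r i) M r al w u) * ap (fw f u) z S)" by blast+
qed

lemma factor_mod_div: "1 \<le> m \<Longrightarrow> factor (m * n) m n (\<lambda>k. k mod m) (\<lambda>k. k div m)"
  unfolding factor_def
proof (rule bij_betw_byWitness[where f' = "\<lambda>(i, j). j * m + i"])
  assume m: "1 \<le> m"
  show "(\<lambda>k. (k mod m, k div m)) ` {..<m * n} \<subseteq> {..<m} \<times> {..<n}"
    using m by (auto simp: less_mult_imp_div_less mult.commute)
  show "(\<lambda>(i, j). j * m + i) ` ({..<m} \<times> {..<n}) \<subseteq> {..<m * n}"
  proof
    fix x assume "x \<in> (\<lambda>(i, j). j * m + i) ` ({..<m} \<times> {..<n})"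
    then obtain i j where ij: "x = j * m + i" "i < m" "j < n" by auto
    then have "j * m + i < Suc j * m" "Suc j * m \<le> n * m" by (simp, intro mult_le_mono1) simp
    then show "x \<in> {..<m * n}" using ij by (simp add: mult.commute)
  qed
qed auto

lemma matrix_in_basis_unit_vecs: "M \<in> carrier_mat d d \<Longrightarrow> matrix_in_basis d (unit_vecs d) M = M"
proof -
  assume M: "M \<in> carrier_mat d d"
  have "mat_of_cols d (unit_vecs d) = (1\<^sub>m d :: ratfun mat)"
    by (intro eq_matI) (auto simp: unit_vecs_def mat_of_cols_def)
  then show ?thesis unfolding matrix_in_basis_def using M by (intro the_equality) auto
qed

lemma ordered_basis_unit_vecs: "ordered_basis d (unit_vecs d)"
proof -
  interpret V: vec_space "TYPE(ratfun)" d .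
  show ?thesis unfolding ordered_basis_def using V.unit_vecs_basis V.unit_vecs_distinct by blast
qed

lemma mat_diag_unit_vec:
  assumes "k < d"
  shows "mat_diag d g *\<^sub>v unit_vec d k = g k \<cdot>\<^sub>v (unit_vec d k :: 'k::field vec)"
proof (rule eq_vecI)
  fix i assume "i < dim_vec (g k \<cdot>\<^sub>v (unit_vec d k :: 'k vec))"
  then have i: "i < d" by simp
  have "(mat_diag d g *\<^sub>v unit_vec d k) $ i = mat_diag d g $$ (i, k)"
    using assms i by (simp add: mat_diag_def scalar_prod_def unit_vec_def if_distrib cong: if_cong)
  then show "(mat_diag d g *\<^sub>v unit_vec d k) $ i = (g k \<cdot>\<^sub>v (unit_vec d k :: 'k vec)) $ i"
    using assms i by (auto simp: mat_diag_def unit_vec_def)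
qed (simp add: mat_diag_def)

text \<open>\<open>phi m n a b\<close> is a Kronecker product, so its derivative at the identity is
  \<open>Y \<otimes> 1 + 1 \<otimes> Z\<close> by the product rule.\<close>

lemma dphi_entry:
  assumes Y: "Y \<in> carrier_mat m m" "Z \<in> carrier_mat n n" and kl: "k < m * n" "l < m * n" and m: "1 \<le> m"
  shows "dphi m n Y Z $$ (k, l) = lft (\<lambda>k. k mod m) (\<lambda>k. k div m) (\<lambda>a b. Y $$ (a, b)) k l
    + lft (\<lambda>k. k div m) (\<lambda>k. k mod m) (\<lambda>a b. Z $$ (a, b)) k l"
proof -
  have mn: "k mod m < m" "l mod m < m" "k div m < n" "l div m < n"
    using kl m by (auto simp: less_mult_imp_div_less mult.commute)
  have phi: "phi m n a b $$ (k, l) = a $$ (k mod m, l mod m) * b $$ (k div m, l div m)"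
    if ab: "a \<in> carrier_mat m m" "b \<in> carrier_mat n n" for a b
  proof -
    let ?E = "munit m n (l mod m) (l div m)"
    have E: "?E \<in> carrier_mat m n" by (simp add: munit_def)
    have 1: "(a * ?E) $$ (k mod m, c) = (if c = l div m then a $$ (k mod m, l mod m) else 0)" if "c < n" for c
      using ab(1) mn that by (simp add: munit_def scalar_prod_def if_distrib cong: if_cong)
    have "(a * ?E * transpose_mat b) $$ (k mod m, k div m)
        = (\<Sum>c = 0..<n. (a * ?E) $$ (k mod m, c) * b $$ (k div m, c))"
    proof -
      have "(Q * transpose_mat b) $$ (p, q) = (\<Sum>c = 0..<n. Q $$ (p, c) * b $$ (q, c))"
        if "Q \<in> carrier_mat m n" "p < m" "q < n" for Q p q
        using that ab(2) by (simp add: scalar_prod_def)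
      then show ?thesis using ab(1) E mn by (meson mult_carrier_mat)
    qed
    also have "\<dots> = (\<Sum>c = 0..<n. if c = l div m then a $$ (k mod m, l mod m) * b $$ (k div m, l div m) else 0)"
      by (intro sum.cong refl) (auto simp: 1)
    also have "\<dots> = a $$ (k mod m, l mod m) * b $$ (k div m, l div m)" using mn by simp
    finally show ?thesis using kl by (simp add: phi_def)
  qed
  let ?d = "\<lambda>x y. if x = y then 1 else (0::complex)"
  have "(\<lambda>z. phi m n (1\<^sub>m m + z \<cdot>\<^sub>m Y) (1\<^sub>m n + z \<cdot>\<^sub>m Z) $$ (k, l))
      = (\<lambda>z. (?d (k mod m) (l mod m) + z * Y $$ (k mod m, l mod m)) * (?d (k div m) (l div m) + z * Z $$ (k div m, l div m)))"
    using Y mn by (simp add: phi)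
  moreover have "((\<lambda>z. (?d (k mod m) (l mod m) + z * Y $$ (k mod m, l mod m)) * (?d (k div m) (l div m) + z * Z $$ (k div m, l div m)))
      has_field_derivative ?d (k mod m) (l mod m) * Z $$ (k div m, l div m) + Y $$ (k mod m, l mod m) * ?d (k div m) (l div m)) (at 0)"
    by (auto intro!: derivative_eq_intros)
  ultimately show ?thesis using kl by (simp add: dphi_def lft_def DERIV_imp_deriv)
qed

text \<open>A basis of the Weyl module indexed by \<open>k < d\<close>: a joint highest weight
  vector \<open>lb k\<close> and a word for each factor. The same indices serve for the quantum
  module; \<open>r\<close> bounds the widths of all diagrams of both factors.\<close>

locale frame = weyl_tensor lam "m * n" m n "\<lambda>k. k mod m" "\<lambda>k. k div m" for lam m n +
  fixes L :: "((nat \<times> nat \<Rightarrow> nat) \<Rightarrow> complex) set" and al be :: "((nat \<times> nat \<Rightarrow> nat) \<Rightarrow> complex) \<Rightarrow> nat \<Rightarrow> nat"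
    and d :: nat and idx :: "nat \<Rightarrow> ((nat \<times> nat \<Rightarrow> nat) \<Rightarrow> complex) \<times> nat list \<times> nat list" and r :: nat
  assumes m: "1 \<le> m" and L: "hwfam L"
    and al: "\<And>x. x \<in> L \<Longrightarrow> in_box m r (al x)" and be: "\<And>x. x \<in> L \<Longrightarrow> in_box n r (be x)"
    and hw: "\<And>x. x \<in> L \<Longrightarrow> Q.hw2 (iw (al x)) (iw (be x)) x"
    and spanning: "\<And>y. inW y \<Longrightarrow> in_span (Sigma L (\<lambda>x. Bs m (al x) \<times> Bs n (be x))) (\<lambda>(x, w, w'). Q.word2 x w w') y"
    and idx: "bij_betw idx {..<d} (Sigma L (\<lambda>x. Bs m (al x) \<times> Bs n (be x)))"
begin

definition lb where "lb k = fst (idx k)"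
definition w1 where "w1 k = fst (snd (idx k))"
definition w2 where "w2 k = snd (snd (idx k))"
definition Z where "Z k = Q.word2 (lb k) (w1 k) (w2 k)"

abbreviation "N \<equiv> m * n"

lemma idx_eq: "idx k = (lb k, w1 k, w2 k)" by (simp add: lb_def w1_def w2_def)

lemma idx_mem: "k < d \<Longrightarrow> lb k \<in> L" "k < d \<Longrightarrow> w1 k \<in> Bs m (al (lb k))" "k < d \<Longrightarrow> w2 k \<in> Bs n (be (lb k))"
  using bij_betwE[OF idx] idx_eq by auto

lemma idx_inj: "k < d \<Longrightarrow> l < d \<Longrightarrow> lb k = lb l \<Longrightarrow> w1 k = w1 l \<Longrightarrow> w2 k = w2 l \<Longrightarrow> k = l"
  using idx idx_eq unfolding bij_betw_def inj_on_def by auto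

lemma idx_surj:
  assumes "x \<in> L" "u \<in> Bs m (al x)" "u' \<in> Bs n (be x)"
  obtains k where "k < d" "lb k = x" "w1 k = u" "w2 k = u'"
proof -
  have "(x, u, u') \<in> idx ` {..<d}" using idx assms unfolding bij_betw_def by auto
  then show ?thesis using that idx_eq by auto
qed

lemma finL: "finite L" using L unfolding hwfam_def by blast

lemma parts: "x \<in> L \<Longrightarrow> part m (al x)" "x \<in> L \<Longrightarrow> part n (be x)"
  using al be in_box_part by blast+

lemma words_Wd: "k < d \<Longrightarrow> w1 k \<in> Wd m" "k < d \<Longrightarrow> w2 k \<in> Wd n"
  using idx_mem parts Bs_facts(4) by blast+

lemma lin_indep_Z: "lin_indep {..<d} Z"
proof -
  have "lin_indep (Sigma L (\<lambda>x. Bs m (al x) \<times> Bs n (be x))) (\<lambda>(x, w, w'). Q.word2 x w w')"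
    by (rule Q.lin_indep_blocks[where kp = "\<lambda>x. iw (al x)" and kp' = "\<lambda>x. iw (be x)" and x = "\<lambda>x. x"])
       (use L hw parts gg_basis_Bs in \<open>auto simp: hwfam_def\<close>)
  from lin_indep_reindex[OF idx this] show ?thesis by (simp add: idx_eq Z_def[abs_def])
qed

sublocale W: weyl_frame lam "m * n" d Z
proof
  show "inW (Z j)" if "j < d" for j
    using idx_mem(1)[OF that] L unfolding Z_def hwfam_def by (intro inW_word2) blast
  show "in_span {..<d} Z x" if "inW x" for x
    using in_span_reindex[OF idx spanning[OF that]] by (simp add: idx_eq Z_def[abs_def])
qed (rule lin_indep_Z)

text \<open>For the first factor the words of the second one only count multiplicity, and conversely
  for \<open>B\<close>.\<close>

sublocale A: blocks m r d "Sigma L (\<lambda>x. Bs n (be x))" "\<lambda>s. al (fst s)" "\<lambda>k. (lb k, w2 k)" w1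
proof
  show "finite (Sigma L (\<lambda>x. Bs n (be x)))" using finL parts Bs_facts(1) by auto
  have "bij_betw (\<lambda>(x, u, u'). ((x, u'), u)) (Sigma L (\<lambda>x. Bs m (al x) \<times> Bs n (be x)))
      (Sigma (Sigma L (\<lambda>x. Bs n (be x))) (\<lambda>s. Bs m (al (fst s))))"
    by (rule bij_betw_byWitness[where f' = "\<lambda>((x, u'), u). (x, u, u')"]) auto
  from bij_betw_trans[OF idx this]
  show "bij_betw (\<lambda>k. ((lb k, w2 k), w1 k)) {..<d} (Sigma (Sigma L (\<lambda>x. Bs n (be x))) (\<lambda>s. Bs m (al (fst s))))"
    by (simp add: o_def idx_eq)
qed (use al in auto)

sublocale B: blocks n r d "Sigma L (\<lambda>x. Bs m (al x))" "\<lambda>s. be (fst s)" "\<lambda>k. (lb k, w1 k)" w2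
proof
  show "finite (Sigma L (\<lambda>x. Bs m (al x)))" using finL parts Bs_facts(1) by auto
  have "bij_betw (\<lambda>(x, u, u'). ((x, u), u')) (Sigma L (\<lambda>x. Bs m (al x) \<times> Bs n (be x)))
      (Sigma (Sigma L (\<lambda>x. Bs m (al x))) (\<lambda>s. Bs n (be (fst s))))"
    by (rule bij_betw_byWitness[where f' = "\<lambda>((x, u), u'). (x, u, u')"]) auto
  from bij_betw_trans[OF idx this]
  show "bij_betw (\<lambda>k. ((lb k, w1 k), w2 k)) {..<d} (Sigma (Sigma L (\<lambda>x. Bs m (al x))) (\<lambda>s. Bs n (be (fst s))))"
    by (simp add: o_def idx_eq)
qed (use be in auto)

text \<open>Block matrices of the form \<open>P \<otimes> 1\<close>, while \<open>tB\<close> gives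
  \<open>1 \<otimes> P\<close>; all generators of the two quantum groups have one of these
  forms.\<close>

definition tA :: "(((nat \<times> nat \<Rightarrow> nat) \<Rightarrow> complex) \<Rightarrow> nat list \<Rightarrow> nat list \<Rightarrow> ratfun) \<Rightarrow> ratfun mat" where
  "tA P = mat d d (\<lambda>(a, b). if lb a = lb b \<and> w2 a = w2 b then P (lb a) (w1 a) (w1 b) else 0)"

definition tB :: "(((nat \<times> nat \<Rightarrow> nat) \<Rightarrow> complex) \<Rightarrow> nat list \<Rightarrow> nat list \<Rightarrow> ratfun) \<Rightarrow> ratfun mat" where
  "tB P = mat d d (\<lambda>(a, b). if lb a = lb b \<and> w1 a = w1 b then P (lb a) (w2 a) (w2 b) else 0)"

lemma tA_tB_commute: "tA P * tB R = tB R * tA P"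
proof (rule eq_matI)
  fix a b assume "a < dim_row (tB R * tA P)" "b < dim_col (tB R * tA P)"
  then have ab: "a < d" "b < d" by (auto simp: tA_def tB_def)
  have l: "(tA P * tB R) $$ (a, b) = (\<Sum>k<d. tA P $$ (a, k) * tB R $$ (k, b))"
    and r: "(tB R * tA P) $$ (a, b) = (\<Sum>k<d. tB R $$ (a, k) * tA P $$ (k, b))"
    using ab by (simp_all add: tA_def tB_def scalar_prod_def atLeast0LessThan)
  show "(tA P * tB R) $$ (a, b) = (tB R * tA P) $$ (a, b)"
  proof (cases "lb a = lb b")
    case True
    \<comment> \<open>The only intermediate index that contributes to the first product;
      \<open>k1\<close> plays this role for the second.\<close>
    obtain k0 where k0: "k0 < d" "lb k0 = lb a" "w1 k0 = w1 b" "w2 k0 = w2 a"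
      by (rule idx_surj[OF idx_mem(1)[OF ab(1)] idx_mem(2)[OF ab(2), folded True] idx_mem(3)[OF ab(1)]])
    obtain k1 where k1: "k1 < d" "lb k1 = lb a" "w1 k1 = w1 a" "w2 k1 = w2 b"
      by (rule idx_surj[OF idx_mem(1)[OF ab(1)] idx_mem(2)[OF ab(1)] idx_mem(3)[OF ab(2), folded True]])
    let ?v = "P (lb a) (w1 a) (w1 b) * R (lb a) (w2 a) (w2 b)"
    have "(\<Sum>k<d. tA P $$ (a, k) * tB R $$ (k, b)) = (\<Sum>k<d. if k = k0 then ?v else 0)"
    proof (intro sum.cong refl)
      fix k assume "k \<in> {..<d}"
      then have k: "k < d" by simp
      show "tA P $$ (a, k) * tB R $$ (k, b) = (if k = k0 then ?v else 0)"
      proof (cases "k = k0")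
        case True
        show ?thesis unfolding True using ab k0 \<open>lb a = lb b\<close> by (simp add: tA_def tB_def)
      next
        case False
        have "k = k0" if "lb k = lb a" "w1 k = w1 b" "w2 k = w2 a"
          by (rule idx_inj[OF k k0(1)]) (simp_all only: that k0)
        then have "\<not> ((lb a = lb k \<and> w2 a = w2 k) \<and> (lb k = lb b \<and> w1 k = w1 b))" using False by metis
        then have "tA P $$ (a, k) = 0 \<or> tB R $$ (k, b) = 0" using ab k unfolding tA_def tB_def
          by (simp del: de_Morgan_conj) metis
        then show ?thesis using False by simp
      qed
    qed
    moreover have "(\<Sum>k<d. tB R $$ (a, k) * tA P $$ (k, b)) = (\<Sum>k<d. if k = k1 then ?v else 0)"
    proof (intro sum.cong refl)
      fix k assume "k \<in> {..<d}"
      then have k: "k < d" by simp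
      show "tB R $$ (a, k) * tA P $$ (k, b) = (if k = k1 then ?v else 0)"
      proof (cases "k = k1")
        case True
        show ?thesis unfolding True using ab k1 \<open>lb a = lb b\<close> by (simp add: tA_def tB_def)
      next
        case False
        have "k = k1" if "lb k = lb a" "w1 k = w1 a" "w2 k = w2 b"
          by (rule idx_inj[OF k k1(1)]) (simp_all only: that k1)
        then have "\<not> ((lb a = lb k \<and> w1 a = w1 k) \<and> (lb k = lb b \<and> w2 k = w2 b))" using False by metis
        then have "tB R $$ (a, k) = 0 \<or> tA P $$ (k, b) = 0" using ab k unfolding tA_def tB_def
          by (simp del: de_Morgan_conj) metis
        then show ?thesis using False by simp
      qed
    qed
    ultimately show ?thesis unfolding l r using k0 k1 by simp
  next
    case False
    have "tA P $$ (a, k) * tB R $$ (k, b) = 0" "tB R $$ (a, k) * tA P $$ (k, b) = 0" if "k < d" for k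
      using False ab that by (auto simp: tA_def tB_def)
    then have "(\<Sum>k<d. tA P $$ (a, k) * tB R $$ (k, b)) = 0" "(\<Sum>k<d. tB R $$ (a, k) * tA P $$ (k, b)) = 0"
      by (intro sum.neutral; simp)+
    then show ?thesis unfolding l r by simp
  qed
qed (simp_all add: tA_def tB_def)

lemma gens_tA: "Y \<in> gens m A.ops \<Longrightarrow> \<exists>P. Y = tA P"
proof -
  have 1: "A.bm O' = tA (\<lambda>x u v. ecoef O' m r (al x) v u)" for O'
    unfolding A.bm_def tA_def by (intro eq_matI) auto
  have 2: "mat_diag d (\<lambda>k. h (A.kk i k)) = tA (\<lambda>x u v. if u = v then h (wtw (iw (al x)) u i) else 0)" for h i
    unfolding mat_diag_def tA_def A.kk_def using idx_inj by (intro eq_matI) auto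
  have 3: "\<exists>P. A.bm O' = tA P" "\<exists>P. mat_diag d (\<lambda>k. h (A.kk i k)) = tA P" for O' h i
    using 1[of O'] 2[of h i] by (blast, blast)
  assume "Y \<in> gens m A.ops"
  then have "(\<exists>i. Y = A.bm (Eq r i)) \<or> (\<exists>i. Y = A.bm (Fq r i)) \<or> (\<exists>i. Y = mat_diag d (\<lambda>k. qq powi A.kk i k))
      \<or> (\<exists>i. Y = mat_diag d (\<lambda>k. qq powi (- A.kk i k)))"
    unfolding gens_def A.ops_def uq_ops.simps by blast
  then show ?thesis
    by (elim disjE exE) (simp_all add: 3(1) 3(2)[of "\<lambda>z. qq powi z"] 3(2)[of "\<lambda>z. qq powi (- z)"])
qed

lemma gens_tB: "Y \<in> gens n B.ops \<Longrightarrow> \<exists>P. Y = tB P"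
proof -
  have 1: "B.bm O' = tB (\<lambda>x u v. ecoef O' n r (be x) v u)" for O'
    unfolding B.bm_def tB_def by (intro eq_matI) auto
  have 2: "mat_diag d (\<lambda>k. h (B.kk i k)) = tB (\<lambda>x u v. if u = v then h (wtw (iw (be x)) u i) else 0)" for h i
    unfolding mat_diag_def tB_def B.kk_def using idx_inj by (intro eq_matI) auto
  have 3: "\<exists>P. B.bm O' = tB P" "\<exists>P. mat_diag d (\<lambda>k. h (B.kk i k)) = tB P" for O' h i
    using 1[of O'] 2[of h i] by (blast, blast)
  assume "Y \<in> gens n B.ops"
  then have "(\<exists>i. Y = B.bm (Eq r i)) \<or> (\<exists>i. Y = B.bm (Fq r i)) \<or> (\<exists>i. Y = mat_diag d (\<lambda>k. qq powi B.kk i k))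
      \<or> (\<exists>i. Y = mat_diag d (\<lambda>k. qq powi (- B.kk i k)))"
    unfolding gens_def B.ops_def uq_ops.simps by blast
  then show ?thesis
    by (elim disjE exE) (simp_all add: 3(1) 3(2)[of "\<lambda>z. qq powi z"] 3(2)[of "\<lambda>z. qq powi (- z)"])
qed

lemma tensor_module: "uq_tensor_module m n d A.ops B.ops"
  unfolding uq_tensor_module_def
proof (intro conjI ballI A.uq_module_ops B.uq_module_ops)
  fix Y Y' assume "Y \<in> gens m A.ops" "Y' \<in> gens n B.ops"
  then obtain P R where "Y = tA P" "Y' = tB R" using gens_tA gens_tB by blast
  then show "Y * Y' = Y' * Y" by (simp only: tA_tB_commute)
qed

lemma weight_basis_unit_vecs:
  "weight_basis m n d A.ops B.ops (unit_vecs d) (\<lambda>k i. A.kk i k) (\<lambda>k j. B.kk j k)"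
  unfolding weight_basis_def
proof (intro conjI allI impI ordered_basis_unit_vecs)
  fix k assume "k < length (unit_vecs d :: ratfun vec list)"
  then have k: "k < d" by (simp add: unit_vecs_def)
  have "unit_vecs d ! k = (unit_vec d k :: ratfun vec)" using k by (simp add: unit_vecs_def)
  moreover have "unit_vec d k \<noteq> (0\<^sub>v d :: ratfun vec)"
    using k by (metis index_unit_vec(1) index_zero_vec(1) zero_neq_one)
  ultimately show "weight_vector m n d A.ops B.ops (\<lambda>i. A.kk i k) (\<lambda>j. B.kk j k) (unit_vecs d ! k)"
    unfolding weight_vector_def A.ops_def B.ops_def by (simp add: mat_diag_unit_vec[OF k])
qed

lemma Z_weight:
  assumes "k < d" and "Z k S \<noteq> 0"
  shows "wtl N C (\<lambda>k. k mod m) S = (\<lambda>i. A.kk i k)" and "wtl N C (\<lambda>k. k div m) S = (\<lambda>j. B.kk j k)"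
  using Q.has_wt_word2[OF hw[OF idx_mem(1)[OF assms(1)]] words_Wd[OF assms(1)]] assms(2)
  unfolding Z_def has_wt_def A.kk_def B.kk_def by auto

lemma wtl_cnt:
  assumes "cnt u = cnt t"
  shows "wtl N C \<sigma> u = wtl N C \<sigma> t"
proof -
  have "wtl N C (\<lambda>k. k) v b = (\<Sum>a<N. int (cnt v a b))" if "b < N" for v b
  proof -
    have C: "C = Sigma {..<N} (\<lambda>a. {..<lam a})" using C_row_less by (force simp: mem_C)
    have "wtl N C (\<lambda>k. k) v b = (\<Sum>c\<in>C. of_bool (v c = b))"
      unfolding wtl_def using that by (intro sum.cong refl) auto
    also have "\<dots> = (\<Sum>a<N. \<Sum>j<lam a. of_bool (v (a, j) = b))"
      unfolding C by (subst sum.Sigma) (simp_all add: case_prod_beta del: sum_of_bool_eq)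
    also have "\<dots> = (\<Sum>a<N. int (cnt v a b))"
      by (intro sum.cong refl) (simp add: cnt_def Int_def)
    finally show ?thesis .
  qed
  then have "wtl N C (\<lambda>k. k) u b = wtl N C (\<lambda>k. k) t b" if "b < N" for b using assms that by simp
  then show ?thesis by (intro ext) (simp add: wtl_id_sum[of \<sigma>])
qed

lemma tvec_weight: "tvec t S \<noteq> 0 \<Longrightarrow> wtl N C \<sigma> S = wtl N C \<sigma> t"
  using tvec_nonzeroE[of t S] wtl_comp wtl_cnt by metis

text \<open>The vectors \<open>tvec\<close> bound the number of tableaux of each weight by the
  dimension of the weight space. The totals agree by \<open>card_Bs\<close>, so the bounds are
  equalities and the weight spaces can be matched one by one.\<close>

lemma tableau_bijection:
  "\<exists>\<Phi>. bij_betw \<Phi> {..<d} (ssyt lam N) \<and> (\<forall>k<d. (\<forall>i<m. A.kk i k = int (row_weight m lam (\<Phi> k) i)) \<and>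
     (\<forall>j<n. B.kk j k = int (col_weight m lam (\<Phi> k) j)))"
proof -
  let ?g = "\<lambda>S. (wtl N C (\<lambda>k. k mod m) S, wtl N C (\<lambda>k. k div m) S)"
  let ?w = "\<lambda>k. (\<lambda>i. A.kk i k, \<lambda>j. B.kk j k)"
  have fin: "finite (ssyt lam N)" by (rule finite_ssyt[OF part])
  have le: "card {t \<in> ssyt lam N. ?g t = \<omega>} \<le> card {k \<in> {..<d}. ?w k = \<omega>}" for \<omega>
    by (rule card_weight_le[where g = ?g, OF finite_lessThan fin lin_indep_tvec W.span[OF inW_tvec_ssyt]])
       (use Z_weight tvec_weight in auto)
  have "card (ssyt lam N) \<le> d"
    using card_le_of_lin_indep_in_span[OF fin finite_lessThan lin_indep_tvec W.span[OF inW_tvec_ssyt]] by simp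
  moreover have "d \<le> card (ssyt lam N)"
    using card_le_of_lin_indep_in_span[OF finite_lessThan Bs_facts(1)[OF part] W.ind, of "\<lambda>w. ap (fw (F.lf C) w) hvec"]
      inW_in_span[OF gg_basis_Bs[OF part] W.ZW] card_Bs[OF part] by simp
  ultimately have "card {..<d} = card (ssyt lam N)" by simp
  from bij_betw_of_card_eq[OF finite_lessThan fin card_fibers_eq[OF finite_lessThan fin this le]]
  obtain \<Phi> where \<Phi>: "bij_betw \<Phi> {..<d} (ssyt lam N)" "\<forall>k\<in>{..<d}. ?g (\<Phi> k) = ?w k" by blast
  have cw: "wtl N C \<sigma> t i = int (card {c \<in> C. \<sigma> (t c) = i})" if t: "t \<in> ssyt lam N" for \<sigma> t i
  proof -
    have "t c < N" if "c \<in> C" for c using ssyt_X[OF t] that by (auto simp: PiE_iff)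
    then have "{c \<in> C. t c < N \<and> \<sigma> (t c) = i} = {c \<in> C. \<sigma> (t c) = i}" by blast
    then show ?thesis unfolding wtl_def using finC by (simp add: Int_def)
  qed
  have "A.kk i k = int (row_weight m lam (\<Phi> k) i)" "B.kk j k = int (col_weight m lam (\<Phi> k) j)" if "k < d" for k i j
  proof -
    have t: "\<Phi> k \<in> ssyt lam N" using bij_betwE[OF \<Phi>(1)] that by blast
    have "wtl N C (\<lambda>k. k mod m) (\<Phi> k) = (\<lambda>i. A.kk i k)" "wtl N C (\<lambda>k. k div m) (\<Phi> k) = (\<lambda>j. B.kk j k)"
      using \<Phi>(2) that by auto
    from fun_cong[OF this(1), of i] fun_cong[OF this(2), of j]
    show "A.kk i k = int (row_weight m lam (\<Phi> k) i)" "B.kk j k = int (col_weight m lam (\<Phi> k) j)"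
      unfolding cw[OF t] row_weight_def col_weight_def by simp_all
  qed
  then show ?thesis using \<Phi>(1) by blast
qed

definition dA :: "complex mat \<Rightarrow> (nat \<times> nat \<Rightarrow> nat, complex) lop" where
  "dA Y = D (lft (\<lambda>k. k mod m) (\<lambda>k. k div m) (W.mf Y))"

definition dB :: "complex mat \<Rightarrow> (nat \<times> nat \<Rightarrow> nat, complex) lop" where
  "dB Y = D (lft (\<lambda>k. k div m) (\<lambda>k. k mod m) (W.mf Y))"

abbreviation "sig \<equiv> restricted_rep m n d W.rho"

lemma rep_sig:
  assumes "Y \<in> carrier_mat m m" and "Y' \<in> carrier_mat n n"
  shows "rep d Z (dA Y + dB Y') (sig Y Y')"
proof -
  have "D (W.mf (dphi m n Y Y')) = dA Y + dB Y'"
    unfolding dA_def dB_def DD_add[symmetric] by (rule DD_cong) (simp add: dphi_entry[OF assms _ _ m])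
  moreover have "sig Y Y' = W.cm (D (W.mf (dphi m n Y Y')))"
    unfolding restricted_rep_def by (rule W.gl_differential_rho) (simp add: dphi_def)
  ultimately show ?thesis using W.rep_D[of "W.mf (dphi m n Y Y')"] by simp
qed

lemma dA_cong: "(\<And>a b. a < m \<Longrightarrow> b < m \<Longrightarrow> Y $$ (a, b) = g a b) \<Longrightarrow> dA Y = D (lft (\<lambda>k. k mod m) (\<lambda>k. k div m) g)"
  and dB_cong: "(\<And>a b. a < n \<Longrightarrow> b < n \<Longrightarrow> Y' $$ (a, b) = g' a b) \<Longrightarrow> dB Y' = D (lft (\<lambda>k. k div m) (\<lambda>k. k mod m) g')"
  unfolding dA_def dB_def by (rule DD_cong, simp add: lft_def G.rho_less G.rho'_less)+

lemma lft_add: "lft \<sigma> \<sigma>' (\<lambda>a b. Y a b + Y' a b) = (\<lambda>k l. lft \<sigma> \<sigma>' Y k l + lft \<sigma> \<sigma>' Y' k l)"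
  and lft_scale: "lft \<sigma> \<sigma>' (\<lambda>a b. c * Y a b) = (\<lambda>k l. c * lft \<sigma> \<sigma>' Y k l)"
  and lft_zero: "lft \<sigma> \<sigma>' (\<lambda>a b. 0) = (\<lambda>k l. 0)"
  by (auto simp: lft_def fun_eq_iff)

lemma commutator_entry:
  assumes "Y \<in> carrier_mat k k" "Y' \<in> carrier_mat k k" "a < k" "b < k"
  shows "commutator Y Y' $$ (a, b) = mm k (W.mf Y) (W.mf Y') a b - mm k (W.mf Y') (W.mf Y) a b"
  using assms by (simp add: commutator_def mm_def scalar_prod_def atLeast0LessThan)

lemma gl_gl_rep_sig: "gl_gl_rep m n d sig"
  unfolding gl_gl_rep_def
proof (intro ballI conjI allI)
  fix Y1 Y2 :: "complex mat" assume Y: "Y1 \<in> carrier_mat m m" "Y2 \<in> carrier_mat n n"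
  show "sig Y1 Y2 \<in> carrier_mat d d" by (rule rep_carrier[OF rep_sig[OF Y]])
  show "sig (c \<cdot>\<^sub>m Y1) (c \<cdot>\<^sub>m Y2) = c \<cdot>\<^sub>m sig Y1 Y2" for c
  proof (rule rep_eq[OF lin_indep_Z rep_sig rep_sc[OF rep_sig[OF Y]]])
    have "dA (c \<cdot>\<^sub>m Y1) = sc c * dA Y1" "dB (c \<cdot>\<^sub>m Y2) = sc c * dB Y2"
      using Y by (simp_all add: dA_cong[of "c \<cdot>\<^sub>m Y1" "\<lambda>a b. c * W.mf Y1 a b"] dB_cong[of "c \<cdot>\<^sub>m Y2" "\<lambda>a b. c * W.mf Y2 a b"]
          lft_scale DD_scale dA_def[of Y1] dB_def[of Y2])
    then show "dA (c \<cdot>\<^sub>m Y1) + dB (c \<cdot>\<^sub>m Y2) = sc c * (dA Y1 + dB Y2)" by (simp add: distrib_left)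
  qed (use Y in auto)
  fix Y1' Y2' :: "complex mat" assume Y': "Y1' \<in> carrier_mat m m" "Y2' \<in> carrier_mat n n"
  show "sig (Y1 + Y1') (Y2 + Y2') = sig Y1 Y2 + sig Y1' Y2'"
  proof (rule rep_eq[OF lin_indep_Z rep_sig rep_add[OF rep_sig[OF Y] rep_sig[OF Y']]])
    have "dA (Y1 + Y1') = dA Y1 + dA Y1'" "dB (Y2 + Y2') = dB Y2 + dB Y2'"
      using Y Y' by (simp_all add: dA_cong[of "Y1 + Y1'" "\<lambda>a b. W.mf Y1 a b + W.mf Y1' a b"]
          dB_cong[of "Y2 + Y2'" "\<lambda>a b. W.mf Y2 a b + W.mf Y2' a b"] lft_add DD_add dA_def[of Y1] dB_def[of Y2] dA_def[of Y1'] dB_def[of Y2'])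
    then show "dA (Y1 + Y1') + dB (Y2 + Y2') = dA Y1 + dB Y2 + (dA Y1' + dB Y2')" by (simp add: algebra_simps)
  qed (use Y Y' in auto)
  let ?c = "\<lambda>x y. x * y - y * x"
  show "sig (commutator Y1 Y1') (commutator Y2 Y2') = commutator (sig Y1 Y2) (sig Y1' Y2')"
    unfolding commutator_def[of "sig Y1 Y2"]
  proof (rule rep_eq[OF lin_indep_Z rep_sig rep_diff[OF rep_mult[OF rep_sig[OF Y] rep_sig[OF Y']] rep_mult[OF rep_sig[OF Y'] rep_sig[OF Y]]]])
    have 1: "dA (commutator Y1 Y1') = ?c (dA Y1) (dA Y1')"
      unfolding dA_def[of Y1] dA_def[of Y1'] G.DD_lft_commutator
      by (rule dA_cong) (rule commutator_entry[OF Y(1) Y'(1)])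
    have 2: "dB (commutator Y2 Y2') = ?c (dB Y2) (dB Y2')"
      unfolding dB_def[of Y2] dB_def[of Y2'] H.DD_lft_commutator
      by (rule dB_cong) (rule commutator_entry[OF Y(2) Y'(2)])
    have 3: "dA Y * dB Y' = dB Y' * dA Y" for Y Y'
      unfolding dA_def dB_def by (rule G.DD_lft_lft'_commute)
    show "dA (commutator Y1 Y1') + dB (commutator Y2 Y2')
        = (dA Y1 + dB Y2) * (dA Y1' + dB Y2') - (dA Y1' + dB Y2') * (dA Y1 + dB Y2)"
      unfolding 1 2 by (simp add: distrib_left distrib_right 3)
  qed (use Y Y' in \<open>auto simp: commutator_def\<close>)
qed

lemma dA_munit: "a < m \<Longrightarrow> b < m \<Longrightarrow> dA (munit m m a b) = D (lft (\<lambda>k. k mod m) (\<lambda>k. k div m) (un a b))"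
  and dB_munit: "a' < n \<Longrightarrow> b' < n \<Longrightarrow> dB (munit n n a' b') = D (lft (\<lambda>k. k div m) (\<lambda>k. k mod m) (un a' b'))"
  by (rule dA_cong dB_cong, simp add: munit_def un_def)+

lemma dA_0: "dA (0\<^sub>m m m) = 0" and dB_0: "dB (0\<^sub>m n n) = 0"
  using dA_cong[of "0\<^sub>m m m" "\<lambda>a b. 0"] dB_cong[of "0\<^sub>m n n" "\<lambda>a b. 0"] by (simp_all add: lft_zero DD_zero)

lemma munit_carrier: "munit a b i j \<in> carrier_mat a b"
  by (simp add: munit_def)

lemma rep_at_one_A:
  assumes "\<And>j S. j < d \<Longrightarrow> ap O' (Z j) S
    = (\<Sum>u\<in>Bs m (al (lb j)). at_one (ecoef Op m r (al (lb j)) (w1 j) u) * Q.word2 (lb j) u (w2 j) S)"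
  shows "rep d Z O' (map_mat at_one (A.bm Op))"
proof (rule repI)
  fix j S assume j: "j < d"
  have "(\<Sum>i<d. map_mat at_one (A.bm Op) $$ (i, j) * Z i S)
      = (\<Sum>i<d. if (lb i, w2 i) = (lb j, w2 j) then at_one (ecoef Op m r (al (lb j)) (w1 j) (w1 i)) * Q.word2 (lb j) (w1 i) (w2 j) S else 0)"
    using j by (intro sum.cong refl) (auto simp: A.bm_def Z_def)
  also have "\<dots> = (\<Sum>u\<in>Bs m (al (lb j)). at_one (ecoef Op m r (al (lb j)) (w1 j) u) * Q.word2 (lb j) u (w2 j) S)"
    using A.sum_block[OF A.tw(1)[OF j]] by simp
  finally show "ap O' (Z j) S = (\<Sum>i<d. map_mat at_one (A.bm Op) $$ (i, j) * Z i S)" using assms[OF j] by simp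
qed (simp add: A.bm_def)

lemma rep_at_one_B:
  assumes "\<And>j S. j < d \<Longrightarrow> ap O' (Z j) S
    = (\<Sum>u\<in>Bs n (be (lb j)). at_one (ecoef Op n r (be (lb j)) (w2 j) u) * Q.word2 (lb j) (w1 j) u S)"
  shows "rep d Z O' (map_mat at_one (B.bm Op))"
proof (rule repI)
  fix j S assume j: "j < d"
  have "(\<Sum>i<d. map_mat at_one (B.bm Op) $$ (i, j) * Z i S)
      = (\<Sum>i<d. if (lb i, w1 i) = (lb j, w1 j) then at_one (ecoef Op n r (be (lb j)) (w2 j) (w2 i)) * Q.word2 (lb j) (w1 j) (w2 i) S else 0)"
    using j by (intro sum.cong refl) (auto simp: B.bm_def Z_def)
  also have "\<dots> = (\<Sum>u\<in>Bs n (be (lb j)). at_one (ecoef Op n r (be (lb j)) (w2 j) u) * Q.word2 (lb j) (w1 j) u S)"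
    using B.sum_block[OF B.tw(1)[OF j]] by simp
  finally show "ap O' (Z j) S = (\<Sum>i<d. map_mat at_one (B.bm Op) $$ (i, j) * Z i S)" using assms[OF j] by simp
qed (simp add: B.bm_def)

lemma word2_swap: "u \<in> Wd m \<Longrightarrow> u' \<in> Wd n \<Longrightarrow> Q.word2 x u u' = ap (fw (H.lf C) u') (ap (fw (G.lf C) u) x)"
  using arg_cong[OF Q.word_commute[of u u'], of "\<lambda>A. ap A x"] by (simp add: Q.word2_def)

lemma sig_A:
  assumes i: "Suc i < m"
  shows "sig (munit m m i (i + 1)) (0\<^sub>m n n) = map_mat at_one (A.bm (Eq r i))"
    and "sig (munit m m (i + 1) i) (0\<^sub>m n n) = map_mat at_one (A.bm (Fq r i))"
proof -
  note S = rep_sig[OF munit_carrier zero_carrier_mat]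
  have e: "dA (munit m m i (i + 1)) + dB (0\<^sub>m n n) = G.le C i" "dA (munit m m (i + 1) i) + dB (0\<^sub>m n n) = G.lf C i"
    using i by (simp_all add: dA_munit dB_0 G.le_def G.lf_def)
  have z: "Q.A.hwv (iw (al (lb j))) (ap (fw (H.lf C) (w2 j)) (lb j))" "supp_in X (ap (fw (H.lf C) (w2 j)) (lb j))" if "j < d" for j
    using Q.hwv_word'[OF hw[OF idx_mem(1)[OF that]] words_Wd(2)[OF that]] by auto
  have "rep d Z (G.le C i) (map_mat at_one (A.bm (Eq r i)))"
    by (rule rep_at_one_A) (unfold Z_def Q.word2_def, rule Q.A1.e_at_one'(1)[OF z al[OF idx_mem(1)] i idx_mem(2)], assumption+)
  from rep_eq[OF lin_indep_Z S this e(1)] show "sig (munit m m i (i + 1)) (0\<^sub>m n n) = map_mat at_one (A.bm (Eq r i))" .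
  have "rep d Z (G.lf C i) (map_mat at_one (A.bm (Fq r i)))"
    by (rule rep_at_one_A) (unfold Z_def Q.word2_def, rule Q.A1.e_at_one'(2)[OF z al[OF idx_mem(1)] i idx_mem(2)], assumption+)
  from rep_eq[OF lin_indep_Z S this e(2)] show "sig (munit m m (i + 1) i) (0\<^sub>m n n) = map_mat at_one (A.bm (Fq r i))" .
qed

lemma sig_B:
  assumes i: "Suc i < n"
  shows "sig (0\<^sub>m m m) (munit n n i (i + 1)) = map_mat at_one (B.bm (Eq r i))"
    and "sig (0\<^sub>m m m) (munit n n (i + 1) i) = map_mat at_one (B.bm (Fq r i))"
proof -
  note S = rep_sig[OF zero_carrier_mat munit_carrier]
  have e: "dA (0\<^sub>m m m) + dB (munit n n i (i + 1)) = H.le C i" "dA (0\<^sub>m m m) + dB (munit n n (i + 1) i) = H.lf C i"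
    using i by (simp_all add: dB_munit dA_0 H.le_def H.lf_def)
  have z: "Q.B.hwv (iw (be (lb j))) (ap (fw (G.lf C) (w1 j)) (lb j))" "supp_in X (ap (fw (G.lf C) (w1 j)) (lb j))" if "j < d" for j
    using Q.hwv'_word[OF hw[OF idx_mem(1)[OF that]] words_Wd(1)[OF that]] by auto
  \<comment> \<open>The two words are exchanged so that the second action meets its own word
    first.\<close>
  have sw: "Q.word2 (lb j) (w1 j) u = ap (fw (H.lf C) u) (ap (fw (G.lf C) (w1 j)) (lb j))"
    if "j < d" "u \<in> Bs n (be (lb j))" for j u
    using that words_Wd(1) Bs_facts(4)[OF parts(2)[OF idx_mem(1)]] by (intro word2_swap) auto
  have "rep d Z (H.le C i) (map_mat at_one (B.bm (Eq r i)))"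
  proof (rule rep_at_one_B)
    fix j S assume j: "j < d"
    show "ap (H.le C i) (Z j) S = (\<Sum>u\<in>Bs n (be (lb j)). at_one (ecoef (Eq r i) n r (be (lb j)) (w2 j) u) * Q.word2 (lb j) (w1 j) u S)"
      using Q.B1.e_at_one'(1)[OF z[OF j] be[OF idx_mem(1)[OF j]] i idx_mem(3)[OF j]] unfolding Z_def
      by (simp add: sw[OF j] idx_mem(3)[OF j])
  qed
  from rep_eq[OF lin_indep_Z S this e(1)] show "sig (0\<^sub>m m m) (munit n n i (i + 1)) = map_mat at_one (B.bm (Eq r i))" .
  have "rep d Z (H.lf C i) (map_mat at_one (B.bm (Fq r i)))"
  proof (rule rep_at_one_B)
    fix j S assume j: "j < d"
    show "ap (H.lf C i) (Z j) S = (\<Sum>u\<in>Bs n (be (lb j)). at_one (ecoef (Fq r i) n r (be (lb j)) (w2 j) u) * Q.word2 (lb j) (w1 j) u S)"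
      using Q.B1.e_at_one'(2)[OF z[OF j] be[OF idx_mem(1)[OF j]] i idx_mem(3)[OF j]] unfolding Z_def
      by (simp add: sw[OF j] idx_mem(3)[OF j])
  qed
  from rep_eq[OF lin_indep_Z S this e(2)] show "sig (0\<^sub>m m m) (munit n n (i + 1) i) = map_mat at_one (B.bm (Fq r i))" .
qed

lemma sig_diag:
  shows "i < m \<Longrightarrow> sig (munit m m i i) (0\<^sub>m n n) = mat_diag d (\<lambda>k. of_int (A.kk i k))"
    and "j < n \<Longrightarrow> sig (0\<^sub>m m m) (munit n n j j) = mat_diag d (\<lambda>k. of_int (B.kk j k))"
proof -
  have 1: "rep d Z (dg (\<lambda>S. of_int (wtl N C (\<lambda>k. k mod m) S i))) (mat_diag d (\<lambda>k. of_int (A.kk i k)))"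
    by (rule rep_diag) (use Z_weight(1) in fastforce)
  have 2: "rep d Z (dg (\<lambda>S. of_int (wtl N C (\<lambda>k. k div m) S j))) (mat_diag d (\<lambda>k. of_int (B.kk j k)))"
    by (rule rep_diag) (use Z_weight(2) in fastforce)
  show "i < m \<Longrightarrow> sig (munit m m i i) (0\<^sub>m n n) = mat_diag d (\<lambda>k. of_int (A.kk i k))"
    by (rule rep_eq[OF lin_indep_Z rep_sig[OF munit_carrier zero_carrier_mat] 1]) (simp add: dA_munit dB_0 G.DD_lft_diag)
  show "j < n \<Longrightarrow> sig (0\<^sub>m m m) (munit n n j j) = mat_diag d (\<lambda>k. of_int (B.kk j k))"
    by (rule rep_eq[OF lin_indep_Z rep_sig[OF zero_carrier_mat munit_carrier] 2]) (simp add: dB_munit dA_0 H.DD_lft_diag)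
qed

lemma regular_A: "Suc i < m \<Longrightarrow> regular_matrix (A.bm (Eq r i))" "Suc i < m \<Longrightarrow> regular_matrix (A.bm (Fq r i))"
  and regular_B: "Suc j < n \<Longrightarrow> regular_matrix (B.bm (Eq r j))" "Suc j < n \<Longrightarrow> regular_matrix (B.bm (Fq r j))"
  unfolding regular_matrix_def A.bm_def B.bm_def
  using ecoef_E(1)[OF al[OF idx_mem(1)] _ idx_mem(2)] ecoef_F(1)[OF al[OF idx_mem(1)] _ idx_mem(2)]
    ecoef_E(1)[OF be[OF idx_mem(1)] _ idx_mem(3)] ecoef_F(1)[OF be[OF idx_mem(1)] _ idx_mem(3)] idx_mem(2,3)
  by (auto) metis+

lemma matches: "matches_at_one m n d A.ops B.ops d sig"
  unfolding matches_at_one_def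
proof (rule exI[of _ "unit_vecs d"], rule exI[of _ "\<lambda>k i. A.kk i k"], rule exI[of _ "\<lambda>k j. B.kk j k"],
    intro conjI allI impI exI[of _ sig] weight_basis_unit_vecs gl_gl_rep_sig)
  have A: "matrix_in_basis d (unit_vecs d) (A.bm Op) = A.bm Op" and B: "matrix_in_basis d (unit_vecs d) (B.bm Op) = B.bm Op" for Op
    by (rule matrix_in_basis_unit_vecs, simp add: A.bm_def B.bm_def)+
  note o = A.ops_def B.ops_def uq_ops.simps A B
  fix i
  show "i + 1 < m \<Longrightarrow> regular_matrix (matrix_in_basis d (unit_vecs d) (opE A.ops i))"
    "i + 1 < m \<Longrightarrow> regular_matrix (matrix_in_basis d (unit_vecs d) (opF A.ops i))"
    "i + 1 < n \<Longrightarrow> regular_matrix (matrix_in_basis d (unit_vecs d) (opE B.ops i))"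
    "i + 1 < n \<Longrightarrow> regular_matrix (matrix_in_basis d (unit_vecs d) (opF B.ops i))"
    unfolding o using regular_A regular_B by simp_all
  show "i + 1 < m \<Longrightarrow> sig (munit m m i (i + 1)) (0\<^sub>m n n) = map_mat at_one (matrix_in_basis d (unit_vecs d) (opE A.ops i))"
    "i + 1 < m \<Longrightarrow> sig (munit m m (i + 1) i) (0\<^sub>m n n) = map_mat at_one (matrix_in_basis d (unit_vecs d) (opF A.ops i))"
    "i + 1 < n \<Longrightarrow> sig (0\<^sub>m m m) (munit n n i (i + 1)) = map_mat at_one (matrix_in_basis d (unit_vecs d) (opE B.ops i))"
    "i + 1 < n \<Longrightarrow> sig (0\<^sub>m m m) (munit n n (i + 1) i) = map_mat at_one (matrix_in_basis d (unit_vecs d) (opF B.ops i))"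
    unfolding o using sig_A sig_B by simp_all
  show "i < m \<Longrightarrow> sig (munit m m i i) (0\<^sub>m n n) = mat_diag d (\<lambda>k. of_int (A.kk i k))"
    "i < n \<Longrightarrow> sig (0\<^sub>m m m) (munit n n i i) = mat_diag d (\<lambda>k. of_int (B.kk i k))"
    using sig_diag by blast+
next
  \<comment> \<open>The specialized matrices and the restricted Weyl module are both written in the
    basis \<open>Z\<close>, so the identity matrix intertwines them.\<close>
  show "gl_gl_isomorphic m n d sig d sig" unfolding gl_gl_isomorphic_def
  proof (intro bexI[of _ "1\<^sub>m d"] conjI ballI)
    show "invertible_mat (1\<^sub>m d :: complex mat)"
      unfolding invertible_mat_def inverts_mat_def by (auto intro!: exI[of _ "1\<^sub>m d"])
    fix Y1 Y2 :: "complex mat" assume "Y1 \<in> carrier_mat m m" "Y2 \<in> carrier_mat n n"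
    from rep_carrier[OF rep_sig[OF this]] show "sig Y1 Y2 * 1\<^sub>m d = 1\<^sub>m d * sig Y1 Y2" by simp
  qed simp
qed

end

theorem mainTheorem1:
  fixes m n :: nat and lam :: "nat \<Rightarrow> nat"
  assumes "m \<ge> 1" and "n \<ge> 1"
    and "is_partition lam"
    and "\<forall>i \<ge> m * n. lam i = 0"
    and "lam 0 \<le> 2 \<or> (\<exists>k. lam = (\<lambda>i. if i = 0 then k else 0)) \<or> (m = 2 \<and> n = 2)"
  shows "\<exists>d A B. uq_tensor_module m n d A B \<and>
     (\<exists>bs \<mu> \<nu> \<Phi>. weight_basis m n d A B bs \<mu> \<nu> \<and>
        bij_betw \<Phi> {..<length bs} (ssyt lam (m * n)) \<and>
        (\<forall>k<length bs. (\<forall>i<m. \<mu> k i = int (row_weight m lam (\<Phi> k) i)) \<and>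
                        (\<forall>j<n. \<nu> k j = int (col_weight m lam (\<Phi> k) j)))) \<and>
     (\<exists>d' \<rho>. weyl_module (m * n) lam d' \<rho> \<and>
        matches_at_one m n d A B d' (restricted_rep m n d' \<rho>))"
proof -
  have "part (m * n) lam" using assms(3,4) unfolding part_def is_partition_def by blast
  then interpret T: weyl_tensor lam "m * n" m n "\<lambda>k. k mod m" "\<lambda>k. k div m"
    by (intro weyl_tensor.intro shape.intro factor_mod_div assms(1))
  obtain L al be where L: "T.hwfam L" "\<And>x. x \<in> L \<Longrightarrow> part m (al x)" "\<And>x. x \<in> L \<Longrightarrow> part n (be x)"
    "\<And>x. x \<in> L \<Longrightarrow> T.Q.hw2 (iw (al x)) (iw (be x)) x"
    "\<And>y. T.inW y \<Longrightarrow> in_span (Sigma L (\<lambda>x. Bs m (al x) \<times> Bs n (be x))) (\<lambda>(x, w, w'). T.Q.word2 x w w') y"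
    by (rule T.decomposition) blast
  have finL: "finite L" using L(1) unfolding T.hwfam_def by blast
  \<comment> \<open>A common bound for the widths of all diagrams that occur for either
    factor.\<close>
  define r where "r = (\<Sum>x\<in>L. al x 0 + be x 0)"
  have r: "al x 0 + be x 0 \<le> r" if "x \<in> L" for x
    unfolding r_def using member_le_sum[OF that, of "\<lambda>x. al x 0 + be x 0"] finL by simp
  have "finite (Sigma L (\<lambda>x. Bs m (al x) \<times> Bs n (be x)))" using finL L(2,3) Bs_facts(1) by auto
  from ex_bij_betw_nat_finite[OF this] obtain idx where
    idx: "bij_betw idx {..<card (Sigma L (\<lambda>x. Bs m (al x) \<times> Bs n (be x)))} (Sigma L (\<lambda>x. Bs m (al x) \<times> Bs n (be x)))"
    unfolding atLeast0LessThan by blast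
  define d where "d = card (Sigma L (\<lambda>x. Bs m (al x) \<times> Bs n (be x)))"
  have "frame_axioms lam m n L al be d idx r"
  proof (rule frame_axioms.intro)
    show "x \<in> L \<Longrightarrow> in_box m r (al x)" "x \<in> L \<Longrightarrow> in_box n r (be x)" for x
      using L(2,3) r[of x] in_box_part by auto
  qed (use assms(1) L idx in \<open>simp_all only: d_def\<close>)
  then interpret frame lam m n L al be d idx r
    by (intro frame.intro T.weyl_tensor_axioms)
  have len: "length (unit_vecs d :: ratfun vec list) = d" by (simp add: unit_vecs_def)
  obtain \<Phi> where \<Phi>: "bij_betw \<Phi> {..<d} (ssyt lam (m * n))"
    "\<forall>k<d. (\<forall>i<m. A.kk i k = int (row_weight m lam (\<Phi> k) i)) \<and> (\<forall>j<n. B.kk j k = int (col_weight m lam (\<Phi> k) j))"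
    using tableau_bijection by blast
  have "\<exists>bs \<mu> \<nu> \<Phi>. weight_basis m n d A.ops B.ops bs \<mu> \<nu> \<and>
        bij_betw \<Phi> {..<length bs} (ssyt lam (m * n)) \<and>
        (\<forall>k<length bs. (\<forall>i<m. \<mu> k i = int (row_weight m lam (\<Phi> k) i)) \<and>
                        (\<forall>j<n. \<nu> k j = int (col_weight m lam (\<Phi> k) j)))"
    by (rule exI[of _ "unit_vecs d"], rule exI[of _ "\<lambda>k i. A.kk i k"], rule exI[of _ "\<lambda>k j. B.kk j k"],
        rule exI[of _ \<Phi>]) (simp add: weight_basis_unit_vecs len \<Phi>)
  moreover have "\<exists>d' \<rho>. weyl_module (m * n) lam d' \<rho> \<and> matches_at_one m n d A.ops B.ops d' (restricted_rep m n d' \<rho>)"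
    using W.weyl_module_rho matches by blast
  ultimately show ?thesis using tensor_module by blast
qed

end
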